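(* Let $\mathcal X,\mathcal V$ be Euclidean spaces, $(\Xi,\mathscr G,\mu)$ a probability space with $\mathscr G$ $\mu$-complete, and let $f,g:\Xi\times\mathcal X\to(-\infty,\infty]$, $p:\Xi\times\mathcal V\to(-\infty,\infty]$, $L:\Xi\to\mathcal L(\mathcal X,\mathcal V)$, $\mathsf F,\mathsf G,\mathsf P=\mathsf H^\star,\mathsf H,\mathsf L$, $\widetilde\nabla f$, the i.i.d. sequence $(\xi_n)$ of law $\mu$ on $(\Omega,\mathscr F,\mathbb P)$, and the set $\mathcal S\subset\mathcal X\times\mathcal V$ of saddle points be as described in the context. Consider the problem of minimizing $\mathsf F(x)+\mathsf G(x)+\mathsf H(\mathsf L x)$ over $x\in\mathcal X$, whose set of solutions is assumed nonempty. Let $(\gamma_n)$ be a sequence of positive numbers, and consider the following iterations applied to the random vector $(x_n,\lambda_n)\in\mathcal X\times\mathcal V$: $$x_{n+1}=\operatorname{prox}_{\gamma_{n+1}g(\xi_{n+1},\cdot)}\big(x_n-\gamma_{n+1}(\widetilde\nabla f(\xi_{n+1},x_n)+L(\xi_{n+1})^T\lambda_n)\big),$$ $$\lambda_{n+1}=\operatorname{prox}_{\gamma_{n+1}p(\xi_{n+1},\cdot)}\big(\lambda_n+\gamma_{n+1}L(\xi_{n+1})x_n\big),$$ together with the weighted averages $$\bar x_n=\frac{\sum_{k=1}^n\gamma_kx_k}{\sum_{k=1}^n\gamma_k},\qquad \bar\lambda_n=\frac{\sum_{k=1}^n\gamma_k\lambda_k}{\sum_{k=1}^n\gamma_k}.$$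 Assume the following. (1) $(\gamma_n)\in\ell^2\setminus\ell^1$ and $\gamma_{n+1}/\gamma_n\to1$ as $n\to\infty$. (2) $\partial\mathsf G(x)=\mathbb E_\mu\partial g(\cdot,x)$ for each $x\in\mathcal X$. (3) There exists an integer $m\ge2$ such that $\int\|L\|^{2m}d\mu<\infty$ and such that there exist a point $(x_\star,\lambda_\star)\in\mathcal S$ and functions $\varphi_f\in\mathfrak S^{2m}_{\partial f(\cdot,x_\star)}$, $\varphi_g\in\mathfrak S^{2m}_{\partial g(\cdot,x_\star)}$, $\varphi_p\in\mathfrak S^{2m}_{\partial p(\cdot,\lambda_\star)}$ satisfying $$\mathbb E_\mu\varphi_f+\mathbb E_\mu\varphi_g+\mathsf L^T\lambda_\star=0\quad\text{and}\quad-\mathsf Lx_\star+\mathbb E_\mu\varphi_p=0.\qquad( * )$$ Moreover, for every point $(x_\star,\lambda_\star)\in\mathcal S$ there exist $\varphi_f\in\mathfrak S^{2}_{\partial f(\cdot,x_\star)}$, $\varphi_g\in\mathfrak S^{2}_{\partial g(\cdot,x_\star)}$, $\varphi_p\in\mathfrak S^{2}_{\partial p(\cdot,\lambda_\star)}$ such that $( * )$ holds. (4) For any compact set $K\subset\operatorname{dom}\partial\mathsf G$, there exist $\varepsilon\in(0,1]$ and $\tilde x\in\operatorname{dom}\partial\mathsf G$ such that $$\sup_{x\in K}\mathbb E_\mu\|\partial_0g(\cdot,x)\|^{1+\varepsilon}<+\infty\quad\text{and}\quad\mathbb E_\mu\|\partial_0g(\cdot,\tilde x)\|^{1+1/\varepsilon}<+\infty.$$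 (5) With $m$ as in (3), there exists a measurable function $\beta:\Xi\to\mathbb R_+$ such that $\beta^{2m}$ is $\mu$-integrable and $\|\widetilde\nabla f(s,x)\|\le\beta(s)(1+\|x\|)$ for all $s\in\Xi$, $x\in\mathcal X$. Moreover, there exists a constant $C>0$ such that $\mathbb E_\mu\|\widetilde\nabla f(\cdot,x)\|^4\le C(1+\|x\|^{2m})$ for all $x\in\mathcal X$. (6) There exists $C>0$ such that for all $x\in\mathcal X$, $$\mathbb E_\mu\operatorname{dist}(x,D_{\partial g}(\cdot))^2\ge C\operatorname{dist}(x,\operatorname{dom}\partial\mathsf G)^2,\qquad\text{where }D_{\partial g}(s)=\operatorname{dom}\partial g(s,\cdot).$$ (7) With $m$ as in (3), there exists $C>0$ such that for any $x\in\mathcal X$ and any $\gamma>0$, $$\int\|\operatorname{prox}_{\gamma g(s,\cdot)}(x)-\Pi_g(s,x)\|^4\,\mu(ds)\le C\gamma^4(1+\|x\|^{2m}),$$ where $\Pi_g(s,\cdot)$ is the projection operator onto $\operatorname{cl}(\operatorname{dom}\partial g(s,\cdot))$. (8) Conditions (2), (4), (6) and (7) also hold when $g$ is replaced with $p$ (hence $\mathsf G$ with $\mathsf P=\mathsf H^\star$) and $\mathcal X$ with $\mathcal V$. Then the sequence $(x_n,\lambda_n)$ is bounded in $\mathscr L^{2m}(\Omega)$, and the sequence $(\bar x_n,\bar\lambda_n)$ converges almost surely to a random variable $(X,\Lambda)$ supported by $\mathcal S$.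
   Context: Basic notation. $\mathcal X$ and $\mathcal V$ are Euclidean (finite-dimensional real inner product) spaces; $\mathcal L(\mathcal X,\mathcal V)$ is the set of linear operators $\mathcal X\to\mathcal V$, identified with matrices; $\|\cdot\|$ denotes both the Euclidean norm and the operator norm. $\Gamma_0(\mathcal X)$ is the set of proper lower semicontinuous convex functions $\mathcal X\to(-\infty,\infty]$. $\operatorname{dist}(x,S)$ is the distance from $x$ to the set $S$, $\operatorname{cl}$ is closure, and $\ell^k$ is the set of real $k$-summable sequences. For $h\in\Gamma_0(\mathcal X)$: $\partial h$ is its subdifferential, $\operatorname{dom}\partial h=\{x:\partial h(x)\ne\emptyset\}$, $\partial_0h(x)$ is the (unique) least-norm element of $\partial h(x)$ when this set is nonempty, and $\operatorname{prox}_h(x)=\arg\min_{y}\,h(y)+\|y-x\|^2/2$. $\mathsf H^\star$ is the Fenchel conjugate of $\mathsf H$. Boundedness of random vectors $Z_n$ in $\mathscr L^{2m}(\Omega)$ means $\sup_n\mathbb E\|Z_n\|^{2m}<\infty$; a random variable is supported by $\mathcal S$ if it belongs to $\mathcal S$ almost surely. Convex normal integrands. $(\Xi,\mathscr G,\mu)$ is a probability space with $\mathscr G$ $\mu$-complete. A function $h:\Xi\times\mathcal X\to(-\infty,\infty]$ is a convex normal integrand if $h(s,\cdot)$ is convex for each $s$ and the set-valued map $s\mapsto\operatorname{epi}h(s,\cdot)$ (epigraph) is closed-valued and measurable (in the sense of Rockafellar–Wets, Variational Analysis, Chap. 14). It is always assumed that $h(s,\cdot)\in\Gamma_0(\mathcal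 X)$ for $\mu$-almost all $s$. $\partial h(s,x)$ is the subdifferential of $h(s,\cdot)$ at $x$, and $\partial_0h(s,x)$ is its least-norm element. Selections and set-valued expectations. For $r\in[1,\infty)$, $\mathscr L^r(\mu)$ is the space of $\mathscr G$-measurable $\varphi:\Xi\to\mathcal X$ with $\int\|\varphi\|^rd\mu<\infty$. If $\mu(\{s:\partial h(s,x)\ne\emptyset\})<1$, set $\mathfrak S^r_{\partial h(\cdot,x)}=\emptyset$; otherwise $$\mathfrak S^r_{\partial h(\cdot,x)}=\{\varphi\in\mathscr L^r(\mu):\varphi(s)\in\partial h(s,x)\ \mu\text{-a.e.}\}.$$ The selection integral is the (possibly empty) set $$\mathbb E_\mu\partial h(\cdot,x)=\operatorname{cl}\Big\{\int_\Xi\varphi\,d\mu:\varphi\in\mathfrak S^1_{\partial h(\cdot,x)}\Big\}.$$ For single-valued functions, $\mathbb E_\mu$ is the usual expectation. The same notions are used with $\mathcal V$ in place of $\mathcal X$. Data of the problem. - $f:\Xi\times\mathcal X\to(-\infty,\infty]$ is a convex normal integrand with $\mathbb E_\mu|f(\cdot,x)|<\infty$ for all $x\in\mathcal X$, and $\mathsf F(x)=\mathbb E_\mu f(\cdot,x)$. - $g:\Xi\times\mathcal X\to(-\infty,\infty]$ is a convex normal integrand and $\mathsf G(x)=\mathbb E_\mu g(\cdot,x)$, where this integral is defined as $\int_{\{g(s,x)\in[0,\infty)\}}g(s,x)\mu(ds)+\int_{\{g(s,x)\in(-\infty,0)\}}g(s,x)\mu(ds)+I(x)$, with $I(x)=+\infty$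 if $\mu(\{s:g(s,x)=\infty\})>0$ and $I(x)=0$ otherwise, and with the convention $(+\infty)+(-\infty)=+\infty$. It is assumed that $\mathsf G(x)>-\infty$ for all $x$ and that $\mathsf G$ is proper. - $p:\Xi\times\mathcal V\to(-\infty,\infty]$ is a convex normal integrand such that $\mathsf P(\lambda)=\mathbb E_\mu p(\cdot,\lambda)$ (integral defined as for $g$) belongs to $\Gamma_0(\mathcal V)$; $\mathsf H$ is the Fenchel conjugate of $\mathsf P$, so that $\mathsf H^\star=\mathsf P$. - $L:\Xi\to\mathcal L(\mathcal X,\mathcal V)$ is measurable with $\|L\|$ $\mu$-integrable, and $\mathsf L=\mathbb E_\mu L$. - $\widetilde\nabla f:\Xi\times\mathcal X\to\mathcal X$ is a $\mathscr G\otimes\mathscr B(\mathcal X)$-measurable function ($\mathscr B$ = Borel $\sigma$-field) such that $\widetilde\nabla f(\cdot,x)\in\mathfrak S^1_{\partial f(\cdot,x)}$ for each $x\in\mathcal X$. - $(\xi_n)$ is a sequence of i.i.d. random variables from a probability space $(\Omega,\mathscr F,\mathbb P)$ to $(\Xi,\mathscr G)$ with distribution $\mu$. Saddle points. $\mathcal S\subset\mathcal X\times\mathcal V$ is the set of saddle points of the Lagrangian $(x,\lambda)\mapsto\mathsf F(x)+\mathsf G(x)-\mathsf H^\star(\lambda)+\langle\mathsf Lx,\lambda\rangle$, i.e. the set of $(x,\lambda)$ such that $0\in\partial\mathsf F(x)+\partial\mathsf G(x)+\mathsf L^T\lambda$ and $0\in-\mathsf Lx+\partial\mathsf H^\star(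\lambda)$.
   Formalization: The initial vector (x_0, λ_0), left unspecified, is assumed to have a finite 2m-th moment and to be independent of (ξ_n), n ≥ 1; for arbitrary random initial vectors the boundedness in L^{2m} claimed fails. *)

theory Defs
  imports "HOL-Probability.Probability"
begin

text \<open>The library's Bochner integral needs a second countable range; the following instance lets
  it apply to operator-valued random variables.\<close>

instance blinfun :: (euclidean_space, euclidean_space) second_countable_topology
proof
  have "\<exists>D. finite D \<and> cball (0 :: 'a \<Rightarrow>\<^sub>L 'b) (real n) \<subseteq> (\<Union>d\<in>D. ball d (inverse (real (Suc k))))" for n k
  proof -
    have "compact (cball (0 :: 'a \<Rightarrow>\<^sub>L 'b) (real n))" by (rule compact_cball)
    then show ?thesis
      unfolding compact_eq_totally_bounded
      by (metis inverse_positive_iff_positive of_nat_0_less_iff zero_less_Suc)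
  qed
  then obtain D where D: "\<And>n k. finite (D n k)"
    "\<And>n k. cball (0 :: 'a \<Rightarrow>\<^sub>L 'b) (real n) \<subseteq> (\<Union>d\<in>D n k. ball d (inverse (real (Suc k))))"
    by metis
  define B where "B = (\<Union>n k. (\<lambda>d. ball d (inverse (real (Suc k)))) ` D n k)"
  have "countable B"
    unfolding B_def using D(1) by (intro countable_UN countable_image) (auto intro: countable_finite)
  moreover have "topological_basis B"
  proof (rule topological_basisI)
    show "open b" if "b \<in> B" for b using that by (auto simp: B_def)
  next
    fix O' :: "('a \<Rightarrow>\<^sub>L 'b) set" and a
    assume "open O'" "a \<in> O'"
    then obtain e where e: "e > 0" "ball a e \<subseteq> O'" by (meson openE)
    obtain k where k: "inverse (real (Suc k)) < e / 2"
      using reals_Archimedean[of "e / 2"] e by auto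
    obtain n where "norm a \<le> real n" using real_arch_simple by blast
    then have "a \<in> cball 0 (real n)" by simp
    then obtain d where d: "d \<in> D n k" "a \<in> ball d (inverse (real (Suc k)))" using D(2) by blast
    have "ball d (inverse (real (Suc k))) \<subseteq> ball a e"
    proof
      fix y assume "y \<in> ball d (inverse (real (Suc k)))"
      then have "dist d y < e / 2" using k by simp
      moreover have "dist d a < e / 2" using d k by simp
      ultimately show "y \<in> ball a e" using dist_triangle3[of a y d] by simp
    qed
    then show "\<exists>B'\<in>B. a \<in> B' \<and> B' \<subseteq> O'"
      using d e by (intro bexI[of _ "ball d (inverse (real (Suc k)))"]) (auto simp: B_def)
  qed
  ultimately show "\<exists>B :: ('a \<Rightarrow>\<^sub>L 'b) set set. countable B \<and> open = generate_topology B"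
    using topological_basis_imp_subbasis by blast
qed


section \<open>Convex analysis of extended real valued functions\<close>

definition convex_fun :: "('a::euclidean_space \<Rightarrow> ereal) \<Rightarrow> bool" where
  "convex_fun h \<longleftrightarrow> (\<forall>x y u v. 0 < u \<and> 0 < v \<and> u + v = 1 \<longrightarrow>
     h (u *\<^sub>R x + v *\<^sub>R y) \<le> ereal u * h x + ereal v * h y)"

definition proper_fun :: "('a::euclidean_space \<Rightarrow> ereal) \<Rightarrow> bool" where
  "proper_fun h \<longleftrightarrow> (\<forall>x. h x \<noteq> -\<infinity>) \<and> (\<exists>x. h x \<noteq> \<infinity>)"

definition lsc_fun :: "('a::euclidean_space \<Rightarrow> ereal) \<Rightarrow> bool" where
  "lsc_fun h \<longleftrightarrow> (\<forall>x. h x \<le> Liminf (at x) h)"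

definition Gamma0 :: "('a::euclidean_space \<Rightarrow> ereal) set" where
  "Gamma0 = {h. proper_fun h \<and> lsc_fun h \<and> convex_fun h}"

text \<open>For proper \<^term>\<open>h\<close> this set is empty at every \<^term>\<open>x\<close> with \<^term>\<open>h x = \<infinity>\<close>.\<close>

definition subdifferential :: "('a::euclidean_space \<Rightarrow> ereal) \<Rightarrow> 'a \<Rightarrow> 'a set" where
  "subdifferential h x = {u. \<forall>y. h x + ereal (u \<bullet> (y - x)) \<le> h y}"

definition dom_subdifferential :: "('a::euclidean_space \<Rightarrow> ereal) \<Rightarrow> 'a set" where
  "dom_subdifferential h = {x. subdifferential h x \<noteq> {}}"

definition least_norm_subgradient :: "('a::euclidean_space \<Rightarrow> ereal) \<Rightarrow> 'a \<Rightarrow> 'a" where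
  "least_norm_subgradient h x = arg_min norm (\<lambda>u. u \<in> subdifferential h x)"

definition prox :: "('a::euclidean_space \<Rightarrow> ereal) \<Rightarrow> 'a \<Rightarrow> 'a" where
  "prox h x = arg_min (\<lambda>y. h y + ereal ((norm (y - x))\<^sup>2 / 2)) (\<lambda>_. True)"

definition fenchel_conjugate :: "('a::euclidean_space \<Rightarrow> ereal) \<Rightarrow> 'a \<Rightarrow> ereal" where
  "fenchel_conjugate h u = (SUP x. ereal (u \<bullet> x) - h x)"


section \<open>Convex normal integrands, selections and expectations\<close>

definition epi :: "('a::euclidean_space \<Rightarrow> ereal) \<Rightarrow> ('a \<times> real) set" where
  "epi h = {(x, r). h x \<le> ereal r}"

definition measurable_multifunction :: "'s measure \<Rightarrow> ('s \<Rightarrow> 'b::topological_space set) \<Rightarrow> bool" where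
  "measurable_multifunction M \<Phi> \<longleftrightarrow> (\<forall>U. open U \<longrightarrow> {s \<in> space M. \<Phi> s \<inter> U \<noteq> {}} \<in> sets M)"

definition convex_normal_integrand ::
    "'s measure \<Rightarrow> ('s \<Rightarrow> 'a::euclidean_space \<Rightarrow> ereal) \<Rightarrow> bool" where
  "convex_normal_integrand M h \<longleftrightarrow>
     (\<forall>s\<in>space M. (\<forall>x. h s x \<noteq> -\<infinity>) \<and> convex_fun (h s) \<and> closed (epi (h s))) \<and>
     measurable_multifunction M (\<lambda>s. epi (h s))"

text \<open>In \<^typ>\<open>ereal\<close> we have \<^term>\<open>\<infinity> - \<infinity> = (\<infinity> :: ereal)\<close>, which is the convention
  \<open>(+\<infinity>) + (-\<infinity>) = +\<infinity>\<close> required of this integral.\<close>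

definition extended_expectation :: "'s measure \<Rightarrow> ('s \<Rightarrow> ereal) \<Rightarrow> ereal" where
  "extended_expectation M \<phi> =
     enn2ereal (\<integral>\<^sup>+ s. e2ennreal (\<phi> s) * indicator {t. 0 \<le> \<phi> t \<and> \<phi> t < \<infinity>} s \<partial>M)
     - enn2ereal (\<integral>\<^sup>+ s. e2ennreal (- \<phi> s) * indicator {t. -\<infinity> < \<phi> t \<and> \<phi> t < 0} s \<partial>M)
     + (if emeasure M {s \<in> space M. \<phi> s = \<infinity>} > 0 then \<infinity> else 0)"

definition Lr :: "'s measure \<Rightarrow> real \<Rightarrow> ('s \<Rightarrow> 'a::euclidean_space) set" where
  "Lr M r = {\<phi>. \<phi> \<in> borel_measurable M \<and> integrable M (\<lambda>s. norm (\<phi> s) powr r)}"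

definition selections ::
    "'s measure \<Rightarrow> real \<Rightarrow> ('s \<Rightarrow> 'a::euclidean_space \<Rightarrow> ereal) \<Rightarrow> 'a \<Rightarrow> ('s \<Rightarrow> 'a) set" where
  "selections M r h x =
     (if \<not> (AE s in M. subdifferential (h s) x \<noteq> {}) then {}
      else {\<phi> \<in> Lr M r. AE s in M. \<phi> s \<in> subdifferential (h s) x})"

definition selection_integral ::
    "'s measure \<Rightarrow> ('s \<Rightarrow> 'a::euclidean_space \<Rightarrow> ereal) \<Rightarrow> 'a \<Rightarrow> 'a set" where
  "selection_integral M h x = closure {\<integral>s. \<phi> s \<partial>M | \<phi>. \<phi> \<in> selections M 1 h x}"


section \<open>Saddle points and the assumptions on the integrands\<close>

definition saddle_points ::
    "('a::euclidean_space \<Rightarrow> ereal) \<Rightarrow> ('a \<Rightarrow> ereal) \<Rightarrow> ('b::euclidean_space \<Rightarrow> ereal) \<Rightarrow>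
     ('a \<Rightarrow>\<^sub>L 'b) \<Rightarrow> ('a \<times> 'b) set" where
  "saddle_points F G H A = {(x, l).
     (\<exists>u\<in>subdifferential F x. \<exists>v\<in>subdifferential G x. 0 = u + v + adjoint (blinfun_apply A) l) \<and>
     (\<exists>w\<in>subdifferential (fenchel_conjugate H) l. 0 = - blinfun_apply A x + w)}"

text \<open>A point \<open>(x, l)\<close> whose optimality conditions are realised by \<open>r\<close>-integrable selections of
  the subdifferentials of the three integrands.\<close>

definition integrable_representation ::
    "'s measure \<Rightarrow> real \<Rightarrow> ('s \<Rightarrow> 'a::euclidean_space \<Rightarrow> ereal) \<Rightarrow> ('s \<Rightarrow> 'a \<Rightarrow> ereal) \<Rightarrow>
     ('s \<Rightarrow> 'b::euclidean_space \<Rightarrow> ereal) \<Rightarrow> ('a \<Rightarrow>\<^sub>L 'b) \<Rightarrow> 'a \<Rightarrow> 'b \<Rightarrow> bool" where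
  "integrable_representation M r f g p A x l \<longleftrightarrow>
     (\<exists>\<phi>f\<in>selections M r f x. \<exists>\<phi>g\<in>selections M r g x. \<exists>\<phi>p\<in>selections M r p l.
        (\<integral>s. \<phi>f s \<partial>M) + (\<integral>s. \<phi>g s \<partial>M) + adjoint (blinfun_apply A) l = 0 \<and>
        - blinfun_apply A x + (\<integral>s. \<phi>p s \<partial>M) = 0)"

text \<open>The assumptions made both on the integrand \<open>g\<close> with mean \<open>G\<close> and on \<open>p\<close> with mean \<open>P\<close>.
  Expectations of nonnegative functions that are not assumed finite are taken in
  \<^typ>\<open>ennreal\<close>, so that the bounds include finiteness where appropriate.  The library's
  \<^const>\<open>infdist\<close> is \<open>0\<close> for the empty set; a function in \<^const>\<open>Gamma0\<close> always has a
  subgradient somewhere, so this value is relevant on a null set of integrands at most.\<close>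

definition subdifferential_interchange ::
    "'s measure \<Rightarrow> ('s \<Rightarrow> 'a::euclidean_space \<Rightarrow> ereal) \<Rightarrow> ('a \<Rightarrow> ereal) \<Rightarrow> bool" where
  "subdifferential_interchange M h E \<longleftrightarrow> (\<forall>x. subdifferential E x = selection_integral M h x)"

definition compact_moment_condition ::
    "'s measure \<Rightarrow> ('s \<Rightarrow> 'a::euclidean_space \<Rightarrow> ereal) \<Rightarrow> ('a \<Rightarrow> ereal) \<Rightarrow> bool" where
  "compact_moment_condition M h E \<longleftrightarrow>
     (\<forall>K. compact K \<and> K \<subseteq> dom_subdifferential E \<longrightarrow>
       (\<exists>\<epsilon>::real. 0 < \<epsilon> \<and> \<epsilon> \<le> 1 \<and> (\<exists>x'\<in>dom_subdifferential E.
          (SUP x\<in>K. \<integral>\<^sup>+ s. ennreal (norm (least_norm_subgradient (h s) x) powr (1 + \<epsilon>)) \<partial>M) < \<infinity> \<and>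
          (\<integral>\<^sup>+ s. ennreal (norm (least_norm_subgradient (h s) x') powr (1 + 1 / \<epsilon>)) \<partial>M) < \<infinity>)))"

definition domain_regularity ::
    "'s measure \<Rightarrow> ('s \<Rightarrow> 'a::euclidean_space \<Rightarrow> ereal) \<Rightarrow> ('a \<Rightarrow> ereal) \<Rightarrow> bool" where
  "domain_regularity M h E \<longleftrightarrow> (\<exists>C>0. \<forall>x.
     ennreal (C * (infdist x (dom_subdifferential E))\<^sup>2)
       \<le> (\<integral>\<^sup>+ s. ennreal ((infdist x (dom_subdifferential (h s)))\<^sup>2) \<partial>M))"

definition prox_projection_bound ::
    "'s measure \<Rightarrow> nat \<Rightarrow> ('s \<Rightarrow> 'a::euclidean_space \<Rightarrow> ereal) \<Rightarrow> bool" where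
  "prox_projection_bound M m h \<longleftrightarrow> (\<exists>C>0. \<forall>x. \<forall>\<gamma>>0.
     (\<integral>\<^sup>+ s. ennreal (norm (prox (\<lambda>y. ereal \<gamma> * h s y) x
                       - closest_point (closure (dom_subdifferential (h s))) x) ^ 4) \<partial>M)
       \<le> ennreal (C * \<gamma> ^ 4 * (1 + norm x ^ (2 * m))))"

definition weighted_average :: "(nat \<Rightarrow> real) \<Rightarrow> (nat \<Rightarrow> 'a::euclidean_space) \<Rightarrow> nat \<Rightarrow> 'a" where
  "weighted_average \<gamma> z n = (\<Sum>k=1..n. \<gamma> k *\<^sub>R z k) /\<^sub>R (\<Sum>k=1..n. \<gamma> k)"

end

theory Submission
  imports Defs
begin

text \<open>Write \<open>z = (x, \<lambda>)\<close>. Monotonicity gives, for a saddle point \<open>z\<^sub>*\<close> represented by integrable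
  selections with total \<open>\<eta>\<close> of mean zero,
  \<open>\<parallel>z\<^sub>n\<^sub>+\<^sub>1 - z\<^sub>*\<parallel>\<^sup>2 \<le> \<parallel>z\<^sub>n - z\<^sub>*\<parallel>\<^sup>2 - 2\<gamma>\<langle>\<eta>, z\<^sub>n - z\<^sub>*\<rangle> + O(\<gamma>\<^sup>2) - \<parallel>z\<^sub>n\<^sub>+\<^sub>1 - z\<^sub>n\<parallel>\<^sup>2 / 2\<close>.
  Powers of it bound the moments; a martingale argument makes \<open>\<parallel>z\<^sub>n - z\<^sub>*\<parallel>\<close> converge and the
  increments square summable, and since \<open>x\<^sub>n\<^sub>+\<^sub>1\<close> lies in the random domain at time \<open>n + 1\<close>, domain
  regularity makes the distance of \<open>x\<^sub>n\<close> to the domain of \<open>\<partial>G\<close> vanish. The same inequality at an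
  arbitrary point \<open>u\<close> of the domain, summed and divided by the total weight, shows that a cluster
  point \<open>z\<close> of the averages satisfies \<open>\<langle>v, u - z\<rangle> \<ge> 0\<close> for one subgradient \<open>v\<close> at \<open>u\<close>; here the
  selection of least norm is merely in \<open>L\<^sup>1\<^sup>+\<^sup>\<epsilon>\<close>, which truncation and Kronecker's lemma can handle.
  As \<open>z\<close> lies in the closure of the domain it is a saddle point, and Opial's argument gives
  convergence.\<close>

section \<open>Subgradients and proximal maps\<close>

text \<open>Monotonicity is used at the old point for the forward field and at the new point for the
  proximal part; the mismatch is a cross term \<open>2 c <b + \<phi>, z(n+1) - z(n)>\<close>. At a
  saddle point the selection \<open>\<phi>\<close> has a second moment, and Young's inequality turns
  the cross term into an error of order gamma^2. At an arbitrary point of the domain c^2 |\<phi>|^2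
  need not be integrable. There the part with \<open>\<phi>\<close> is kept and paired with the
  increments, whose square summability has already been won at a saddle point; after division by the
  total weight the normalized weights lie in every l^r with r > 1, which matches a moment of order 1
  + \<epsilon>. The coupling L acts as a skew operator on the product space and so drops out of all
  monotonicity inequalities. The exceptional null set depends on u, and v need not vary continuously
  with u. Density is therefore taken in the graph of a choice of pairs (u, v), not in the domain. In
  place of conditional expectations, the next draw has a product law with the past and is integrated
  out by Fubini's theorem.\<close>

definition effective_domain :: "('a::euclidean_space \<Rightarrow> ereal) \<Rightarrow> 'a set" where
  "effective_domain h = {x. h x < \<infinity>}"

lemma subdifferentialD:
  "u \<in> subdifferential h x \<Longrightarrow> h x + ereal (u \<bullet> (y - x)) \<le> h y"
  by (auto simp: subdifferential_def)

lemma proper_fun_cases: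
  assumes "proper_fun h" "h x \<noteq> \<infinity>"
  obtains r where "h x = ereal r"
  using assms by (cases "h x") (auto simp: proper_fun_def)

lemma subdifferential_finite:
  assumes h: "proper_fun h" and u: "u \<in> subdifferential h x"
  obtains r where "h x = ereal r"
proof -
  obtain y where y: "h y \<noteq> \<infinity>" using h by (auto simp: proper_fun_def)
  have "h x \<noteq> \<infinity>" using subdifferentialD[OF u, of y] y by auto
  then show ?thesis using proper_fun_cases[OF h] that by blast
qed

lemma dom_subdifferential_subset:
  assumes "proper_fun h"
  shows "dom_subdifferential h \<subseteq> effective_domain h"
proof
  fix x assume "x \<in> dom_subdifferential h"
  then obtain u where "u \<in> subdifferential h x" by (auto simp: dom_subdifferential_def)
  then obtain r where "h x = ereal r" by (rule subdifferential_finite[OF assms])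
  then show "x \<in> effective_domain h" by (simp add: effective_domain_def)
qed

lemma subdifferential_monotone:
  assumes h: "proper_fun h" and u: "u \<in> subdifferential h x" and v: "v \<in> subdifferential h y"
  shows "0 \<le> (u - v) \<bullet> (x - y)"
proof -
  obtain r where r: "h x = ereal r" by (rule subdifferential_finite[OF h u])
  obtain q where q: "h y = ereal q" by (rule subdifferential_finite[OF h v])
  show ?thesis
    using subdifferentialD[OF u, of y] subdifferentialD[OF v, of x] r q
    by (simp add: inner_diff algebra_simps)
qed

section \<open>Lower semicontinuity and attainment of minima\<close>

lemma lsc_open_superlevel:
  assumes "lsc_fun h"
  shows "open {z. c < h z}"
proof (rule topological_space_class.openI)
  fix x assume "x \<in> {z. c < h z}"
  then have c: "c < h x" by simp
  then have "eventually (\<lambda>z. c < h z) (at x)"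
    using assms le_Liminf_iff[of "h x" "at x" h] by (auto simp: lsc_fun_def)
  \<comment> \<open>\<open>Liminf (at x)\<close> sees punctured neighbourhoods only; the point
    \<open>x\<close> itself is supplied by the assumption \<open>c\<close>.\<close>
  then have "eventually (\<lambda>z. c < h z) (nhds x)"
    unfolding eventually_at_filter by (rule eventually_mono) (use c in auto)
  then show "\<exists>T. open T \<and> x \<in> T \<and> T \<subseteq> {z. c < h z}"
    unfolding eventually_nhds by auto
qed

lemma lsc_eventually:
  assumes "lsc_fun h" "c < h y" "(X \<longlongrightarrow> y) F"
  shows "eventually (\<lambda>t. c < h (X t)) F"
  using topological_tendstoD[OF assms(3) lsc_open_superlevel[OF assms(1)], of c] assms(2) by simp

text \<open>If no point of \<open>K\<close> were minimal, the open sets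
  \<open>{z. \<phi> y < \<phi> z}\<close> would cover \<open>K\<close>; the centre of least value in
  a finite subcover would then have to be covered by a centre of still smaller value.\<close>

lemma compact_attains_inf_superlevel:
  fixes \<phi> :: "'a::euclidean_space \<Rightarrow> ereal"
  assumes K: "compact K" "K \<noteq> {}" and op: "\<And>c. open {z. c < \<phi> z}"
  shows "\<exists>x\<in>K. \<forall>y\<in>K. \<phi> x \<le> \<phi> y"
proof (rule ccontr)
  assume "\<not> ?thesis"
  then have "K \<subseteq> (\<Union>y\<in>K. {z. \<phi> y < \<phi> z})" by (force simp: not_le)
  then obtain D where D: "D \<subseteq> K" "finite D" "K \<subseteq> (\<Union>y\<in>D. {z. \<phi> y < \<phi> z})"
    using compactE_image[OF K(1), of K "\<lambda>y. {z. \<phi> y < \<phi> z}"] op by metis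
  have ne: "D \<noteq> {}" using D K by auto
  define q where "q = Min (\<phi> ` D)"
  have "q \<in> \<phi> ` D" unfolding q_def using D ne by (intro Min_in) auto
  then obtain d where d: "d \<in> D" "\<phi> d = q" by auto
  then obtain y where "y \<in> D" "\<phi> y < q" using D by auto
  moreover have "q \<le> \<phi> y" unfolding q_def using D \<open>y \<in> D\<close> by (intro Min_le) auto
  ultimately show False by simp
qed

text \<open>Beyond the unit sphere about \<open>x0\<close>, a convex combination of
  \<open>x0\<close> and \<open>y\<close> lies on that sphere, where \<open>h\<close> is at least its
  minimum over the ball. Solving the convexity inequality for \<open>h y\<close> shows that
  \<open>h\<close> decreases at most linearly.\<close>

lemma Gamma0_linear_lower_bound:
  fixes h :: "'a::euclidean_space \<Rightarrow> ereal"
  assumes h: "h \<in> Gamma0" and x0: "h x0 = ereal r0"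
  obtains c where "0 \<le> c" "\<And>y. ereal (- c * (1 + norm (y - x0))) \<le> h y"
proof -
  have lsc: "lsc_fun h" and pr: "proper_fun h" and cv: "convex_fun h" using h by (auto simp: Gamma0_def)
  obtain a where a: "\<And>y. y \<in> cball x0 1 \<Longrightarrow> h a \<le> h y"
    using compact_attains_inf_superlevel[OF _ _ lsc_open_superlevel[OF lsc], of "cball x0 1"]
    by (metis cball_eq_empty compact_cball not_one_less_zero)
  have "h a \<noteq> \<infinity>" using a[of x0] x0 by auto
  then obtain q where q: "h a = ereal q" using proper_fun_cases[OF pr] by blast
  define c where "c = \<bar>q\<bar> + \<bar>r0\<bar>"
  show thesis
  proof
    show "0 \<le> c" by (simp add: c_def)
    fix y
    show "ereal (- c * (1 + norm (y - x0))) \<le> h y"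
    proof (cases "h y = \<infinity>")
      case False
      then obtain s where s: "h y = ereal s" using proper_fun_cases[OF pr] by blast
      have c0: "- c * (1 + norm (y - x0)) \<le> - c" 
        using mult_nonneg_nonneg[of c "norm (y - x0)"] by (simp add: c_def algebra_simps)
      show ?thesis
      proof (cases "norm (y - x0) \<le> 1")
        case True
        then have "ereal q \<le> h y" using a[of y] q by (auto simp: dist_norm norm_minus_commute)
        then have "- c \<le> s" using s by (auto simp: c_def)
        then show ?thesis using c0 s by auto
      next
        case False
        define R where "R = norm (y - x0)"
        have R: "R > 1" using False by (simp add: R_def)
        \<comment> \<open>The point where the segment from \<open>x0\<close> to \<open>y\<close>
          crosses the unit sphere about \<open>x0\<close>.\<close>
        define w where "w = (1 - 1 / R) *\<^sub>R x0 + (1 / R) *\<^sub>R y"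
        have "w - x0 = (1 / R) *\<^sub>R (y - x0)" by (simp add: w_def algebra_simps)
        then have "norm (w - x0) = 1" using R unfolding R_def by auto
        then have "ereal q \<le> h w" using a[of w] q by (auto simp: dist_norm norm_minus_commute)
        also have "h w \<le> ereal (1 - 1 / R) * h x0 + ereal (1 / R) * h y"
          using cv[unfolded convex_fun_def, rule_format, of "1 - 1/R" "1/R" x0 y] R by (simp add: w_def)
        finally have "q \<le> (1 - 1 / R) * r0 + s / R" using x0 s by simp
        then have "R * q \<le> (R - 1) * r0 + s" using R by (simp add: field_simps)
        moreover have "R * q \<ge> - R * \<bar>q\<bar>" using R mult_left_mono[of "-\<bar>q\<bar>" q R] by auto
        moreover have "(R - 1) * r0 \<le> R * \<bar>r0\<bar>" using R 
          by (smt (verit, best) mult_left_mono mult_right_mono)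
        ultimately have "- c * R \<le> s" by (simp add: c_def algebra_simps)
        then have "- c * (1 + R) \<le> s" by (simp add: c_def algebra_simps)
        then show ?thesis using s by (simp add: R_def)
      qed
    qed simp
  qed
qed

section \<open>Proximal maps\<close>

lemma Gamma0_scale:
  assumes h: "h \<in> Gamma0" and a: "0 < (a::real)"
  shows "(\<lambda>y. ereal a * h y) \<in> Gamma0"
proof -
  have lsc: "lsc_fun h" and pr: "proper_fun h" and cv: "convex_fun h" using h by (auto simp: Gamma0_def)
  have "lsc_fun (\<lambda>y. ereal a * h y)"
    using lsc a unfolding lsc_fun_def
    by (subst Liminf_ereal_mult_left) (auto intro!: ereal_mult_left_mono)
  moreover have "proper_fun (\<lambda>y. ereal a * h y)"
    using pr a by (auto simp: proper_fun_def ereal_mult_eq_PInfty ereal_mult_eq_MInfty)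
  moreover have "convex_fun (\<lambda>y. ereal a * h y)"
    unfolding convex_fun_def
  proof (intro allI impI)
    fix x y :: 'a and u v :: real assume uv: "0 < u \<and> 0 < v \<and> u + v = 1"
    have "ereal a * h (u *\<^sub>R x + v *\<^sub>R y) \<le> ereal a * (ereal u * h x + ereal v * h y)"
      using cv uv a by (intro ereal_mult_left_mono) (auto simp: convex_fun_def)
    also have "\<dots> = ereal u * (ereal a * h x) + ereal v * (ereal a * h y)"
      using pr uv a by (cases "h x"; cases "h y") (auto simp: proper_fun_def algebra_simps)
    finally show "ereal a * h (u *\<^sub>R x + v *\<^sub>R y) \<le> \<dots>" .
  qed
  ultimately show ?thesis by (simp add: Gamma0_def)
qed

text \<open>The quadratic term beats the linear lower bound, which confines the search for a
  minimizer to a ball. Existence has to be settled before anything can be said about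
  \<open>prox\<close>, an \<open>arg_min\<close> defined by choice.\<close>

lemma prox_is_minimizer:
  fixes h :: "'a::euclidean_space \<Rightarrow> ereal"
  assumes h: "h \<in> Gamma0"
  shows "h (prox h x) + ereal ((norm (prox h x - x))\<^sup>2 / 2) \<le> h y + ereal ((norm (y - x))\<^sup>2 / 2)"
proof -
  have lsc: "lsc_fun h" and pr: "proper_fun h" using h by (auto simp: Gamma0_def)
  define \<phi> where "\<phi> y = h y + ereal ((norm (y - x))\<^sup>2 / 2)" for y
  have op: "open {z. c < \<phi> z}" for c
  proof (rule topological_space_class.openI)
    fix z assume "z \<in> {z. c < \<phi> z}"
    then have "c < \<phi> z" by simp
    then have "c - ereal ((norm (z - x))\<^sup>2 / 2) < h z"
      using pr by (cases c; cases "h z") (auto simp: \<phi>_def proper_fun_def algebra_simps)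
    then obtain d where d: "c - ereal ((norm (z - x))\<^sup>2 / 2) < ereal d" "ereal d < h z"
      using ereal_dense2[of "c - ereal ((norm (z - x))\<^sup>2 / 2)" "h z"] by auto
    have "open ({w. ereal d < h w} \<inter> {w. c < ereal (d + (norm (w - x))\<^sup>2 / 2)})"
      by (intro open_Int lsc_open_superlevel[OF lsc] open_Collect_less continuous_on_ereal continuous_intros) auto
    moreover have "z \<in> {w. ereal d < h w} \<inter> {w. c < ereal (d + (norm (w - x))\<^sup>2 / 2)}"
      using d by (cases c) auto
    moreover have "{w. ereal d < h w} \<inter> {w. c < ereal (d + (norm (w - x))\<^sup>2 / 2)} \<subseteq> {z. c < \<phi> z}"
    proof safe
      fix w assume "ereal d < h w" "c < ereal (d + (norm (w - x))\<^sup>2 / 2)"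
      then show "c < \<phi> w" unfolding \<phi>_def by (cases c; cases "h w") auto
    qed
    ultimately show "\<exists>T. open T \<and> z \<in> T \<and> T \<subseteq> {z. c < \<phi> z}" by blast
  qed
  obtain x0 where "h x0 \<noteq> \<infinity>" using pr by (auto simp: proper_fun_def)
  then obtain r0 where r0: "h x0 = ereal r0" using proper_fun_cases[OF pr] by blast
  obtain c where c: "0 \<le> c" "\<And>y. ereal (- c * (1 + norm (y - x0))) \<le> h y"
    using Gamma0_linear_lower_bound[OF h r0] by blast
  define r where "r = r0 + (norm (x0 - x))\<^sup>2 / 2"
  define B where "B = norm (x0 - x)"
  \<comment> \<open>Chosen so that for \<open>t > R\<close> the term \<open>t^2 / 2\<close> exceeds
    the linear loss \<open>c + c t + c B\<close> by more than \<open>r\<close>, the value of the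
    objective at \<open>x0\<close>.\<close>
  define R where "R = B + 2 * c + 2 + \<bar>r\<bar> + c + c * B"
  have outside: "\<phi> y > ereal r" if "norm (y - x) > R" for y
  proof -
    define t where "t = norm (y - x)"
    have cB: "0 \<le> c * B" using c(1) by (simp add: B_def)
    have R0: "R \<ge> 2 * c + 2" "R \<ge> 2" "R \<ge> 2 * c + 2 + \<bar>r\<bar> + c + c * B" using c(1) cB by (auto simp: R_def B_def)
    have t: "t > R" using that by (simp add: t_def)
    have "norm (y - x0) \<le> t + B" unfolding t_def B_def
      by (metis dist_norm dist_triangle dist_commute)
    then have "c * norm (y - x0) \<le> c * t + c * B" using c(1) by (metis distrib_left mult_left_mono)
    then have "ereal (- c - c * t - c * B) \<le> ereal (- c * (1 + norm (y - x0)))" by (simp add: algebra_simps)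
    also have "\<dots> \<le> h y" by (rule c)
    finally have 1: "ereal (- c - c * t - c * B) \<le> h y" .
    have "t * (t / 2 - c) \<ge> t * 1" using t R0 c(1) by (intro mult_left_mono) auto
    then have "r < - c - c * t - c * B + t\<^sup>2 / 2"
      using t R0 c(1) by (simp add: power2_eq_square algebra_simps)
    then have "ereal r < ereal (- c - c * t - c * B) + ereal (t\<^sup>2 / 2)" by simp
    also have "\<dots> \<le> \<phi> y" unfolding \<phi>_def using 1 by (intro add_mono) (auto simp: t_def)
    finally show ?thesis .
  qed
  have R0: "0 \<le> R" using c(1) by (simp add: R_def B_def)
  obtain p where p: "p \<in> cball x R" "\<And>y. y \<in> cball x R \<Longrightarrow> \<phi> p \<le> \<phi> y"
    using compact_attains_inf_superlevel[of "cball x R" \<phi>] op R0 by auto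
  have x0in: "x0 \<in> cball x R" using c(1) by (auto simp: R_def B_def dist_norm norm_minus_commute)
  have "\<phi> p \<le> \<phi> y" for y
  proof (cases "y \<in> cball x R")
    case False
    then have "ereal r < \<phi> y" using outside[of y] by (simp add: dist_norm norm_minus_commute)
    moreover have "\<phi> x0 = ereal r" by (simp add: \<phi>_def r_def r0)
    ultimately show ?thesis using p(2)[OF x0in] by simp
  qed (use p in auto)
  then have "is_arg_min \<phi> (\<lambda>_. True) p" by (auto simp: is_arg_min_linorder)
  then have "is_arg_min \<phi> (\<lambda>_. True) (prox h x)"
    unfolding prox_def arg_min_def \<phi>_def by (rule someI)
  then show ?thesis by (simp add: is_arg_min_linorder \<phi>_def)
qed

text \<open>The minimizer \<open>p\<close> is compared with \<open>(1 - t) p + t y\<close>: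
  convexity bounds the change of \<open>h\<close> linearly in \<open>t\<close>, the quadratic term
  has slope \<open>(p - x) . (y - p)\<close>, and division by \<open>t\<close> leaves an error of
  order \<open>t\<close>.\<close>

lemma prox_subgradient:
  fixes h :: "'a::euclidean_space \<Rightarrow> ereal"
  assumes h: "h \<in> Gamma0"
  shows "x - prox h x \<in> subdifferential h (prox h x)"
proof -
  have pr: "proper_fun h" and cv: "convex_fun h" using h by (auto simp: Gamma0_def)
  define p where "p = prox h x"
  have min: "h p + ereal ((norm (p - x))\<^sup>2 / 2) \<le> h y + ereal ((norm (y - x))\<^sup>2 / 2)" for y
    using prox_is_minimizer[OF h] by (simp add: p_def)
  obtain x0 where "h x0 \<noteq> \<infinity>" using pr by (auto simp: proper_fun_def)
  then have "h p \<noteq> \<infinity>" using min[of x0] by auto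
  then obtain r where r: "h p = ereal r" using proper_fun_cases[OF pr] by blast
  have "h p + ereal ((x - p) \<bullet> (y - p)) \<le> h y" for y
  proof (cases "h y = \<infinity>")
    case False
    then obtain s where s: "h y = ereal s" using proper_fun_cases[OF pr] by blast
    have bound: "r + (x - p) \<bullet> (y - p) - s \<le> t * ((norm (y - p))\<^sup>2 / 2)" if t: "0 < t" "t < 1" for t
    proof -
      have "h p + ereal ((norm (p - x))\<^sup>2 / 2) \<le>
        h ((1 - t) *\<^sub>R p + t *\<^sub>R y) + ereal ((norm ((1 - t) *\<^sub>R p + t *\<^sub>R y - x))\<^sup>2 / 2)" by (rule min)
      also have "\<dots> \<le> ereal (1 - t) * h p + ereal t * h y + ereal ((norm ((1 - t) *\<^sub>R p + t *\<^sub>R y - x))\<^sup>2 / 2)"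
        using cv[unfolded convex_fun_def, rule_format, of "1 - t" t p y] t by (intro add_mono) auto
      also have "(1 - t) *\<^sub>R p + t *\<^sub>R y - x = (p - x) + t *\<^sub>R (y - p)" by (simp add: algebra_simps)
      also have "(norm ((p - x) + t *\<^sub>R (y - p)))\<^sup>2 = (norm (p - x))\<^sup>2 + 2 * t * ((p - x) \<bullet> (y - p)) + t\<^sup>2 * (norm (y - p))\<^sup>2"
        unfolding power2_norm_eq_inner by (simp add: inner_add inner_commute algebra_simps power2_eq_square)
      finally have "r + (norm (p - x))\<^sup>2 / 2 \<le> (1 - t) * r + t * s +
        ((norm (p - x))\<^sup>2 + 2 * t * ((p - x) \<bullet> (y - p)) + t\<^sup>2 * (norm (y - p))\<^sup>2) / 2"
        using r s by simp
      then have "t * (r + (x - p) \<bullet> (y - p) - s) \<le> t * (t * ((norm (y - p))\<^sup>2 / 2))"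
        by (simp add: field_simps power2_eq_square inner_diff)
      then show ?thesis using t by simp
    qed
    have "((\<lambda>t. t * ((norm (y - p))\<^sup>2 / 2)) \<longlongrightarrow> 0 * ((norm (y - p))\<^sup>2 / 2)) (at_right (0::real))"
      by (intro tendsto_intros)
    moreover have "eventually (\<lambda>t. r + (x - p) \<bullet> (y - p) - s \<le> t * ((norm (y - p))\<^sup>2 / 2)) (at_right (0::real))"
      unfolding eventually_at_right_field using bound by (intro exI[of _ 1]) auto
    ultimately have "r + (x - p) \<bullet> (y - p) - s \<le> 0"
      by (intro tendsto_lowerbound[of _ _ "at_right (0::real)"]) auto
    then show ?thesis using r s by simp
  qed simp
  then show ?thesis by (simp add: subdifferential_def p_def)
qed

lemma prox_scale_subgradient:
  fixes h :: "'a::euclidean_space \<Rightarrow> ereal" and x :: 'a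
  assumes h: "h \<in> Gamma0" and a: "0 < a"
  defines "q \<equiv> prox (\<lambda>y. ereal a * h y) x"
  shows "(1 / a) *\<^sub>R (x - q) \<in> subdifferential h q"
proof -
  have pr: "proper_fun h" using h by (auto simp: Gamma0_def)
  have *: "x - q \<in> subdifferential (\<lambda>y. ereal a * h y) q"
    unfolding q_def by (rule prox_subgradient[OF Gamma0_scale[OF h a]])
  have "h q + ereal ((1 / a) *\<^sub>R (x - q) \<bullet> (y - q)) \<le> h y" for y
  proof (cases "h y = \<infinity>")
    case False
    then obtain s where s: "h y = ereal s" using proper_fun_cases[OF pr] by blast
    have "h q \<noteq> \<infinity>" using subdifferentialD[OF *, of y] s a by auto
    then obtain r where r: "h q = ereal r" using proper_fun_cases[OF pr] by blast
    have "a * r + (x - q) \<bullet> (y - q) \<le> a * s" using subdifferentialD[OF *, of y] r s by simp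
    then have "r + ((x - q) \<bullet> (y - q)) / a \<le> s" using a by (simp add: field_simps)
    then show ?thesis using r s by simp
  qed simp
  then show ?thesis by (simp add: subdifferential_def)
qed

lemma prox_in_dom_subdifferential:
  "h \<in> Gamma0 \<Longrightarrow> 0 < a \<Longrightarrow> prox (\<lambda>y. ereal a * h y) x \<in> dom_subdifferential h"
  using prox_scale_subgradient[of h a x] by (auto simp: dom_subdifferential_def)

text \<open>Monotonicity applied to the two residuals gives firm nonexpansiveness, and
  Cauchy-Schwarz the Lipschitz bound.\<close>

lemma prox_nonexpansive:
  fixes h :: "'a::euclidean_space \<Rightarrow> ereal"
  assumes h: "h \<in> Gamma0"
  shows "norm (prox h x - prox h y) \<le> norm (x - y)"
proof -
  have pr: "proper_fun h" using h by (auto simp: Gamma0_def)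
  define d where "d = prox h x - prox h y"
  have "0 \<le> ((x - prox h x) - (y - prox h y)) \<bullet> d"
    unfolding d_def by (intro subdifferential_monotone[OF pr] prox_subgradient h)
  also have "(x - prox h x) - (y - prox h y) = (x - y) - d" by (simp add: d_def)
  finally have "(norm d)\<^sup>2 \<le> (x - y) \<bullet> d" by (simp add: inner_diff power2_norm_eq_inner)
  also have "\<dots> \<le> norm (x - y) * norm d" by (rule norm_cauchy_schwarz)
  finally show ?thesis by (cases "norm d = 0") (auto simp: d_def power2_eq_square)
qed

section \<open>Least norm subgradients\<close>

lemma subdifferential_closed_convex:
  assumes "proper_fun h"
  shows "closed (subdifferential h x)" "convex (subdifferential h x)"
proof -
  \<comment> \<open>An intersection of half-spaces, one for each \<open>y\<close>. The case
    \<open>h x = \<infinity>\<close> is separate because \<open>real_of_ereal\<close> would read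
    this value as \<open>0\<close>.\<close>
  have *: "subdifferential h x = (if h x = \<infinity> then {} else (\<Inter>y. {u. u \<bullet> (y - x) \<le> real_of_ereal (h y) - real_of_ereal (h x) \<or> h y = \<infinity>}))"
  proof (cases "h x = \<infinity>")
    case True
    have "u \<notin> subdifferential h x" for u using True by (auto elim: subdifferential_finite[OF assms])
    then show ?thesis using True by auto
  next
    case False
    have "h x + ereal (u \<bullet> (y - x)) \<le> h y \<longleftrightarrow> u \<bullet> (y - x) \<le> real_of_ereal (h y) - real_of_ereal (h x) \<or> h y = \<infinity>" for u y
      using False assms by (cases "h x"; cases "h y") (auto simp: proper_fun_def)
    then show ?thesis using False by (auto simp: subdifferential_def)
  qed
  have c1: "closed {u. u \<bullet> (y - x) \<le> real_of_ereal (h y) - real_of_ereal (h x) \<or> h y = \<infinity>}" for y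
    by (cases "h y = \<infinity>") (auto intro!: closed_Collect_le continuous_intros)
  have c2: "convex {u. u \<bullet> (y - x) \<le> real_of_ereal (h y) - real_of_ereal (h x) \<or> h y = \<infinity>}" for y
    using convex_halfspace_le[of "y - x"] by (cases "h y = \<infinity>") (auto simp: inner_commute)
  show "closed (subdifferential h x)" unfolding * using c1 by auto
  show "convex (subdifferential h x)" unfolding * using c2 by (auto intro!: convex_INT)
qed

text \<open>The subdifferential is closed and convex, so whatever \<open>arg_min\<close> chooses is
  the projection of the origin; this gives uniqueness.\<close>

lemma least_norm_subgradient_eq_closest_point:
  assumes h: "proper_fun h" and ne: "subdifferential h x \<noteq> {}"
  shows "least_norm_subgradient h x = closest_point (subdifferential h x) 0"
    "least_norm_subgradient h x \<in> subdifferential h x"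
    "\<And>u. u \<in> subdifferential h x \<Longrightarrow> norm (least_norm_subgradient h x) \<le> norm u"
proof -
  let ?S = "subdifferential h x"
  have cp: "closest_point ?S 0 \<in> ?S" "\<forall>y\<in>?S. dist 0 (closest_point ?S 0) \<le> dist 0 y"
    using closest_point_exists[OF subdifferential_closed_convex(1)[OF h] ne] by blast+
  then have cp': "norm (closest_point ?S 0) \<le> norm y" if "y \<in> ?S" for y using that by auto
  have "is_arg_min norm (\<lambda>u. u \<in> ?S) (closest_point ?S 0)"
    using cp(1) cp' by (auto simp: is_arg_min_linorder)
  then have "is_arg_min norm (\<lambda>u. u \<in> ?S) (least_norm_subgradient h x)"
    unfolding least_norm_subgradient_def arg_min_def by (rule someI)
  then show 1: "least_norm_subgradient h x \<in> ?S" "\<And>u. u \<in> ?S \<Longrightarrow> norm (least_norm_subgradient h x) \<le> norm u"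
    by (auto simp: is_arg_min_linorder)
  show "least_norm_subgradient h x = closest_point ?S 0"
    using closest_point_unique[OF subdifferential_closed_convex(2,1)[OF h] 1(1), of 0] 1(2) by simp
qed

text \<open>Along \<open>x n\<close> only lower semicontinuity of \<open>h\<close> is available,
  which is the right direction: these values stand on the smaller side of the subgradient
  inequality.\<close>

lemma subdifferential_closed_graph:
  fixes h :: "'a::euclidean_space \<Rightarrow> ereal"
  assumes h: "h \<in> Gamma0" and u: "\<And>n::nat. u n \<in> subdifferential h (x n)"
    and lim: "u \<longlonglongrightarrow> u'" "x \<longlonglongrightarrow> x'"
  shows "u' \<in> subdifferential h x'"
proof -
  have lsc: "lsc_fun h" and pr: "proper_fun h" using h by (auto simp: Gamma0_def)
  have "h x' + ereal (u' \<bullet> (y - x')) \<le> h y" for y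
  proof (cases "h y = \<infinity>")
    case False
    then obtain s where s: "h y = ereal s" using proper_fun_cases[OF pr] by blast
    have "h x' \<le> ereal (s - u' \<bullet> (y - x'))"
    proof (rule ereal_le_real, rule ccontr)
      fix c assume "ereal (s - u' \<bullet> (y - x')) \<le> ereal c" "\<not> h x' \<le> ereal c"
      then have "ereal (s - u' \<bullet> (y - x')) < h x'" by (meson less_le_trans not_le le_less_trans)
      then obtain d where d: "ereal (s - u' \<bullet> (y - x')) < ereal d" "ereal d < h x'"
        using ereal_dense2 by blast
      have "eventually (\<lambda>n. ereal d < h (x n)) sequentially"
        by (rule lsc_eventually[OF lsc d(2) lim(2)])
      then have "eventually (\<lambda>n. d \<le> s - u n \<bullet> (y - x n)) sequentially"
      proof eventually_elim
        case (elim n)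
        then show ?case using subdifferentialD[OF u[of n], of y] s by (cases "h (x n)") auto
      qed
      then have "d \<le> s - u' \<bullet> (y - x')"
        by (intro tendsto_lowerbound[OF _ _ sequentially_bot, of "\<lambda>n. s - u n \<bullet> (y - x n)"])
           (auto intro!: tendsto_intros lim)
      then show False using d by simp
    qed
    then show ?thesis using s pr by (cases "h x'") (auto simp: proper_fun_def)
  qed simp
  then show ?thesis by (simp add: subdifferential_def)
qed

lemma tendsto_unique_cluster_point:
  fixes X :: "nat \<Rightarrow> 'a::euclidean_space"
  assumes bd: "bounded (range X)"
    and cl: "\<And>r l'. strict_mono r \<Longrightarrow> (X \<circ> r) \<longlonglongrightarrow> l' \<Longrightarrow> l' = l"
  shows "X \<longlonglongrightarrow> l"
proof (rule ccontr)
  assume "\<not> X \<longlonglongrightarrow> l"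
  then obtain e where e: "e > 0" "\<exists>\<^sub>F n in sequentially. \<not> dist (X n) l < e"
    by (auto simp: tendsto_iff not_eventually)
  then have "infinite {n. \<not> dist (X n) l < e}"
    by (simp add: frequently_sequentially infinite_nat_iff_unbounded_le)
  then obtain r :: "nat \<Rightarrow> nat" where r: "strict_mono r" "\<And>n. \<not> dist (X (r n)) l < e"
    using infinite_enumerate by blast
  have "bounded (range (X \<circ> r))" by (rule bounded_subset[OF bd]) auto
  then obtain l' q where q: "strict_mono q" "((X \<circ> r) \<circ> q) \<longlonglongrightarrow> l'"
    using bounded_imp_convergent_subsequence by blast
  have "l' = l" using cl[of "r \<circ> q" l'] r q by (simp add: strict_mono_o o_assoc)
  then have "eventually (\<lambda>n. dist (X (r (q n))) l < e) sequentially"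
    using q(2) e(1) by (auto simp: tendsto_iff)
  then show False using r(2) by (auto simp: eventually_sequentially)
qed

text \<open>The Yosida approximations \<open>(x - prox\<^bsub>ah\<^esub> x) / a\<close> converge to the least norm subgradient;
  this transfers measurability from proximal maps to least norm subgradients.\<close>

lemma yosida_tendsto_least_norm_subgradient:
  fixes h :: "'a::euclidean_space \<Rightarrow> ereal"
  assumes h: "h \<in> Gamma0" and ne: "subdifferential h x \<noteq> {}"
  shows "(\<lambda>n. real (Suc n) *\<^sub>R (x - prox (\<lambda>y. ereal (1 / real (Suc n)) * h y) x)) \<longlonglongrightarrow> least_norm_subgradient h x"
proof -
  have pr: "proper_fun h" using h by (auto simp: Gamma0_def)
  define p where "p n = prox (\<lambda>y. ereal (1 / real (Suc n)) * h y) x" for n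
  define Y where "Y n = real (Suc n) *\<^sub>R (x - p n)" for n
  define v where "v = least_norm_subgradient h x"
  have v: "v \<in> subdifferential h x" "\<And>u. u \<in> subdifferential h x \<Longrightarrow> norm v \<le> norm u"
    using least_norm_subgradient_eq_closest_point[OF pr ne] by (auto simp: v_def)
  have Y: "Y n \<in> subdifferential h (p n)" for n
    using prox_scale_subgradient[OF h, of "1 / real (Suc n)" x] by (simp add: Y_def p_def)
  have px: "p n - x = - (1 / real (Suc n)) *\<^sub>R Y n" for n by (simp add: Y_def)
  \<comment> \<open>Monotonicity between \<open>Y n\<close> at \<open>p n\<close> and
    \<open>v\<close> at \<open>x\<close>, where \<open>p n - x\<close> is a negative multiple of
    \<open>Y n\<close>. The bound also forces \<open>p n\<close> to converge to
    \<open>x\<close>.\<close>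
  have nY: "norm (Y n) \<le> norm v" for n
  proof -
    have "0 \<le> (Y n - v) \<bullet> (p n - x)" by (rule subdifferential_monotone[OF pr Y v(1)])
    also have "\<dots> = - (1 / real (Suc n)) * ((Y n - v) \<bullet> Y n)" unfolding px by simp
    finally have "(Y n - v) \<bullet> Y n \<le> 0" by (simp add: zero_le_divide_iff divide_le_0_iff)
    then have "(norm (Y n))\<^sup>2 \<le> v \<bullet> Y n" by (simp add: inner_diff power2_norm_eq_inner)
    also have "\<dots> \<le> norm v * norm (Y n)" by (rule norm_cauchy_schwarz)
    finally show ?thesis by (cases "norm (Y n) = 0") (auto simp: power2_eq_square)
  qed
  have pl: "p \<longlonglongrightarrow> x"
  proof -
    have "(\<lambda>n. norm (p n - x)) \<longlonglongrightarrow> 0"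
    proof (rule tendsto_sandwich[of "\<lambda>_. 0" _ _ "\<lambda>n. inverse (real (Suc n)) * norm v"])
      show "eventually (\<lambda>n. norm (p n - x) \<le> inverse (real (Suc n)) * norm v) sequentially"
        unfolding px using nY by (intro always_eventually allI) (auto simp: divide_inverse mult.commute intro!: mult_left_mono)
      show "(\<lambda>n. inverse (real (Suc n)) * norm v) \<longlonglongrightarrow> 0"
        using tendsto_mult_left_zero[OF LIMSEQ_inverse_real_of_nat] by simp
    qed auto
    then show ?thesis by (simp add: LIM_zero_iff tendsto_norm_zero_iff)
  qed
  have "Y \<longlonglongrightarrow> v"
  proof (rule tendsto_unique_cluster_point)
    show "bounded (range Y)" using nY by (auto simp: bounded_iff)
    fix r w assume r: "strict_mono r" "(Y \<circ> r) \<longlonglongrightarrow> w"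
    \<comment> \<open>A cluster point is a subgradient at \<open>x\<close> of norm at most that of
      \<open>v\<close>, hence equal to \<open>v\<close> because the projection of the origin is
      unique.\<close>
    have w: "w \<in> subdifferential h x"
      by (rule subdifferential_closed_graph[OF h _ r(2), of "p \<circ> r"])
         (use Y LIMSEQ_subseq_LIMSEQ[OF pl r(1)] in auto)
    have "norm w \<le> norm v"
      using tendsto_norm[OF r(2)] nY by (intro LIMSEQ_le_const2[of "\<lambda>n. norm ((Y \<circ> r) n)"]) auto
    then have "w = closest_point (subdifferential h x) 0"
      using closest_point_unique[OF subdifferential_closed_convex(2,1)[OF pr] w, of 0] v(2) by force
    then show "w = v" using least_norm_subgradient_eq_closest_point(1)[OF pr ne] by (simp add: v_def)
  qed
  then show ?thesis unfolding Y_def p_def v_def .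
qed

section \<open>Subgradients of sums and saddle points\<close>

lemma convex_epi:
  assumes "convex_fun h"
  shows "convex (epi h)"
  unfolding convex_alt
proof (intro ballI allI impI)
  fix z w :: "'a \<times> real" and t :: real
  assume z: "z \<in> epi h" and w: "w \<in> epi h" and t: "0 \<le> t \<and> t \<le> 1"
  show "(1 - t) *\<^sub>R z + t *\<^sub>R w \<in> epi h"
  proof (cases "t = 0 \<or> t = 1")
    case False
    have "h ((1 - t) *\<^sub>R fst z + t *\<^sub>R fst w) \<le> ereal (1 - t) * h (fst z) + ereal t * h (fst w)"
      using assms False t by (simp add: convex_fun_def)
    also have "\<dots> \<le> ereal (1 - t) * ereal (snd z) + ereal t * ereal (snd w)"
      using z w t by (intro add_mono ereal_mult_left_mono) (auto simp: epi_def)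
    finally have "((1 - t) *\<^sub>R fst z + t *\<^sub>R fst w, (1 - t) * snd z + t * snd w) \<in> epi h"
      by (simp add: epi_def)
    moreover have "((1 - t) *\<^sub>R fst z + t *\<^sub>R fst w, (1 - t) * snd z + t * snd w) = (1 - t) *\<^sub>R z + t *\<^sub>R w"
      by (simp add: prod_eq_iff)
    ultimately show ?thesis by simp
  qed (use z w in auto)
qed

lemma convex_effective_domain:
  assumes "convex_fun h"
  shows "convex (effective_domain h)"
proof -
  have "effective_domain h = fst ` epi h"
  proof safe
    fix x assume "x \<in> effective_domain h"
    then obtain r where "h x \<le> ereal r"
      by (metis effective_domain_def ereal_dense2 less_imp_le mem_Collect_eq)
    then show "x \<in> fst ` epi h" by (force simp: epi_def)
  qed (auto simp: epi_def effective_domain_def intro: le_less_trans)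
  then show ?thesis using convex_linear_image[OF linear_fst convex_epi[OF assms]] by simp
qed

text \<open>A supporting hyperplane of the epigraph at \<open>(x, h x)\<close> cannot be vertical,
  since the domain continues beyond the relatively interior point \<open>x\<close> in every
  direction from which \<open>x\<close> is approached. Normalizing it gives a subgradient.\<close>

lemma subdifferential_rel_interior_nonempty:
  assumes cv: "convex_fun h" and pr: "proper_fun h"
    and x: "x \<in> rel_interior (effective_domain h)"
  shows "subdifferential h x \<noteq> {}"
proof -
  have xd: "x \<in> effective_domain h" using x rel_interior_subset by blast
  then obtain r where r: "h x = ereal r"
    using proper_fun_cases[OF pr] by (metis effective_domain_def mem_Collect_eq less_irrefl)
  have inE: "(x, r) \<in> epi h" by (simp add: epi_def r)
  have "(x, r) \<notin> rel_interior (epi h)"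
  proof
    assume "(x, r) \<in> rel_interior (epi h)"
    \<comment> \<open>Prolonging the segment from \<open>(x, r + 1)\<close> past
      \<open>(x, r)\<close> would end below the graph.\<close>
    then have "\<forall>w\<in>epi h. \<exists>e>1. (1 - e) *\<^sub>R w + e *\<^sub>R (x, r) \<in> epi h"
      by (metis convex_rel_interior_iff[OF convex_epi[OF cv]] inE empty_iff)
    then obtain e where e: "e > 1" "(1 - e) *\<^sub>R (x, r + 1) + e *\<^sub>R (x, r) \<in> epi h"
      using r by (metis (no_types, lifting) epi_def case_prodI ereal_less_eq(3) le_add_same_cancel1 mem_Collect_eq zero_le_one)
    moreover have "(1 - e) *\<^sub>R (x, r + 1) + e *\<^sub>R (x, r) = (x, (1 - e) * (r + 1) + e * r)"
      by (simp add: algebra_simps)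
    ultimately have "r \<le> (1 - e) * (r + 1) + e * r" by (simp add: epi_def r)
    then show False using e by (simp add: algebra_simps)
  qed
  then obtain A where "A \<noteq> 0" and A: "\<And>y. y \<in> epi h \<Longrightarrow> A \<bullet> (x, r) \<le> A \<bullet> y"
    and As: "\<And>y. y \<in> rel_interior (epi h) \<Longrightarrow> A \<bullet> (x, r) < A \<bullet> y"
    using supporting_hyperplane_rel_boundary[OF convex_epi[OF cv] inE] by metis
  obtain a \<alpha> where aa: "A = (a, \<alpha>)" by (cases A)
  have ineq: "a \<bullet> x + \<alpha> * r \<le> a \<bullet> y + \<alpha> * q" if "h y \<le> ereal q" for y q
    using A[of "(y, q)"] that by (simp add: aa epi_def)
  have "\<alpha> \<ge> 0" using ineq[of x "r + 1"] r by (simp add: algebra_simps)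
  moreover have "\<alpha> \<noteq> 0"
  proof
    assume z: "\<alpha> = 0"
    \<comment> \<open>At a relatively interior point of the epigraph the separation is strict;
      prolonging from its base point \<open>y\<close> beyond \<open>x\<close> inside the domain
      reverses the sign.\<close>
    obtain y q where yq: "(y, q) \<in> rel_interior (epi h)"
      using rel_interior_eq_empty[OF convex_epi[OF cv]] inE by (metis empty_iff surj_pair ex_in_conv)
    then have lt: "a \<bullet> x < a \<bullet> y" using As[OF yq] by (simp add: aa z)
    have "y \<in> effective_domain h" using yq rel_interior_subset[of "epi h"]
      by (auto simp: epi_def effective_domain_def intro: le_less_trans)
    then obtain e where e: "e > 1" "(1 - e) *\<^sub>R y + e *\<^sub>R x \<in> effective_domain h"
      using x convex_rel_interior_iff[OF convex_effective_domain[OF cv]] by (metis empty_iff xd)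
    then obtain s where "h ((1 - e) *\<^sub>R y + e *\<^sub>R x) = ereal s"
      using proper_fun_cases[OF pr] by (metis effective_domain_def mem_Collect_eq less_irrefl)
    then have "a \<bullet> x \<le> a \<bullet> ((1 - e) *\<^sub>R y + e *\<^sub>R x)" using ineq[of _ s] z by simp
    then have "0 \<le> (1 - e) * (a \<bullet> y - a \<bullet> x)" by (simp add: inner_add algebra_simps)
    then show False using e lt by (simp add: zero_le_mult_iff)
  qed
  ultimately have al: "\<alpha> > 0" by simp
  have "h x + ereal ((- (1 / \<alpha>) *\<^sub>R a) \<bullet> (y - x)) \<le> h y" for y
  proof (cases "h y = \<infinity>")
    case False
    then obtain q where q: "h y = ereal q" using proper_fun_cases[OF pr] by blast
    show ?thesis using ineq[of y q] q r al by (simp add: inner_diff field_simps)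
  qed simp
  then show ?thesis unfolding subdifferential_def by blast
qed

text \<open>The strict epigraph of \<open>F - F x\<close> is separated from the region below the
  concave function \<open>G x - G y - c . (y - x)\<close>; minimality makes the two sets disjoint,
  and the slope of the hyperplane splits the optimality condition.\<close>

lemma subdifferential_sum_rule_at_minimizer:
  fixes F :: "'a::euclidean_space \<Rightarrow> real" and G :: "'a \<Rightarrow> ereal"
  assumes F: "convex_on UNIV F" and G: "convex_fun G" "proper_fun G" and x: "G x \<noteq> \<infinity>"
    and min: "\<And>y. ereal (F x) + G x + ereal (c \<bullet> x) \<le> ereal (F y) + G y + ereal (c \<bullet> y)"
  shows "\<exists>u\<in>subdifferential (\<lambda>y. ereal (F y)) x. \<exists>v\<in>subdifferential G x. u + v + c = 0"
proof -
  obtain g where g: "G x = ereal g" using proper_fun_cases[OF G(2) x] .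
  define C1 where "C1 = {z. F (fst z) - F x < snd z}"
  define C2 where "C2 = {z. G (fst z) + ereal (c \<bullet> (fst z - x) + snd z) \<le> ereal g}"
  have "convex C1"
    unfolding convex_alt
  proof (intro ballI allI impI)
    fix z w and t :: real assume z: "z \<in> C1" and w: "w \<in> C1" and t: "0 \<le> t \<and> t \<le> 1"
    have "F ((1 - t) *\<^sub>R fst z + t *\<^sub>R fst w) \<le> (1 - t) * F (fst z) + t * F (fst w)"
      using F t by (intro convex_onD) auto
    moreover have "(1 - t) * (F (fst z) - F x) + t * (F (fst w) - F x) < (1 - t) * snd z + t * snd w"
      using z w t by (cases "t = 0"; cases "t = 1")
        (auto simp: C1_def intro!: add_strict_mono mult_strict_left_mono)
    ultimately show "(1 - t) *\<^sub>R z + t *\<^sub>R w \<in> C1" by (simp add: C1_def algebra_simps)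
  qed
  moreover have "convex C2"
    unfolding convex_alt
  proof (intro ballI allI impI)
    fix z w and t :: real assume z: "z \<in> C2" and w: "w \<in> C2" and t: "0 \<le> t \<and> t \<le> 1"
    show "(1 - t) *\<^sub>R z + t *\<^sub>R w \<in> C2"
    proof (cases "t = 0 \<or> t = 1")
      case False
      obtain a where a: "G (fst z) = ereal a"
        using z proper_fun_cases[OF G(2), of "fst z"] by (cases "G (fst z)") (auto simp: C2_def)
      obtain b where b: "G (fst w) = ereal b"
        using w proper_fun_cases[OF G(2), of "fst w"] by (cases "G (fst w)") (auto simp: C2_def)
      have "G ((1 - t) *\<^sub>R fst z + t *\<^sub>R fst w) \<le> ereal (1 - t) * G (fst z) + ereal t * G (fst w)"
        using G(1) False t by (simp add: convex_fun_def)
      then have 1: "G ((1 - t) *\<^sub>R fst z + t *\<^sub>R fst w) \<le> ereal ((1 - t) * a + t * b)" using a b by simp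
      have "(1 - t) * (a + (c \<bullet> (fst z - x) + snd z)) + t * (b + (c \<bullet> (fst w - x) + snd w)) \<le> (1 - t) * g + t * g"
        using z w t a b by (intro add_mono mult_left_mono) (auto simp: C2_def)
      then have 2: "(1 - t) * a + t * b + (c \<bullet> ((1 - t) *\<^sub>R fst z + t *\<^sub>R fst w - x) + ((1 - t) * snd z + t * snd w)) \<le> g"
        by (simp add: algebra_simps inner_diff inner_add)
      have "G ((1 - t) *\<^sub>R fst z + t *\<^sub>R fst w) + ereal (c \<bullet> ((1 - t) *\<^sub>R fst z + t *\<^sub>R fst w - x) + ((1 - t) * snd z + t * snd w))
        \<le> ereal ((1 - t) * a + t * b) + ereal (c \<bullet> ((1 - t) *\<^sub>R fst z + t *\<^sub>R fst w - x) + ((1 - t) * snd z + t * snd w))"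
        by (intro add_mono 1) auto
      also have "\<dots> \<le> ereal g" using 2 by simp
      finally show ?thesis by (simp add: C2_def)
    qed (use z w in auto)
  qed
  moreover have "(x, 1) \<in> C1" "(x, 0) \<in> C2" by (auto simp: C1_def C2_def g)
  moreover have "C1 \<inter> C2 = {}"
  proof (rule ccontr)
    assume "C1 \<inter> C2 \<noteq> {}"
    then obtain y r where yr: "(y, r) \<in> C1" "(y, r) \<in> C2" by auto
    obtain a where a: "G y = ereal a"
      using yr proper_fun_cases[OF G(2), of y] by (cases "G y") (auto simp: C2_def)
    show False using yr min[of y] a g by (auto simp: C1_def C2_def inner_diff)
  qed
  ultimately obtain A b where "A \<noteq> 0" and A1: "\<And>z. z \<in> C1 \<Longrightarrow> A \<bullet> z \<le> b" and A2: "\<And>z. z \<in> C2 \<Longrightarrow> b \<le> A \<bullet> z"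
    using separating_hyperplane_sets[of C1 C2] by (metis empty_iff)
  obtain a \<alpha> where aa: "A = (a, \<alpha>)" by (cases A)
  have i1: "a \<bullet> y + \<alpha> * r \<le> b" if "F y - F x < r" for y r
    using A1[of "(y, r)"] that by (simp add: aa C1_def)
  have i2: "b \<le> a \<bullet> y + \<alpha> * r" if "G y + ereal (c \<bullet> (y - x) + r) \<le> ereal g" for y r
    using A2[of "(y, r)"] that by (simp add: aa C2_def)
  have b0: "b \<le> a \<bullet> x" using i2[of x 0] g by simp
  have "\<alpha> \<le> 0" using i1[of x 1] b0 by simp
  moreover have "\<alpha> \<noteq> 0"
  proof
    assume "\<alpha> = 0"
    \<comment> \<open>\<open>C1\<close> projects onto the whole space because \<open>F\<close> is
      finite, so a vertical hyperplane would bound a nonzero linear functional from above.\<close>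
    then have "a \<bullet> y \<le> a \<bullet> x" for y using i1[of y "F y - F x + 1"] b0 by simp
    from this[of "x + a"] have "a \<bullet> a \<le> 0" by (simp add: inner_add)
    then have "a = 0" by (metis inner_gt_zero_iff not_le)
    with \<open>\<alpha> = 0\<close> \<open>A \<noteq> 0\<close> aa show False by (simp add: zero_prod_def)
  qed
  ultimately have al: "\<alpha> < 0" by simp
  define u where "u = (1 / (- \<alpha>)) *\<^sub>R a"
  have u: "u \<bullet> (y - x) \<le> F y - F x" for y
  proof (rule field_le_epsilon)
    fix e :: real assume "0 < e"
    then have "a \<bullet> y + \<alpha> * (F y - F x + e) \<le> a \<bullet> x" using i1[of y "F y - F x + e"] b0 by simp
    then have "a \<bullet> (y - x) \<le> (- \<alpha>) * (F y - F x + e)" by (simp add: inner_diff)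
    then show "u \<bullet> (y - x) \<le> F y - F x + e" using al by (simp add: u_def field_simps)
  qed
  have bx: "a \<bullet> x \<le> b"
  proof (rule field_le_epsilon)
    fix e :: real assume "0 < e"
    then show "a \<bullet> x \<le> b + e" using i1[of x "e / (- \<alpha>)"] al by (simp add: field_simps)
  qed
  have v: "G x + ereal ((- u - c) \<bullet> (y - x)) \<le> G y" for y
  proof (cases "G y = \<infinity>")
    case False
    then obtain q where q: "G y = ereal q" using proper_fun_cases[OF G(2)] by blast
    have "b \<le> a \<bullet> y + \<alpha> * (g - q - c \<bullet> (y - x))" by (rule i2) (simp add: q)
    then have "(- \<alpha>) * (g - q - c \<bullet> (y - x)) \<le> a \<bullet> (y - x)" using bx by (simp add: inner_diff)
    then have "g - q - c \<bullet> (y - x) \<le> u \<bullet> (y - x)" using al by (simp add: u_def field_simps)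
    then show ?thesis using q g by (simp add: inner_diff)
  qed simp
  have "u \<in> subdifferential (\<lambda>y. ereal (F y)) x" using u by (simp add: subdifferential_def algebra_simps)
  moreover have "- u - c \<in> subdifferential G x" using v by (simp add: subdifferential_def)
  ultimately show ?thesis by (intro bexI[of _ u] bexI[of _ "- u - c"]) auto
qed

text \<open>Saddle points are defined through the conjugate of \<open>H\<close>, that is the
  biconjugate of \<open>P\<close>, whereas the variational argument yields subgradients of
  \<open>P\<close>. The Fenchel-Young inequality and its equality case at \<open>u\<close> carry
  them over.\<close>

lemma subdifferential_biconjugate:
  assumes h: "proper_fun h" and u: "u \<in> subdifferential h x"
  shows "u \<in> subdifferential (fenchel_conjugate (fenchel_conjugate h)) x"
proof -
  obtain r where r: "h x = ereal r" by (rule subdifferential_finite[OF h u])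
  have conj: "fenchel_conjugate h u \<le> ereal (u \<bullet> x - r)"
    unfolding fenchel_conjugate_def
  proof (rule SUP_least)
    fix y
    show "ereal (u \<bullet> y) - h y \<le> ereal (u \<bullet> x - r)"
      using subdifferentialD[OF u, of y] r h
      by (cases "h y") (auto simp: inner_diff proper_fun_def)
  qed
  have le: "fenchel_conjugate (fenchel_conjugate h) x \<le> ereal r"
    unfolding fenchel_conjugate_def[of "fenchel_conjugate h"]
  proof (rule SUP_least)
    fix w
    have "ereal (w \<bullet> x - r) \<le> fenchel_conjugate h w"
      unfolding fenchel_conjugate_def using SUP_upper[of x UNIV "\<lambda>x. ereal (w \<bullet> x) - h x"] r by simp
    then show "ereal (x \<bullet> w) - fenchel_conjugate h w \<le> ereal r"
      unfolding inner_commute[of x w] by (cases "fenchel_conjugate h w") auto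
  qed
  have "fenchel_conjugate (fenchel_conjugate h) x + ereal (u \<bullet> (y - x)) \<le> fenchel_conjugate (fenchel_conjugate h) y" for y
  proof -
    have "fenchel_conjugate (fenchel_conjugate h) x + ereal (u \<bullet> (y - x)) \<le> ereal r + ereal (u \<bullet> (y - x))"
      using le by (intro add_mono) auto
    also have "\<dots> = ereal (u \<bullet> y) - ereal (u \<bullet> x - r)" by (simp add: inner_diff)
    also have "\<dots> \<le> ereal (u \<bullet> y) - fenchel_conjugate h u" using conj by (intro ereal_minus_mono) auto
    also have "\<dots> \<le> fenchel_conjugate (fenchel_conjugate h) y"
      unfolding fenchel_conjugate_def[of "fenchel_conjugate h"]
      using SUP_upper[of u UNIV "\<lambda>u. ereal (y \<bullet> u) - fenchel_conjugate h u"] by (simp add: inner_commute)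
    finally show ?thesis .
  qed
  then show ?thesis by (simp add: subdifferential_def)
qed

text \<open>A point in the closure of the domain which satisfies the monotonicity inequality against
  one arbitrary subgradient at each point is a saddle point: along a segment ending in the relative
  interior the inequality turns into an inequality between values, which passes to the limit by
  lower semicontinuity.\<close>

lemma saddle_point_of_monotone_inequalities:
  fixes F :: "'a::euclidean_space \<Rightarrow> real" and G :: "'a \<Rightarrow> ereal" and P :: "'b::euclidean_space \<Rightarrow> ereal"
    and A :: "'a \<Rightarrow>\<^sub>L 'b"
  assumes F: "convex_on UNIV F" and G: "G \<in> Gamma0" and P: "P \<in> Gamma0"
    and xb: "xb \<in> closure (effective_domain G)" and lb: "lb \<in> closure (effective_domain P)"
    and ineq: "\<And>x l. x \<in> dom_subdifferential G \<Longrightarrow> l \<in> dom_subdifferential P \<Longrightarrow>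
      \<exists>u\<in>subdifferential (\<lambda>y. ereal (F y)) x. \<exists>v\<in>subdifferential G x. \<exists>w\<in>subdifferential P l.
        0 \<le> (u + v + adjoint (blinfun_apply A) l) \<bullet> (x - xb) + (w - blinfun_apply A x) \<bullet> (l - lb)"
  shows "(xb, lb) \<in> saddle_points (\<lambda>y. ereal (F y)) G (fenchel_conjugate P) A"
proof -
  let ?A = "blinfun_apply A"
  have G': "lsc_fun G" "proper_fun G" "convex_fun G" using G by (auto simp: Gamma0_def)
  have P': "lsc_fun P" "proper_fun P" "convex_fun P" using P by (auto simp: Gamma0_def)
  have adj: "x \<bullet> adjoint ?A y = ?A x \<bullet> y" "adjoint ?A y \<bullet> x = y \<bullet> ?A x" for x y
    using adjoint_works[of ?A x y] blinfun.bounded_linear_right[of A]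
    by (auto simp: bounded_linear.linear inner_commute)
  \<comment> \<open>The contribution of the skew coupling. Along the segments used below its
    quadratic parts cancel, so that the value does not depend on \<open>t\<close>.\<close>
  define \<kappa> where "\<kappa> x l = lb \<bullet> ?A (x - xb) - ?A xb \<bullet> (l - lb)" for x l
  have contF: "continuous_on UNIV F" by (rule convex_on_continuous[OF open_UNIV F])
  have dG: "convex (effective_domain G)" "effective_domain G \<noteq> {}"
    using convex_effective_domain G' by (auto simp: effective_domain_def proper_fun_def)
  have dP: "convex (effective_domain P)" "effective_domain P \<noteq> {}"
    using convex_effective_domain P' by (auto simp: effective_domain_def proper_fun_def)
  have toxb: "((\<lambda>t::real. a + t *\<^sub>R b) \<longlongrightarrow> a) (at_right 0)" for a b :: "'c::euclidean_space"
    by (auto intro!: tendsto_eq_intros)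
  have small: "eventually (\<lambda>t::real. 0 < t \<and> t < 1) (at_right 0)"
    unfolding eventually_at_right_field by (intro exI[of _ 1]) auto
  \<comment> \<open>\<open>c1\<close> and \<open>c2\<close> stand in for \<open>G xb\<close> and
    \<open>P lb\<close>, whose finiteness is not yet known; real numbers strictly below these values
    remain below along the segment by lower semicontinuity.\<close>
  have ri: "F xb + c1 + c2 \<le> F x + g + q + \<kappa> x l"
    if x: "x \<in> rel_interior (effective_domain G)" and l: "l \<in> rel_interior (effective_domain P)"
      and g: "G x = ereal g" and q: "P l = ereal q" and c1: "ereal c1 < G xb" and c2: "ereal c2 < P lb"
    for x l g q c1 c2
  proof -
    define X where "X t = xb + t *\<^sub>R (x - xb)" for t
    define Y where "Y t = lb + t *\<^sub>R (l - lb)" for t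
    have bnd: "eventually (\<lambda>t. F (X t) + c1 + c2 \<le> F x + g + q + (1 - t) * \<kappa> x l) (at_right 0)"
      using small lsc_eventually[OF G'(1) c1 toxb[of xb "x - xb"]] lsc_eventually[OF P'(1) c2 toxb[of lb "l - lb"]]
    proof eventually_elim
      case (elim t)
      have XY: "X t \<in> rel_interior (effective_domain G)" "Y t \<in> rel_interior (effective_domain P)"
        using rel_interior_closure_convex_shrink[OF dG(1) x xb, of t] elim
          rel_interior_closure_convex_shrink[OF dP(1) l lb, of t]
        by (auto simp: X_def Y_def algebra_simps)
      have "X t \<in> dom_subdifferential G" "Y t \<in> dom_subdifferential P"
        using subdifferential_rel_interior_nonempty G' P' XY by (auto simp: dom_subdifferential_def)
      from ineq[OF this] obtain u v w where uvw: "u \<in> subdifferential (\<lambda>y. ereal (F y)) (X t)"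
        "v \<in> subdifferential G (X t)" "w \<in> subdifferential P (Y t)"
        "0 \<le> (u + v + adjoint ?A (Y t)) \<bullet> (X t - xb) + (w - ?A (X t)) \<bullet> (Y t - lb)" by blast
      \<comment> \<open>\<open>X t - xb\<close> and \<open>Y t - lb\<close> are both
        \<open>t\<close> times the full direction, so the factor \<open>t\<close> can be divided
        out.\<close>
      have "0 \<le> t * ((u + v + adjoint ?A (Y t)) \<bullet> (x - xb) + (w - ?A (X t)) \<bullet> (l - lb))"
        using uvw(4) by (simp add: X_def Y_def algebra_simps)
      then have 0: "0 \<le> (u + v + adjoint ?A (Y t)) \<bullet> (x - xb) + (w - ?A (X t)) \<bullet> (l - lb)"
        using elim by (simp add: zero_le_mult_iff)
      have kap: "adjoint ?A (Y t) \<bullet> (x - xb) - ?A (X t) \<bullet> (l - lb) = \<kappa> x l"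
        unfolding adj \<kappa>_def X_def Y_def by (simp add: blinfun.bilinear_simps inner_add inner_commute)
      have 1: "0 \<le> u \<bullet> (x - xb) + v \<bullet> (x - xb) + w \<bullet> (l - lb) + \<kappa> x l"
        using 0 kap by (simp add: inner_add inner_diff_left)
      have dx: "x - X t = (1 - t) *\<^sub>R (x - xb)" "l - Y t = (1 - t) *\<^sub>R (l - lb)"
        by (auto simp: X_def Y_def algebra_simps)
      have f: "F (X t) + (1 - t) * (u \<bullet> (x - xb)) \<le> F x"
        using subdifferentialD[OF uvw(1), of x] by (simp add: dx)
      obtain g' where g': "G (X t) = ereal g'" by (rule subdifferential_finite[OF G'(2) uvw(2)])
      obtain q' where q': "P (Y t) = ereal q'" by (rule subdifferential_finite[OF P'(2) uvw(3)])
      have gg: "c1 + (1 - t) * (v \<bullet> (x - xb)) \<le> g"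
        using subdifferentialD[OF uvw(2), of x, unfolded dx] g g' elim(2)[folded X_def] by simp
      have pp: "c2 + (1 - t) * (w \<bullet> (l - lb)) \<le> q"
        using subdifferentialD[OF uvw(3), of l, unfolded dx] q q' elim(3)[folded Y_def] by simp
      have "0 \<le> (1 - t) * (u \<bullet> (x - xb) + v \<bullet> (x - xb) + w \<bullet> (l - lb) + \<kappa> x l)" using 1 elim by simp
      then show ?case using f gg pp by (simp add: algebra_simps)
    qed
    have "((\<lambda>t. F (X t) + c1 + c2) \<longlongrightarrow> F xb + c1 + c2) (at_right 0)"
      unfolding X_def using continuous_on_tendsto_compose[OF contF toxb[of xb "x - xb"]] by (auto intro!: tendsto_intros)
    moreover have "((\<lambda>t. F x + g + q + (1 - t) * \<kappa> x l) \<longlongrightarrow> F x + g + q + (1 - 0) * \<kappa> x l) (at_right 0)"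
      by (intro tendsto_intros)
    ultimately show ?thesis using tendsto_le[OF _ _ _ bnd] by force
  qed
  obtain x0 where x0: "x0 \<in> rel_interior (effective_domain G)" using rel_interior_eq_empty[OF dG(1)] dG(2) by auto
  obtain l0 where l0: "l0 \<in> rel_interior (effective_domain P)" using rel_interior_eq_empty[OF dP(1)] dP(2) by auto
  have fin: "\<exists>r. G x = ereal r" if "x \<in> effective_domain G" for x
    using that proper_fun_cases[OF G'(2), of x] by (fastforce simp: effective_domain_def)
  have finP: "\<exists>r. P x = ereal r" if "x \<in> effective_domain P" for x
    using that proper_fun_cases[OF P'(2), of x] by (fastforce simp: effective_domain_def)
  obtain g0 where g0: "G x0 = ereal g0" using fin x0 rel_interior_subset by blast
  obtain q0 where q0: "P l0 = ereal q0" using finP l0 rel_interior_subset by blast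
  \<comment> \<open>From relatively interior points to all points of the domain, by moving slightly
    towards \<open>(x0, l0)\<close>; convexity bounds \<open>G\<close> and \<open>P\<close> along
    that segment.\<close>
  have all: "F xb + c1 + c2 \<le> F x + g + q + \<kappa> x l"
    if g: "G x = ereal g" and q: "P l = ereal q" and c: "ereal c1 < G xb" "ereal c2 < P lb" for x l g q c1 c2
  proof -
    define X where "X t = x + t *\<^sub>R (x0 - x)" for t
    define Y where "Y t = l + t *\<^sub>R (l0 - l)" for t
    have xd: "x \<in> closure (effective_domain G)" "l \<in> closure (effective_domain P)"
      using g q closure_subset by (fastforce simp: effective_domain_def)+
    have bnd: "eventually (\<lambda>t. F xb + c1 + c2 \<le> F (X t) + ((1 - t) * g + t * g0) + ((1 - t) * q + t * q0) + \<kappa> (X t) (Y t)) (at_right 0)"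
      using small
    proof eventually_elim
      case (elim t)
      have XY: "X t \<in> rel_interior (effective_domain G)" "Y t \<in> rel_interior (effective_domain P)"
        using rel_interior_closure_convex_shrink[OF dG(1) x0 xd(1), of t] elim
          rel_interior_closure_convex_shrink[OF dP(1) l0 xd(2), of t]
        by (auto simp: X_def Y_def algebra_simps)
      obtain g' where g': "G (X t) = ereal g'" using fin XY rel_interior_subset by blast
      obtain q' where q': "P (Y t) = ereal q'" using finP XY rel_interior_subset by blast
      have eq: "X t = (1 - t) *\<^sub>R x + t *\<^sub>R x0" "Y t = (1 - t) *\<^sub>R l + t *\<^sub>R l0"
        by (auto simp: X_def Y_def algebra_simps)
      have "G (X t) \<le> ereal (1 - t) * G x + ereal t * G x0"
        using G'(3) elim unfolding eq convex_fun_def by auto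
      then have 1: "g' \<le> (1 - t) * g + t * g0" using g g0 g' by simp
      have "P (Y t) \<le> ereal (1 - t) * P l + ereal t * P l0"
        using P'(3) elim unfolding eq convex_fun_def by auto
      then have 2: "q' \<le> (1 - t) * q + t * q0" using q q0 q' by simp
      show ?case using ri[OF XY g' q' c] 1 2 by simp
    qed
    have tX: "(X \<longlongrightarrow> x) (at_right 0)" "(Y \<longlongrightarrow> l) (at_right 0)" unfolding X_def Y_def by (auto intro: toxb)
    have "((\<lambda>t. F (X t)) \<longlongrightarrow> F x) (at_right 0)"
      using continuous_on_tendsto_compose[OF contF tX(1)] by auto
    moreover have "((\<lambda>t. \<kappa> (X t) (Y t)) \<longlongrightarrow> \<kappa> x l) (at_right 0)"
      unfolding \<kappa>_def by (intro tendsto_intros tX)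
    ultimately have "((\<lambda>t. F (X t) + ((1 - t) * g + t * g0) + ((1 - t) * q + t * q0) + \<kappa> (X t) (Y t)) \<longlongrightarrow>
      F x + ((1 - 0) * g + 0 * g0) + ((1 - 0) * q + 0 * q0) + \<kappa> x l) (at_right 0)"
      by (intro tendsto_intros)
    then show ?thesis using tendsto_lowerbound[OF _ bnd] by force
  qed
  obtain c1 where c1: "ereal c1 < G xb" using ereal_dense2[of "-\<infinity>" "G xb"] G'(2) by (auto simp: proper_fun_def)
  obtain c2 where c2: "ereal c2 < P lb" using ereal_dense2[of "-\<infinity>" "P lb"] P'(2) by (auto simp: proper_fun_def)
  have "G xb \<noteq> \<infinity>"
  proof
    assume "G xb = \<infinity>"
    \<comment> \<open>If \<open>G xb\<close> were infinite, \<open>c1\<close> could be as large as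
      desired; here it exceeds by one what \<open>all\<close> permits.\<close>
    then show False using all[OF g0 q0, of "F x0 + g0 + q0 + \<kappa> x0 l0 - F xb - c2 + 1" c2] c2 by simp
  qed
  then obtain gb where gb: "G xb = ereal gb" using proper_fun_cases[OF G'(2)] by blast
  have "P lb \<noteq> \<infinity>"
  proof
    assume "P lb = \<infinity>"
    then show False using all[OF g0 q0, of c1 "F x0 + g0 + q0 + \<kappa> x0 l0 - F xb - c1 + 1"] c1 by simp
  qed
  then obtain qb where qb: "P lb = ereal qb" using proper_fun_cases[OF P'(2)] by blast
  have VI: "F xb + gb + qb \<le> F x + g + q + \<kappa> x l" if "G x = ereal g" "P l = ereal q" for x l g q
  proof (rule field_le_epsilon)
    fix e :: real assume "0 < e"
    then show "F xb + gb + qb \<le> F x + g + q + \<kappa> x l + e"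
      using all[OF that, of "gb - e / 2" "qb - e / 2"] gb qb by simp
  qed
  \<comment> \<open>\<open>VI\<close> with \<open>l = lb\<close> says that \<open>xb\<close>
    minimizes \<open>F + G\<close> plus a linear term; with \<open>x = xb\<close> it becomes the
    subgradient inequality of \<open>P\<close> at \<open>lb\<close>.\<close>
  have "\<exists>u\<in>subdifferential (\<lambda>y. ereal (F y)) xb. \<exists>v\<in>subdifferential G xb. u + v + adjoint ?A lb = 0"
  proof (rule subdifferential_sum_rule_at_minimizer[OF F G'(3,2)])
    show "G xb \<noteq> \<infinity>" by (simp add: gb)
    fix y
    show "ereal (F xb) + G xb + ereal (adjoint ?A lb \<bullet> xb) \<le> ereal (F y) + G y + ereal (adjoint ?A lb \<bullet> y)"
    proof (cases "G y = \<infinity>")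
      case False
      then obtain g where "G y = ereal g" using proper_fun_cases[OF G'(2)] by blast
      then show ?thesis using VI[of y g lb qb] qb gb unfolding adj
        by (simp add: \<kappa>_def blinfun.bilinear_simps inner_diff)
    qed simp
  qed
  moreover have "?A xb \<in> subdifferential P lb"
  proof -
    have "P lb + ereal (?A xb \<bullet> (l - lb)) \<le> P l" for l
    proof (cases "P l = \<infinity>")
      case False
      then obtain q where "P l = ereal q" using proper_fun_cases[OF P'(2)] by blast
      then show ?thesis using VI[of xb gb l q] qb gb by (simp add: \<kappa>_def blinfun.bilinear_simps)
    qed simp
    then show ?thesis by (simp add: subdifferential_def)
  qed
  ultimately show ?thesis
    unfolding saddle_points_def using subdifferential_biconjugate[OF P'(2)] by force
qed

section \<open>Expectations of extended real valued random variables\<close>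

lemma extended_expectation_AE_real:
  assumes [measurable]: "\<phi> \<in> borel_measurable M" and r[measurable]: "r \<in> borel_measurable M"
    and eq: "AE s in M. \<phi> s = ereal (r s)"
  shows "extended_expectation M \<phi> = enn2ereal (\<integral>\<^sup>+ s. ennreal (r s) \<partial>M) - enn2ereal (\<integral>\<^sup>+ s. ennreal (- r s) \<partial>M)"
proof -
  have "(\<integral>\<^sup>+ s. e2ennreal (\<phi> s) * indicator {t. 0 \<le> \<phi> t \<and> \<phi> t < \<infinity>} s \<partial>M) = (\<integral>\<^sup>+ s. ennreal (r s) \<partial>M)"
    by (rule nn_integral_cong_AE, use eq in eventually_elim) (auto simp: indicator_def ennreal_neg)
  moreover have "(\<integral>\<^sup>+ s. e2ennreal (- \<phi> s) * indicator {t. -\<infinity> < \<phi> t \<and> \<phi> t < 0} s \<partial>M) = (\<integral>\<^sup>+ s. ennreal (- r s) \<partial>M)"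
    by (rule nn_integral_cong_AE, use eq in eventually_elim) (auto simp: indicator_def ennreal_neg)
  moreover have "AE s in M. \<not> \<phi> s = \<infinity>" using eq by eventually_elim auto
  then have "emeasure M {s \<in> space M. \<phi> s = \<infinity>} = 0" by (subst (asm) AE_iff_measurable[OF _ refl]) auto
  ultimately show ?thesis by (simp add: extended_expectation_def)
qed

lemma extended_expectation_integrable:
  assumes [measurable]: "\<phi> \<in> borel_measurable M" and r: "integrable M r"
    and eq: "AE s in M. \<phi> s = ereal (r s)"
  shows "extended_expectation M \<phi> = ereal (\<integral>s. r s \<partial>M)"
proof -
  have r': "r \<in> borel_measurable M" "(\<integral>\<^sup>+ s. ennreal (r s) \<partial>M) \<noteq> \<infinity>" "(\<integral>\<^sup>+ s. ennreal (- r s) \<partial>M) \<noteq> \<infinity>"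
    using r by (auto simp: real_integrable_def)
  obtain a where a: "0 \<le> a" "(\<integral>\<^sup>+ s. ennreal (r s) \<partial>M) = ennreal a" using r'(2) by (cases "\<integral>\<^sup>+ s. ennreal (r s) \<partial>M") auto
  obtain b where b: "0 \<le> b" "(\<integral>\<^sup>+ s. ennreal (- r s) \<partial>M) = ennreal b" using r'(3) by (cases "\<integral>\<^sup>+ s. ennreal (- r s) \<partial>M") auto
  have "(\<integral>s. r s \<partial>M) = a - b" using real_lebesgue_integral_def[OF r] a b by simp
  then show ?thesis using extended_expectation_AE_real[OF assms(1) r'(1) eq] a b by (simp add: enn2ereal_ennreal)
qed

text \<open>The majorant keeps the positive part finite, and then an expectation other than
  \<open>-\<infinity>\<close> forces the negative part to be finite as well.\<close>

lemma extended_expectation_upper_bound: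
  assumes \<phi>[measurable]: "\<phi> \<in> borel_measurable M" and bot: "AE s in M. \<phi> s \<noteq> -\<infinity>"
    and u: "integrable M u" "AE s in M. \<phi> s \<le> ereal (u s)"
    and E: "extended_expectation M \<phi> \<noteq> -\<infinity>"
  shows "AE s in M. \<phi> s = ereal (real_of_ereal (\<phi> s))" "integrable M (\<lambda>s. real_of_ereal (\<phi> s))"
proof -
  show 1: "AE s in M. \<phi> s = ereal (real_of_ereal (\<phi> s))"
    using bot u(2) by eventually_elim (auto simp: ereal_real)
  have [measurable]: "u \<in> borel_measurable M" using u by auto
  have "(\<integral>\<^sup>+ s. ennreal (real_of_ereal (\<phi> s)) \<partial>M) \<le> (\<integral>\<^sup>+ s. ennreal (u s) \<partial>M)"
    by (rule nn_integral_mono_AE, use 1 u(2) in eventually_elim) (metis ennreal_leI ereal_less_eq(3))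
  also have "\<dots> < \<infinity>" using u by (auto simp: real_integrable_def less_top)
  finally have p: "(\<integral>\<^sup>+ s. ennreal (real_of_ereal (\<phi> s)) \<partial>M) < \<infinity>" .
  then obtain a where a: "(\<integral>\<^sup>+ s. ennreal (real_of_ereal (\<phi> s)) \<partial>M) = ennreal a" "0 \<le> a" by (cases "\<integral>\<^sup>+ s. ennreal (real_of_ereal (\<phi> s)) \<partial>M") auto
  have "(\<integral>\<^sup>+ s. ennreal (- real_of_ereal (\<phi> s)) \<partial>M) \<noteq> \<infinity>"
  proof
    assume "(\<integral>\<^sup>+ s. ennreal (- real_of_ereal (\<phi> s)) \<partial>M) = \<infinity>"
    then show False using E extended_expectation_AE_real[OF \<phi> _ 1] a by (simp add: enn2ereal_ennreal)
  qed
  then show "integrable M (\<lambda>s. real_of_ereal (\<phi> s))" using p by (auto simp: real_integrable_def)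
qed

text \<open>Subtracting an integrable minorant leaves a nonnegative integrand, open to Fatou's lemma
  and to additivity in \<open>ennreal\<close>. The identity covers the infinite values too.\<close>

lemma extended_expectation_minorant:
  assumes \<phi>[measurable]: "\<phi> \<in> borel_measurable M" and l: "integrable M l" "AE s in M. ereal (l s) \<le> \<phi> s"
  shows "extended_expectation M \<phi> = enn2ereal (\<integral>\<^sup>+ s. e2ennreal (\<phi> s - ereal (l s)) \<partial>M) + ereal (\<integral>s. l s \<partial>M)"
    (is "_ = enn2ereal ?I + _")
proof -
  have [measurable]: "l \<in> borel_measurable M" using l by auto
  define X where "X = {s \<in> space M. \<phi> s = \<infinity>}"
  have [measurable]: "X \<in> sets M" unfolding X_def by measurable
  show ?thesis
  proof (cases "emeasure M X > 0")
    case True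
    have "\<infinity> = \<infinity> * emeasure M X" using True by (simp add: ennreal_top_mult)
    also have "\<dots> = (\<integral>\<^sup>+ s. \<infinity> * indicator X s \<partial>M)" by (subst nn_integral_cmult_indicator) auto
    also have "\<dots> \<le> ?I" by (intro nn_integral_mono) (auto simp: X_def indicator_def)
    finally have "?I = \<infinity>" by (simp add: top_unique)
    then show ?thesis using True by (simp add: extended_expectation_def X_def[symmetric])
  next
    case False
    then have "X \<in> null_sets M" by (auto simp: null_sets_def)
    then have "AE s in M. s \<notin> X" by (rule AE_not_in)
    with l(2) have eq: "AE s in M. \<phi> s = ereal (real_of_ereal (\<phi> s))" 
      using AE_space by eventually_elim (auto simp: X_def ereal_real)
    define r where "r s = real_of_ereal (\<phi> s)" for s
    have [measurable]: "r \<in> borel_measurable M" unfolding r_def by measurable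
    have lr: "AE s in M. l s \<le> r s" using l(2) eq by eventually_elim (metis ereal_less_eq(3) r_def)
    have I: "?I = (\<integral>\<^sup>+ s. ennreal (r s - l s) \<partial>M)"
      by (rule nn_integral_cong_AE, use eq in eventually_elim) (metis e2ennreal_ereal ereal_minus(1) r_def)
    show ?thesis
    proof (cases "(\<integral>\<^sup>+ s. ennreal (r s) \<partial>M) = \<infinity>")
      case False
      have "(\<integral>\<^sup>+ s. ennreal (- r s) \<partial>M) \<le> (\<integral>\<^sup>+ s. ennreal (- l s) \<partial>M)"
        by (rule nn_integral_mono_AE, use lr in eventually_elim) (auto intro: ennreal_leI)
      then have "integrable M r" using False l by (auto simp: real_integrable_def top_unique)
      moreover have "?I = ennreal (\<integral>s. r s - l s \<partial>M)"
        unfolding I using lr \<open>integrable M r\<close> l by (intro nn_integral_eq_integral) auto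
      moreover have "0 \<le> (\<integral>s. r s - l s \<partial>M)" using lr by (intro integral_nonneg_AE) auto
      ultimately show ?thesis
        using extended_expectation_integrable[OF \<phi>, of r] eq l by (simp add: enn2ereal_ennreal flip: r_def)
    next
      case True
      have "(\<integral>\<^sup>+ s. ennreal (- r s) \<partial>M) \<le> (\<integral>\<^sup>+ s. ennreal (- l s) \<partial>M)"
        by (rule nn_integral_mono_AE, use lr in eventually_elim) (auto intro: ennreal_leI)
      then have "(\<integral>\<^sup>+ s. ennreal (- r s) \<partial>M) \<noteq> \<infinity>" using l by (auto simp: real_integrable_def top_unique)
      then obtain b where "0 \<le> b" "(\<integral>\<^sup>+ s. ennreal (- r s) \<partial>M) = ennreal b" by (cases "\<integral>\<^sup>+ s. ennreal (- r s) \<partial>M") auto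
      then have 1: "extended_expectation M \<phi> = \<infinity>"
        using True extended_expectation_AE_real[OF \<phi> _ eq] by (simp add: enn2ereal_ennreal r_def)
      \<comment> \<open>The integrable \<open>l\<close> cannot account for an infinite positive
        part, so the integral of \<open>r - l\<close> is infinite as well.\<close>
      have "(\<integral>\<^sup>+ s. ennreal (r s) \<partial>M) \<le> (\<integral>\<^sup>+ s. ennreal (r s - l s) + ennreal (l s) \<partial>M)"
      proof (rule nn_integral_mono_AE, use lr in eventually_elim)
        case (elim s)
        show ?case
        proof (cases "0 \<le> l s")
          case True
          then show ?thesis using elim by (simp flip: ennreal_plus)
        qed (simp add: ennreal_neg ennreal_leI)
      qed
      also have "\<dots> = ?I + (\<integral>\<^sup>+ s. ennreal (l s) \<partial>M)" unfolding I by (rule nn_integral_add) auto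
      finally have "?I = \<infinity>" using True l by (auto simp: real_integrable_def top_unique)
      then show ?thesis using 1 by simp
    qed
  qed
qed

section \<open>Measurability of normal integrands and their proximal maps\<close>

text \<open>\<open>h s y \<le> r\<close> means that \<open>(y, r)\<close> lies in the closed set
  \<open>epi (h s)\<close>, hence that this set meets every ball of radius
  \<open>1 / (k + 1)\<close> around the point; each of these hitting events is measurable.\<close>

lemma normal_integrand_measurable:
  assumes h: "convex_normal_integrand M h"
  shows "(\<lambda>s. h s y) \<in> borel_measurable M"
proof (rule borel_measurableI_le)
  fix c :: ereal
  show "{s \<in> space M. h s y \<le> c} \<in> sets M"
  proof (cases c)
    case (real r)
    have "{s \<in> space M. h s y \<le> c} = (\<Inter>k::nat. {s \<in> space M. epi (h s) \<inter> ball (y, r) (inverse (real (Suc k))) \<noteq> {}})"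
    proof safe
      fix s k assume "s \<in> space M" "h s y \<le> c" "epi (h s) \<inter> ball (y, r) (inverse (real (Suc k))) = {}"
      moreover have "(y, r) \<in> ball (y, r) (inverse (real (Suc k)))" by simp
      ultimately show False using real by (auto simp: epi_def)
    next
      fix s assume s: "s \<in> (\<Inter>k::nat. {s \<in> space M. epi (h s) \<inter> ball (y, r) (inverse (real (Suc k))) \<noteq> {}})"
      then have sM: "s \<in> space M" by auto
      have cl: "closed (epi (h s))" using h sM by (auto simp: convex_normal_integrand_def)
      have "(y, r) \<in> closure (epi (h s))"
        unfolding closure_approachable
      proof (intro allI impI)
        fix e :: real assume "0 < e"
        then obtain k where k: "inverse (real (Suc k)) < e" using reals_Archimedean by blast
        obtain z where "z \<in> epi (h s)" "z \<in> ball (y, r) (inverse (real (Suc k)))" using s by blast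
        then show "\<exists>z\<in>epi (h s). dist z (y, r) < e" using k by (intro bexI[of _ z]) (auto simp: dist_commute)
      qed
      then show "h s y \<le> c" using closure_closed[OF cl] real by (simp add: epi_def)
    qed auto
    then show ?thesis using h by (auto simp: convex_normal_integrand_def measurable_multifunction_def)
  next
    case MInf
    then have "{s \<in> space M. h s y \<le> c} = {}" using h by (auto simp: convex_normal_integrand_def)
    then show ?thesis by (simp only: sets.empty_sets)
  qed auto
qed

text \<open>The identity of the second space is a pointwise limit of simple functions
  \<open>D i\<close>. The map \<open>T s (D i x)\<close> involves finitely many sections only, and
  continuity carries joint measurability to the limit.\<close>

lemma Caratheodory_measurable:
  fixes T :: "'s \<Rightarrow> 'a::{metric_space, second_countable_topology} \<Rightarrow> 'b::metric_space"
  assumes m: "\<And>x. (\<lambda>s. T s x) \<in> borel_measurable M"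
    and c: "\<And>s. s \<in> space M \<Longrightarrow> continuous_on UNIV (T s)"
  shows "(\<lambda>(s, x). T s x) \<in> borel_measurable (M \<Otimes>\<^sub>M borel)"
proof -
  obtain D :: "nat \<Rightarrow> 'a \<Rightarrow> 'a" where D: "\<And>i. simple_function borel (D i)" "\<And>x. (\<lambda>i. D i x) \<longlonglongrightarrow> x"
    using borel_measurable_implies_sequence_metric[of "\<lambda>x::'a. x" borel undefined] by auto
  have "(\<lambda>w. T (fst w) (D i (snd w))) \<in> borel_measurable (M \<Otimes>\<^sub>M borel)" for i
  proof (rule measurable_compose_countable'[of "range (D i)" "\<lambda>d w. T (fst w) d"])
    show "(\<lambda>w. T (fst w) d) \<in> borel_measurable (M \<Otimes>\<^sub>M borel)" for d
      by (rule measurable_compose[OF measurable_fst m])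
    have "finite (range (D i))" using D(1)[of i] by (simp add: simple_function_def)
    then show "countable (range (D i))" by (rule countable_finite)
    have "D i \<in> measurable borel (count_space UNIV)" using D(1) measurable_simple_function by blast
    then have "D i \<in> measurable borel (count_space (range (D i)))"
      by (auto simp: measurable_def Int_absorb2)
    then show "(\<lambda>w. D i (snd w)) \<in> measurable (M \<Otimes>\<^sub>M borel) (count_space (range (D i)))"
      by (rule measurable_compose[OF measurable_snd])
  qed
  then show ?thesis
  proof (rule borel_measurable_LIMSEQ_metric)
    fix w :: "'s \<times> 'a" assume "w \<in> space (M \<Otimes>\<^sub>M borel)"
    then have s: "fst w \<in> space M" by (auto simp: space_pair_measure)
    show "(\<lambda>i. T (fst w) (D i (snd w))) \<longlonglongrightarrow> (case w of (s, x) \<Rightarrow> T s x)"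
      using continuous_on_tendsto_compose[OF c[OF s] D(2)[of "snd w"]] by (auto simp: case_prod_beta)
  qed
qed

section \<open>Moreau envelopes\<close>

definition moreau_envelope :: "('a::euclidean_space \<Rightarrow> ereal) \<Rightarrow> 'a \<Rightarrow> real" where
  "moreau_envelope h x = real_of_ereal (h (prox h x)) + (norm (prox h x - x))\<^sup>2 / 2"

lemma moreau_envelope_le:
  assumes h: "h \<in> Gamma0"
  shows "ereal (moreau_envelope h x) \<le> h y + ereal ((norm (y - x))\<^sup>2 / 2)"
proof -
  have pr: "proper_fun h" using h by (auto simp: Gamma0_def)
  obtain r where "h (prox h x) = ereal r" by (rule subdifferential_finite[OF pr prox_subgradient[OF h]])
  then show ?thesis using prox_is_minimizer[OF h, of x y] by (simp add: moreau_envelope_def)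
qed

text \<open>Phrased through points of the epigraph so that, for a random \<open>h\<close>, the
  sublevel event becomes the event of hitting an open set.\<close>

lemma moreau_envelope_less_iff:
  assumes h: "h \<in> Gamma0"
  shows "moreau_envelope h x < c \<longleftrightarrow> (\<exists>y r. h y \<le> ereal r \<and> r + (norm (y - x))\<^sup>2 / 2 < c)"
proof
  have pr: "proper_fun h" using h by (auto simp: Gamma0_def)
  obtain r where r: "h (prox h x) = ereal r" by (rule subdifferential_finite[OF pr prox_subgradient[OF h]])
  assume "moreau_envelope h x < c"
  then show "\<exists>y r. h y \<le> ereal r \<and> r + (norm (y - x))\<^sup>2 / 2 < c"
    using r by (intro exI[of _ "prox h x"] exI[of _ r]) (auto simp: moreau_envelope_def)
next
  assume "\<exists>y r. h y \<le> ereal r \<and> r + (norm (y - x))\<^sup>2 / 2 < c"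
  then obtain y r where yr: "h y \<le> ereal r" "r + (norm (y - x))\<^sup>2 / 2 < c" by auto
  have "ereal (moreau_envelope h x) \<le> h y + ereal ((norm (y - x))\<^sup>2 / 2)" by (rule moreau_envelope_le[OF h])
  also have "\<dots> \<le> ereal r + ereal ((norm (y - x))\<^sup>2 / 2)" using yr by (intro add_mono) auto
  finally show "moreau_envelope h x < c" using yr(2) by simp
qed

text \<open>The gradient of the envelope is the residual \<open>x - prox h x\<close>. Testing the
  envelope at \<open>x + v\<close> with the old proximal point gives the upper bound; exchanging the
  two points and using nonexpansiveness gives the lower one.\<close>

lemma moreau_envelope_expansion:
  assumes h: "h \<in> Gamma0"
  shows "\<bar>moreau_envelope h (x + v) - moreau_envelope h x - (x - prox h x) \<bullet> v\<bar> \<le> (norm v)\<^sup>2 / 2"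
proof -
  have pr: "proper_fun h" using h by (auto simp: Gamma0_def)
  have step: "moreau_envelope h (y + w) \<le> moreau_envelope h y + (y - prox h y) \<bullet> w + (norm w)\<^sup>2 / 2" for y w
  proof -
    obtain r where r: "h (prox h y) = ereal r" by (rule subdifferential_finite[OF pr prox_subgradient[OF h]])
    have "moreau_envelope h (y + w) \<le> r + (norm (prox h y - (y + w)))\<^sup>2 / 2"
      using moreau_envelope_le[OF h, of "y + w" "prox h y"] r by simp
    also have "(norm (prox h y - (y + w)))\<^sup>2 = (norm (prox h y - y))\<^sup>2 + 2 * ((y - prox h y) \<bullet> w) + (norm w)\<^sup>2"
      unfolding power2_norm_eq_inner by (simp add: inner_diff inner_add inner_commute algebra_simps)
    finally have "moreau_envelope h (y + w) \<le> r + ((norm (prox h y - y))\<^sup>2 + 2 * ((y - prox h y) \<bullet> w) + (norm w)\<^sup>2) / 2" .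
    moreover have "moreau_envelope h y = r + (norm (prox h y - y))\<^sup>2 / 2" using r by (simp add: moreau_envelope_def)
    ultimately show ?thesis by (simp add: field_simps)
  qed
  have "(prox h (x + v) - prox h x) \<bullet> v \<le> norm (prox h (x + v) - prox h x) * norm v" by (rule norm_cauchy_schwarz)
  also have "\<dots> \<le> norm v * norm v" using prox_nonexpansive[OF h, of "x + v" x] by (intro mult_right_mono) auto
  finally have "(prox h (x + v) - prox h x) \<bullet> v \<le> (norm v)\<^sup>2" by (simp add: power2_eq_square)
  moreover have "moreau_envelope h (x + v) \<le> moreau_envelope h x + (x - prox h x) \<bullet> v + (norm v)\<^sup>2 / 2"
    by (rule step)
  moreover have "moreau_envelope h x \<le> moreau_envelope h (x + v) - (x - prox h x) \<bullet> v
      + (prox h (x + v) - prox h x) \<bullet> v - (norm v)\<^sup>2 / 2"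
    using step[of "x + v" "- v"] by (simp add: inner_diff_left inner_add_left power2_norm_eq_inner algebra_simps)
  ultimately show ?thesis by linarith
qed

lemma AE_Gamma0_null_set:
  assumes "AE s in M. h s \<in> Gamma0"
  obtains N where "N \<in> null_sets M" "\<And>s. s \<in> space M - N \<Longrightarrow> h s \<in> Gamma0"
  using assms by (auto elim!: AE_E simp: null_sets_def)

text \<open>The random proximal map, made \<open>0\<close> on a null set on which the integrand may fail to be
  proper; it is read off from the Moreau envelope as its gradient.\<close>

lemma prox_measurable_version:
  fixes h :: "'s \<Rightarrow> 'a::euclidean_space \<Rightarrow> ereal"
  assumes h: "convex_normal_integrand M h" and N: "N \<in> null_sets M" "\<And>s. s \<in> space M - N \<Longrightarrow> h s \<in> Gamma0"
    and a: "0 < a"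
  shows "(\<lambda>(s, x). if s \<in> N then 0 else prox (\<lambda>y. ereal a * h s y) x) \<in> borel_measurable (M \<Otimes>\<^sub>M borel)"
proof (rule Caratheodory_measurable)
  have [measurable]: "N \<in> sets M" using N by auto
  define e where "e s x = (if s \<in> N then 0 else moreau_envelope (\<lambda>y. ereal a * h s y) x)" for s x
  have G: "(\<lambda>y. ereal a * h s y) \<in> Gamma0" if "s \<in> space M - N" for s using Gamma0_scale[OF N(2)[OF that] a] .
  have e[measurable]: "(\<lambda>s. e s x) \<in> borel_measurable M" for x
  proof (rule borel_measurableI_less)
    fix c :: real
    \<comment> \<open>\<open>epi (h s)\<close> hits this open set exactly when the envelope of
      \<open>a h\<close> at \<open>x\<close> is below \<open>c\<close>.\<close>
    define U where "U = {(y, r). a * r + (norm (y - x))\<^sup>2 / 2 < c}"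
    have "open U" unfolding U_def case_prod_beta by (intro open_Collect_less continuous_intros) auto
    then have U: "{s \<in> space M. epi (h s) \<inter> U \<noteq> {}} \<in> sets M"
      using h by (auto simp: convex_normal_integrand_def measurable_multifunction_def)
    have "{s \<in> space M. e s x < c} = (N \<inter> {s\<in>space M. 0 < c}) \<union> ({s \<in> space M. epi (h s) \<inter> U \<noteq> {}} - N)"
    proof -
      have "e s x < c \<longleftrightarrow> epi (h s) \<inter> U \<noteq> {}" if s: "s \<in> space M" "s \<notin> N" for s
      proof -
        have "e s x < c \<longleftrightarrow> (\<exists>y r. ereal a * h s y \<le> ereal r \<and> r + (norm (y - x))\<^sup>2 / 2 < c)"
          using s moreau_envelope_less_iff[OF G] by (simp add: e_def)
        also have "\<dots> \<longleftrightarrow> (\<exists>y r. h s y \<le> ereal r \<and> a * r + (norm (y - x))\<^sup>2 / 2 < c)"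
        proof safe
          fix y r assume "ereal a * h s y \<le> ereal r" "r + (norm (y - x))\<^sup>2 / 2 < c"
          then show "\<exists>y r. h s y \<le> ereal r \<and> a * r + (norm (y - x))\<^sup>2 / 2 < c"
            using a by (intro exI[of _ y] exI[of _ "r / a"]) (cases "h s y"; auto simp: field_simps)
        next
          fix y r assume "h s y \<le> ereal r" "a * r + (norm (y - x))\<^sup>2 / 2 < c"
          then show "\<exists>y r. ereal a * h s y \<le> ereal r \<and> r + (norm (y - x))\<^sup>2 / 2 < c"
            using a by (intro exI[of _ y] exI[of _ "a * r"]) (cases "h s y"; auto)
        qed
        also have "\<dots> \<longleftrightarrow> epi (h s) \<inter> U \<noteq> {}" by (auto simp: epi_def U_def)
        finally show ?thesis .
      qed
      moreover have "N \<subseteq> space M" using sets.sets_into_space[of N M] by simp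
      ultimately show ?thesis by (auto simp: e_def)
    qed
    then show "{s \<in> space M. e s x < c} \<in> sets M" using U by auto
  qed
  define q where "q s x = (if s \<in> N then 0 else prox (\<lambda>y. ereal a * h s y) x)" for s x
  \<comment> \<open>Difference quotients of the envelope in the direction \<open>b\<close> recover a
    coordinate of the residual, with error at most \<open>1 / (n + 1)\<close> by the
    expansion.\<close>
  have lim: "(\<lambda>n. real (Suc n) * (e s (x + (1 / real (Suc n)) *\<^sub>R b) - e s x)) \<longlonglongrightarrow> (if s \<in> N then 0 else (x - q s x) \<bullet> b)"
    if s: "s \<in> space M" and b: "norm b = 1" for s x b
  proof (cases "s \<in> N")
    case False
    have 1: "\<bar>real (Suc n) * (e s (x + (1 / real (Suc n)) *\<^sub>R b) - e s x) - (x - q s x) \<bullet> b\<bar> \<le> inverse (real (Suc n))" for n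
    proof -
      define k where "k = real (Suc n)"
      have k: "k > 0" by (simp add: k_def)
      have "\<bar>e s (x + (1 / k) *\<^sub>R b) - e s x - (x - q s x) \<bullet> ((1 / k) *\<^sub>R b)\<bar> \<le> (norm ((1 / k) *\<^sub>R b))\<^sup>2 / 2"
        unfolding e_def q_def using False s moreau_envelope_expansion[OF G, of s x "(1 / k) *\<^sub>R b"] by simp
      then have "k * \<bar>e s (x + (1 / k) *\<^sub>R b) - e s x - (x - q s x) \<bullet> ((1 / k) *\<^sub>R b)\<bar> \<le> k * ((norm ((1 / k) *\<^sub>R b))\<^sup>2 / 2)"
        using k by (intro mult_left_mono) auto
      moreover have "k * ((norm ((1 / k) *\<^sub>R b))\<^sup>2 / 2) \<le> inverse k" using k b by (simp add: power2_eq_square field_simps)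
      moreover have "k * \<bar>e s (x + (1 / k) *\<^sub>R b) - e s x - (x - q s x) \<bullet> ((1 / k) *\<^sub>R b)\<bar> = \<bar>k * (e s (x + (1 / k) *\<^sub>R b) - e s x) - (x - q s x) \<bullet> b\<bar>"
      proof -
        have "k * (d - w \<bullet> ((1 / k) *\<^sub>R b)) = k * d - w \<bullet> b" for d w using k by (simp add: right_diff_distrib)
        then show ?thesis using k by (metis abs_mult abs_of_pos)
      qed
      ultimately have "\<bar>k * (e s (x + (1 / k) *\<^sub>R b) - e s x) - (x - q s x) \<bullet> b\<bar> \<le> inverse k" by linarith
      then show ?thesis by (simp only: k_def)
    qed
    have "(\<lambda>n. real (Suc n) * (e s (x + (1 / real (Suc n)) *\<^sub>R b) - e s x) - (x - q s x) \<bullet> b) \<longlonglongrightarrow> 0"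
      by (rule Lim_null_comparison[OF _ LIMSEQ_inverse_real_of_nat]) (use 1 in auto)
    then show ?thesis using False by (simp add: LIM_zero_iff)
  qed (simp add: e_def)
  show "(\<lambda>s. if s \<in> N then 0 else prox (\<lambda>y. ereal a * h s y) x) \<in> borel_measurable M" for x
  proof (subst borel_measurable_euclidean_space, intro ballI)
    fix b :: 'a assume b: "b \<in> Basis"
    have [measurable]: "(\<lambda>s. if s \<in> N then 0 else (x - q s x) \<bullet> b) \<in> borel_measurable M"
      by (rule borel_measurable_LIMSEQ_metric[OF _ lim]) (use b in auto)
    have "(\<lambda>s. if s \<in> N then 0 else x \<bullet> b - (if s \<in> N then 0 else (x - q s x) \<bullet> b)) \<in> borel_measurable M"
      by measurable
    also have "(\<lambda>s. if s \<in> N then 0 else x \<bullet> b - (if s \<in> N then 0 else (x - q s x) \<bullet> b)) =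
      (\<lambda>s. (if s \<in> N then 0 else prox (\<lambda>y. ereal a * h s y) x) \<bullet> b)"
      by (auto simp: q_def inner_diff fun_eq_iff)
    finally show "(\<lambda>s. (if s \<in> N then 0 else prox (\<lambda>y. ereal a * h s y) x) \<bullet> b) \<in> borel_measurable M" .
  qed
  fix s assume s: "s \<in> space M"
  have "1-lipschitz_on UNIV (prox (\<lambda>y. ereal a * h s y))" if "s \<notin> N"
    using prox_nonexpansive[OF G] s that by (intro lipschitz_onI) (auto simp: dist_norm)
  then show "continuous_on UNIV (\<lambda>x. if s \<in> N then 0 else prox (\<lambda>y. ereal a * h s y) x)"
    using lipschitz_on_continuous_on by (cases "s \<in> N") auto
qed

text \<open>A limit of measurable Yosida quotients. It is identified with the least norm subgradient
  only almost everywhere, since membership in \<open>Gamma0\<close> and nonemptiness hold only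
  almost everywhere.\<close>

lemma least_norm_subgradient_measurable_version:
  fixes h :: "'s \<Rightarrow> 'a::euclidean_space \<Rightarrow> ereal"
  assumes h: "convex_normal_integrand M h" "AE s in M. h s \<in> Gamma0"
    and ne: "AE s in M. subdifferential (h s) x \<noteq> {}"
  obtains \<phi> where "\<phi> \<in> borel_measurable M" "AE s in M. \<phi> s = least_norm_subgradient (h s) x"
    "AE s in M. \<phi> s \<in> subdifferential (h s) x"
proof -
  obtain N where N: "N \<in> null_sets M" "\<And>s. s \<in> space M - N \<Longrightarrow> h s \<in> Gamma0"
    using AE_Gamma0_null_set[OF h(2)] by blast
  define q where "q a s y = (if s \<in> N then 0 else prox (\<lambda>y. ereal a * h s y) y)" for a s y
  have [measurable]: "(\<lambda>s. q (1 / real (Suc n)) s x) \<in> borel_measurable M" for n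
    using measurable_compose[OF measurable_Pair2' prox_measurable_version[OF h(1) N, of "1 / real (Suc n)"], of x]
    by (simp add: q_def del: of_nat_Suc)
  define \<phi> where "\<phi> s = lim (\<lambda>n. real (Suc n) *\<^sub>R (x - q (1 / real (Suc n)) s x))" for s
  have m: "\<phi> \<in> borel_measurable M" unfolding \<phi>_def by measurable
  have eq: "AE s in M. \<phi> s = least_norm_subgradient (h s) x"
    using AE_not_in[OF N(1)] ne AE_space
  proof eventually_elim
    case (elim s)
    then show ?case
      using yosida_tendsto_least_norm_subgradient[OF N(2), of s x] by (auto simp: \<phi>_def q_def intro!: limI)
  qed
  have "AE s in M. \<phi> s \<in> subdifferential (h s) x"
    using eq h(2) ne by eventually_elim (auto simp: Gamma0_def intro: least_norm_subgradient_eq_closest_point)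
  then show thesis using that m eq by blast
qed


section \<open>Mean functions of normal integrands\<close>

lemma extended_expectation_finite:
  assumes \<phi>[measurable]: "\<phi> \<in> borel_measurable M" and bot: "AE s in M. \<phi> s \<noteq> -\<infinity>"
    and E: "extended_expectation M \<phi> \<noteq> -\<infinity>" "extended_expectation M \<phi> \<noteq> \<infinity>"
  shows "AE s in M. \<phi> s = ereal (real_of_ereal (\<phi> s))" "integrable M (\<lambda>s. real_of_ereal (\<phi> s))"
proof -
  have "emeasure M {s \<in> space M. \<phi> s = \<infinity>} = 0"
    using E(2) by (auto simp: extended_expectation_def split: if_splits)
  then have "AE s in M. \<not> \<phi> s = \<infinity>" by (subst AE_iff_measurable[OF _ refl]) auto
  with bot show 1: "AE s in M. \<phi> s = ereal (real_of_ereal (\<phi> s))"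
    by eventually_elim (auto simp: ereal_real)
  note EE = extended_expectation_AE_real[OF \<phi> _ 1]
  have "(\<integral>\<^sup>+ s. ennreal (real_of_ereal (\<phi> s)) \<partial>M) \<noteq> \<infinity>" using E(2) EE by auto
  moreover from this have "(\<integral>\<^sup>+ s. ennreal (- real_of_ereal (\<phi> s)) \<partial>M) \<noteq> \<infinity>"
    using E(1) EE by (cases "\<integral>\<^sup>+ s. ennreal (real_of_ereal (\<phi> s)) \<partial>M") (auto simp: enn2ereal_ennreal)
  ultimately show "integrable M (\<lambda>s. real_of_ereal (\<phi> s))" by (auto simp: real_integrable_def)
qed

lemma enn2ereal_less_iff: "0 \<le> K \<Longrightarrow> enn2ereal y < K \<longleftrightarrow> y < e2ennreal K"
  by (metis enn2ereal_e2ennreal less_ennreal.rep_eq)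

text \<open>Instantiated once for \<open>g\<close> and once for \<open>p\<close>. Of the mean only
  properness is assumed; that it lies in \<open>Gamma0\<close> is derived from the existence of an
  integrable selection.\<close>

locale mean_integrand = prob_space M for M :: "'s measure" +
  fixes h :: "'s \<Rightarrow> 'a::euclidean_space \<Rightarrow> ereal" and E :: "'a \<Rightarrow> ereal"
  assumes normal: "convex_normal_integrand M h" and Gamma0: "AE s in M. h s \<in> Gamma0"
    and mean: "E = (\<lambda>y. extended_expectation M (\<lambda>s. h s y))" and proper: "proper_fun E"
begin

lemma h_measurable[measurable]: "(\<lambda>s. h s y) \<in> borel_measurable M"
  by (rule normal_integrand_measurable[OF normal])

lemma AE_proper: "AE s in M. proper_fun (h s)"
  using Gamma0 by eventually_elim (auto simp: Gamma0_def)

text \<open>The mean is finite at some \<open>y\<close>. The subgradient inequality from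
  \<open>x\<close> to \<open>y\<close> is then an integrable upper bound for \<open>h s x\<close>,
  and properness of the mean provides the lower side.\<close>

lemma integrable_at_subgradient:
  assumes \<phi>: "integrable M \<phi>" "AE s in M. \<phi> s \<in> subdifferential (h s) x"
  shows "AE s in M. h s x = ereal (real_of_ereal (h s x))" "integrable M (\<lambda>s. real_of_ereal (h s x))"
proof -
  obtain y where y: "E y \<noteq> \<infinity>" using proper by (auto simp: proper_fun_def)
  have bot: "AE s in M. h s y \<noteq> -\<infinity>" for y using AE_proper by eventually_elim (auto simp: proper_fun_def)
  have E: "extended_expectation M (\<lambda>s. h s y) \<noteq> -\<infinity>" for y using proper by (auto simp: proper_fun_def mean)
  have Ey: "extended_expectation M (\<lambda>s. h s y) \<noteq> \<infinity>" using y by (simp add: mean)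
  note fy = extended_expectation_finite[OF h_measurable bot E Ey]
  have "AE s in M. h s x \<le> ereal (real_of_ereal (h s y) - \<phi> s \<bullet> (y - x))"
    using fy(1) \<phi>(2)
  proof eventually_elim
    case (elim s)
    then obtain r where r: "h s y = ereal r" by metis
    show ?case using subdifferentialD[OF elim(2), of y] r by (cases "h s x") (auto simp: r)
  qed
  moreover have "integrable M (\<lambda>s. real_of_ereal (h s y) - \<phi> s \<bullet> (y - x))" using fy(2) \<phi>(1) by auto
  ultimately show "AE s in M. h s x = ereal (real_of_ereal (h s x))" "integrable M (\<lambda>s. real_of_ereal (h s x))"
    using extended_expectation_upper_bound[OF h_measurable bot _ _ E, of _ x] by blast+
qed

text \<open>The selection gives a random affine minorant \<open>l s\<close>, integrable in
  \<open>s\<close>, so that \<open>E\<close> is the integral of the nonnegative \<open>h - l\<close>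
  plus an affine function. Fatou's lemma yields lower semicontinuity, the pointwise inequality
  convexity.\<close>

lemma mean_Gamma0:
  assumes \<phi>: "integrable M \<phi>" "AE s in M. \<phi> s \<in> subdifferential (h s) x0"
  shows "E \<in> Gamma0"
proof -
  note fin = integrable_at_subgradient[OF \<phi>]
  define l where "l s y = real_of_ereal (h s x0) + \<phi> s \<bullet> (y - x0)" for s y
  have [measurable]: "\<phi> \<in> borel_measurable M" using \<phi>(1) by auto
  have li: "integrable M (\<lambda>s. l s y)" for y unfolding l_def using fin(2) \<phi>(1) by auto
  have lm[measurable]: "(\<lambda>s. l s y) \<in> borel_measurable M" for y using li by auto
  have le: "AE s in M. \<forall>y. ereal (l s y) \<le> h s y"
    using fin(1) \<phi>(2)
  proof eventually_elim
    case (elim s)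
    then show ?case using subdifferentialD[OF elim(2)] unfolding l_def by (metis plus_ereal.simps(1))
  qed
  define I where "I y = (\<integral>\<^sup>+ s. e2ennreal (h s y - ereal (l s y)) \<partial>M)" for y
  define b where "b y = (\<integral>s. l s y \<partial>M)" for y
  have E: "E y = enn2ereal (I y) + ereal (b y)" for y
    unfolding mean I_def b_def
    by (rule extended_expectation_minorant[OF h_measurable li]) (use le in auto)
  have b: "b y = (\<integral>s. real_of_ereal (h s x0) \<partial>M) + (\<integral>s. \<phi> s \<partial>M) \<bullet> (y - x0)" for y
    unfolding b_def l_def using fin(2) \<phi>(1) by (subst Bochner_Integration.integral_add) auto
  have lsc: "lsc_fun E"
    unfolding lsc_fun_def le_Liminf_iff
  proof (intro allI impI)
    fix x c assume c: "c < E x"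
    show "eventually (\<lambda>z. c < E z) (at x)"
    proof (rule sequentially_imp_eventually_at, intro allI impI, goal_cases)
      case (1 X)
      then have X: "X \<longlonglongrightarrow> x" by simp
      have "c - ereal (b x) < enn2ereal (I x)"
        using c unfolding E by (cases c; cases "enn2ereal (I x)") (auto simp: algebra_simps)
      then obtain d where d: "c - ereal (b x) < ereal d" "ereal d < enn2ereal (I x)" using ereal_dense2 by blast
      have fatou: "I x \<le> liminf (\<lambda>n. I (X n))"
      proof -
        have "I x \<le> (\<integral>\<^sup>+ s. liminf (\<lambda>n. e2ennreal (h s (X n) - ereal (l s (X n)))) \<partial>M)"
          unfolding I_def
        proof (rule nn_integral_mono_AE, use le Gamma0 in eventually_elim)
          case (elim s)
          have k0: "0 \<le> h s z - ereal (l s z)" for z using elim(1)[rule_format, of z] by (cases "h s z") auto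
          show ?case
            unfolding le_Liminf_iff
          proof (intro allI impI)
            fix y assume "y < e2ennreal (h s x - ereal (l s x))"
            then have "enn2ereal y < h s x - ereal (l s x)" using k0 by (simp add: enn2ereal_less_iff)
            then obtain p where p: "enn2ereal y < ereal p" "ereal p < h s x - ereal (l s x)" using ereal_dense2 by blast
            \<comment> \<open>Two levels: \<open>p\<close> is preserved by \<open>h s\<close>
              through lower semicontinuity, and the gap \<open>p - p'\<close> absorbs the variation
              of the continuous minorant.\<close>
            then obtain p' where p': "enn2ereal y < ereal p'" "p' < p" using ereal_dense2[of "enn2ereal y" "ereal p"] by auto
            have 1: "ereal (p + l s x) < h s x" using p(2) by (cases "h s x") auto
            have "eventually (\<lambda>n. ereal (p + l s x) < h s (X n)) sequentially"
              using elim(2) by (intro lsc_eventually[of "h s", OF _ 1 X]) (auto simp: Gamma0_def)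
            moreover have "(\<lambda>n. l s (X n)) \<longlonglongrightarrow> l s x" unfolding l_def by (intro tendsto_intros X)
            then have "eventually (\<lambda>n. l s (X n) < l s x + (p - p')) sequentially"
              using p'(2) by (intro order_tendstoD(2)) auto
            ultimately show "eventually (\<lambda>n. y < e2ennreal (h s (X n) - ereal (l s (X n)))) sequentially"
            proof eventually_elim
              case (elim n)
              then have "ereal p' < h s (X n) - ereal (l s (X n))" by (cases "h s (X n)") auto
              then have "enn2ereal y < h s (X n) - ereal (l s (X n))" using p' by (meson less_trans)
              then show ?case using k0 by (simp add: enn2ereal_less_iff)
            qed
          qed
        qed
        also have "\<dots> \<le> liminf (\<lambda>n. I (X n))" unfolding I_def by (rule nn_integral_liminf) measurable
        finally show ?thesis .
      qed
      have ev: "eventually (\<lambda>n. ereal d < enn2ereal (I (X n))) sequentially"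
      proof (cases "d < 0")
        case True
        then show ?thesis by (auto intro!: always_eventually intro: less_le_trans[OF _ enn2ereal_nonneg])
      next
        case False
        then have "ennreal d < I x" using d(2) by (simp add: less_ennreal.rep_eq enn2ereal_ennreal)
        then have "eventually (\<lambda>n. ennreal d < I (X n)) sequentially" using fatou unfolding le_Liminf_iff by blast
        then show ?thesis by eventually_elim (use False in \<open>simp add: less_ennreal.rep_eq enn2ereal_ennreal\<close>)
      qed
      have "(\<lambda>n. ereal (d + b (X n))) \<longlonglongrightarrow> ereal (d + b x)" unfolding b by (intro tendsto_intros X)
      moreover have "c < ereal (d + b x)" using d(1) by (cases c) auto
      ultimately have "eventually (\<lambda>n. c < ereal (d + b (X n))) sequentially" by (rule order_tendstoD(1))
      with ev show ?case
      proof eventually_elim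
        case (elim n)
        then have "ereal d + ereal (b (X n)) \<le> E (X n)" unfolding E by (intro add_mono) auto
        then show ?case using elim by (simp add: less_le_trans)
      qed
    qed
  qed
  have "convex_fun E"
    unfolding convex_fun_def
  proof (intro allI impI)
    fix x y :: 'a and u v :: real assume uv: "0 < u \<and> 0 < v \<and> u + v = 1"
    have lc: "l s (u *\<^sub>R x + v *\<^sub>R y) = u * l s x + v * l s y" for s
    proof -
      have "u *\<^sub>R x + v *\<^sub>R y - x0 = u *\<^sub>R (x - x0) + v *\<^sub>R (y - x0)"
      proof -
        have "v = 1 - u" using uv by simp
        then show ?thesis by (simp only: scaleR_diff_left scaleR_diff_right scaleR_one) simp
      qed
      moreover have "real_of_ereal (h s x0) = u * real_of_ereal (h s x0) + v * real_of_ereal (h s x0)"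
        using uv by (metis mult_1 distrib_right)
      ultimately show ?thesis unfolding l_def by (simp add: inner_add_right distrib_left)
    qed
    have bc: "b (u *\<^sub>R x + v *\<^sub>R y) = u * b x + v * b y"
      unfolding b_def lc using li by simp
    have "I (u *\<^sub>R x + v *\<^sub>R y) \<le> (\<integral>\<^sup>+ s. ennreal u * e2ennreal (h s x - ereal (l s x)) + ennreal v * e2ennreal (h s y - ereal (l s y)) \<partial>M)"
      unfolding I_def
    proof (rule nn_integral_mono_AE, use le Gamma0 in eventually_elim)
      case (elim s)
      have 1: "h s (u *\<^sub>R x + v *\<^sub>R y) \<le> ereal u * h s x + ereal v * h s y"
        using elim(2) uv by (auto simp: Gamma0_def convex_fun_def)
      have x: "ereal (l s x) \<le> h s x" "ereal (l s y) \<le> h s y" using elim(1) by auto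
      show ?case
      proof (cases "h s x = \<infinity> \<or> h s y = \<infinity>")
        case True
        then show ?thesis using uv by (auto simp: ennreal_mult_top)
      next
        case False
        then obtain p q where pq: "h s x = ereal p" "h s y = ereal q" using x by (cases "h s x"; cases "h s y") auto
        have "h s (u *\<^sub>R x + v *\<^sub>R y) - ereal (l s (u *\<^sub>R x + v *\<^sub>R y)) \<le> ereal (u * (p - l s x) + v * (q - l s y))"
          using 1 pq unfolding lc by (cases "h s (u *\<^sub>R x + v *\<^sub>R y)") (auto simp: algebra_simps)
        then have "e2ennreal (h s (u *\<^sub>R x + v *\<^sub>R y) - ereal (l s (u *\<^sub>R x + v *\<^sub>R y))) \<le> ennreal (u * (p - l s x) + v * (q - l s y))"
          using e2ennreal_mono by fastforce
        also have "\<dots> = ennreal u * ennreal (p - l s x) + ennreal v * ennreal (q - l s y)"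
          using uv x pq by (subst ennreal_plus) (auto simp: ennreal_mult)
        finally show ?thesis unfolding pq by (simp only: ereal_minus e2ennreal_ereal)
      qed
    qed
    also have "\<dots> = ennreal u * I x + ennreal v * I y"
      unfolding I_def by (subst nn_integral_add) (auto simp: nn_integral_cmult)
    finally have "enn2ereal (I (u *\<^sub>R x + v *\<^sub>R y)) \<le> enn2ereal (ennreal u * I x + ennreal v * I y)"
      by (simp add: less_eq_ennreal.rep_eq)
    also have "\<dots> = ereal u * enn2ereal (I x) + ereal v * enn2ereal (I y)"
      using uv by (simp add: plus_ennreal.rep_eq times_ennreal.rep_eq enn2ereal_ennreal)
    finally have 2: "enn2ereal (I (u *\<^sub>R x + v *\<^sub>R y)) \<le> ereal u * enn2ereal (I x) + ereal v * enn2ereal (I y)" .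
    have "E (u *\<^sub>R x + v *\<^sub>R y) \<le> (ereal u * enn2ereal (I x) + ereal v * enn2ereal (I y)) + ereal (u * b x + v * b y)"
      unfolding E[of "u *\<^sub>R x + v *\<^sub>R y"] bc by (intro add_mono 2) auto
    also have "\<dots> = ereal u * E x + ereal v * E y"
      unfolding E using uv enn2ereal_nonneg[of "I x"] enn2ereal_nonneg[of "I y"]
      by (cases "enn2ereal (I x)"; cases "enn2ereal (I y)") (auto simp: algebra_simps)
    finally show "E (u *\<^sub>R x + v *\<^sub>R y) \<le> ereal u * E x + ereal v * E y" .
  qed
  then show ?thesis using lsc proper by (simp add: Gamma0_def)
qed

text \<open>The moment condition for the compact set \<open>{x}\<close> gives the least norm
  selection a moment of order \<open>1 + \<epsilon>\<close>, with \<open>\<epsilon>\<close>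
  depending on \<open>x\<close>; the interchange of subdifferential and expectation makes its mean a
  subgradient of \<open>E\<close>.\<close>

lemma minimal_selection:
  assumes a2: "subdifferential_interchange M h E" and a4: "compact_moment_condition M h E"
    and x: "x \<in> dom_subdifferential E"
  obtains \<epsilon> \<phi> where "0 < \<epsilon>" "\<epsilon> \<le> 1" "\<phi> \<in> borel_measurable M" "AE s in M. \<phi> s \<in> subdifferential (h s) x"
    "(\<integral>\<^sup>+ s. ennreal (norm (\<phi> s) powr (1 + \<epsilon>)) \<partial>M) < \<infinity>" "integrable M \<phi>" "(\<integral>s. \<phi> s \<partial>M) \<in> subdifferential E x"
proof -
  have "selection_integral M h x \<noteq> {}"
    using a2 x by (auto simp: subdifferential_interchange_def dom_subdifferential_def)
  then have "selections M 1 h x \<noteq> {}" by (auto simp: selection_integral_def)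
  then have ne: "AE s in M. subdifferential (h s) x \<noteq> {}" by (auto simp: selections_def split: if_splits)
  obtain \<phi> where \<phi>: "\<phi> \<in> borel_measurable M" "AE s in M. \<phi> s = least_norm_subgradient (h s) x"
    "AE s in M. \<phi> s \<in> subdifferential (h s) x"
    using least_norm_subgradient_measurable_version[OF normal Gamma0 ne] by blast
  note [measurable] = \<phi>(1)
  obtain \<epsilon> where e: "0 < \<epsilon>" "\<epsilon> \<le> 1"
    "(SUP x\<in>{x}. \<integral>\<^sup>+ s. ennreal (norm (least_norm_subgradient (h s) x) powr (1 + \<epsilon>)) \<partial>M) < \<infinity>"
    using a4[unfolded compact_moment_condition_def, rule_format, of "{x}"] x by auto
  have "(\<integral>\<^sup>+ s. ennreal (norm (\<phi> s) powr (1 + \<epsilon>)) \<partial>M) = (\<integral>\<^sup>+ s. ennreal (norm (least_norm_subgradient (h s) x) powr (1 + \<epsilon>)) \<partial>M)"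
    by (rule nn_integral_cong_AE, use \<phi>(2) in eventually_elim) simp
  then have fin: "(\<integral>\<^sup>+ s. ennreal (norm (\<phi> s) powr (1 + \<epsilon>)) \<partial>M) < \<infinity>" using e(3) by simp
  have int: "integrable M \<phi>"
  proof (rule integrableI_bounded)
    have "(\<integral>\<^sup>+ s. ennreal (norm (\<phi> s)) \<partial>M) \<le> (\<integral>\<^sup>+ s. 1 + ennreal (norm (\<phi> s) powr (1 + \<epsilon>)) \<partial>M)"
    proof (rule nn_integral_mono)
      fix s
      have "norm (\<phi> s) \<le> 1 + norm (\<phi> s) powr (1 + \<epsilon>)"
      proof (cases "norm (\<phi> s) \<le> 1")
        case False
        then have "norm (\<phi> s) powr 1 \<le> norm (\<phi> s) powr (1 + \<epsilon>)" using e by (intro powr_mono) auto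
        then show ?thesis using False by simp
      qed (simp add: add_increasing2)
      then show "ennreal (norm (\<phi> s)) \<le> 1 + ennreal (norm (\<phi> s) powr (1 + \<epsilon>))"
        by (metis ennreal_1 ennreal_leI ennreal_plus powr_ge_zero zero_le_one)
    qed
    also have "\<dots> < \<infinity>" using fin by (subst nn_integral_add) (auto simp: emeasure_space_1)
    finally show "(\<integral>\<^sup>+ s. ennreal (norm (\<phi> s)) \<partial>M) < \<infinity>" .
  qed measurable
  then have "\<phi> \<in> selections M 1 h x" using ne \<phi> by (auto simp: selections_def Lr_def)
  then have "(\<integral>s. \<phi> s \<partial>M) \<in> {\<integral>s. \<phi> s \<partial>M |\<phi>. \<phi> \<in> selections M 1 h x}" by blast
  then have "(\<integral>s. \<phi> s \<partial>M) \<in> selection_integral M h x"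
    unfolding selection_integral_def using closure_subset by (rule subsetD[rotated])
  then have "(\<integral>s. \<phi> s \<partial>M) \<in> subdifferential E x" using a2 by (simp add: subdifferential_interchange_def)
  then show thesis using that[OF e(1,2) \<phi>(1,3) fin int] by blast
qed

end

section \<open>Weighted means\<close>

lemma weighted_mean_tendsto:
  fixes a :: "nat \<Rightarrow> 'a::real_normed_vector" and c :: "nat \<Rightarrow> real"
  assumes c: "\<And>k. 0 \<le> c k" and S: "filterlim (\<lambda>n. \<Sum>k<n. c k) at_top sequentially" and a: "a \<longlonglongrightarrow> l"
  shows "(\<lambda>n. (\<Sum>k<n. c k *\<^sub>R a k) /\<^sub>R (\<Sum>k<n. c k)) \<longlonglongrightarrow> l"
proof (rule LIMSEQ_I)
  fix e :: real assume e: "0 < e"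
  obtain K where K: "\<And>k. k \<ge> K \<Longrightarrow> norm (a k - l) < e / 2" using LIMSEQ_D[OF a, of "e / 2"] e by auto
  define B where "B = (\<Sum>k<K. c k * norm (a k - l))"
  have B: "0 \<le> B" unfolding B_def using c by (intro sum_nonneg) auto
  obtain n0 where n0: "\<And>n. n \<ge> n0 \<Longrightarrow> 2 * B / e + 1 \<le> (\<Sum>k<n. c k)"
    using S unfolding filterlim_at_top eventually_sequentially by blast
  show "\<exists>n0. \<forall>n\<ge>n0. norm ((\<Sum>k<n. c k *\<^sub>R a k) /\<^sub>R (\<Sum>k<n. c k) - l) < e"
  proof (intro exI allI impI)
    fix n assume n: "n \<ge> max n0 K"
    define s where "s = (\<Sum>k<n. c k)"
    have sB: "2 * B / e + 1 \<le> s" using n0 n by (simp add: s_def)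
    have s: "0 < s" using sB B e by (smt (verit) divide_nonneg_pos)
    have "(\<Sum>k<n. c k *\<^sub>R a k) /\<^sub>R s - l = (\<Sum>k<n. c k *\<^sub>R (a k - l)) /\<^sub>R s"
      using s by (simp add: scaleR_diff_right sum_subtractf s_def flip: scaleR_left.sum)
    also have "norm \<dots> \<le> (\<Sum>k<n. c k * norm (a k - l)) / s"
      using s c sum_norm_le[of "{..<n}" "\<lambda>k. c k *\<^sub>R (a k - l)" "\<lambda>k. c k * norm (a k - l)"]
      by (simp add: divide_inverse_commute)
    also have "(\<Sum>k<n. c k * norm (a k - l)) = B + (\<Sum>k=K..<n. c k * norm (a k - l))"
      using n unfolding B_def lessThan_atLeast0 by (intro sum.atLeastLessThan_concat[symmetric]) auto
    also have "(\<Sum>k=K..<n. c k * norm (a k - l)) \<le> (\<Sum>k=K..<n. c k * (e / 2))"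
      using K c by (intro sum_mono mult_left_mono) (auto intro: less_imp_le)
    also have "\<dots> \<le> (\<Sum>k<n. c k * (e / 2))" using c e by (intro sum_mono2) auto
    also have "\<dots> = s * (e / 2)" by (simp add: s_def sum_distrib_right)
    finally have 1: "norm ((\<Sum>k<n. c k *\<^sub>R a k) /\<^sub>R s - l) \<le> (B + s * (e / 2)) / s" using s by (simp add: divide_right_mono)
    have "2 * B / e < s" using sB by simp
    then have "B < s * (e / 2)" using e by (simp add: field_simps)
    then have "(B + s * (e / 2)) / s < e" using s by (simp add: field_simps)
    with 1 show "norm ((\<Sum>k<n. c k *\<^sub>R a k) /\<^sub>R (\<Sum>k<n. c k) - l) < e" by (simp add: s_def)
  qed
qed

text \<open>Summation by parts with the partial sums \<open>A\<close> of the normalized series: the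
  quotient is \<open>A n\<close> minus the weighted mean of the earlier \<open>A k\<close>, and both
  have the same limit.\<close>

lemma kronecker_lemma:
  fixes y c :: "nat \<Rightarrow> real"
  assumes c: "\<And>k. 0 < c k" and S: "filterlim (\<lambda>n. \<Sum>k<n. c k) at_top sequentially"
    and y: "summable (\<lambda>k. y k / (\<Sum>j<Suc k. c j))"
  shows "(\<lambda>n. (\<Sum>k<n. y k) / (\<Sum>k<n. c k)) \<longlonglongrightarrow> 0"
proof -
  define A where "A n = (\<Sum>k<n. y k / (\<Sum>j<Suc k. c j))" for n
  obtain l where l: "A \<longlonglongrightarrow> l"
    using y unfolding summable_iff_convergent A_def[symmetric] convergent_def by blast
  have eq: "(\<Sum>k<n. y k) = (\<Sum>k<n. c k) * A n - (\<Sum>k<n. c k * A k)" for n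
  proof (induction n)
    case (Suc n)
    have p: "0 < (\<Sum>j<Suc n. c j)" using c by (intro sum_pos) auto
    have "A (Suc n) = A n + y n / (\<Sum>j<Suc n. c j)" by (simp add: A_def)
    then have "(\<Sum>j<Suc n. c j) * A (Suc n) = (\<Sum>j<Suc n. c j) * A n + y n"
      using p by (simp add: field_simps del: sum.lessThan_Suc)
    then show ?case using Suc by (simp add: algebra_simps)
  qed simp
  have "(\<lambda>n. A n - (\<Sum>k<n. c k *\<^sub>R A k) /\<^sub>R (\<Sum>k<n. c k)) \<longlonglongrightarrow> l - l"
    using c by (intro tendsto_diff l weighted_mean_tendsto[OF _ S l]) (auto intro: less_imp_le)
  moreover have "A n - (\<Sum>k<n. c k *\<^sub>R A k) /\<^sub>R (\<Sum>k<n. c k) = (\<Sum>k<n. y k) / (\<Sum>k<n. c k)" if "n \<ge> 1" for n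
  proof -
    have "0 < (\<Sum>j<n. c j)" using c that by (intro sum_pos) (auto simp: lessThan_empty_iff)
    then show ?thesis unfolding eq by (simp add: field_simps)
  qed
  then have "eventually (\<lambda>n. A n - (\<Sum>k<n. c k *\<^sub>R A k) /\<^sub>R (\<Sum>k<n. c k) = (\<Sum>k<n. y k) / (\<Sum>k<n. c k)) sequentially"
    by (rule eventually_sequentiallyI)
  ultimately show ?thesis by (simp add: tendsto_cong)
qed

text \<open>The right side is the integral of \<open>t powr - (1 + e)\<close> over
  \<open>[p, q]\<close>, the left side the length of the interval times the smallest value of the
  integrand.\<close>

lemma powr_minus_difference:
  fixes p q e :: real
  assumes "0 < p" "p \<le> q" "0 < e"
  shows "(q - p) * q powr (- (1 + e)) \<le> (p powr - e - q powr - e) / e"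
proof -
  have q: "0 < q" using assms by simp
  have "ln (p / q) \<le> p / q - 1" using assms q by (intro ln_le_minus_one) auto
  then have "e * (1 - p / q) \<le> - e * ln (p / q)" using assms(3) mult_left_mono[of "ln (p / q)" "p / q - 1" e] by (simp add: algebra_simps)
  also have "\<dots> \<le> exp (- e * ln (p / q)) - 1" using exp_ge_add_one_self[of "- e * ln (p / q)"] by linarith
  also have "exp (- e * ln (p / q)) = (p / q) powr - e" using assms q by (simp add: powr_def)
  also have "\<dots> = p powr - e / q powr - e" using assms q by (simp add: powr_divide)
  finally have "e * (1 - p / q) * q powr - e \<le> (p powr - e / q powr - e - 1) * q powr - e" by (intro mult_right_mono) auto
  moreover have "(p powr - e / Q - 1) * Q = p powr - e - Q" if "0 < Q" for Q using that by (simp add: field_simps)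
  ultimately have 1: "e * ((1 - p / q) * q powr - e) \<le> p powr - e - q powr - e" using q by (simp add: mult.assoc)
  have "q powr (- (1 + e)) = q powr - e / q" using q by (simp add: powr_diff powr_minus_divide powr_add)
  then have "(q - p) * q powr (- (1 + e)) = (1 - p / q) * q powr - e" using q by (simp add: field_simps)
  then show ?thesis using 1 by (simp only: pos_le_divide_eq[OF assms(3)] mult.commute)
qed

text \<open>The Abel-Dini argument: bounded weights contribute the factor \<open>C powr e\<close>,
  and the rest is dominated by a telescoping series in the partial sums to the power
  \<open>- e\<close>. It allows noise with a moment of order \<open>1 + e\<close> to be summed after
  normalization.\<close>

lemma summable_normalized_weights_powr:
  fixes c :: "nat \<Rightarrow> real"
  assumes c: "\<And>k. 0 < c k" "\<And>k. c k \<le> C" and S: "filterlim (\<lambda>n. \<Sum>k<n. c k) at_top sequentially" and e: "0 < e"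
  shows "summable (\<lambda>k. (c k / (\<Sum>j<Suc k. c j)) powr (1 + e))"
proof -
  define s where "s n = (\<Sum>k<Suc n. c k)" for n
  have s: "0 < s n" for n unfolding s_def using c by (intro sum_pos) auto
  have sS: "s (Suc n) = s n + c (Suc n)" for n by (simp add: s_def)
  have "filterlim s at_top sequentially" unfolding s_def using S by (subst filterlim_sequentially_Suc)
  then have "(\<lambda>n. s n powr - e) \<longlonglongrightarrow> 0" using e by (intro tendsto_neg_powr) auto
  then have "summable (\<lambda>n. s n powr - e - s (Suc n) powr - e)" by (rule telescope_summable')
  then have "summable (\<lambda>n. C powr e / e * (s n powr - e - s (Suc n) powr - e))" by (rule summable_mult)
  moreover have "norm ((c (Suc n) / s (Suc n)) powr (1 + e)) \<le> C powr e / e * (s n powr - e - s (Suc n) powr - e)" for n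
  proof -
    have "(c (Suc n) / s (Suc n)) powr (1 + e) = c (Suc n) powr e * (c (Suc n) * s (Suc n) powr (- (1 + e)))"
    proof -
      have "s (Suc n) powr (- (1 + e)) = 1 / (s (Suc n) * s (Suc n) powr e)"
        using s[of "Suc n"] by (subst powr_minus_divide) (simp add: powr_add)
      then show ?thesis using c(1)[of "Suc n"] s[of "Suc n"] by (simp add: powr_divide powr_add)
    qed
    also have "\<dots> \<le> C powr e * (c (Suc n) * s (Suc n) powr (- (1 + e)))"
      using c(1)[of "Suc n"] c(2) e by (intro mult_right_mono powr_mono2) auto
    also have "c (Suc n) * s (Suc n) powr (- (1 + e)) \<le> (s n powr - e - s (Suc n) powr - e) / e"
      using powr_minus_difference[OF s[of n] _ e, of "s (Suc n)"] c(1)[of "Suc n"] sS[of n] by simp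
    finally show ?thesis by (simp add: mult_left_mono)
  qed
  ultimately have "summable (\<lambda>n. (c (Suc n) / s (Suc n)) powr (1 + e))" by (rule summable_comparison_test')
  then show ?thesis unfolding s_def by (subst (asm) summable_Suc_iff)
qed

section \<open>Martingale convergence\<close>

lemma abs_mult_le_sum_squares: "\<bar>a * b\<bar> \<le> a\<^sup>2 + b\<^sup>2" for a b :: real
proof -
  have "2 * \<bar>a * b\<bar> \<le> a\<^sup>2 + b\<^sup>2" using sum_squares_bound[of "\<bar>a\<bar>" "\<bar>b\<bar>"] by (simp add: abs_mult)
  then show ?thesis by linarith
qed

lemma (in prob_space) AE_summable:
  fixes Y :: "nat \<Rightarrow> 'a \<Rightarrow> real"
  assumes [measurable]: "\<And>n. Y n \<in> borel_measurable M" and nn: "\<And>n \<omega>. 0 \<le> Y n \<omega>"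
    and fin: "\<And>n. (\<integral>\<^sup>+ \<omega>. ennreal (Y n \<omega>) \<partial>M) \<le> ennreal (b n)" and b: "summable b" "\<And>n. 0 \<le> b n"
  shows "AE \<omega> in M. summable (\<lambda>n. Y n \<omega>)"
proof -
  have "(\<integral>\<^sup>+ \<omega>. (\<Sum>n. ennreal (Y n \<omega>)) \<partial>M) = (\<Sum>n. \<integral>\<^sup>+ \<omega>. ennreal (Y n \<omega>) \<partial>M)"
    by (rule nn_integral_suminf) measurable
  also have "\<dots> \<le> (\<Sum>n. ennreal (b n))" using fin by (intro suminf_le) auto
  also have "\<dots> = ennreal (suminf b)" using b by (intro suminf_ennreal2) auto
  finally have "(\<integral>\<^sup>+ \<omega>. (\<Sum>n. ennreal (Y n \<omega>)) \<partial>M) \<noteq> \<infinity>" by (auto simp: top_unique)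
  then have "AE \<omega> in M. (\<Sum>n. ennreal (Y n \<omega>)) \<noteq> \<infinity>" by (intro nn_integral_PInf_AE) measurable
  then show ?thesis by eventually_elim (auto intro!: summable_suminf_not_top nn)
qed

locale filtered_prob_space = prob_space M for M :: "'w measure" +
  fixes \<F> :: "nat \<Rightarrow> 'w measure"
  assumes space_F[simp]: "\<And>n. space (\<F> n) = space M"
    and sets_F: "\<And>n. sets (\<F> n) \<subseteq> sets M" and sets_F_Suc: "\<And>n. sets (\<F> n) \<subseteq> sets (\<F> (Suc n))"
begin

lemma measurable_F: "f \<in> measurable (\<F> n) N \<Longrightarrow> f \<in> measurable M N"
  using measurable_mono[of N N "\<F> n" M] sets_F by auto

lemma measurable_F_mono: "f \<in> measurable (\<F> n) N \<Longrightarrow> n \<le> m \<Longrightarrow> f \<in> measurable (\<F> m) N"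
proof -
  assume f: "f \<in> measurable (\<F> n) N" and "n \<le> m"
  from \<open>n \<le> m\<close> have "sets (\<F> n) \<subseteq> sets (\<F> m)" by (induction rule: dec_induct) (use sets_F_Suc in auto)
  then show ?thesis using f measurable_mono[of N N "\<F> n" "\<F> m"] by auto
qed

text \<open>Martingale differences, with the vanishing conditional mean expressed as orthogonality
  to every square integrable variable of the past.\<close>

context
  fixes Y :: "nat \<Rightarrow> 'w \<Rightarrow> real"
  assumes Y: "\<And>n. Y n \<in> borel_measurable (\<F> (Suc n))" and Y2: "\<And>n. integrable M (\<lambda>\<omega>. (Y n \<omega>)\<^sup>2)"
    and orth: "\<And>n W. W \<in> borel_measurable (\<F> n) \<Longrightarrow> integrable M (\<lambda>\<omega>. (W \<omega>)\<^sup>2) \<Longrightarrow> (\<integral>\<omega>. W \<omega> * Y n \<omega> \<partial>M) = 0"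
begin

lemma increment_measurable: "Y n \<in> borel_measurable M"
  using Y by (rule measurable_F)

text \<open>Kolmogorov's maximal inequality: the sum of the increments stopped at the first exceedance
  exceeds \<open>\<epsilon>\<close> on the event, and its second moment is computed by orthogonality.\<close>

lemma kolmogorov_maximal_inequality:
  assumes e: "0 < \<epsilon>" and mN: "m \<le> N"
  shows "prob {\<omega> \<in> space M. \<exists>n\<in>{m..N}. \<epsilon> \<le> \<bar>\<Sum>k=m..<n. Y k \<omega>\<bar>} \<le> (\<Sum>k=m..<N. \<integral>\<omega>. (Y k \<omega>)\<^sup>2 \<partial>M) / \<epsilon>\<^sup>2"
proof -
  \<comment> \<open>The indicator that no partial sum up to time \<open>k\<close> has reached
    \<open>\<epsilon>\<close>. It belongs to the past of \<open>Y k\<close>, because those sums end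
    with \<open>Y (k - 1)\<close> at the latest.\<close>
  define D :: "nat \<Rightarrow> 'w \<Rightarrow> real" where "D k \<omega> = of_bool (\<forall>n\<in>{m..k}. \<bar>\<Sum>j=m..<n. Y j \<omega>\<bar> < \<epsilon>)" for k \<omega>
  define T where "T N \<omega> = (\<Sum>k=m..<N. D k \<omega> * Y k \<omega>)" for N \<omega>
  have YF: "Y j \<in> borel_measurable (\<F> k)" if "j < k" for j k using measurable_F_mono[OF Y] that by auto
  have SF: "(\<lambda>\<omega>. \<Sum>j=m..<n. Y j \<omega>) \<in> borel_measurable (\<F> k)" if "n \<le> k" for n k
    using that by (intro borel_measurable_sum YF) auto
  have DF: "D k \<in> borel_measurable (\<F> k)" for k
  proof -
    have "Measurable.pred (\<F> k) (\<lambda>\<omega>. \<forall>n\<in>{m..k}. \<bar>\<Sum>j=m..<n. Y j \<omega>\<bar> < \<epsilon>)"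
    proof (intro pred_intros_finite)
      fix n assume "n \<in> {m..k}"
      then have [measurable]: "(\<lambda>\<omega>. \<Sum>j=m..<n. Y j \<omega>) \<in> borel_measurable (\<F> k)" by (intro SF) auto
      show "Measurable.pred (\<F> k) (\<lambda>\<omega>. \<bar>\<Sum>j=m..<n. Y j \<omega>\<bar> < \<epsilon>)" by measurable
    qed auto
    then show ?thesis unfolding D_def by measurable
  qed
  have TF: "T n \<in> borel_measurable (\<F> n)" for n
    unfolding T_def by (intro borel_measurable_sum borel_measurable_times measurable_F_mono[OF DF] YF) auto
  have D01: "D k \<omega> = 0 \<or> D k \<omega> = 1" for k \<omega> unfolding D_def of_bool_def by presburger
  have Dle: "(D k \<omega> * y)\<^sup>2 \<le> y\<^sup>2" "(y * D k \<omega>)\<^sup>2 \<le> y\<^sup>2" for k \<omega> y using D01[of k \<omega>] by auto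
  note [measurable] = increment_measurable measurable_F[OF DF] measurable_F[OF TF]
  have TN: "integrable M (\<lambda>\<omega>. (T N \<omega>)\<^sup>2) \<and> (\<integral>\<omega>. (T N \<omega>)\<^sup>2 \<partial>M) \<le> (\<Sum>k=m..<N. \<integral>\<omega>. (Y k \<omega>)\<^sup>2 \<partial>M)"
    using mN
  proof (induction rule: dec_induct)
    case base
    then show ?case by (simp add: T_def)
  next
    case (step n)
    have TS: "T (Suc n) \<omega> = T n \<omega> + D n \<omega> * Y n \<omega>" for \<omega> using step by (simp add: T_def)
    have DY: "integrable M (\<lambda>\<omega>. (D n \<omega> * Y n \<omega>)\<^sup>2)"
      by (rule Bochner_Integration.integrable_bound[OF Y2[of n]]) (use Dle in auto)
    have TD: "integrable M (\<lambda>\<omega>. (T n \<omega> * D n \<omega>)\<^sup>2)"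
      by (rule Bochner_Integration.integrable_bound[OF conjunct1[OF step.IH]]) (use Dle in auto)
    have cross: "integrable M (\<lambda>\<omega>. (T n \<omega> * D n \<omega>) * Y n \<omega>)"
    proof (rule Bochner_Integration.integrable_bound)
      show "integrable M (\<lambda>\<omega>. (T n \<omega> * D n \<omega>)\<^sup>2 + (Y n \<omega>)\<^sup>2)" using TD Y2 by auto
      show "AE \<omega> in M. norm ((T n \<omega> * D n \<omega>) * Y n \<omega>) \<le> norm ((T n \<omega> * D n \<omega>)\<^sup>2 + (Y n \<omega>)\<^sup>2)" using abs_mult_le_sum_squares by auto
    qed measurable
    \<comment> \<open>\<open>T n * D n\<close> belongs to the past, hence is orthogonal to
      \<open>Y n\<close>; second moments therefore add up.\<close>
    have zero: "(\<integral>\<omega>. (T n \<omega> * D n \<omega>) * Y n \<omega> \<partial>M) = 0"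
      by (rule orth[OF _ TD]) (intro borel_measurable_times TF DF)
    have eq: "(T (Suc n) \<omega>)\<^sup>2 = (T n \<omega>)\<^sup>2 + 2 * ((T n \<omega> * D n \<omega>) * Y n \<omega>) + (D n \<omega> * Y n \<omega>)\<^sup>2" for \<omega>
      unfolding TS by (simp add: power2_eq_square algebra_simps)
    have "(\<integral>\<omega>. (D n \<omega> * Y n \<omega>)\<^sup>2 \<partial>M) \<le> (\<integral>\<omega>. (Y n \<omega>)\<^sup>2 \<partial>M)"
    proof (rule integral_mono[OF DY Y2])
      fix \<omega> show "(D n \<omega> * Y n \<omega>)\<^sup>2 \<le> (Y n \<omega>)\<^sup>2" by (rule Dle)
    qed
    then show ?case unfolding eq using step cross zero DY by auto
  qed
  have hit: "\<epsilon>\<^sup>2 \<le> (T N \<omega>)\<^sup>2" if "\<exists>n\<in>{m..N}. \<epsilon> \<le> \<bar>\<Sum>k=m..<n. Y k \<omega>\<bar>" for \<omega>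
  proof -
    define n where "n = (LEAST n. n \<in> {m..N} \<and> \<epsilon> \<le> \<bar>\<Sum>k=m..<n. Y k \<omega>\<bar>)"
    have n: "n \<in> {m..N}" "\<epsilon> \<le> \<bar>\<Sum>k=m..<n. Y k \<omega>\<bar>"
      using that LeastI_ex[of "\<lambda>n. n \<in> {m..N} \<and> \<epsilon> \<le> \<bar>\<Sum>k=m..<n. Y k \<omega>\<bar>"] unfolding n_def by blast+
    have least: "\<bar>\<Sum>k=m..<k. Y k \<omega>\<bar> < \<epsilon>" if "k \<in> {m..<n}" for k
    proof -
      have "k < n" using that by simp
      then have "\<not> (k \<in> {m..N} \<and> \<epsilon> \<le> \<bar>\<Sum>k=m..<k. Y k \<omega>\<bar>)" unfolding n_def by (rule not_less_Least)
      then show ?thesis using that n(1) by auto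
    qed
    \<comment> \<open>Stopping freezes \<open>T\<close> at the first exceedance time
      \<open>n\<close>: \<open>D k\<close> is \<open>1\<close> for \<open>k < n\<close> and
      \<open>0\<close> from \<open>n\<close> on.\<close>
    have "T N \<omega> = (\<Sum>k=m..<N. if k < n then Y k \<omega> else 0)"
      unfolding T_def
    proof (rule sum.cong)
      fix k assume k: "k \<in> {m..<N}"
      show "D k \<omega> * Y k \<omega> = (if k < n then Y k \<omega> else 0)"
      proof (cases "k < n")
        case True
        then have "D k \<omega> = 1" using least unfolding D_def by auto
        then show ?thesis using True by simp
      next
        case False
        then have "D k \<omega> = 0" using n k unfolding D_def by (auto intro!: bexI[of _ n])
        then show ?thesis using False by simp
      qed
    qed simp
    also have "\<dots> = (\<Sum>k=m..<n. Y k \<omega>)"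
      using n(1) by (subst sum.inter_filter[symmetric]) (auto intro!: sum.cong)
    finally have "\<epsilon> \<le> \<bar>T N \<omega>\<bar>" using n by simp
    then show ?thesis using e by (metis abs_le_square_iff abs_of_pos)
  qed
  have "prob {\<omega> \<in> space M. \<exists>n\<in>{m..N}. \<epsilon> \<le> \<bar>\<Sum>k=m..<n. Y k \<omega>\<bar>} \<le> prob {\<omega> \<in> space M. (T N \<omega>)\<^sup>2 \<ge> \<epsilon>\<^sup>2}"
    using hit by (intro finite_measure_mono) auto
  also have "\<dots> \<le> (\<integral>\<omega>. (T N \<omega>)\<^sup>2 \<partial>M) / \<epsilon>\<^sup>2"
    using e TN by (intro integral_Markov_inequality_measure[where A="space M"]) auto
  also have "\<dots> \<le> (\<Sum>k=m..<N. \<integral>\<omega>. (Y k \<omega>)\<^sup>2 \<partial>M) / \<epsilon>\<^sup>2" using TN by (intro divide_right_mono) auto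
  finally show ?thesis .
qed

text \<open>The maximal inequality bounds the probability of an oscillation of size
  \<open>\<epsilon>\<close> after time \<open>m\<close> by a tail of the variance series. Almost
  every path thus has arbitrarily small oscillations from some time on and its partial sums are
  Cauchy.\<close>

lemma square_integrable_martingale_convergence:
  assumes sm: "summable (\<lambda>k. \<integral>\<omega>. (Y k \<omega>)\<^sup>2 \<partial>M)"
  shows "AE \<omega> in M. summable (\<lambda>k. Y k \<omega>)"
proof -
  define v where "v k = (\<integral>\<omega>. (Y k \<omega>)\<^sup>2 \<partial>M)" for k
  have v0: "0 \<le> v k" for k unfolding v_def by simp
  define B where "B \<epsilon> m = {\<omega> \<in> space M. \<exists>n\<ge>m. \<epsilon> \<le> \<bar>\<Sum>k=m..<n. Y k \<omega>\<bar>}" for \<epsilon> m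
  note [measurable] = increment_measurable
  have [measurable]: "B \<epsilon> m \<in> sets M" for \<epsilon> m unfolding B_def by measurable
  have pB: "prob (B \<epsilon> m) \<le> (suminf v - sum v {..<m}) / \<epsilon>\<^sup>2" if e: "0 < \<epsilon>" for \<epsilon> m
  proof -
    define A where "A N = {\<omega> \<in> space M. \<exists>n\<in>{m..N}. \<epsilon> \<le> \<bar>\<Sum>k=m..<n. Y k \<omega>\<bar>}" for N
    have "(\<lambda>N. prob (A N)) \<longlonglongrightarrow> prob (\<Union>N. A N)"
    proof (rule finite_Lim_measure_incseq)
      show "range A \<subseteq> events" unfolding A_def by auto
      show "incseq A" unfolding A_def by (rule monoI) fastforce
    qed
    moreover have "(\<Union>N. A N) = B \<epsilon> m" unfolding A_def B_def by force
    moreover have "prob (A N) \<le> (suminf v - sum v {..<m}) / \<epsilon>\<^sup>2" if "m \<le> N" for N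
    proof -
      have "prob (A N) \<le> (\<Sum>k=m..<N. v k) / \<epsilon>\<^sup>2" unfolding A_def v_def by (rule kolmogorov_maximal_inequality[OF e that])
      also have "(\<Sum>k=m..<N. v k) = sum v {..<N} - sum v {..<m}"
        using that sum_diff_nat_ivl[of 0 m N v] by (simp add: lessThan_atLeast0)
      also have "\<dots> \<le> suminf v - sum v {..<m}" using sum_le_suminf[of v "{..<N}"] sm v0 by (auto simp: v_def[abs_def])
      finally show ?thesis by (simp add: divide_right_mono)
    qed
    ultimately show ?thesis by (intro LIMSEQ_le_const2[of "\<lambda>N. prob (A N)"]) auto
  qed
  have AEe: "AE \<omega> in M. \<exists>m. \<omega> \<notin> B \<epsilon> m" if e: "0 < \<epsilon>" for \<epsilon>
  proof -
    have "prob (\<Inter>m. B \<epsilon> m) \<le> (suminf v - sum v {..<m}) / \<epsilon>\<^sup>2" for m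
      by (rule order_trans[OF finite_measure_mono pB[OF e, of m]]) auto
    moreover have "(\<lambda>m. (suminf v - sum v {..<m}) / \<epsilon>\<^sup>2) \<longlonglongrightarrow> (suminf v - suminf v) / \<epsilon>\<^sup>2"
      using summable_LIMSEQ[OF sm] e unfolding v_def[abs_def] by (intro tendsto_intros) auto
    ultimately have "prob (\<Inter>m. B \<epsilon> m) \<le> 0" by (intro LIMSEQ_le_const) auto
    then have "(\<Inter>m. B \<epsilon> m) \<in> null_sets M"
      by (auto simp: null_sets_def emeasure_eq_measure measure_le_0_iff)
    then show ?thesis by (auto dest: AE_not_in)
  qed
  have "AE \<omega> in M. \<forall>j. \<exists>m. \<omega> \<notin> B (inverse (real (Suc j))) m" unfolding AE_all_countable by (intro allI AEe) auto
  then show ?thesis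
    using AE_space
  proof eventually_elim
    case (elim \<omega>)
    show ?case
      unfolding summable_iff_convergent
    proof (rule Cauchy_convergent, rule CauchyI)
      fix e :: real assume "0 < e"
      then obtain j where j: "inverse (real (Suc j)) < e / 2" using reals_Archimedean[of "e / 2"] by auto
      obtain m where m: "\<omega> \<notin> B (inverse (real (Suc j))) m" using elim by auto
      have sm: "\<bar>(\<Sum>k<n. Y k \<omega>) - (\<Sum>k<m. Y k \<omega>)\<bar> < e / 2" if "n \<ge> m" for n
      proof -
        have "\<bar>\<Sum>k=m..<n. Y k \<omega>\<bar> < inverse (real (Suc j))" using m elim(2) that unfolding B_def by force
        then show ?thesis using j that sum_diff_nat_ivl[of 0 m n "\<lambda>k. Y k \<omega>"] by (simp add: lessThan_atLeast0)
      qed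
      show "\<exists>M. \<forall>p\<ge>M. \<forall>n\<ge>M. norm ((\<Sum>k<p. Y k \<omega>) - (\<Sum>k<n. Y k \<omega>)) < e"
      proof (intro exI[of _ m] allI impI)
        fix p n assume "m \<le> p" "m \<le> n"
        then show "norm ((\<Sum>k<p. Y k \<omega>) - (\<Sum>k<n. Y k \<omega>)) < e" using sm[of p] sm[of n] by (simp add: abs_if split: if_splits)
      qed
    qed
  qed
qed

end

end


section \<open>Independent innovations\<close>

text \<open>Independence of draw \<open>n + 1\<close> from the past is encoded as a product law. The
  first component is the sample point itself, seen through the sigma algebra \<open>\<F> n\<close>,
  so that any function measurable in the past can be frozen while the draw is integrated
  out.\<close>

locale innovations = filtered_prob_space M \<F> + innovation: prob_space \<mu>
  for M :: "'w measure" and \<F> and \<mu> :: "'s measure" +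
  fixes \<xi> :: "nat \<Rightarrow> 'w \<Rightarrow> 's"
  assumes xi_measurable: "\<And>n. \<xi> (Suc n) \<in> measurable (\<F> (Suc n)) \<mu>"
    and xi_distr: "\<And>n. distr M (\<F> n \<Otimes>\<^sub>M \<mu>) (\<lambda>\<omega>. (\<omega>, \<xi> (Suc n) \<omega>)) = distr M (\<F> n) (\<lambda>\<omega>. \<omega>) \<Otimes>\<^sub>M \<mu>"
begin

lemma id_measurable: "(\<lambda>\<omega>. \<omega>) \<in> measurable M (\<F> n)"
  using measurable_F[of "\<lambda>\<omega>. \<omega>" n "\<F> n"] by simp

lemma innovation_measurable: "(\<lambda>\<omega>. (\<omega>, \<xi> (Suc n) \<omega>)) \<in> measurable M (\<F> n \<Otimes>\<^sub>M \<mu>)"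
  by (intro measurable_Pair id_measurable measurable_F[OF xi_measurable])

lemma xi_measurable_M[measurable]: "\<xi> (Suc n) \<in> measurable M \<mu>"
  by (rule measurable_F[OF xi_measurable])

lemma prob_space_past: "prob_space (distr M (\<F> n) (\<lambda>\<omega>. \<omega>))"
  by (rule prob_space_distr[OF id_measurable])

lemma nn_integral_innovation:
  assumes h: "h \<in> borel_measurable (\<F> n \<Otimes>\<^sub>M \<mu>)"
  shows "(\<integral>\<^sup>+ \<omega>. h (\<omega>, \<xi> (Suc n) \<omega>) \<partial>M) = (\<integral>\<^sup>+ \<omega>. (\<integral>\<^sup>+ s. h (\<omega>, s) \<partial>\<mu>) \<partial>M)"
proof -
  have h': "h \<in> borel_measurable (distr M (\<F> n) (\<lambda>\<omega>. \<omega>) \<Otimes>\<^sub>M \<mu>)"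
    using h by (subst measurable_cong_sets[OF sets_pair_measure_cong]) auto
  have "(\<integral>\<^sup>+ \<omega>. h (\<omega>, \<xi> (Suc n) \<omega>) \<partial>M) = (\<integral>\<^sup>+ w. h w \<partial>distr M (\<F> n \<Otimes>\<^sub>M \<mu>) (\<lambda>\<omega>. (\<omega>, \<xi> (Suc n) \<omega>)))"
    by (rule nn_integral_distr[OF innovation_measurable, symmetric]) (simp add: h)
  also have "\<dots> = (\<integral>\<^sup>+ \<omega>. (\<integral>\<^sup>+ s. h (\<omega>, s) \<partial>\<mu>) \<partial>distr M (\<F> n) (\<lambda>\<omega>. \<omega>))"
    unfolding xi_distr by (rule innovation.nn_integral_fst[symmetric, OF h'])
  also have "\<dots> = (\<integral>\<^sup>+ \<omega>. (\<integral>\<^sup>+ s. h (\<omega>, s) \<partial>\<mu>) \<partial>M)"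
    by (rule nn_integral_distr[OF id_measurable]) (use innovation.borel_measurable_nn_integral_fst[OF h] in simp)
  finally show ?thesis .
qed

lemma nn_integral_xi:
  assumes h: "h \<in> borel_measurable \<mu>"
  shows "(\<integral>\<^sup>+ \<omega>. h (\<xi> (Suc n) \<omega>) \<partial>M) = (\<integral>\<^sup>+ s. h s \<partial>\<mu>)"
  using nn_integral_innovation[of "\<lambda>w. h (snd w)" n] h by (simp add: emeasure_space_1)

text \<open>The exceptional set is measurable in the product and null in each section, hence null
  for the product law, which is the joint law of the past and the next draw.\<close>

lemma AE_innovation:
  assumes Q: "{w \<in> space (\<F> n \<Otimes>\<^sub>M \<mu>). Q w} \<in> sets (\<F> n \<Otimes>\<^sub>M \<mu>)"
    and ae: "\<And>\<omega>. \<omega> \<in> space M \<Longrightarrow> AE s in \<mu>. Q (\<omega>, s)"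
  shows "AE \<omega> in M. Q (\<omega>, \<xi> (Suc n) \<omega>)"
proof -
  interpret pair_sigma_finite "distr M (\<F> n) (\<lambda>\<omega>. \<omega>)" \<mu>
    using prob_space_past[of n] innovation.prob_space_axioms by (intro pair_sigma_finite.intro prob_space_imp_sigma_finite)
  have "AE w in distr M (\<F> n) (\<lambda>\<omega>. \<omega>) \<Otimes>\<^sub>M \<mu>. Q w"
  proof (rule AE_pair_measure)
    have 1: "sets (distr M (\<F> n) (\<lambda>\<omega>. \<omega>) \<Otimes>\<^sub>M \<mu>) = sets (\<F> n \<Otimes>\<^sub>M \<mu>)" by (intro sets_pair_measure_cong) auto
    then show "{x \<in> space (distr M (\<F> n) (\<lambda>\<omega>. \<omega>) \<Otimes>\<^sub>M \<mu>). Q x} \<in> sets (distr M (\<F> n) (\<lambda>\<omega>. \<omega>) \<Otimes>\<^sub>M \<mu>)"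
      using Q sets_eq_imp_space_eq[OF 1] by simp
    show "AE x in distr M (\<F> n) (\<lambda>\<omega>. \<omega>). AE y in \<mu>. Q (x, y)" by (rule AE_I2) (use ae in simp)
  qed
  then have "AE w in distr M (\<F> n \<Otimes>\<^sub>M \<mu>) (\<lambda>\<omega>. (\<omega>, \<xi> (Suc n) \<omega>)). Q w" by (subst xi_distr)
  then show ?thesis by (subst (asm) AE_distr_iff[OF innovation_measurable Q])
qed

lemma AE_xi:
  assumes "AE s in \<mu>. Q s"
  shows "AE \<omega> in M. Q (\<xi> (Suc n) \<omega>)"
proof -
  obtain N where N: "N \<in> null_sets \<mu>" "{s \<in> space \<mu>. \<not> Q s} \<subseteq> N" using assms by (auto elim!: AE_E simp: null_sets_def)
  have [measurable]: "N \<in> sets \<mu>" using N by auto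
  have "AE \<omega> in M. snd (\<omega>, \<xi> (Suc n) \<omega>) \<notin> N"
    by (rule AE_innovation[of n "\<lambda>w. snd w \<notin> N"]) (use AE_not_in[OF N(1)] in auto)
  then show ?thesis using AE_space
  proof eventually_elim
    case (elim \<omega>)
    then have "\<xi> (Suc n) \<omega> \<in> space \<mu>" using measurable_space[OF xi_measurable_M] by blast
    then show ?case using elim N by auto
  qed
qed

lemma integral_innovation:
  fixes h :: "'w \<times> 's \<Rightarrow> real"
  assumes h: "h \<in> borel_measurable (\<F> n \<Otimes>\<^sub>M \<mu>)"
    and fin: "(\<integral>\<^sup>+ \<omega>. (\<integral>\<^sup>+ s. ennreal \<bar>h (\<omega>, s)\<bar> \<partial>\<mu>) \<partial>M) < \<infinity>"
  shows "integrable M (\<lambda>\<omega>. h (\<omega>, \<xi> (Suc n) \<omega>))"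
    "(\<integral>\<omega>. h (\<omega>, \<xi> (Suc n) \<omega>) \<partial>M) = (\<integral>\<omega>. (\<integral>s. h (\<omega>, s) \<partial>\<mu>) \<partial>M)"
proof -
  let ?Q = "distr M (\<F> n) (\<lambda>\<omega>. \<omega>)"
  interpret pair_sigma_finite ?Q \<mu>
    using prob_space_past[of n] innovation.prob_space_axioms by (intro pair_sigma_finite.intro prob_space_imp_sigma_finite)
  have h': "h \<in> borel_measurable (?Q \<Otimes>\<^sub>M \<mu>)"
    using h by (subst measurable_cong_sets[OF sets_pair_measure_cong]) auto
  have habs: "(\<lambda>w. ennreal \<bar>h w\<bar>) \<in> borel_measurable (\<F> n \<Otimes>\<^sub>M \<mu>)" using h by measurable
  have fin': "(\<integral>\<^sup>+ \<omega>. ennreal \<bar>h (\<omega>, \<xi> (Suc n) \<omega>)\<bar> \<partial>M) < \<infinity>" using nn_integral_innovation[OF habs] fin by simp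
  show int: "integrable M (\<lambda>\<omega>. h (\<omega>, \<xi> (Suc n) \<omega>))"
    by (rule integrableI_bounded[OF measurable_compose[OF innovation_measurable h]]) (use fin' in simp)
  have "integrable (distr M (\<F> n \<Otimes>\<^sub>M \<mu>) (\<lambda>\<omega>. (\<omega>, \<xi> (Suc n) \<omega>))) h"
    by (subst integrable_distr_eq[OF innovation_measurable h]) (rule int)
  then have intQ: "integrable (?Q \<Otimes>\<^sub>M \<mu>) h" by (simp add: xi_distr)
  have "(\<integral>\<omega>. h (\<omega>, \<xi> (Suc n) \<omega>) \<partial>M) = integral\<^sup>L (distr M (\<F> n \<Otimes>\<^sub>M \<mu>) (\<lambda>\<omega>. (\<omega>, \<xi> (Suc n) \<omega>))) h"
    by (rule integral_distr[OF innovation_measurable h, symmetric])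
  also have "\<dots> = (\<integral>\<omega>. (\<integral>s. h (\<omega>, s) \<partial>\<mu>) \<partial>?Q)"
    unfolding xi_distr by (rule integral_fst'[OF intQ, symmetric])
  also have "\<dots> = (\<integral>\<omega>. (\<integral>s. h (\<omega>, s) \<partial>\<mu>) \<partial>M)"
    by (rule integral_distr[OF id_measurable]) (rule innovation.borel_measurable_lebesgue_integral, use h in simp)
  finally show "(\<integral>\<omega>. h (\<omega>, \<xi> (Suc n) \<omega>) \<partial>M) = (\<integral>\<omega>. (\<integral>s. h (\<omega>, s) \<partial>\<mu>) \<partial>M)" .
qed

text \<open>For \<open>r \<le> 2\<close> the square of \<open>min y 1\<close> is at most
  \<open>y powr r\<close>, so the truncated squares have summable expectations. Their terms then
  tend to \<open>0\<close>, the truncation is eventually inactive, and the full squares are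
  summable.\<close>

lemma AE_summable_truncated_squares:
  fixes \<phi> :: "'s \<Rightarrow> 'e::euclidean_space"
  assumes \<phi>[measurable]: "\<phi> \<in> borel_measurable \<mu>" and r: "1 \<le> r" "r \<le> 2"
    and fin: "(\<integral>\<^sup>+ s. ennreal (norm (\<phi> s) powr r) \<partial>\<mu>) < \<infinity>"
    and a: "\<And>n. 0 \<le> a n" "summable (\<lambda>n. a n powr r)"
  shows "AE \<omega> in M. summable (\<lambda>n. (a n * norm (\<phi> (\<xi> (Suc n) \<omega>)))\<^sup>2) \<and>
    eventually (\<lambda>n. a n * norm (\<phi> (\<xi> (Suc n) \<omega>)) < 1) sequentially"
proof -
  obtain K where K: "0 \<le> K" "(\<integral>\<^sup>+ s. ennreal (norm (\<phi> s) powr r) \<partial>\<mu>) = ennreal K"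
    using fin by (cases "\<integral>\<^sup>+ s. ennreal (norm (\<phi> s) powr r) \<partial>\<mu>") auto
  define t where "t n s = (min (a n * norm (\<phi> s)) 1)\<^sup>2" for n s
  have "AE \<omega> in M. summable (\<lambda>n. t n (\<xi> (Suc n) \<omega>))"
  proof (rule AE_summable[where b="\<lambda>n. a n powr r * K"])
    fix n
    have [measurable]: "t n \<in> borel_measurable \<mu>" unfolding t_def by measurable
    show "(\<lambda>\<omega>. t n (\<xi> (Suc n) \<omega>)) \<in> borel_measurable M"
      by (rule measurable_compose[OF xi_measurable_M]) measurable
    have tle: "t n s \<le> a n powr r * norm (\<phi> s) powr r" for s
    proof -
      define y where "y = a n * norm (\<phi> s)"
      have y: "0 \<le> y" using a by (simp add: y_def)
      have "(min y 1)\<^sup>2 \<le> y powr r"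
      proof (cases "y \<le> 1")
        case True
        then show ?thesis using y r powr_mono'[of r 2 y] by (cases "y = 0") (auto simp: powr_numeral)
      next
        case False
        then show ?thesis using r by (simp add: ge_one_powr_ge_zero)
      qed
      then show ?thesis using a by (simp add: t_def y_def powr_mult)
    qed
    have "(\<integral>\<^sup>+ \<omega>. ennreal (t n (\<xi> (Suc n) \<omega>)) \<partial>M) = (\<integral>\<^sup>+ s. ennreal (t n s) \<partial>\<mu>)"
      by (rule nn_integral_xi) measurable
    also have "\<dots> \<le> (\<integral>\<^sup>+ s. ennreal (a n powr r) * ennreal (norm (\<phi> s) powr r) \<partial>\<mu>)"
      using tle by (intro nn_integral_mono) (simp add: ennreal_leI flip: ennreal_mult)
    also have "\<dots> = ennreal (a n powr r * K)" using K by (subst nn_integral_cmult) (auto simp: ennreal_mult)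
    finally show "(\<integral>\<^sup>+ \<omega>. ennreal (t n (\<xi> (Suc n) \<omega>)) \<partial>M) \<le> ennreal (a n powr r * K)" .
  qed (use a K in \<open>auto simp: t_def summable_mult2\<close>)
  then show ?thesis
  proof eventually_elim
    case (elim \<omega>)
    define y where "y n = a n * norm (\<phi> (\<xi> (Suc n) \<omega>))" for n
    have y0: "0 \<le> y n" for n using a by (simp add: y_def)
    have sm: "summable (\<lambda>n. (min (y n) 1)\<^sup>2)" using elim by (simp add: t_def y_def)
    have "eventually (\<lambda>n. (min (y n) 1)\<^sup>2 < 1) sequentially"
      using summable_LIMSEQ_zero[OF sm] by (rule order_tendstoD(2)) simp
    then have ev: "eventually (\<lambda>n. y n < 1) sequentially"
    proof eventually_elim
      case (elim n)
      then show ?case by (cases "y n < 1") (auto simp: not_less min_absorb2)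
    qed
    then have "eventually (\<lambda>n. (min (y n) 1)\<^sup>2 = (y n)\<^sup>2) sequentially"
      by eventually_elim (simp add: min_def)
    then have "summable (\<lambda>n. (y n)\<^sup>2)" using sm summable_cong by force
    then show ?case using ev by (simp add: y_def)
  qed
qed

text \<open>For \<open>r < 2\<close> the terms need not be square integrable, so
  \<open>\<eta>\<close> is cut off where \<open>a n * norm \<eta>\<close> exceeds \<open>1\<close>.
  This leaves a centred part, which is a square integrable martingale, a bias, which is absolutely
  summable, and a discarded part, which vanishes eventually.\<close>

lemma weighted_innovations_summable:
  fixes \<eta> :: "'s \<Rightarrow> 'e::euclidean_space"
  assumes \<eta>[measurable]: "\<eta> \<in> borel_measurable \<mu>" and r: "1 < r" "r \<le> 2"
    and fin: "(\<integral>\<^sup>+ s. ennreal (norm (\<eta> s) powr r) \<partial>\<mu>) < \<infinity>"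
    and int: "integrable \<mu> \<eta>" and mean: "(\<integral>s. \<eta> s \<partial>\<mu>) = 0"
    and a: "\<And>n. 0 < a n" "summable (\<lambda>n. a n powr r)"
    and w: "\<And>n. w n \<in> borel_measurable (\<F> n)"
    and C: "0 \<le> C" "\<And>n. (\<integral>\<^sup>+ \<omega>. ennreal ((norm (w n \<omega>))\<^sup>2) \<partial>M) \<le> ennreal C"
  shows "AE \<omega> in M. summable (\<lambda>n. a n * (\<eta> (\<xi> (Suc n) \<omega>) \<bullet> w n \<omega>))"
proof -
  note [measurable] = measurable_F[OF w]
  obtain K where K: "0 \<le> K" "(\<integral>\<^sup>+ s. ennreal (norm (\<eta> s) powr r) \<partial>\<mu>) = ennreal K"
    using fin by (cases "\<integral>\<^sup>+ s. ennreal (norm (\<eta> s) powr r) \<partial>\<mu>") auto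
  define \<tau> where "\<tau> n s = (if a n * norm (\<eta> s) \<le> 1 then \<eta> s else 0)" for n s
  have [measurable]: "\<tau> n \<in> borel_measurable \<mu>" for n unfolding \<tau>_def by measurable
  define c where "c n = (\<integral>s. \<tau> n s \<partial>\<mu>)" for n
  have powr1: "y\<^sup>2 \<le> y powr r" if "0 \<le> y" "y \<le> 1" for y :: real
    using that r powr_mono'[of r 2 y] by (cases "y = 0") (auto simp: powr_numeral)
  have powr2: "y \<le> y powr r" if "1 \<le> y" for y :: real
    using that r powr_mono[of 1 r y] by simp
  have bnd: "norm (\<tau> n s) \<le> 1 / a n" for n s using a(1)[of n] by (simp add: \<tau>_def field_simps)
  have \<tau>int: "integrable \<mu> (\<tau> n)" for n
    by (rule innovation.integrable_const_bound[of _ "1 / a n"]) (use bnd in auto)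
  have \<tau>2: "integrable \<mu> (\<lambda>s. (norm (\<tau> n s))\<^sup>2)" for n
    by (rule innovation.integrable_const_bound[of _ "(1 / a n)\<^sup>2"]) (use bnd in \<open>auto intro!: power_mono\<close>)
  have powra: "(a n * norm (\<eta> s)) powr r = a n powr r * norm (\<eta> s) powr r" for n s
    using a(1)[of n] by (simp add: powr_mult)
  have K': "(\<integral>\<^sup>+ s. ennreal ((a n * norm (\<eta> s)) powr r) \<partial>\<mu>) = ennreal (a n powr r * K)" for n
    unfolding powra using K by (simp add: ennreal_mult nn_integral_cmult)
  \<comment> \<open>The variance is at most the second moment, and below the truncation level a
    square is at most an \<open>r\<close>-th power.\<close>
  have second: "(\<integral>s. (a n * norm (\<tau> n s - c n))\<^sup>2 \<partial>\<mu>) \<le> a n powr r * K"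
    and second_int: "integrable \<mu> (\<lambda>s. (a n * norm (\<tau> n s - c n))\<^sup>2)" for n
  proof -
    have eq: "(a n * norm (\<tau> n s - c n))\<^sup>2 = (a n)\<^sup>2 * ((norm (\<tau> n s))\<^sup>2 - 2 * (\<tau> n s \<bullet> c n) + (norm (c n))\<^sup>2)" for s
      unfolding power_mult_distrib power2_norm_eq_inner by (simp add: inner_diff inner_commute)
    show "integrable \<mu> (\<lambda>s. (a n * norm (\<tau> n s - c n))\<^sup>2)" unfolding eq using \<tau>int \<tau>2 by auto
    have "(\<integral>s. (a n * norm (\<tau> n s - c n))\<^sup>2 \<partial>\<mu>) = (a n)\<^sup>2 * ((\<integral>s. (norm (\<tau> n s))\<^sup>2 \<partial>\<mu>) - 2 * (c n \<bullet> c n) + (norm (c n))\<^sup>2)"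
      unfolding eq using \<tau>int[of n] \<tau>2[of n] by (simp add: c_def innovation.prob_space)
    also have "\<dots> \<le> (a n)\<^sup>2 * (\<integral>s. (norm (\<tau> n s))\<^sup>2 \<partial>\<mu>)" by (intro mult_left_mono) (auto simp: power2_norm_eq_inner)
    also have "\<dots> = (\<integral>s. (a n * norm (\<tau> n s))\<^sup>2 \<partial>\<mu>)" by (simp add: power_mult_distrib)
    finally have 1: "(\<integral>s. (a n * norm (\<tau> n s - c n))\<^sup>2 \<partial>\<mu>) \<le> (\<integral>s. (a n * norm (\<tau> n s))\<^sup>2 \<partial>\<mu>)" .
    have "ennreal (\<integral>s. (a n * norm (\<tau> n s))\<^sup>2 \<partial>\<mu>) = (\<integral>\<^sup>+ s. ennreal ((a n * norm (\<tau> n s))\<^sup>2) \<partial>\<mu>)"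
      using \<tau>2[of n] by (intro nn_integral_eq_integral[symmetric]) (auto simp: power_mult_distrib)
    also have "\<dots> \<le> (\<integral>\<^sup>+ s. ennreal ((a n * norm (\<eta> s)) powr r) \<partial>\<mu>)"
      using a(1)[of n] powr1 by (intro nn_integral_mono ennreal_leI) (auto simp: \<tau>_def)
    finally have "ennreal (\<integral>s. (a n * norm (\<tau> n s))\<^sup>2 \<partial>\<mu>) \<le> ennreal (a n powr r * K)" by (simp add: K')
    then have "(\<integral>s. (a n * norm (\<tau> n s))\<^sup>2 \<partial>\<mu>) \<le> a n powr r * K" using K by (subst (asm) ennreal_le_iff) auto
    with 1 show "(\<integral>s. (a n * norm (\<tau> n s - c n))\<^sup>2 \<partial>\<mu>) \<le> a n powr r * K" by linarith
  qed
  \<comment> \<open>As \<open>\<eta>\<close> has mean zero, the truncated mean is minus the mean of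
    the discarded part; there \<open>a n * norm (\<eta> s)\<close> exceeds \<open>1\<close> and is
    at most its \<open>r\<close>-th power.\<close>
  have bias: "a n * norm (c n) \<le> a n powr r * K" for n
  proof -
    have "c n = (\<integral>s. \<tau> n s - \<eta> s \<partial>\<mu>)" using \<tau>int int mean by (simp add: c_def)
    then have "ennreal (a n * norm (c n)) \<le> ennreal (\<integral>s. a n * norm (\<tau> n s - \<eta> s) \<partial>\<mu>)"
      using a(1)[of n] by (auto intro!: ennreal_leI mult_left_mono integral_norm_bound less_imp_le)
    also have "\<dots> = (\<integral>\<^sup>+ s. ennreal (a n * norm (\<tau> n s - \<eta> s)) \<partial>\<mu>)"
      using \<tau>int[of n] int a(1)[of n] by (intro nn_integral_eq_integral[symmetric]) auto
    also have "\<dots> \<le> (\<integral>\<^sup>+ s. ennreal ((a n * norm (\<eta> s)) powr r) \<partial>\<mu>)"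
      using powr2 by (intro nn_integral_mono ennreal_leI) (auto simp: \<tau>_def)
    finally have "ennreal (a n * norm (c n)) \<le> ennreal (a n powr r * K)" by (simp add: K')
    then show ?thesis using K by (subst (asm) ennreal_le_iff) auto
  qed
  define Y where "Y n \<omega> = a n * ((\<tau> n (\<xi> (Suc n) \<omega>) - c n) \<bullet> w n \<omega>)" for n \<omega>
  have hY: "(\<lambda>z. a n * ((\<tau> n (snd z) - c n) \<bullet> w n (fst z))) \<in> borel_measurable (\<F> n \<Otimes>\<^sub>M \<mu>)" for n
    using w[of n] by measurable
  have Y2bound: "(\<integral>\<^sup>+ \<omega>. ennreal ((Y n \<omega>)\<^sup>2) \<partial>M) \<le> ennreal (a n powr r * K * C)" for n
  proof -
    have "(\<integral>\<^sup>+ \<omega>. ennreal ((Y n \<omega>)\<^sup>2) \<partial>M) = (\<integral>\<^sup>+ \<omega>. (\<integral>\<^sup>+ s. ennreal ((a n * ((\<tau> n s - c n) \<bullet> w n \<omega>))\<^sup>2) \<partial>\<mu>) \<partial>M)"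
    proof -
      have "(\<lambda>z. ennreal ((a n * ((\<tau> n (snd z) - c n) \<bullet> w n (fst z)))\<^sup>2)) \<in> borel_measurable (\<F> n \<Otimes>\<^sub>M \<mu>)"
        using hY[of n] by measurable
      from nn_integral_innovation[OF this] show ?thesis by (simp only: Y_def fst_conv snd_conv)
    qed
    also have "\<dots> \<le> (\<integral>\<^sup>+ \<omega>. ennreal (a n powr r * K) * ennreal ((norm (w n \<omega>))\<^sup>2) \<partial>M)"
    proof (rule nn_integral_mono)
      fix \<omega>
      have le: "(a n * ((\<tau> n s - c n) \<bullet> w n \<omega>))\<^sup>2 \<le> (a n * norm (\<tau> n s - c n))\<^sup>2 * (norm (w n \<omega>))\<^sup>2" for s
      proof -
        have "\<bar>a n * ((\<tau> n s - c n) \<bullet> w n \<omega>)\<bar> \<le> \<bar>a n * norm (\<tau> n s - c n) * norm (w n \<omega>)\<bar>"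
          using a(1)[of n] Cauchy_Schwarz_ineq2[of "\<tau> n s - c n" "w n \<omega>"] by (simp add: abs_mult mult.assoc)
        then show ?thesis unfolding abs_le_square_iff by (simp add: power_mult_distrib)
      qed
      have "(\<integral>\<^sup>+ s. ennreal ((a n * ((\<tau> n s - c n) \<bullet> w n \<omega>))\<^sup>2) \<partial>\<mu>) \<le>
          (\<integral>\<^sup>+ s. ennreal ((a n * norm (\<tau> n s - c n))\<^sup>2) * ennreal ((norm (w n \<omega>))\<^sup>2) \<partial>\<mu>)"
        using le by (intro nn_integral_mono) (simp add: ennreal_leI flip: ennreal_mult)
      also have "\<dots> = (\<integral>\<^sup>+ s. ennreal ((a n * norm (\<tau> n s - c n))\<^sup>2) \<partial>\<mu>) * ennreal ((norm (w n \<omega>))\<^sup>2)"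
        by (rule nn_integral_multc) measurable
      also have "(\<integral>\<^sup>+ s. ennreal ((a n * norm (\<tau> n s - c n))\<^sup>2) \<partial>\<mu>) = ennreal (\<integral>s. (a n * norm (\<tau> n s - c n))\<^sup>2 \<partial>\<mu>)"
        by (intro nn_integral_eq_integral second_int) auto
      also have "\<dots> \<le> ennreal (a n powr r * K)" by (intro ennreal_leI second)
      finally show "(\<integral>\<^sup>+ s. ennreal ((a n * ((\<tau> n s - c n) \<bullet> w n \<omega>))\<^sup>2) \<partial>\<mu>) \<le> ennreal (a n powr r * K) * ennreal ((norm (w n \<omega>))\<^sup>2)"
        by (simp add: mult_right_mono)
    qed
    also have "\<dots> = ennreal (a n powr r * K) * (\<integral>\<^sup>+ \<omega>. ennreal ((norm (w n \<omega>))\<^sup>2) \<partial>M)" by (rule nn_integral_cmult) measurable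
    also have "\<dots> \<le> ennreal (a n powr r * K) * ennreal C" by (intro mult_left_mono C) auto
    finally show ?thesis using K C by (simp add: ennreal_mult)
  qed
  have Ym: "Y n \<in> borel_measurable (\<F> (Suc n))" for n
  proof -
    have [measurable]: "w n \<in> borel_measurable (\<F> (Suc n))" using measurable_F_mono[OF w, of n "Suc n"] by simp
    have [measurable]: "(\<lambda>\<omega>. \<tau> n (\<xi> (Suc n) \<omega>)) \<in> borel_measurable (\<F> (Suc n))"
      by (rule measurable_compose[OF xi_measurable]) measurable
    show ?thesis unfolding Y_def by measurable
  qed
  note [measurable] = measurable_F[OF Ym]
  have Y2: "integrable M (\<lambda>\<omega>. (Y n \<omega>)\<^sup>2)" for n
  proof (rule integrableI_bounded)
    show "(\<integral>\<^sup>+ \<omega>. ennreal (norm ((Y n \<omega>)\<^sup>2)) \<partial>M) < \<infinity>"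
      using le_less_trans[OF Y2bound[of n] ennreal_less_top] by simp
  qed measurable
  have sumb: "summable (\<lambda>n. a n powr r * K * C)" using a(2) by (intro summable_mult2)
  have martingale: "AE \<omega> in M. summable (\<lambda>n. Y n \<omega>)"
  proof (rule square_integrable_martingale_convergence[OF Ym Y2])
    show "summable (\<lambda>k. \<integral>\<omega>. (Y k \<omega>)\<^sup>2 \<partial>M)"
    proof (rule summable_comparison_test'[OF sumb])
      fix n
      have "ennreal (\<integral>\<omega>. (Y n \<omega>)\<^sup>2 \<partial>M) \<le> ennreal (a n powr r * K * C)"
        using Y2bound[of n] Y2[of n] by (subst nn_integral_eq_integral[symmetric]) auto
      then show "norm (\<integral>\<omega>. (Y n \<omega>)\<^sup>2 \<partial>M) \<le> a n powr r * K * C"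
        using K C by (subst (asm) ennreal_le_iff) auto
    qed
    fix n and W :: "'w \<Rightarrow> real" assume W: "W \<in> borel_measurable (\<F> n)" and W2: "integrable M (\<lambda>\<omega>. (W \<omega>)\<^sup>2)"
    note [measurable] = measurable_F[OF W]
    define h where "h z = W (fst z) * (a n * ((\<tau> n (snd z) - c n) \<bullet> w n (fst z)))" for z
    have h: "h \<in> borel_measurable (\<F> n \<Otimes>\<^sub>M \<mu>)" unfolding h_def using hY[of n] W by measurable
    have h': "(\<lambda>z. ennreal \<bar>h z\<bar>) \<in> borel_measurable (\<F> n \<Otimes>\<^sub>M \<mu>)" using h by measurable
    have heq: "h (\<omega>, \<xi> (Suc n) \<omega>) = W \<omega> * Y n \<omega>" for \<omega> by (simp add: h_def Y_def)
    have prod: "integrable M (\<lambda>\<omega>. W \<omega> * Y n \<omega>)"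
    proof (rule Bochner_Integration.integrable_bound)
      show "integrable M (\<lambda>\<omega>. (W \<omega>)\<^sup>2 + (Y n \<omega>)\<^sup>2)" using W2 Y2 by auto
      show "AE \<omega> in M. norm (W \<omega> * Y n \<omega>) \<le> norm ((W \<omega>)\<^sup>2 + (Y n \<omega>)\<^sup>2)" using abs_mult_le_sum_squares by auto
      show "(\<lambda>\<omega>. W \<omega> * Y n \<omega>) \<in> borel_measurable M" by measurable
    qed
    have "(\<integral>\<^sup>+ \<omega>. (\<integral>\<^sup>+ s. ennreal \<bar>h (\<omega>, s)\<bar> \<partial>\<mu>) \<partial>M) = (\<integral>\<^sup>+ \<omega>. ennreal \<bar>W \<omega> * Y n \<omega>\<bar> \<partial>M)"
      using nn_integral_innovation[OF h'] by (simp add: heq)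
    also have "\<dots> < \<infinity>" using prod by (simp add: integrable_iff_bounded)
    finally have "(\<integral>\<omega>. W \<omega> * Y n \<omega> \<partial>M) = (\<integral>\<omega>. (\<integral>s. h (\<omega>, s) \<partial>\<mu>) \<partial>M)"
      using integral_innovation(2)[OF h] by (simp add: heq)
    also have "\<dots> = 0"
    proof -
      have "(\<integral>s. h (\<omega>, s) \<partial>\<mu>) = 0" for \<omega>
      proof -
        have "(\<integral>s. (\<tau> n s - c n) \<bullet> w n \<omega> \<partial>\<mu>) = (\<integral>s. \<tau> n s - c n \<partial>\<mu>) \<bullet> w n \<omega>"
          using \<tau>int[of n] by (intro integral_inner_left) auto
        also have "(\<integral>s. \<tau> n s - c n \<partial>\<mu>) = 0" using \<tau>int[of n] by (simp add: c_def innovation.prob_space)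
        finally show ?thesis by (simp add: h_def)
      qed
      then show ?thesis by simp
    qed
    finally show "(\<integral>\<omega>. W \<omega> * Y n \<omega> \<partial>M) = 0" .
  qed
  have bias_sum: "AE \<omega> in M. summable (\<lambda>n. \<bar>a n * (c n \<bullet> w n \<omega>)\<bar>)"
  proof (rule AE_summable[where b="\<lambda>n. a n powr r * K * (1 + C)"])
    fix n
    have "(\<integral>\<^sup>+ \<omega>. ennreal \<bar>a n * (c n \<bullet> w n \<omega>)\<bar> \<partial>M) \<le> (\<integral>\<^sup>+ \<omega>. ennreal (a n powr r * K) * (1 + ennreal ((norm (w n \<omega>))\<^sup>2)) \<partial>M)"
    proof (rule nn_integral_mono)
      fix \<omega>
      have "norm (w n \<omega>) \<le> 1 + (norm (w n \<omega>))\<^sup>2"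
        using zero_le_power2[of "norm (w n \<omega>) - 1"] by (simp add: power2_diff) (smt (verit) norm_ge_zero)
      moreover have "\<bar>a n * (c n \<bullet> w n \<omega>)\<bar> \<le> (a n * norm (c n)) * norm (w n \<omega>)"
        using a(1)[of n] Cauchy_Schwarz_ineq2[of "c n" "w n \<omega>"] by (simp add: abs_mult mult.assoc)
      ultimately have "\<bar>a n * (c n \<bullet> w n \<omega>)\<bar> \<le> (a n powr r * K) * (1 + (norm (w n \<omega>))\<^sup>2)"
        using bias[of n] a(1)[of n] K by (smt (verit) mult_mono norm_ge_zero mult_nonneg_nonneg powr_ge_zero)
      then have "ennreal \<bar>a n * (c n \<bullet> w n \<omega>)\<bar> \<le> ennreal ((a n powr r * K) * (1 + (norm (w n \<omega>))\<^sup>2))" by (rule ennreal_leI)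
      then show "ennreal \<bar>a n * (c n \<bullet> w n \<omega>)\<bar> \<le> ennreal (a n powr r * K) * (1 + ennreal ((norm (w n \<omega>))\<^sup>2))"
        using K by (simp add: ennreal_mult)
    qed
    also have "\<dots> = ennreal (a n powr r * K) * (1 + (\<integral>\<^sup>+ \<omega>. ennreal ((norm (w n \<omega>))\<^sup>2) \<partial>M))"
      by (simp add: nn_integral_cmult nn_integral_add emeasure_space_1)
    also have "\<dots> \<le> ennreal (a n powr r * K) * (1 + ennreal C)" by (intro mult_left_mono add_mono C) auto
    finally show "(\<integral>\<^sup>+ \<omega>. ennreal \<bar>a n * (c n \<bullet> w n \<omega>)\<bar> \<partial>M) \<le> ennreal (a n powr r * K * (1 + C))"
      using K C by (simp add: ennreal_mult)
  qed (use a(2) K C in \<open>auto intro: summable_mult2\<close>)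
  have trunc: "AE \<omega> in M. eventually (\<lambda>n. a n * norm (\<eta> (\<xi> (Suc n) \<omega>)) < 1) sequentially"
    using AE_summable_truncated_squares[OF \<eta> _ r(2) fin _ a(2)] r a(1) by (auto intro: less_imp_le)
  show ?thesis
    using martingale bias_sum trunc
  proof eventually_elim
    case (elim \<omega>)
    have "summable (\<lambda>n. Y n \<omega> + a n * (c n \<bullet> w n \<omega>))"
      using elim summable_rabs_cancel by (intro summable_add) auto
    moreover have "eventually (\<lambda>n. Y n \<omega> + a n * (c n \<bullet> w n \<omega>) = a n * (\<eta> (\<xi> (Suc n) \<omega>) \<bullet> w n \<omega>)) sequentially"
      using elim(3) by eventually_elim (simp add: Y_def \<tau>_def inner_diff_left algebra_simps)
    ultimately show ?case using summable_cong by force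
  qed
qed

end

text \<open>The past \<open>\<F> n\<close> is generated by the initial state and the first \<open>n\<close> draws.\<close>

lemma (in prob_space) innovations_of_iid:
  fixes \<xi> :: "nat \<Rightarrow> 'a \<Rightarrow> 's" and z0 :: "'a \<Rightarrow> 'z::topological_space"
  assumes mu: "prob_space \<mu>"
    and xi: "indep_vars (\<lambda>_. \<mu>) \<xi> {1..}" "\<And>n. 1 \<le> n \<Longrightarrow> distr M \<mu> (\<xi> n) = \<mu>"
    and z0: "z0 \<in> borel_measurable M"
    and indep: "indep_set (sets (vimage_algebra (space M) z0 borel))
      (sets (vimage_algebra (space M) (\<lambda>\<omega>. \<lambda>n\<in>{1..}. \<xi> n \<omega>) (PiM {1..} (\<lambda>_. \<mu>))))"
  obtains \<F> where "innovations M \<F> \<mu> \<xi>" "z0 \<in> borel_measurable (\<F> 0)"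
proof -
  \<comment> \<open>Generators of the filtration: index \<open>0\<close> carries the initial state,
    index \<open>i > 0\<close> the draw \<open>\<xi> i\<close>.\<close>
  define G where "G i = (if i = 0 then sets (vimage_algebra (space M) z0 borel) else {\<xi> i -` A \<inter> space M | A. A \<in> sets \<mu>})" for i :: nat
  have xim: "\<xi> n \<in> measurable M \<mu>" if "1 \<le> n" for n using xi(1) that by (auto simp: indep_vars_def)
  have z0G: "G 0 = {z0 -` A \<inter> space M | A. A \<in> sets borel}" by (simp add: G_def sets_vimage_algebra2)
  have Gev: "G i \<subseteq> events" for i
    using measurable_sets[OF z0] measurable_sets[OF xim] by (cases "i = 0") (auto simp: z0G, auto simp: G_def)
  have Gst: "Int_stable (G i)" for i
  proof (cases "i = 0")
    case False
    then show ?thesis by (auto simp: G_def Int_stable_def) (metis Int_assoc Int_left_commute inf.idem sets.Int vimage_Int)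
  qed (auto simp: G_def Int_stable_def)
  have "indep_sets G UNIV"
  proof (rule indep_setsI[OF Gev])
    fix A :: "nat \<Rightarrow> 'a set" and J assume J: "J \<noteq> {}" "finite J" "\<forall>j\<in>J. A j \<in> G j"
    \<comment> \<open>Index \<open>0\<close> is split off: the draws are independent among
      themselves, while the initial state is independent of the whole sequence and hence of all
      events indexed by \<open>J'\<close>.\<close>
    define J' where "J' = J - {0}"
    have J': "finite J'" "J' \<subseteq> {1..}" using J by (auto simp: J'_def)
    have ind: "indep_sets (\<lambda>i. {\<xi> i -` A \<inter> space M | A. A \<in> sets \<mu>}) {1..}" using xi(1) by (simp add: indep_vars_def2)
    have AJ': "A j \<in> {\<xi> j -` A \<inter> space M | A. A \<in> sets \<mu>}" if "j \<in> J'" for j using J(3) that by (auto simp: J'_def G_def)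
    have prod': "prob (\<Inter>j\<in>J'. A j) = (\<Prod>j\<in>J'. prob (A j))" if "J' \<noteq> {}"
      by (rule indep_setsD[OF ind J'(2) that J'(1)]) (use AJ' in blast)
    show "prob (\<Inter>j\<in>J. A j) = (\<Prod>j\<in>J. prob (A j))"
    proof (cases "0 \<in> J")
      case False
      then have "J' = J" by (auto simp: J'_def)
      then show ?thesis using prod' J by simp
    next
      case True
      then have JJ: "J = insert 0 J'" "0 \<notin> J'" by (auto simp: J'_def)
      show ?thesis
      proof (cases "J' = {}")
        case True
        then show ?thesis using JJ by simp
      next
        case False
        let ?V = "vimage_algebra (space M) (\<lambda>\<omega>. \<lambda>n\<in>{1..}. \<xi> n \<omega>) (PiM {1..} (\<lambda>_. \<mu>))"
        have V: "A j \<in> sets ?V" if j: "j \<in> J'" for j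
        proof -
          obtain B where B: "B \<in> sets \<mu>" "A j = \<xi> j -` B \<inter> space M" using AJ'[OF j] by blast
          have j1: "j \<in> {1..}" using j J'(2) by auto
          have "(\<lambda>\<omega>. \<lambda>n\<in>{1..}. \<xi> n \<omega>) \<in> measurable ?V (PiM {1..} (\<lambda>_. \<mu>))"
            using measurable_space[OF xim] by (intro measurable_vimage_algebra1) (auto simp: space_PiM)
          then have "(\<lambda>\<omega>. (\<lambda>n\<in>{1..}. \<xi> n \<omega>) j) \<in> measurable ?V \<mu>"
            by (rule measurable_compose) (rule measurable_component_singleton[OF j1])
          then have "\<xi> j \<in> measurable ?V \<mu>" using j1 by simp
          from measurable_sets[OF this B(1)] show ?thesis by (simp add: B)
        qed
        have "(\<Inter>j\<in>J'. A j) \<in> sets ?V" using V False J' by (intro sets.finite_INT) auto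
        moreover have "A 0 \<in> sets (vimage_algebra (space M) z0 borel)" using J(3) True by (auto simp: G_def)
        ultimately have "prob (A 0 \<inter> (\<Inter>j\<in>J'. A j)) = prob (A 0) * prob (\<Inter>j\<in>J'. A j)"
          using indep by (auto simp: indep_sets2_eq)
        then show ?thesis using prod'[OF False] JJ J' by simp
      qed
    qed
  qed
  define \<F> where "\<F> n = sigma (space M) (\<Union>i\<in>{..n}. G i)" for n
  have Gpow: "(\<Union>i\<in>I. G i) \<subseteq> Pow (space M)" for I using Gev sets.sets_into_space by blast
  have setsF: "sets (\<F> n) = sigma_sets (space M) (\<Union>i\<in>{..n}. G i)" for n unfolding \<F>_def using Gpow by (rule sets_measure_of)
  have spF: "space (\<F> n) = space M" for n unfolding \<F>_def by (simp add: space_measure_of_conv)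
  have GF: "G i \<subseteq> sets (\<F> n)" if "i \<le> n" for i n unfolding setsF using that by (auto intro: sigma_sets.Basic)
  have Fsub: "sets (\<F> n) \<subseteq> sets M" for n
    unfolding setsF using Gev by (intro sets.sigma_sets_subset) auto
  have FSuc: "sets (\<F> n) \<subseteq> sets (\<F> (Suc n))" for n
    unfolding setsF by (intro sigma_sets_mono' UN_mono) auto
  have xiF: "\<xi> (Suc n) \<in> measurable (\<F> (Suc n)) \<mu>" for n
  proof (rule measurableI)
    show "\<xi> (Suc n) x \<in> space \<mu>" if "x \<in> space (\<F> (Suc n))" for x using that measurable_space[OF xim] by (simp add: spF)
    fix A assume "A \<in> sets \<mu>"
    then have "\<xi> (Suc n) -` A \<inter> space M \<in> G (Suc n)" by (auto simp: G_def)
    then show "\<xi> (Suc n) -` A \<inter> space (\<F> (Suc n)) \<in> sets (\<F> (Suc n))" using GF[of "Suc n" "Suc n"] by (auto simp: spF)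
  qed
  have z0F: "z0 \<in> borel_measurable (\<F> 0)"
  proof (rule measurableI)
    fix A :: "'z set" assume "A \<in> sets borel"
    then have "z0 -` A \<inter> space M \<in> G 0" by (auto simp: z0G)
    then show "z0 -` A \<inter> space (\<F> 0) \<in> sets (\<F> 0)" using GF[of 0 0] by (auto simp: spF)
  qed auto
  have joint: "distr M (\<F> n \<Otimes>\<^sub>M \<mu>) (\<lambda>\<omega>. (\<omega>, \<xi> (Suc n) \<omega>)) = distr M (\<F> n) (\<lambda>\<omega>. \<omega>) \<Otimes>\<^sub>M \<mu>" for n
  proof -
    \<comment> \<open>Grouping the indices into \<open>{..n}\<close> and \<open>{Suc n}\<close>
      preserves independence of the generated sigma algebras, as each generator is stable under
      intersection.\<close>
    define I where "I b = (if b then {..n} else {Suc n})" for b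
    have "indep_sets (\<lambda>j. sigma_sets (space M) (\<Union>i\<in>I j. G i)) (UNIV :: bool set)"
    proof (rule indep_sets_collect_sigma)
      show "indep_sets G (\<Union>j\<in>UNIV. I j)" using \<open>indep_sets G UNIV\<close> by (rule indep_sets_mono_index[rotated]) auto
      show "disjoint_family_on I UNIV" by (auto simp: disjoint_family_on_def I_def)
    qed (rule Gst)
    then have 1: "indep_set (sets (\<F> n)) (sigma_sets (space M) (G (Suc n)))"
      unfolding indep_set_def setsF
      by (rule indep_sets_mono_sets) (auto simp: I_def split: bool.splits)
    have idm: "random_variable (\<F> n) (\<lambda>\<omega>. \<omega>)"
      using measurable_mono[of "\<F> n" "\<F> n" "\<F> n" M] Fsub[of n] by (auto simp: spF)
    have xm: "random_variable \<mu> (\<xi> (Suc n))" by (rule xim) simp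
    have pm: "random_variable (\<F> n \<Otimes>\<^sub>M \<mu>) (\<lambda>\<omega>. (\<omega>, \<xi> (Suc n) \<omega>))" by (intro measurable_Pair idm xm)
    show ?thesis
    proof (rule pair_measure_eqI[symmetric])
      show "sigma_finite_measure (distr M (\<F> n) (\<lambda>\<omega>. \<omega>))" "sigma_finite_measure \<mu>"
        using prob_space_distr[OF idm] mu by (auto intro: prob_space_imp_sigma_finite)
      show "sets (distr M (\<F> n) (\<lambda>\<omega>. \<omega>) \<Otimes>\<^sub>M \<mu>) = sets (distr M (\<F> n \<Otimes>\<^sub>M \<mu>) (\<lambda>\<omega>. (\<omega>, \<xi> (Suc n) \<omega>)))"
        by (simp cong: sets_pair_measure_cong)
      fix A B assume "A \<in> sets (distr M (\<F> n) (\<lambda>\<omega>. \<omega>))" and B: "B \<in> sets \<mu>"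
      then have A: "A \<in> sets (\<F> n)" by simp
      then have AM: "A \<in> sets M" "A \<subseteq> space M" using Fsub sets.sets_into_space by blast+
      have "prob (A \<inter> (\<xi> (Suc n) -` B \<inter> space M)) = prob A * prob (\<xi> (Suc n) -` B \<inter> space M)"
      proof -
        have "\<xi> (Suc n) -` B \<inter> space M \<in> sigma_sets (space M) (G (Suc n))"
          using B by (intro sigma_sets.Basic) (auto simp: G_def)
        then show ?thesis using 1 A unfolding indep_sets2_eq by blast
      qed
      moreover have "emeasure \<mu> B = emeasure M (\<xi> (Suc n) -` B \<inter> space M)"
        using xi(2)[of "Suc n"] emeasure_distr[OF xm B] by simp
      moreover have "emeasure (distr M (\<F> n) (\<lambda>\<omega>. \<omega>)) A = emeasure M A"
        using emeasure_distr[OF idm A] AM(2) by (simp add: Int_absorb2)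
      moreover have "emeasure (distr M (\<F> n \<Otimes>\<^sub>M \<mu>) (\<lambda>\<omega>. (\<omega>, \<xi> (Suc n) \<omega>))) (A \<times> B) = emeasure M (A \<inter> (\<xi> (Suc n) -` B \<inter> space M))"
        using A B by (subst emeasure_distr[OF pm]) (auto intro!: arg_cong[where f="emeasure M"])
      ultimately show "emeasure (distr M (\<F> n) (\<lambda>\<omega>. \<omega>)) A * emeasure \<mu> B
          = emeasure (distr M (\<F> n \<Otimes>\<^sub>M \<mu>) (\<lambda>\<omega>. (\<omega>, \<xi> (Suc n) \<omega>))) (A \<times> B)"
        by (simp add: emeasure_eq_measure ennreal_mult)
    qed
  qed
  have "innovations M \<F> \<mu> \<xi>"
    unfolding innovations_def innovations_axioms_def filtered_prob_space_def filtered_prob_space_axioms_def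
    using mu prob_space_axioms spF Fsub FSuc xiF joint by blast
  then show thesis using z0F that by blast
qed

section \<open>Stochastic forward-backward iterations\<close>

lemma power_le_sum_of_extremes:
  fixes x :: real
  assumes "0 \<le> x" "p \<le> j" "j \<le> q"
  shows "x ^ j \<le> x ^ p + x ^ q"
proof (cases "x \<le> 1")
  case True
  then have "x ^ j \<le> x ^ p" using assms by (intro power_decreasing) auto
  then show ?thesis using assms by (simp add: add_increasing2)
next
  case False
  then have "x ^ j \<le> x ^ q" using assms by (intro power_increasing) auto
  then show ?thesis using assms by (simp add: add_increasing)
qed

text \<open>The linear term of the binomial expansion is kept because its mean will vanish. Higher
  powers are bounded by the extreme ones \<open>t^2\<close> and \<open>t^m\<close>, and these by
  \<open>r^2\<close> and \<open>r^(2 m)\<close>. The factor \<open>2 ^ m\<close> sums the binomial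
  coefficients; \<open>4\<close> and \<open>2 * 2 ^ m\<close> come from the two extreme
  powers.\<close>

lemma power_perturbation:
  fixes t r :: real
  assumes m: "2 \<le> m" and r: "0 \<le> r" "\<bar>t\<bar> \<le> r + r\<^sup>2"
  shows "(1 + t) ^ m \<le> 1 + real m * t + 2 ^ m * (4 + 2 * 2 ^ m) * (r\<^sup>2 + r ^ (2 * m))"
proof -
  define e where "e = r\<^sup>2 + r ^ (2 * m)"
  have rj: "r ^ j \<le> e" if "2 \<le> j" "j \<le> 2 * m" for j
    unfolding e_def using power_le_sum_of_extremes[OF r(1) that] .
  have split: "{..m} = insert 0 (insert 1 {2..m})" using m by auto
  have "(1 + t) ^ m = (\<Sum>j\<le>m. real (m choose j) * t ^ j)"
    using binomial_ring[of t 1 m] by (simp add: add.commute)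
  also have "\<dots> = 1 + real m * t + (\<Sum>j=2..m. real (m choose j) * t ^ j)"
    unfolding split using m by (subst sum.insert; simp)+
  also have "(\<Sum>j=2..m. real (m choose j) * t ^ j) \<le> (\<Sum>j=2..m. real (m choose j) * (\<bar>t\<bar>\<^sup>2 + \<bar>t\<bar> ^ m))"
  proof (intro sum_mono mult_left_mono)
    fix j assume "j \<in> {2..m}"
    then have "\<bar>t\<bar> ^ j \<le> \<bar>t\<bar>\<^sup>2 + \<bar>t\<bar> ^ m" by (intro power_le_sum_of_extremes) auto
    then show "t ^ j \<le> \<bar>t\<bar>\<^sup>2 + \<bar>t\<bar> ^ m" using abs_ge_self[of "t ^ j"] unfolding power_abs by linarith
  qed simp
  also have "\<dots> = (\<Sum>j=2..m. real (m choose j)) * (\<bar>t\<bar>\<^sup>2 + \<bar>t\<bar> ^ m)" by (simp add: sum_distrib_right)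
  also have "\<dots> \<le> 2 ^ m * (\<bar>t\<bar>\<^sup>2 + \<bar>t\<bar> ^ m)"
  proof (rule mult_right_mono)
    have "(\<Sum>j=2..m. real (m choose j)) \<le> (\<Sum>j\<le>m. real (m choose j))" by (intro sum_mono2) auto
    also have "\<dots> = 2 ^ m" using choose_row_sum[of m] by (simp flip: of_nat_sum)
    finally show "(\<Sum>j=2..m. real (m choose j)) \<le> 2 ^ m" .
  qed simp
  also have "\<bar>t\<bar>\<^sup>2 \<le> 4 * e"
  proof -
    have "\<bar>t\<bar>\<^sup>2 \<le> (r + r\<^sup>2)\<^sup>2" using r by (intro power_mono) auto
    also have "\<dots> \<le> 2 * r\<^sup>2 + 2 * r ^ 4"
      using sum_squares_bound[of r "r\<^sup>2"] by (simp add: power2_sum power_mult[symmetric])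
    also have "\<dots> \<le> 4 * e" using rj[of 2] rj[of 4] m by simp
    finally show ?thesis .
  qed
  also have "\<bar>t\<bar> ^ m \<le> 2 * 2 ^ m * e"
  proof -
    have "\<bar>t\<bar> ^ m \<le> (2 * max r (r\<^sup>2)) ^ m" using r by (intro power_mono) auto
    also have "\<dots> = 2 ^ m * (max r (r\<^sup>2)) ^ m" by (simp add: power_mult_distrib)
    also have "(max r (r\<^sup>2)) ^ m \<le> r ^ m + r ^ (2 * m)" using r by (auto simp: max_def power_mult[symmetric])
    also have "\<dots> \<le> 2 * e" using rj[of m] rj[of "2 * m"] m by simp
    finally show ?thesis by simp
  qed
  finally show ?thesis by (simp add: e_def algebra_simps)
qed

text \<open>Subtracting the partial sums of \<open>x\<close> makes the sequence decreasing. Only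
  convergence of the series is asked, not absolute convergence: the martingale terms provide no
  more.\<close>

lemma almost_decreasing_convergent:
  fixes V x :: "nat \<Rightarrow> real"
  assumes V: "\<And>n. 0 \<le> V n" "\<And>n. V (Suc n) \<le> V n + x n" and x: "summable x"
  shows "convergent V"
proof -
  define y where "y n = V n - sum x {..<n}" for n
  have "y (Suc n) \<le> y n" for n using V(2)[of n] by (simp add: y_def)
  then have "decseq y" by (rule decseq_SucI)
  moreover obtain B where B: "\<And>n. sum x {..<n} \<le> B"
    using convergent_imp_bounded[OF summable_LIMSEQ[OF x]] unfolding bounded_iff by (metis abs_le_D1 rangeI real_norm_def)
  have "- B \<le> y n" for n using V(1)[of n] B[of n] by (simp add: y_def)
  ultimately have "convergent y" using decseq_convergent[of y "- B"] by (metis convergent_def)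
  then have "convergent (\<lambda>n. y n + sum x {..<n})" using x unfolding summable_iff_convergent by (rule convergent_add)
  then show ?thesis by (simp add: y_def)
qed

lemma less_one_plus_square: "x < 1 + x\<^sup>2" for x :: real
proof -
  have "2 * x \<le> x\<^sup>2 + 1" using sum_squares_bound[of x 1] by simp
  then show ?thesis using zero_le_power2[of x] by linarith
qed

text \<open>The product-space iteration in abstract form: \<open>b\<close> is the forward field,
  \<open>T n\<close> the complete step of size \<open>c n\<close> driven by draw
  \<open>n + 1\<close>, \<open>W\<close> a random growth constant of \<open>b\<close>. The relation
  between \<open>b\<close> and \<open>T\<close> enters through \<open>comparison\<close>.\<close>

locale forward_backward = innovations M \<F> \<mu> \<xi>
  for M :: "'w measure" and \<F> and \<mu> :: "'s measure" and \<xi> +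
  fixes c :: "nat \<Rightarrow> real" and b :: "'s \<Rightarrow> 'e::euclidean_space \<Rightarrow> 'e" and T :: "nat \<Rightarrow> 's \<Rightarrow> 'e \<Rightarrow> 'e"
    and z :: "nat \<Rightarrow> 'w \<Rightarrow> 'e" and W :: "'s \<Rightarrow> real"
  assumes c_pos: "\<And>n. 0 < c n" and c_square: "summable (\<lambda>n. (c n)\<^sup>2)"
    and c_sum: "filterlim (\<lambda>n. \<Sum>k<n. c k) at_top sequentially"
    and b_measurable: "(\<lambda>(s, y). b s y) \<in> borel_measurable (\<mu> \<Otimes>\<^sub>M borel)"
    and T_measurable: "\<And>n. (\<lambda>(s, y). T n s y) \<in> borel_measurable (\<mu> \<Otimes>\<^sub>M borel)"
    and z_0: "z 0 \<in> borel_measurable (\<F> 0)" and z_Suc: "\<And>n \<omega>. z (Suc n) \<omega> = T n (\<xi> (Suc n) \<omega>) (z n \<omega>)"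
    and W_measurable[measurable]: "W \<in> borel_measurable \<mu>" and W_nonneg: "\<And>s. s \<in> space \<mu> \<Longrightarrow> 0 \<le> W s"
    and b_growth: "\<And>s y. s \<in> space \<mu> \<Longrightarrow> norm (b s y) \<le> W s * (1 + norm y)"
    and W_square: "integrable \<mu> (\<lambda>s. (W s)\<^sup>2)"
begin

text \<open>The one-step inequality at \<open>u\<close> that monotonicity yields when \<open>\<phi>\<close> is a selection of the
  backward operator at \<open>u\<close> and \<open>\<eta> - \<phi>\<close> one of the forward operator.\<close>

definition comparison :: "'e \<Rightarrow> ('s \<Rightarrow> 'e) \<Rightarrow> ('s \<Rightarrow> 'e) \<Rightarrow> bool" where
  "comparison u \<phi> \<eta> \<longleftrightarrow> \<phi> \<in> borel_measurable \<mu> \<and> \<eta> \<in> borel_measurable \<mu> \<and>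
    (\<forall>n y. AE s in \<mu>. (norm (T n s y - u))\<^sup>2 \<le> (norm (y - u))\<^sup>2 - 2 * c n * (\<eta> s \<bullet> (y - u))
      - 2 * c n * ((b s y + \<phi> s) \<bullet> (T n s y - y)) - (norm (T n s y - y))\<^sup>2)"

section \<open>Adaptedness and the one-step inequality\<close>

lemma c_bounded: obtains C where "1 \<le> C" "\<And>n. c n \<le> C"
proof -
  have "bounded (range (\<lambda>n. (c n)\<^sup>2))" by (rule convergent_imp_bounded[OF summable_LIMSEQ_zero[OF c_square]])
  then obtain B where B: "\<And>n. (c n)\<^sup>2 \<le> B" by (fastforce simp: bounded_iff)
  have "c n \<le> 1 + B" for n using B[of n] less_one_plus_square[of "c n"] by linarith
  moreover have "0 \<le> B" using B[of 0] zero_le_power2 order_trans by blast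
  ultimately show thesis using that[of "1 + B"] by simp
qed

lemma z_adapted: "z n \<in> borel_measurable (\<F> n)"
proof (induction n)
  case (Suc n)
  have "(\<lambda>\<omega>. (\<xi> (Suc n) \<omega>, z n \<omega>)) \<in> measurable (\<F> (Suc n)) (\<mu> \<Otimes>\<^sub>M borel)"
    by (intro measurable_Pair xi_measurable measurable_F_mono[OF Suc]) simp
  from measurable_compose[OF this T_measurable] show ?case by (simp add: z_Suc[abs_def])
qed (rule z_0)

lemma z_measurable[measurable]: "z n \<in> borel_measurable M"
  by (rule measurable_F[OF z_adapted])

lemma step_measurable:
  "(\<lambda>w. T n (snd w) (z n (fst w))) \<in> borel_measurable (\<F> n \<Otimes>\<^sub>M \<mu>)"
  "(\<lambda>w. b (snd w) (z n (fst w))) \<in> borel_measurable (\<F> n \<Otimes>\<^sub>M \<mu>)"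
  "(\<lambda>w. z n (fst w)) \<in> borel_measurable (\<F> n \<Otimes>\<^sub>M \<mu>)"
proof -
  show z: "(\<lambda>w. z n (fst w)) \<in> borel_measurable (\<F> n \<Otimes>\<^sub>M \<mu>)" by (rule measurable_compose[OF measurable_fst z_adapted])
  have p: "(\<lambda>w. (snd w, z n (fst w))) \<in> measurable (\<F> n \<Otimes>\<^sub>M \<mu>) (\<mu> \<Otimes>\<^sub>M borel)"
    by (intro measurable_Pair z measurable_snd)
  show "(\<lambda>w. T n (snd w) (z n (fst w))) \<in> borel_measurable (\<F> n \<Otimes>\<^sub>M \<mu>)"
    using measurable_compose[OF p T_measurable] by simp
  show "(\<lambda>w. b (snd w) (z n (fst w))) \<in> borel_measurable (\<F> n \<Otimes>\<^sub>M \<mu>)"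
    using measurable_compose[OF p b_measurable] by simp
qed

lemma b_along: "(\<lambda>\<omega>. b (\<xi> (Suc n) \<omega>) (z n \<omega>)) \<in> borel_measurable M"
  using measurable_compose[OF innovation_measurable step_measurable(2)] by simp

lemma step_inequality_measurable:
  fixes t v y p e :: "'x \<Rightarrow> 'e"
  assumes "t \<in> borel_measurable N" "v \<in> borel_measurable N" "y \<in> borel_measurable N"
    "p \<in> borel_measurable N" "e \<in> borel_measurable N"
  shows "{w \<in> space N. (norm (t w - u))\<^sup>2 \<le> (norm (y w - u))\<^sup>2 - 2 * k * (e w \<bullet> (y w - u))
    - 2 * k * ((v w + p w) \<bullet> (t w - y w)) - (norm (t w - y w))\<^sup>2} \<in> sets N"
  using assms
  by (intro borel_measurable_le borel_measurable_diff borel_measurable_add borel_measurable_times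
      borel_measurable_inner borel_measurable_power borel_measurable_norm borel_measurable_const) auto

text \<open>\<open>comparison\<close> allows a null set of draws for every fixed state
  \<open>y\<close>. Since the draw is independent of the past, the state may be replaced by the
  random \<open>z n\<close>.\<close>

lemma comparison_AE:
  assumes "comparison u \<phi> \<eta>"
  shows "AE \<omega> in M. \<forall>n. (norm (z (Suc n) \<omega> - u))\<^sup>2 \<le> (norm (z n \<omega> - u))\<^sup>2 - 2 * c n * (\<eta> (\<xi> (Suc n) \<omega>) \<bullet> (z n \<omega> - u))
      - 2 * c n * ((b (\<xi> (Suc n) \<omega>) (z n \<omega>) + \<phi> (\<xi> (Suc n) \<omega>)) \<bullet> (z (Suc n) \<omega> - z n \<omega>)) - (norm (z (Suc n) \<omega> - z n \<omega>))\<^sup>2"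
  unfolding AE_all_countable
proof
  fix n
  have sel: "(\<lambda>w. \<phi> (snd w)) \<in> borel_measurable (\<F> n \<Otimes>\<^sub>M \<mu>)" "(\<lambda>w. \<eta> (snd w)) \<in> borel_measurable (\<F> n \<Otimes>\<^sub>M \<mu>)"
    using assms by (auto simp: comparison_def intro: measurable_compose[OF measurable_snd])
  define Q where "Q w \<longleftrightarrow> (norm (T n (snd w) (z n (fst w)) - u))\<^sup>2 \<le> (norm (z n (fst w) - u))\<^sup>2 - 2 * c n * (\<eta> (snd w) \<bullet> (z n (fst w) - u))
      - 2 * c n * ((b (snd w) (z n (fst w)) + \<phi> (snd w)) \<bullet> (T n (snd w) (z n (fst w)) - z n (fst w))) - (norm (T n (snd w) (z n (fst w)) - z n (fst w)))\<^sup>2" for w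
  have "AE \<omega> in M. Q (\<omega>, \<xi> (Suc n) \<omega>)"
  proof (rule AE_innovation)
    show "{w \<in> space (\<F> n \<Otimes>\<^sub>M \<mu>). Q w} \<in> sets (\<F> n \<Otimes>\<^sub>M \<mu>)"
      unfolding Q_def by (rule step_inequality_measurable[OF step_measurable sel])
    show "AE s in \<mu>. Q (\<omega>, s)" for \<omega>
      unfolding Q_def fst_conv snd_conv using assms unfolding comparison_def by blast
  qed
  then show "AE \<omega> in M. (norm (z (Suc n) \<omega> - u))\<^sup>2 \<le> (norm (z n \<omega> - u))\<^sup>2 - 2 * c n * (\<eta> (\<xi> (Suc n) \<omega>) \<bullet> (z n \<omega> - u))
      - 2 * c n * ((b (\<xi> (Suc n) \<omega>) (z n \<omega>) + \<phi> (\<xi> (Suc n) \<omega>)) \<bullet> (z (Suc n) \<omega> - z n \<omega>)) - (norm (z (Suc n) \<omega> - z n \<omega>))\<^sup>2"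
    by (simp add: Q_def z_Suc)
qed

text \<open>Completing the square in \<open>d + 2 k v\<close>. Half of the squared increment is
  retained, to be proved summable later.\<close>

lemma cross_term_bound:
  fixes v d :: "'e"
  shows "- 2 * k * (v \<bullet> d) - (norm d)\<^sup>2 \<le> 2 * k\<^sup>2 * (norm v)\<^sup>2 - (norm d)\<^sup>2 / 2"
proof -
  have "0 \<le> (norm (d + (2 * k) *\<^sub>R v))\<^sup>2" by simp
  also have "\<dots> = (norm d)\<^sup>2 + 4 * k * (v \<bullet> d) + 4 * k\<^sup>2 * (norm v)\<^sup>2"
    unfolding power2_norm_eq_inner by (simp add: inner_add inner_commute power2_eq_square algebra_simps)
  finally show ?thesis by simp
qed

lemma norm_add_square_le: "(norm (v + w))\<^sup>2 \<le> 2 * (norm v)\<^sup>2 + 2 * (norm w)\<^sup>2" for v w :: 'e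
proof -
  have "0 \<le> (norm (v - w))\<^sup>2" by simp
  then show ?thesis unfolding power2_norm_eq_inner by (simp add: inner_add inner_diff inner_commute)
qed

lemma one_plus_square_le: "(1 + x)\<^sup>2 \<le> 2 * (1 + x\<^sup>2)" for x :: real
  using zero_le_power2[of "1 - x"] by (simp add: power2_diff power2_sum)

lemma shifted_second_moment:
  assumes C: "0 \<le> C" "(\<integral>\<^sup>+ \<omega>. ennreal ((norm (z n \<omega>))\<^sup>2) \<partial>M) \<le> ennreal C"
  shows "(\<integral>\<^sup>+ \<omega>. ennreal ((norm (z n \<omega> - u))\<^sup>2) \<partial>M) \<le> ennreal (2 * C + 2 * (norm u)\<^sup>2)"
proof -
  have "(\<integral>\<^sup>+ \<omega>. ennreal ((norm (z n \<omega> - u))\<^sup>2) \<partial>M) \<le> (\<integral>\<^sup>+ \<omega>. ennreal 2 * ennreal ((norm (z n \<omega>))\<^sup>2) + ennreal (2 * (norm u)\<^sup>2) \<partial>M)"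
  proof (rule nn_integral_mono)
    fix \<omega>
    have "ennreal ((norm (z n \<omega> - u))\<^sup>2) \<le> ennreal (2 * (norm (z n \<omega>))\<^sup>2 + 2 * (norm u)\<^sup>2)"
      using norm_add_square_le[of "z n \<omega>" "- u"] by (intro ennreal_leI) simp
    then show "ennreal ((norm (z n \<omega> - u))\<^sup>2) \<le> ennreal 2 * ennreal ((norm (z n \<omega>))\<^sup>2) + ennreal (2 * (norm u)\<^sup>2)"
      by (simp add: ennreal_mult)
  qed
  also have "\<dots> \<le> ennreal 2 * ennreal C + ennreal (2 * (norm u)\<^sup>2)"
    using C(2) by (simp add: nn_integral_add nn_integral_cmult emeasure_space_1 mult_left_mono)
  finally show ?thesis using C(1) by (simp add: ennreal_mult)
qed

text \<open>The summability of the squared increments is what forces the iterates towards the domain.\<close>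

lemma comparison_square:
  assumes cmp: "comparison u \<phi> \<eta>" and \<phi>: "integrable \<mu> (\<lambda>s. (norm (\<phi> s))\<^sup>2)"
    and \<eta>: "integrable \<mu> (\<lambda>s. (norm (\<eta> s))\<^sup>2)" and mean: "(\<integral>s. \<eta> s \<partial>\<mu>) = 0"
    and C: "0 \<le> C" "\<And>n. (\<integral>\<^sup>+ \<omega>. ennreal ((norm (z n \<omega>))\<^sup>2) \<partial>M) \<le> ennreal C"
  obtains d where "\<And>n. 0 \<le> d n" "summable d"
    "\<And>n. (\<integral>\<^sup>+ \<omega>. ennreal ((norm (z (Suc n) \<omega> - z n \<omega>))\<^sup>2) \<partial>M) \<le> ennreal (d n)"
    "AE \<omega> in M. convergent (\<lambda>n. norm (z n \<omega> - u))"
proof -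
  have m[measurable]: "\<phi> \<in> borel_measurable \<mu>" "\<eta> \<in> borel_measurable \<mu>" using cmp by (auto simp: comparison_def)
  define q where "q s y = 2 * (norm (b s y + \<phi> s))\<^sup>2" for s y
  define w where "w = (\<integral>s. (W s)\<^sup>2 \<partial>\<mu>)"
  define p where "p = (\<integral>s. (norm (\<phi> s))\<^sup>2 \<partial>\<mu>)"
  have w0: "0 \<le> w" and p0: "0 \<le> p" by (auto simp: w_def p_def)
  have qle: "q s y \<le> 8 * (W s)\<^sup>2 * (1 + (norm y)\<^sup>2) + 4 * (norm (\<phi> s))\<^sup>2" if s: "s \<in> space \<mu>" for s y
  proof -
    have "(norm (b s y))\<^sup>2 \<le> (W s * (1 + norm y))\<^sup>2" using b_growth[OF s] by (intro power_mono) auto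
    also have "\<dots> \<le> (W s)\<^sup>2 * (2 * (1 + (norm y)\<^sup>2))"
      unfolding power_mult_distrib by (intro mult_left_mono one_plus_square_le) auto
    finally show ?thesis using norm_add_square_le[of "b s y" "\<phi> s"] by (simp add: q_def algebra_simps)
  qed
  have \<eta>i: "integrable \<mu> \<eta>"
  proof (rule Bochner_Integration.integrable_bound)
    show "integrable \<mu> (\<lambda>s. 1 + (norm (\<eta> s))\<^sup>2)" using \<eta> by simp
    show "AE s in \<mu>. norm (\<eta> s) \<le> norm (1 + (norm (\<eta> s))\<^sup>2)"
      by (rule AE_I2) (simp add: less_imp_le[OF less_one_plus_square])
  qed measurable
  \<comment> \<open>Integration over the draw removes the linear term, as \<open>\<eta>\<close> has
    mean zero, and leaves a perturbation of order \<open>(c n)^2\<close>.\<close>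
  have one: "(\<integral>\<^sup>+ s. ennreal ((norm (T n s y - u))\<^sup>2 + (norm (T n s y - y))\<^sup>2 / 2) \<partial>\<mu>)
    \<le> ennreal ((norm (y - u))\<^sup>2 + (c n)\<^sup>2 * (8 * w * (1 + (norm y)\<^sup>2) + 4 * p))" for n y
  proof -
    define R where "R s = (norm (y - u))\<^sup>2 - 2 * c n * (\<eta> s \<bullet> (y - u)) + (c n)\<^sup>2 * (8 * (W s)\<^sup>2 * (1 + (norm y)\<^sup>2) + 4 * (norm (\<phi> s))\<^sup>2)" for s
    have le: "AE s in \<mu>. (norm (T n s y - u))\<^sup>2 + (norm (T n s y - y))\<^sup>2 / 2 \<le> R s"
      using cmp[unfolded comparison_def, THEN conjunct2, THEN conjunct2, rule_format, of n y] AE_space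
    proof eventually_elim
      case (elim s)
      have "(c n)\<^sup>2 * q s y \<le> (c n)\<^sup>2 * (8 * (W s)\<^sup>2 * (1 + (norm y)\<^sup>2) + 4 * (norm (\<phi> s))\<^sup>2)"
        by (intro mult_left_mono qle elim) auto
      then show ?case using elim(1) cross_term_bound[of "c n" "b s y + \<phi> s" "T n s y - y"] unfolding R_def q_def by simp
    qed
    have Ri: "integrable \<mu> R" unfolding R_def using \<eta>i \<phi> W_square by auto
    have "(\<integral>\<^sup>+ s. ennreal ((norm (T n s y - u))\<^sup>2 + (norm (T n s y - y))\<^sup>2 / 2) \<partial>\<mu>) \<le> (\<integral>\<^sup>+ s. ennreal (R s) \<partial>\<mu>)"
      by (rule nn_integral_mono_AE, use le in eventually_elim) (rule ennreal_leI)
    also have "\<dots> = ennreal (\<integral>s. R s \<partial>\<mu>)"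
    proof (rule nn_integral_eq_integral[OF Ri])
      show "AE s in \<mu>. 0 \<le> R s" using le by eventually_elim (erule order_trans[rotated], simp)
    qed
    also have "(\<integral>s. R s \<partial>\<mu>) = (norm (y - u))\<^sup>2 + (c n)\<^sup>2 * (8 * w * (1 + (norm y)\<^sup>2) + 4 * p)"
      unfolding R_def w_def p_def using \<eta>i \<phi> W_square mean
      by (simp add: innovation.prob_space algebra_simps integral_inner_left)
    finally show ?thesis .
  qed
  define E where "E n = (\<integral>\<^sup>+ \<omega>. ennreal ((norm (z n \<omega> - u))\<^sup>2) \<partial>M)" for n
  define D where "D n = (\<integral>\<^sup>+ \<omega>. ennreal ((norm (z (Suc n) \<omega> - z n \<omega>))\<^sup>2) \<partial>M)" for n
  define k where "k = 8 * w * (1 + C) + 4 * p"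
  have k0: "0 \<le> k" using w0 p0 C by (simp add: k_def)
  have step: "E (Suc n) + ennreal (1/2) * D n \<le> E n + ennreal ((c n)\<^sup>2 * k)" for n
  proof -
    note [measurable] = step_measurable[of n]
    have hm: "(\<lambda>v. ennreal ((norm (T n (snd v) (z n (fst v)) - u))\<^sup>2 + (norm (T n (snd v) (z n (fst v)) - z n (fst v)))\<^sup>2 / 2)) \<in> borel_measurable (\<F> n \<Otimes>\<^sub>M \<mu>)"
      by measurable
    have "E (Suc n) + ennreal (1/2) * D n = (\<integral>\<^sup>+ \<omega>. ennreal ((norm (z (Suc n) \<omega> - u))\<^sup>2) + ennreal (1/2) * ennreal ((norm (z (Suc n) \<omega> - z n \<omega>))\<^sup>2) \<partial>M)"
      unfolding E_def D_def by (subst nn_integral_add) (auto simp: nn_integral_cmult)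
    also have "\<dots> = (\<integral>\<^sup>+ \<omega>. ennreal ((norm (z (Suc n) \<omega> - u))\<^sup>2 + (norm (z (Suc n) \<omega> - z n \<omega>))\<^sup>2 / 2) \<partial>M)"
    proof (rule nn_integral_cong)
      have half: "ennreal a + ennreal (1/2) * ennreal d = ennreal (a + d / 2)" if "0 \<le> a" "0 \<le> d" for a d
      proof -
        have "ennreal (1/2) * ennreal d = ennreal (d / 2)" using that by (subst ennreal_mult[symmetric]) auto
        then show ?thesis using that by (simp only: ennreal_plus[of a "d / 2"] divide_nonneg_pos zero_less_numeral)
      qed
      show "ennreal ((norm (z (Suc n) \<omega> - u))\<^sup>2) + ennreal (1/2) * ennreal ((norm (z (Suc n) \<omega> - z n \<omega>))\<^sup>2)
        = ennreal ((norm (z (Suc n) \<omega> - u))\<^sup>2 + (norm (z (Suc n) \<omega> - z n \<omega>))\<^sup>2 / 2)" for \<omega> by (rule half) simp_all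
    qed
    also have "\<dots> = (\<integral>\<^sup>+ \<omega>. (\<integral>\<^sup>+ s. ennreal ((norm (T n s (z n \<omega>) - u))\<^sup>2 + (norm (T n s (z n \<omega>) - z n \<omega>))\<^sup>2 / 2) \<partial>\<mu>) \<partial>M)"
      using nn_integral_innovation[OF hm] unfolding z_Suc fst_conv snd_conv .
    also have "\<dots> \<le> (\<integral>\<^sup>+ \<omega>. ennreal ((norm (z n \<omega> - u))\<^sup>2 + (c n)\<^sup>2 * (8 * w * (1 + (norm (z n \<omega>))\<^sup>2) + 4 * p)) \<partial>M)"
      by (intro nn_integral_mono one)
    also have "\<dots> = (\<integral>\<^sup>+ \<omega>. ennreal ((norm (z n \<omega> - u))\<^sup>2) + (ennreal ((c n)\<^sup>2 * (8 * w + 4 * p)) + ennreal ((c n)\<^sup>2 * (8 * w)) * ennreal ((norm (z n \<omega>))\<^sup>2)) \<partial>M)"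
      using w0 p0 by (intro nn_integral_cong) (simp add: ennreal_plus[symmetric] ennreal_mult[symmetric] algebra_simps del: ennreal_plus)
    also have "\<dots> = E n + (ennreal ((c n)\<^sup>2 * (8 * w + 4 * p)) + ennreal ((c n)\<^sup>2 * (8 * w)) * (\<integral>\<^sup>+ \<omega>. ennreal ((norm (z n \<omega>))\<^sup>2) \<partial>M))"
      unfolding E_def by (simp add: nn_integral_add nn_integral_cmult emeasure_space_1)
    also have "\<dots> \<le> E n + (ennreal ((c n)\<^sup>2 * (8 * w + 4 * p)) + ennreal ((c n)\<^sup>2 * (8 * w)) * ennreal C)"
      by (intro add_left_mono mult_left_mono C) auto
    also have "\<dots> = E n + ennreal ((c n)\<^sup>2 * k)"
      using w0 p0 C by (simp add: k_def ennreal_plus[symmetric] ennreal_mult[symmetric] algebra_simps del: ennreal_plus)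
    finally show ?thesis .
  qed
  have Efin: "E n < \<infinity>" for n
    unfolding E_def using le_less_trans[OF shifted_second_moment[OF C] ennreal_less_top] by simp
  define e where "e n = enn2real (E n)" for n
  have E: "E n = ennreal (e n)" and e0: "0 \<le> e n" for n using Efin[of n] by (auto simp: e_def)
  have Dfin: "D n < \<infinity>" for n
  proof -
    have "ennreal (1/2) * D n \<le> E (Suc n) + ennreal (1/2) * D n" by (rule add_increasing) auto
    also have "\<dots> \<le> E n + ennreal ((c n)\<^sup>2 * k)" by (rule step)
    also have "\<dots> < \<infinity>" using Efin by simp
    finally show ?thesis by (auto simp: ennreal_mult_less_top)
  qed
  define d where "d n = enn2real (D n)" for n
  have D: "D n = ennreal (d n)" and d0: "0 \<le> d n" for n using Dfin[of n] by (auto simp: d_def)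
  have step': "e (Suc n) + d n / 2 \<le> e n + (c n)\<^sup>2 * k" for n
  proof -
    have "ennreal (1/2) * ennreal (d n) = ennreal (d n / 2)" using d0[of n] by (subst ennreal_mult[symmetric]) auto
    then have "ennreal (e (Suc n)) + ennreal (d n / 2) \<le> ennreal (e n) + ennreal ((c n)\<^sup>2 * k)"
      using step[of n] unfolding E D by simp
    then show ?thesis using e0[of n] e0[of "Suc n"] d0[of n] k0
      by (simp add: ennreal_plus[symmetric] del: ennreal_plus)
  qed
  have ck: "summable (\<lambda>n. (c n)\<^sup>2 * k)" using c_square by (rule summable_mult2)
  have ds: "summable d"
  proof (rule summableI_nonneg_bounded)
    fix n
    \<comment> \<open>Adding up the recursion telescopes \<open>e\<close> and bounds half the sum of
      the expected squared increments.\<close>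
    have "e n + sum d {..<n} / 2 \<le> e 0 + (\<Sum>i<n. (c i)\<^sup>2 * k)"
    proof (induction n)
      case (Suc n) then show ?case using step'[of n] by (simp add: add_divide_distrib)
    qed simp
    also have "(\<Sum>i<n. (c i)\<^sup>2 * k) \<le> (\<Sum>i. (c i)\<^sup>2 * k)" using ck k0 by (intro sum_le_suminf) auto
    finally show "sum d {..<n} \<le> 2 * (e 0 + (\<Sum>i. (c i)\<^sup>2 * k))" using e0[of n] by simp
  qed (rule d0)
  \<comment> \<open>On a single path the linear term does not average out; it is summable as a
    square integrable martingale.\<close>
  have "AE \<omega> in M. summable (\<lambda>n. c n * (\<eta> (\<xi> (Suc n) \<omega>) \<bullet> (z n \<omega> - u)))"
  proof (rule weighted_innovations_summable[where r=2 and C="2 * C + 2 * (norm u)\<^sup>2"])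
    have "(\<integral>\<^sup>+ s. ennreal ((norm (\<eta> s))\<^sup>2) \<partial>\<mu>) < \<infinity>" using \<eta> by (simp add: integrable_iff_bounded)
    then show "(\<integral>\<^sup>+ s. ennreal (norm (\<eta> s) powr 2) \<partial>\<mu>) < \<infinity>" by (simp add: powr_numeral)
    show "summable (\<lambda>n. c n powr 2)" using c_square c_pos by (simp add: powr_numeral less_imp_le)
    show "(\<lambda>\<omega>. z n \<omega> - u) \<in> borel_measurable (\<F> n)" for n using z_adapted[of n] by simp
    show "(\<integral>\<^sup>+ \<omega>. ennreal ((norm (z n \<omega> - u))\<^sup>2) \<partial>M) \<le> ennreal (2 * C + 2 * (norm u)\<^sup>2)" for n
      by (rule shifted_second_moment[OF C])
  qed (use \<eta>i mean c_pos C(1) in auto)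
  moreover have "AE \<omega> in M. summable (\<lambda>n. (c n)\<^sup>2 * q (\<xi> (Suc n) \<omega>) (z n \<omega>))"
  proof (rule AE_summable[where b="\<lambda>n. (c n)\<^sup>2 * k"])
    fix n
    note [measurable] = step_measurable[of n]
    have hm: "(\<lambda>v. ennreal ((c n)\<^sup>2 * q (snd v) (z n (fst v)))) \<in> borel_measurable (\<F> n \<Otimes>\<^sub>M \<mu>)"
      unfolding q_def by measurable
    note [measurable] = b_along[of n]
    have [measurable]: "(\<lambda>\<omega>. \<phi> (\<xi> (Suc n) \<omega>)) \<in> borel_measurable M" by (rule measurable_compose[OF xi_measurable_M]) measurable
    show "(\<lambda>\<omega>. (c n)\<^sup>2 * q (\<xi> (Suc n) \<omega>) (z n \<omega>)) \<in> borel_measurable M" unfolding q_def by measurable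
    have "(\<integral>\<^sup>+ \<omega>. ennreal ((c n)\<^sup>2 * q (\<xi> (Suc n) \<omega>) (z n \<omega>)) \<partial>M) = (\<integral>\<^sup>+ \<omega>. (\<integral>\<^sup>+ s. ennreal ((c n)\<^sup>2 * q s (z n \<omega>)) \<partial>\<mu>) \<partial>M)"
      using nn_integral_innovation[OF hm] unfolding fst_conv snd_conv .
    also have "\<dots> \<le> (\<integral>\<^sup>+ \<omega>. ennreal ((c n)\<^sup>2 * (8 * w + 4 * p)) + ennreal ((c n)\<^sup>2 * (8 * w)) * ennreal ((norm (z n \<omega>))\<^sup>2) \<partial>M)"
    proof (rule nn_integral_mono)
      fix \<omega>
      let ?y = "z n \<omega>"
      have "(\<integral>\<^sup>+ s. ennreal ((c n)\<^sup>2 * q s ?y) \<partial>\<mu>) \<le> (\<integral>\<^sup>+ s. ennreal ((c n)\<^sup>2 * (8 * (W s)\<^sup>2 * (1 + (norm ?y)\<^sup>2) + 4 * (norm (\<phi> s))\<^sup>2)) \<partial>\<mu>)"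
        by (intro nn_integral_mono ennreal_leI mult_left_mono qle) auto
      also have "\<dots> = ennreal (\<integral>s. (c n)\<^sup>2 * (8 * (W s)\<^sup>2 * (1 + (norm ?y)\<^sup>2) + 4 * (norm (\<phi> s))\<^sup>2) \<partial>\<mu>)"
        using \<phi> W_square by (intro nn_integral_eq_integral) auto
      also have "(\<integral>s. (c n)\<^sup>2 * (8 * (W s)\<^sup>2 * (1 + (norm ?y)\<^sup>2) + 4 * (norm (\<phi> s))\<^sup>2) \<partial>\<mu>) = (c n)\<^sup>2 * (8 * w + 4 * p) + (c n)\<^sup>2 * (8 * w) * (norm ?y)\<^sup>2"
        unfolding w_def p_def using \<phi> W_square by (simp add: algebra_simps)
      finally show "(\<integral>\<^sup>+ s. ennreal ((c n)\<^sup>2 * q s ?y) \<partial>\<mu>) \<le> ennreal ((c n)\<^sup>2 * (8 * w + 4 * p)) + ennreal ((c n)\<^sup>2 * (8 * w)) * ennreal ((norm ?y)\<^sup>2)"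
        using w0 p0 by (simp add: ennreal_mult)
    qed
    also have "\<dots> = ennreal ((c n)\<^sup>2 * (8 * w + 4 * p)) + ennreal ((c n)\<^sup>2 * (8 * w)) * (\<integral>\<^sup>+ \<omega>. ennreal ((norm (z n \<omega>))\<^sup>2) \<partial>M)"
      by (simp add: nn_integral_add nn_integral_cmult emeasure_space_1)
    also have "\<dots> \<le> ennreal ((c n)\<^sup>2 * (8 * w + 4 * p)) + ennreal ((c n)\<^sup>2 * (8 * w)) * ennreal C"
      by (intro add_left_mono mult_left_mono C) auto
    also have "\<dots> = ennreal ((c n)\<^sup>2 * k)"
      using w0 p0 C by (simp add: k_def ennreal_plus[symmetric] ennreal_mult[symmetric] algebra_simps del: ennreal_plus)
    finally show "(\<integral>\<^sup>+ \<omega>. ennreal ((c n)\<^sup>2 * q (\<xi> (Suc n) \<omega>) (z n \<omega>)) \<partial>M) \<le> ennreal ((c n)\<^sup>2 * k)" .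
  qed (use ck k0 in \<open>auto simp: q_def\<close>)
  ultimately have "AE \<omega> in M. convergent (\<lambda>n. norm (z n \<omega> - u))"
    using comparison_AE[OF cmp]
  proof eventually_elim
    case (elim \<omega>)
    define x where "x n = - 2 * (c n * (\<eta> (\<xi> (Suc n) \<omega>) \<bullet> (z n \<omega> - u))) + (c n)\<^sup>2 * q (\<xi> (Suc n) \<omega>) (z n \<omega>)" for n
    have "convergent (\<lambda>n. (norm (z n \<omega> - u))\<^sup>2)"
    proof (rule almost_decreasing_convergent)
      show "summable x" unfolding x_def by (intro summable_add summable_mult elim)
      fix n
      show "(norm (z (Suc n) \<omega> - u))\<^sup>2 \<le> (norm (z n \<omega> - u))\<^sup>2 + x n"
      proof -
        have gen: "A \<le> V + (- 2 * (k * e) + k\<^sup>2 * (2 * B))"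
          if "A \<le> V - 2 * k * e - 2 * k * f - D" "- 2 * k * f - D \<le> 2 * k\<^sup>2 * B - D / 2" "0 \<le> D" for A V k e f B D :: real
          using that by (simp add: algebra_simps)
        show ?thesis
          unfolding x_def q_def by (rule gen[OF elim(3)[rule_format, of n] cross_term_bound]) simp
      qed
    qed simp
    then obtain v where "(\<lambda>n. (norm (z n \<omega> - u))\<^sup>2) \<longlonglongrightarrow> v" by (auto simp: convergent_def)
    then have "(\<lambda>n. sqrt ((norm (z n \<omega> - u))\<^sup>2)) \<longlonglongrightarrow> sqrt v" by (rule tendsto_real_sqrt)
    then show ?case by (auto simp: convergent_def)
  qed
  then show thesis using that[OF d0 ds] D by (simp add: D_def)
qed

text \<open>Let \<open>U = 1 + norm (y - u) ^ 2\<close>. One step multiplies \<open>U\<close> by at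
  most \<open>1 + t1 + t2\<close>, where \<open>t1\<close> is linear in the step size and of mean
  zero and \<open>t2\<close> is quadratic, both controlled by \<open>r = c n * R s\<close>. In the
  \<open>m\<close>-th power the first order term integrates to zero and the remainder is of order
  \<open>(c n)^2\<close>.\<close>

lemma moment_step:
  assumes cmp: "comparison u \<phi> \<eta>" and m: "2 \<le> m"
    and W: "integrable \<mu> (\<lambda>s. W s ^ (2 * m))" and \<phi>: "integrable \<mu> (\<lambda>s. norm (\<phi> s) ^ (2 * m))"
    and \<eta>: "integrable \<mu> (\<lambda>s. norm (\<eta> s) ^ (2 * m))" and mean: "(\<integral>s. \<eta> s \<partial>\<mu>) = 0"
  obtains K where "0 \<le> K" "\<And>n y. (\<integral>\<^sup>+ s. ennreal ((1 + (norm (T n s y - u))\<^sup>2) ^ m) \<partial>\<mu>)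
    \<le> ennreal ((1 + (norm (y - u))\<^sup>2) ^ m * (1 + K * (c n)\<^sup>2))"
proof -
  have ms[measurable]: "\<phi> \<in> borel_measurable \<mu>" "\<eta> \<in> borel_measurable \<mu>" using cmp by (auto simp: comparison_def)
  \<comment> \<open>The factor \<open>3\<close> gives
    \<open>(a * W s)^2 = 9 (W s)^2 (1 + norm u)^2\<close>, which covers the \<open>8\<close> arising
    from the estimate of the forward field.\<close>
  define a where "a = 3 * (1 + norm u)"
  have a: "0 \<le> a" by (simp add: a_def)
  define R where "R s = 2 * norm (\<eta> s) + a * \<bar>W s\<bar> + 2 * norm (\<phi> s)" for s
  have R0: "0 \<le> R s" for s using a by (auto simp: R_def)
  have [measurable]: "R \<in> borel_measurable \<mu>" unfolding R_def by measurable
  have Ri: "integrable \<mu> (\<lambda>s. R s ^ (2 * m))"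
  proof (rule Bochner_Integration.integrable_bound)
    show "integrable \<mu> (\<lambda>s. (3 * 2) ^ (2 * m) * norm (\<eta> s) ^ (2 * m) + ((3 * a) ^ (2 * m) * W s ^ (2 * m) + (3 * 2) ^ (2 * m) * norm (\<phi> s) ^ (2 * m)))"
      using W \<phi> \<eta> by auto
    have pow3: "(x + y + w) ^ k \<le> (3 * x) ^ k + ((3 * y) ^ k + (3 * w) ^ k)" if "0 \<le> x" "0 \<le> y" "0 \<le> w" for x y w :: real and k
    proof -
      define M where "M = max x (max y w)"
      have "(x + y + w) ^ k \<le> (3 * M) ^ k" using that by (intro power_mono) (auto simp: M_def)
      also have "\<dots> \<le> (3 * x) ^ k + ((3 * y) ^ k + (3 * w) ^ k)"
        using that by (auto simp: M_def max_def intro: add_increasing add_increasing2)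
      finally show ?thesis .
    qed
    have "R s ^ (2 * m) \<le> (3 * 2) ^ (2 * m) * norm (\<eta> s) ^ (2 * m) + ((3 * a) ^ (2 * m) * W s ^ (2 * m) + (3 * 2) ^ (2 * m) * norm (\<phi> s) ^ (2 * m))" for s
      using pow3[of "2 * norm (\<eta> s)" "a * \<bar>W s\<bar>" "2 * norm (\<phi> s)" "2 * m"] a
      by (simp add: R_def power_mult_distrib mult.assoc power_mult)
    then show "AE s in \<mu>. norm (R s ^ (2 * m)) \<le> norm ((3 * 2) ^ (2 * m) * norm (\<eta> s) ^ (2 * m) + ((3 * a) ^ (2 * m) * W s ^ (2 * m) + (3 * 2) ^ (2 * m) * norm (\<phi> s) ^ (2 * m)))"
      using R0 by (intro AE_I2) (smt (verit) real_norm_def zero_le_power)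
  qed measurable
  have \<eta>i: "integrable \<mu> \<eta>"
  proof (rule Bochner_Integration.integrable_bound)
    show "integrable \<mu> (\<lambda>s. 1 + norm (\<eta> s) ^ (2 * m))" using \<eta> by simp
    show "AE s in \<mu>. norm (\<eta> s) \<le> norm (1 + norm (\<eta> s) ^ (2 * m))"
      using power_le_sum_of_extremes[of "norm (\<eta> _)" 0 1 "2 * m"] m by (intro AE_I2) (simp add: abs_of_nonneg)
  qed measurable
  obtain C where C: "1 \<le> C" "\<And>n. c n \<le> C" using c_bounded by blast
  define k where "k = real m + 2 ^ m * (4 + 2 * 2 ^ m)"
  \<comment> \<open>Boundedness of the weights trades \<open>c n ^ (2 * m)\<close> for
    \<open>(c n)^2 * J\<close>.\<close>
  define J where "J = 1 + C ^ (2 * m)"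
  have kJ: "0 \<le> k" "1 \<le> J" using C(1) by (auto simp: k_def J_def)
  define I where "I = (\<integral>s. R s ^ (2 * m) \<partial>\<mu>)"
  have I0: "0 \<le> I" unfolding I_def using R0 by (intro integral_nonneg_AE) auto
  define K where "K = k * (1 + J) * (1 + I)"
  have K0: "0 \<le> K" using kJ I0 by (simp add: K_def)
  have "(\<integral>\<^sup>+ s. ennreal ((1 + (norm (T n s y - u))\<^sup>2) ^ m) \<partial>\<mu>) \<le> ennreal ((1 + (norm (y - u))\<^sup>2) ^ m * (1 + K * (c n)\<^sup>2))" for n y
  proof -
    define U where "U = 1 + (norm (y - u))\<^sup>2"
    have U1: "1 \<le> U" by (simp add: U_def)
    \<comment> \<open>This makes the linear term, of size \<open>norm (y - u)\<close>, relative to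
      \<open>U\<close>.\<close>
    have dU: "norm (y - u) \<le> U" using less_one_plus_square[of "norm (y - u)"] by (simp add: U_def)
    define B where "B s = U ^ m * (1 + real m * (- 2 * c n * (\<eta> s \<bullet> (y - u)) / U) + k * ((c n)\<^sup>2 * ((1 + J) * (1 + R s ^ (2 * m)))))" for s
    have le: "AE s in \<mu>. (1 + (norm (T n s y - u))\<^sup>2) ^ m \<le> B s"
      using cmp[unfolded comparison_def, THEN conjunct2, THEN conjunct2, rule_format, of n y] AE_space
    proof eventually_elim
      case (elim s)
      define r where "r = c n * R s"
      have r0: "0 \<le> r" using c_pos[of n] R0 by (simp add: r_def)
      define t1 where "t1 = - 2 * c n * (\<eta> s \<bullet> (y - u)) / U"
      define t2 where "t2 = 2 * (c n)\<^sup>2 * (norm (b s y + \<phi> s))\<^sup>2 / U"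
      have Ut: "U * t1 = - 2 * c n * (\<eta> s \<bullet> (y - u))" "U * t2 = 2 * (c n)\<^sup>2 * (norm (b s y + \<phi> s))\<^sup>2"
        using U1 by (auto simp: t1_def t2_def)
      have "1 + (norm (T n s y - u))\<^sup>2 \<le> U + (U * t1 + U * t2)"
        using elim(1) cross_term_bound[of "c n" "b s y + \<phi> s" "T n s y - y"]
          zero_le_power2[of "norm (T n s y - y)"] unfolding Ut unfolding U_def by linarith
      then have up: "1 + (norm (T n s y - u))\<^sup>2 \<le> U * (1 + (t1 + t2))" by (simp add: distrib_left)
      have t1: "\<bar>t1\<bar> \<le> r"
      proof -
        have "\<bar>\<eta> s \<bullet> (y - u)\<bar> \<le> norm (\<eta> s) * U"
          using Cauchy_Schwarz_ineq2[of "\<eta> s" "y - u"] mult_left_mono[OF dU, of "norm (\<eta> s)"] by simp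
        then have "\<bar>\<eta> s \<bullet> (y - u)\<bar> / U \<le> norm (\<eta> s)" using U1 by (simp add: field_simps)
        then have "c n * (2 * (\<bar>\<eta> s \<bullet> (y - u)\<bar> / U)) \<le> c n * R s"
          using c_pos[of n] a unfolding R_def by (intro mult_left_mono add_increasing2) auto
        then show ?thesis using c_pos[of n] U1 by (simp add: t1_def r_def abs_mult mult.assoc mult.left_commute)
      qed
      have bW: "norm (b s y) \<le> W s * (1 + norm y)" and Ws: "0 \<le> W s" using b_growth W_nonneg elim(2) by auto
      have "1 + norm y \<le> 1 + norm u + norm (y - u)" using norm_triangle_sub[of y u] by simp
      also have "\<dots> \<le> (1 + norm u) * (1 + norm (y - u))" by (simp add: algebra_simps)
      finally have "norm (b s y) \<le> W s * ((1 + norm u) * (1 + norm (y - u)))" using bW Ws mult_left_mono order_trans by blast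
      then have "(norm (b s y))\<^sup>2 \<le> (W s * ((1 + norm u) * (1 + norm (y - u))))\<^sup>2" by (intro power_mono) auto
      also have "\<dots> = (W s * (1 + norm u))\<^sup>2 * (1 + norm (y - u))\<^sup>2" by (simp add: power_mult_distrib)
      also have "\<dots> \<le> (W s * (1 + norm u))\<^sup>2 * (2 * U)" unfolding U_def by (intro mult_left_mono one_plus_square_le) auto
      finally have b2: "(norm (b s y))\<^sup>2 \<le> 2 * (W s * (1 + norm u))\<^sup>2 * U" by simp
      have p2: "(norm (\<phi> s))\<^sup>2 \<le> (norm (\<phi> s))\<^sup>2 * U" using U1 by (simp add: mult_le_cancel_left1)
      have "2 * (norm (b s y + \<phi> s))\<^sup>2 \<le> (8 * (W s * (1 + norm u))\<^sup>2 + 4 * (norm (\<phi> s))\<^sup>2) * U"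
        using norm_add_square_le[of "b s y" "\<phi> s"] b2 p2 by (simp add: distrib_right)
      also have "8 * (W s * (1 + norm u))\<^sup>2 + 4 * (norm (\<phi> s))\<^sup>2 \<le> (R s)\<^sup>2"
      proof -
        have "8 * (W s * (1 + norm u))\<^sup>2 + 4 * (norm (\<phi> s))\<^sup>2 \<le> (a * \<bar>W s\<bar>)\<^sup>2 + (2 * norm (\<phi> s))\<^sup>2"
        proof -
          have "(a * \<bar>W s\<bar>)\<^sup>2 = 9 * (W s * (1 + norm u))\<^sup>2"
            unfolding a_def power_mult_distrib power2_abs by simp
          then show ?thesis by (simp add: power_mult_distrib[of 2])
        qed
        also have "\<dots> \<le> (a * \<bar>W s\<bar> + 2 * norm (\<phi> s))\<^sup>2" using a by (simp add: power2_sum)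
        also have "\<dots> \<le> (R s)\<^sup>2" unfolding R_def using a by (intro power_mono) auto
        finally show ?thesis .
      qed
      finally have "2 * (norm (b s y + \<phi> s))\<^sup>2 / U \<le> (R s)\<^sup>2" using U1 by (simp add: mult_right_mono pos_divide_le_eq)
      then have "(c n)\<^sup>2 * (2 * (norm (b s y + \<phi> s))\<^sup>2 / U) \<le> (c n)\<^sup>2 * (R s)\<^sup>2" by (intro mult_left_mono) auto
      then have t2: "0 \<le> t2" "t2 \<le> r\<^sup>2" using U1 by (auto simp: t2_def r_def power_mult_distrib mult.left_commute mult.assoc)
      have "(1 + (norm (T n s y - u))\<^sup>2) ^ m \<le> (U * (1 + (t1 + t2))) ^ m" using up by (intro power_mono) auto
      also have "\<dots> = U ^ m * (1 + (t1 + t2)) ^ m" by (simp add: power_mult_distrib)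
      also have "\<dots> \<le> U ^ m * (1 + real m * (t1 + t2) + 2 ^ m * (4 + 2 * 2 ^ m) * (r\<^sup>2 + r ^ (2 * m)))"
        using t1 t2 m r0 U1 by (intro mult_left_mono power_perturbation) auto
      also have "\<dots> \<le> U ^ m * (1 + real m * t1 + k * (r\<^sup>2 + r ^ (2 * m)))"
      proof (rule mult_left_mono)
        have "real m * t2 \<le> real m * (r\<^sup>2 + r ^ (2 * m))" using t2 r0 by (intro mult_left_mono) (auto intro: add_increasing2)
        then show "1 + real m * (t1 + t2) + 2 ^ m * (4 + 2 * 2 ^ m) * (r\<^sup>2 + r ^ (2 * m)) \<le> 1 + real m * t1 + k * (r\<^sup>2 + r ^ (2 * m))"
          by (simp add: k_def distrib_left distrib_right)
      qed (use U1 in auto)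
      also have "\<dots> \<le> B s"
        unfolding B_def t1_def[symmetric]
      proof (intro mult_left_mono add_left_mono)
        have "R s ^ 2 \<le> 1 + R s ^ (2 * m)" using power_le_sum_of_extremes[of "R s" 0 2 "2 * m"] R0 m by simp
        then have 1: "r\<^sup>2 \<le> (c n)\<^sup>2 * (1 + R s ^ (2 * m))" by (simp add: r_def power_mult_distrib mult_left_mono)
        have "2 * m = 2 + (2 * m - 2)" using m by simp
        then have "c n ^ (2 * m) = (c n)\<^sup>2 * c n ^ (2 * m - 2)" by (metis power_add)
        also have "\<dots> \<le> (c n)\<^sup>2 * J"
        proof (rule mult_left_mono)
          have "c n ^ (2 * m - 2) \<le> C ^ (2 * m - 2)" using C c_pos[of n] by (intro power_mono) (auto intro: less_imp_le)
          also have "\<dots> \<le> C ^ (2 * m)" using C by (intro power_increasing) auto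
          finally show "c n ^ (2 * m - 2) \<le> J" by (simp add: J_def)
        qed simp
        finally have "r ^ (2 * m) \<le> ((c n)\<^sup>2 * J) * R s ^ (2 * m)" using R0 by (simp add: r_def power_mult_distrib mult_right_mono)
        also have "\<dots> \<le> ((c n)\<^sup>2 * J) * (1 + R s ^ (2 * m))" using kJ by (intro mult_left_mono) auto
        finally show "r\<^sup>2 + r ^ (2 * m) \<le> (c n)\<^sup>2 * ((1 + J) * (1 + R s ^ (2 * m)))" using 1 by (simp add: algebra_simps)
      qed (use U1 kJ in auto)
      finally show ?case .
    qed
    have Bi: "integrable \<mu> B" unfolding B_def using \<eta>i Ri by auto
    have "(\<integral>\<^sup>+ s. ennreal ((1 + (norm (T n s y - u))\<^sup>2) ^ m) \<partial>\<mu>) \<le> (\<integral>\<^sup>+ s. ennreal (B s) \<partial>\<mu>)"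
      by (rule nn_integral_mono_AE, use le in eventually_elim) (rule ennreal_leI)
    also have "\<dots> = ennreal (\<integral>s. B s \<partial>\<mu>)"
    proof (rule nn_integral_eq_integral[OF Bi])
      show "AE s in \<mu>. 0 \<le> B s" using le by eventually_elim (erule order_trans[rotated], simp)
    qed
    also have "(\<integral>s. B s \<partial>\<mu>) = U ^ m * (1 + k * ((c n)\<^sup>2 * ((1 + J) * (1 + I))))"
    proof -
      have 1: "(\<integral>s. real m * (- 2 * c n * (\<eta> s \<bullet> (y - u)) / U) \<partial>\<mu>) = 0"
        using \<eta>i mean by (simp add: integral_inner_left)
      have 2: "(\<integral>s. k * ((c n)\<^sup>2 * ((1 + J) * (1 + R s ^ (2 * m)))) \<partial>\<mu>) = k * ((c n)\<^sup>2 * ((1 + J) * (1 + I)))"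
        using Ri by (simp add: I_def innovation.prob_space)
      have i1: "integrable \<mu> (\<lambda>s. real m * (- 2 * c n * (\<eta> s \<bullet> (y - u)) / U))" using \<eta>i by auto
      have i2: "integrable \<mu> (\<lambda>s. k * ((c n)\<^sup>2 * ((1 + J) * (1 + R s ^ (2 * m)))))" using Ri by auto
      have add: "(\<integral>s. k * (1 + f s + g s) \<partial>\<mu>) = k * (1 + (\<integral>s. f s \<partial>\<mu>) + (\<integral>s. g s \<partial>\<mu>))"
        if "integrable \<mu> f" "integrable \<mu> g" for f g :: "'s \<Rightarrow> real" and k
        using that by (simp add: innovation.prob_space)
      show ?thesis
        unfolding B_def using add[OF i1 i2, of "U ^ m"] unfolding 1 2 by simp
    qed
    also have "\<dots> = (1 + (norm (y - u))\<^sup>2) ^ m * (1 + K * (c n)\<^sup>2)" by (simp add: U_def K_def mult.assoc mult.commute mult.left_commute)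
    finally show ?thesis .
  qed
  with K0 show thesis using that by blast
qed

text \<open>The one-step factors are at most \<open>exp (K * (c n)^2)\<close>, and square
  summability bounds their product. The recursion runs in \<open>ennreal\<close>, so finiteness at
  each time is a result of it and not a prerequisite.\<close>

lemma comparison_moments:
  assumes cmp: "comparison u \<phi> \<eta>" and m: "2 \<le> m"
    and W: "integrable \<mu> (\<lambda>s. W s ^ (2 * m))" and \<phi>: "integrable \<mu> (\<lambda>s. norm (\<phi> s) ^ (2 * m))"
    and \<eta>: "integrable \<mu> (\<lambda>s. norm (\<eta> s) ^ (2 * m))" and mean: "(\<integral>s. \<eta> s \<partial>\<mu>) = 0"
    and z0: "integrable M (\<lambda>\<omega>. norm (z 0 \<omega>) ^ (2 * m))"
  obtains C where "0 \<le> C" "\<And>n. (\<integral>\<^sup>+ \<omega>. ennreal (norm (z n \<omega>) ^ (2 * m)) \<partial>M) \<le> ennreal C"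
proof -
  obtain K where K: "0 \<le> K" "\<And>n y. (\<integral>\<^sup>+ s. ennreal ((1 + (norm (T n s y - u))\<^sup>2) ^ m) \<partial>\<mu>)
    \<le> ennreal ((1 + (norm (y - u))\<^sup>2) ^ m * (1 + K * (c n)\<^sup>2))"
    using moment_step[OF cmp m W \<phi> \<eta> mean] by blast
  define E where "E n = (\<integral>\<^sup>+ \<omega>. ennreal ((1 + (norm (z n \<omega> - u))\<^sup>2) ^ m) \<partial>M)" for n
  have step: "E (Suc n) \<le> E n * ennreal (exp (K * (c n)\<^sup>2))" for n
  proof -
    have hm: "(\<lambda>v. ennreal ((1 + (norm (T n (snd v) (z n (fst v)) - u))\<^sup>2) ^ m)) \<in> borel_measurable (\<F> n \<Otimes>\<^sub>M \<mu>)"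
      using step_measurable[of n] by measurable
    have "E (Suc n) = (\<integral>\<^sup>+ \<omega>. (\<integral>\<^sup>+ s. ennreal ((1 + (norm (T n s (z n \<omega>) - u))\<^sup>2) ^ m) \<partial>\<mu>) \<partial>M)"
      unfolding E_def z_Suc using nn_integral_innovation[OF hm] unfolding fst_conv snd_conv .
    also have "\<dots> \<le> (\<integral>\<^sup>+ \<omega>. ennreal ((1 + (norm (z n \<omega> - u))\<^sup>2) ^ m) * ennreal (exp (K * (c n)\<^sup>2)) \<partial>M)"
    proof (rule nn_integral_mono)
      fix \<omega>
      have "(1 + (norm (z n \<omega> - u))\<^sup>2) ^ m * (1 + K * (c n)\<^sup>2) \<le> (1 + (norm (z n \<omega> - u))\<^sup>2) ^ m * exp (K * (c n)\<^sup>2)"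
        by (intro mult_left_mono exp_ge_add_one_self) auto
      then show "(\<integral>\<^sup>+ s. ennreal ((1 + (norm (T n s (z n \<omega>) - u))\<^sup>2) ^ m) \<partial>\<mu>) \<le> ennreal ((1 + (norm (z n \<omega> - u))\<^sup>2) ^ m) * ennreal (exp (K * (c n)\<^sup>2))"
        using K(2)[of n "z n \<omega>"] by (simp add: ennreal_mult[symmetric]) (meson ennreal_leI order_trans)
    qed
    also have "\<dots> = E n * ennreal (exp (K * (c n)\<^sup>2))" unfolding E_def by (rule nn_integral_multc) measurable
    finally show ?thesis .
  qed
  have En: "E n \<le> E 0 * ennreal (exp (K * (\<Sum>k<n. (c k)\<^sup>2)))" for n
  proof (induction n)
    case (Suc n)
    have "E (Suc n) \<le> E 0 * ennreal (exp (K * (\<Sum>k<n. (c k)\<^sup>2))) * ennreal (exp (K * (c n)\<^sup>2))"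
      using step[of n] mult_right_mono[OF Suc, of "ennreal (exp (K * (c n)\<^sup>2))"] by (meson order_trans zero_le)
    also have "\<dots> = E 0 * ennreal (exp (K * (\<Sum>k<Suc n. (c k)\<^sup>2)))"
      by (simp add: mult.assoc ennreal_mult[symmetric] exp_add[symmetric] distrib_left)
    finally show ?case .
  qed simp
  have pow: "(1 + (norm (v - w))\<^sup>2) ^ m \<le> (3 * (1 + 2 * (norm w)\<^sup>2)) ^ m + 6 ^ m * norm v ^ (2 * m)" for v w :: 'e
  proof -
    have "1 + (norm (v - w))\<^sup>2 \<le> (1 + 2 * (norm w)\<^sup>2) + 2 * (norm v)\<^sup>2"
      using norm_add_square_le[of v "- w"] by simp
    also have "\<dots> \<le> max (3 * (1 + 2 * (norm w)\<^sup>2)) (6 * (norm v)\<^sup>2)"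
    proof -
      have "(1 + 2 * q) + 2 * p \<le> max (3 * (1 + 2 * q)) (6 * p)" if "0 \<le> p" "0 \<le> q" for p q :: real
        using that by (auto simp: max_def)
      then show ?thesis by simp
    qed
    finally have "(1 + (norm (v - w))\<^sup>2) ^ m \<le> (max (3 * (1 + 2 * (norm w)\<^sup>2)) (6 * (norm v)\<^sup>2)) ^ m" by (intro power_mono) auto
    also have "\<dots> \<le> (3 * (1 + 2 * (norm w)\<^sup>2)) ^ m + (6 * (norm v)\<^sup>2) ^ m"
      by (cases "3 * (1 + 2 * (norm w)\<^sup>2) \<le> 6 * (norm v)\<^sup>2") (auto simp: max_def intro!: add_increasing add_increasing2)
    finally show ?thesis by (simp add: power_mult_distrib power_mult)
  qed
  have E0: "E 0 < \<infinity>"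
  proof -
    have "E 0 \<le> (\<integral>\<^sup>+ \<omega>. ennreal ((3 * (1 + 2 * (norm u)\<^sup>2)) ^ m + 6 ^ m * norm (z 0 \<omega>) ^ (2 * m)) \<partial>M)"
      unfolding E_def using pow by (intro nn_integral_mono ennreal_leI)
    also have "\<dots> < \<infinity>"
    proof -
      have "integrable M (\<lambda>\<omega>. (3 * (1 + 2 * (norm u)\<^sup>2)) ^ m + 6 ^ m * norm (z 0 \<omega>) ^ (2 * m))" using z0 by auto
      then show ?thesis by (auto simp: real_integrable_def less_top)
    qed
    finally show ?thesis .
  qed
  define e where "e = enn2real (E 0)"
  have e: "E 0 = ennreal e" "0 \<le> e" using E0 by (auto simp: e_def)
  define Q where "Q = exp (K * (\<Sum>k. (c k)\<^sup>2))"
  have EnQ: "E n \<le> ennreal (e * Q)" for n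
  proof -
    have "K * (\<Sum>k<n. (c k)\<^sup>2) \<le> K * (\<Sum>k. (c k)\<^sup>2)" using K c_square by (intro mult_left_mono sum_le_suminf) auto
    then have "exp (K * (\<Sum>k<n. (c k)\<^sup>2)) \<le> Q" by (simp add: Q_def)
    then have "E 0 * ennreal (exp (K * (\<Sum>k<n. (c k)\<^sup>2))) \<le> ennreal e * ennreal Q" unfolding e by (intro mult_left_mono ennreal_leI) auto
    then show ?thesis using En[of n] e by (simp add: ennreal_mult Q_def)
  qed
  define a where "a = (3 * (1 + 2 * (norm u)\<^sup>2)) ^ m"
  have "(\<integral>\<^sup>+ \<omega>. ennreal (norm (z n \<omega>) ^ (2 * m)) \<partial>M) \<le> ennreal (a + 6 ^ m * (e * Q))" for n
  proof -
    have "(\<integral>\<^sup>+ \<omega>. ennreal (norm (z n \<omega>) ^ (2 * m)) \<partial>M) \<le> (\<integral>\<^sup>+ \<omega>. ennreal a + ennreal (6 ^ m) * ennreal ((1 + (norm (z n \<omega> - u))\<^sup>2) ^ m) \<partial>M)"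
    proof (rule nn_integral_mono)
      fix \<omega>
      have "norm (z n \<omega>) ^ (2 * m) \<le> (1 + (norm ((z n \<omega> - u) - (- u)))\<^sup>2) ^ m"
        unfolding power_mult by (intro power_mono) auto
      also have "\<dots> \<le> a + 6 ^ m * norm (z n \<omega> - u) ^ (2 * m)" using pow[of "z n \<omega> - u" "- u"] by (simp add: a_def)
      also have "norm (z n \<omega> - u) ^ (2 * m) \<le> (1 + (norm (z n \<omega> - u))\<^sup>2) ^ m" unfolding power_mult by (intro power_mono) auto
      finally have "ennreal (norm (z n \<omega>) ^ (2 * m)) \<le> ennreal (a + 6 ^ m * (1 + (norm (z n \<omega> - u))\<^sup>2) ^ m)" by (simp add: ennreal_leI)
      also have "\<dots> = ennreal a + ennreal (6 ^ m) * ennreal ((1 + (norm (z n \<omega> - u))\<^sup>2) ^ m)"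
        by (subst ennreal_plus) (auto simp: a_def ennreal_mult)
      finally show "ennreal (norm (z n \<omega>) ^ (2 * m)) \<le> ennreal a + ennreal (6 ^ m) * ennreal ((1 + (norm (z n \<omega> - u))\<^sup>2) ^ m)" .
    qed
    also have "\<dots> = ennreal a + ennreal (6 ^ m) * E n"
      unfolding E_def by (subst nn_integral_add) (auto simp: nn_integral_cmult emeasure_space_1)
    also have "\<dots> \<le> ennreal a + ennreal (6 ^ m) * ennreal (e * Q)" by (intro add_left_mono mult_left_mono EnQ) auto
    also have "\<dots> = ennreal (a + 6 ^ m * (e * Q))" using e by (subst ennreal_plus) (auto simp: a_def Q_def ennreal_mult)
    finally show ?thesis .
  qed
  moreover have "0 \<le> a + 6 ^ m * (e * Q)" using e by (auto simp: a_def Q_def)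
  ultimately show thesis using that by blast
qed

text \<open>The forward field is estimated on its own, because at a general comparison point it must
  be separated from the selection \<open>\<phi>\<close>, which may lack a second moment.\<close>

lemma forward_square_summable:
  assumes C: "0 \<le> C" "\<And>n. (\<integral>\<^sup>+ \<omega>. ennreal ((norm (z n \<omega>))\<^sup>2) \<partial>M) \<le> ennreal C"
  shows "AE \<omega> in M. summable (\<lambda>n. (c n)\<^sup>2 * (norm (b (\<xi> (Suc n) \<omega>) (z n \<omega>)))\<^sup>2)"
proof -
  define w where "w = (\<integral>s. (W s)\<^sup>2 \<partial>\<mu>)"
  have w0: "0 \<le> w" by (simp add: w_def)
  have bnd: "(\<integral>\<^sup>+ s. ennreal ((c n)\<^sup>2 * (norm (b s y))\<^sup>2) \<partial>\<mu>) \<le> ennreal ((c n)\<^sup>2 * w * 2) * (1 + ennreal ((norm y)\<^sup>2))" for n y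
  proof -
    have "(\<integral>\<^sup>+ s. ennreal ((c n)\<^sup>2 * (norm (b s y))\<^sup>2) \<partial>\<mu>) \<le> (\<integral>\<^sup>+ s. ennreal ((c n)\<^sup>2 * ((W s)\<^sup>2 * (2 * (1 + (norm y)\<^sup>2)))) \<partial>\<mu>)"
    proof (intro nn_integral_mono ennreal_leI mult_left_mono)
      fix s assume "s \<in> space \<mu>"
      then have "(norm (b s y))\<^sup>2 \<le> (W s * (1 + norm y))\<^sup>2" using b_growth by (intro power_mono) auto
      also have "\<dots> \<le> (W s)\<^sup>2 * (2 * (1 + (norm y)\<^sup>2))"
        unfolding power_mult_distrib by (intro mult_left_mono one_plus_square_le) auto
      finally show "(norm (b s y))\<^sup>2 \<le> (W s)\<^sup>2 * (2 * (1 + (norm y)\<^sup>2))" .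
    qed simp
    also have "\<dots> = ennreal (\<integral>s. (c n)\<^sup>2 * ((W s)\<^sup>2 * (2 * (1 + (norm y)\<^sup>2))) \<partial>\<mu>)"
      using W_square by (intro nn_integral_eq_integral) auto
    also have "(\<integral>s. (c n)\<^sup>2 * ((W s)\<^sup>2 * (2 * (1 + (norm y)\<^sup>2))) \<partial>\<mu>) = ((c n)\<^sup>2 * w * 2) * (1 + (norm y)\<^sup>2)"
    proof -
      have "(c n)\<^sup>2 * ((W s)\<^sup>2 * (2 * (1 + (norm y)\<^sup>2))) = ((c n)\<^sup>2 * (2 * (1 + (norm y)\<^sup>2))) * (W s)\<^sup>2" for s by simp
      then show ?thesis unfolding w_def by (simp only: integral_mult_right_zero) simp
    qed
    also have "ennreal \<dots> = ennreal ((c n)\<^sup>2 * w * 2) * (1 + ennreal ((norm y)\<^sup>2))" using w0 by (simp add: ennreal_mult)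
    finally show ?thesis .
  qed
  show ?thesis
  proof (rule AE_summable[where b="\<lambda>n. (c n)\<^sup>2 * w * 2 * (1 + C)"])
    fix n
    note [measurable] = b_along[of n]
    have hm: "(\<lambda>v. ennreal ((c n)\<^sup>2 * (norm (b (snd v) (z n (fst v))))\<^sup>2)) \<in> borel_measurable (\<F> n \<Otimes>\<^sub>M \<mu>)"
      using step_measurable(2)[of n] by measurable
    show "(\<lambda>\<omega>. (c n)\<^sup>2 * (norm (b (\<xi> (Suc n) \<omega>) (z n \<omega>)))\<^sup>2) \<in> borel_measurable M" by measurable
    have "(\<integral>\<^sup>+ \<omega>. ennreal ((c n)\<^sup>2 * (norm (b (\<xi> (Suc n) \<omega>) (z n \<omega>)))\<^sup>2) \<partial>M)
      = (\<integral>\<^sup>+ \<omega>. (\<integral>\<^sup>+ s. ennreal ((c n)\<^sup>2 * (norm (b s (z n \<omega>)))\<^sup>2) \<partial>\<mu>) \<partial>M)"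
      using nn_integral_innovation[OF hm] unfolding fst_conv snd_conv .
    also have "\<dots> \<le> (\<integral>\<^sup>+ \<omega>. ennreal ((c n)\<^sup>2 * w * 2) * (1 + ennreal ((norm (z n \<omega>))\<^sup>2)) \<partial>M)"
      by (intro nn_integral_mono bnd)
    also have "\<dots> = ennreal ((c n)\<^sup>2 * w * 2) * (1 + (\<integral>\<^sup>+ \<omega>. ennreal ((norm (z n \<omega>))\<^sup>2) \<partial>M))"
      by (simp add: nn_integral_cmult nn_integral_add emeasure_space_1)
    also have "\<dots> \<le> ennreal ((c n)\<^sup>2 * w * 2) * (1 + ennreal C)" by (intro mult_left_mono add_left_mono C) auto
    finally show "(\<integral>\<^sup>+ \<omega>. ennreal ((c n)\<^sup>2 * (norm (b (\<xi> (Suc n) \<omega>) (z n \<omega>)))\<^sup>2) \<partial>M) \<le> ennreal ((c n)\<^sup>2 * w * 2 * (1 + C))"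
      using w0 C by (simp add: ennreal_mult)
  qed (use summable_mult2[OF summable_mult2[OF summable_mult2[OF c_square]], of w 2 "1 + C"] w0 C in auto)
qed

text \<open>Kronecker's lemma turns the almost sure convergence of the normalized innovation sums into
  vanishing of their weighted means, so that only the mean of \<open>\<eta>\<close> survives in the limit.\<close>

lemma comparison_weighted_mean:
  assumes cmp: "comparison u \<phi> \<eta>" and r: "1 < r" "r \<le> 2"
    and \<phi>: "(\<integral>\<^sup>+ s. ennreal (norm (\<phi> s) powr r) \<partial>\<mu>) < \<infinity>" and \<eta>: "(\<integral>\<^sup>+ s. ennreal (norm (\<eta> s) powr r) \<partial>\<mu>) < \<infinity>"
    and \<eta>i: "integrable \<mu> \<eta>"
    and C: "0 \<le> C" "\<And>n. (\<integral>\<^sup>+ \<omega>. ennreal ((norm (z n \<omega>))\<^sup>2) \<partial>M) \<le> ennreal C"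
    and incr: "AE \<omega> in M. summable (\<lambda>n. (norm (z (Suc n) \<omega> - z n \<omega>))\<^sup>2)"
  shows "AE \<omega> in M. \<forall>q l. strict_mono q \<longrightarrow> (\<lambda>n. (\<Sum>k<q n. c k *\<^sub>R z (Suc k) \<omega>) /\<^sub>R (\<Sum>k<q n. c k)) \<longlonglongrightarrow> l \<longrightarrow> 0 \<le> (\<integral>s. \<eta> s \<partial>\<mu>) \<bullet> (u - l)"
proof -
  have ms[measurable]: "\<phi> \<in> borel_measurable \<mu>" "\<eta> \<in> borel_measurable \<mu>" using cmp by (auto simp: comparison_def)
  define v where "v = (\<integral>s. \<eta> s \<partial>\<mu>)"
  \<comment> \<open>Centring: only \<open>h\<close> is treated as noise, while the mean
    \<open>v\<close> remains in the limit.\<close>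
  define h where "h s = \<eta> s - v" for s
  have hi: "integrable \<mu> h" and h0: "(\<integral>s. h s \<partial>\<mu>) = 0" unfolding h_def using \<eta>i by (auto simp: v_def innovation.prob_space)
  have [measurable]: "h \<in> borel_measurable \<mu>" using hi by auto
  have hr: "(\<integral>\<^sup>+ s. ennreal (norm (h s) powr r) \<partial>\<mu>) < \<infinity>"
  proof -
    have le: "norm (h s) powr r \<le> 2 powr r * norm (\<eta> s) powr r + 2 powr r * norm v powr r" for s
    proof -
      define k where "k = max (norm (\<eta> s)) (norm v)"
      have "norm (h s) \<le> 2 * k" unfolding h_def k_def using norm_triangle_ineq4[of "\<eta> s" v] by simp
      then have "norm (h s) powr r \<le> (2 * k) powr r" using r by (intro powr_mono2) auto
      also have "\<dots> = 2 powr r * k powr r" by (simp add: powr_mult k_def)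
      also have "\<dots> \<le> 2 powr r * (norm (\<eta> s) powr r + norm v powr r)"
        unfolding k_def max_def by (intro mult_left_mono) auto
      finally show ?thesis by (simp add: distrib_left)
    qed
    have "(\<integral>\<^sup>+ s. ennreal (norm (h s) powr r) \<partial>\<mu>) \<le> (\<integral>\<^sup>+ s. ennreal (2 powr r) * ennreal (norm (\<eta> s) powr r) + ennreal (2 powr r * norm v powr r) \<partial>\<mu>)"
      using le by (intro nn_integral_mono) (auto simp: ennreal_mult[symmetric] ennreal_plus[symmetric] ennreal_leI simp del: ennreal_plus)
    also have "\<dots> < \<infinity>" using \<eta> by (simp add: nn_integral_add nn_integral_cmult innovation.emeasure_space_1 ennreal_mult_less_top)
    finally show ?thesis .
  qed
  define S where "S n = (\<Sum>k<n. c k)" for n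
  \<comment> \<open>The normalization required by Kronecker's lemma, with the total weight including
    \<open>c n\<close> itself.\<close>
  define a where "a n = c n / S (Suc n)" for n
  have Spos: "0 < S (Suc n)" for n unfolding S_def using c_pos by (intro sum_pos) auto
  have apos: "0 < a n" for n using c_pos Spos by (simp add: a_def)
  obtain B where B: "1 \<le> B" "\<And>n. c n \<le> B" using c_bounded by blast
  have asum: "summable (\<lambda>n. a n powr r)"
    using summable_normalized_weights_powr[OF c_pos B(2) c_sum, of "r - 1"] r by (simp add: a_def S_def)
  have mart: "AE \<omega> in M. summable (\<lambda>n. a n * (h (\<xi> (Suc n) \<omega>) \<bullet> (z n \<omega> - u)))"
  proof (rule weighted_innovations_summable[OF _ r hr hi h0 apos asum])
    show "(\<lambda>\<omega>. z n \<omega> - u) \<in> borel_measurable (\<F> n)" for n using z_adapted[of n] by simp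
    show "0 \<le> 2 * C + 2 * (norm u)\<^sup>2" using C by simp
    show "(\<integral>\<^sup>+ \<omega>. ennreal ((norm (z n \<omega> - u))\<^sup>2) \<partial>M) \<le> ennreal (2 * C + 2 * (norm u)\<^sup>2)" for n
      by (rule shifted_second_moment[OF C])
  qed (use C in auto)
  have sq: "AE \<omega> in M. summable (\<lambda>n. (a n * norm (\<phi> (\<xi> (Suc n) \<omega>)))\<^sup>2) \<and> eventually (\<lambda>n. a n * norm (\<phi> (\<xi> (Suc n) \<omega>)) < 1) sequentially"
    by (rule AE_summable_truncated_squares[OF _ _ r(2) \<phi> _ asum]) (use r apos in \<open>auto intro: less_imp_le\<close>)
  show ?thesis
    using mart sq incr forward_square_summable[OF C] comparison_AE[OF cmp]
  proof eventually_elim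
    case (elim \<omega>)
    define \<Delta> where "\<Delta> k = norm (z (Suc k) \<omega> - z k \<omega>)" for k
    define p where "p k = norm (\<phi> (\<xi> (Suc k) \<omega>))" for k
    define g where "g k = h (\<xi> (Suc k) \<omega>) \<bullet> (z k \<omega> - u)" for k
    define f where "f k = (c k)\<^sup>2 * (norm (b (\<xi> (Suc k) \<omega>) (z k \<omega>)))\<^sup>2" for k
    define V where "V k = (norm (z k \<omega> - u))\<^sup>2" for k
    have fs: "summable f" unfolding f_def[abs_def] by (rule elim(4))
    \<comment> \<open>The squared increment is spent on the forward term alone; the term with
      \<open>\<phi>\<close> is kept as \<open>c k * p k * \<Delta> k\<close>.\<close>
    have one: "2 * c k * (v \<bullet> (z k \<omega> - u)) \<le> V k - V (Suc k) - 2 * (c k * g k) + f k + 2 * (c k * p k * \<Delta> k)" for k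
    proof -
      let ?b = "b (\<xi> (Suc k) \<omega>) (z k \<omega>)" and ?d = "z (Suc k) \<omega> - z k \<omega>"
      have 1: "- 2 * c k * (?b \<bullet> ?d) - (norm ?d)\<^sup>2 \<le> f k"
      proof -
        have "0 \<le> (norm (?d + c k *\<^sub>R ?b))\<^sup>2" by simp
        also have "\<dots> = (norm ?d)\<^sup>2 + 2 * c k * (?b \<bullet> ?d) + f k"
          unfolding power2_norm_eq_inner f_def by (simp add: inner_add inner_commute power2_eq_square algebra_simps)
        finally show ?thesis by simp
      qed
      have "- (\<phi> (\<xi> (Suc k) \<omega>) \<bullet> ?d) \<le> p k * \<Delta> k"
        using Cauchy_Schwarz_ineq2[of "\<phi> (\<xi> (Suc k) \<omega>)" ?d] by (simp add: p_def \<Delta>_def)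
      then have 2: "2 * c k * - (\<phi> (\<xi> (Suc k) \<omega>) \<bullet> ?d) \<le> 2 * c k * (p k * \<Delta> k)" using c_pos[of k] by (intro mult_left_mono) auto
      have 3: "\<eta> (\<xi> (Suc k) \<omega>) \<bullet> (z k \<omega> - u) = v \<bullet> (z k \<omega> - u) + g k" by (simp add: g_def h_def inner_diff_left)
      show ?thesis
        using elim(5)[rule_format, of k] 1 2 unfolding 3 V_def by (simp add: inner_add_left algebra_simps)
    qed
    define m where "m n = (\<Sum>k<n. c k *\<^sub>R z k \<omega>) /\<^sub>R S n" for n
    define F where "F = suminf f"
    have total: "v \<bullet> (m n - u) \<le> (V 0 + F) / (2 * S n) - (\<Sum>k<n. c k * g k) / S n + (\<Sum>k<n. c k * p k * \<Delta> k) / S n" if n: "1 \<le> n" for n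
    proof -
      have Sn: "0 < S n" using Spos[of "n - 1"] n by simp
      have "(\<Sum>k<n. 2 * c k * (v \<bullet> (z k \<omega> - u))) \<le> (\<Sum>k<n. V k - V (Suc k) - 2 * (c k * g k) + f k + 2 * (c k * p k * \<Delta> k))"
        by (intro sum_mono one)
      also have "\<dots> = V 0 - V n - 2 * (\<Sum>k<n. c k * g k) + sum f {..<n} + 2 * (\<Sum>k<n. c k * p k * \<Delta> k)"
        by (induction n) (auto simp: algebra_simps)
      also have "\<dots> \<le> V 0 - 2 * (\<Sum>k<n. c k * g k) + F + 2 * (\<Sum>k<n. c k * p k * \<Delta> k)"
      proof -
        have "sum f {..<n} \<le> F" unfolding F_def by (rule sum_le_suminf[OF fs]) (auto simp: f_def)
        moreover have "0 \<le> V n" by (simp add: V_def)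
        ultimately show ?thesis by linarith
      qed
      also have "(\<Sum>k<n. 2 * c k * (v \<bullet> (z k \<omega> - u))) = 2 * S n * (v \<bullet> (m n - u))"
      proof -
        have "S n *\<^sub>R (m n - u) = (\<Sum>k<n. c k *\<^sub>R (z k \<omega> - u))"
          using Sn by (simp add: m_def S_def scaleR_diff_right sum_subtractf flip: scaleR_left.sum)
        then have "v \<bullet> (S n *\<^sub>R (m n - u)) = (\<Sum>k<n. c k * (v \<bullet> (z k \<omega> - u)))" by (simp add: inner_sum_right)
        then show ?thesis by (simp add: sum_distrib_left mult.assoc)
      qed
      finally have "v \<bullet> (m n - u) \<le> (V 0 - 2 * (\<Sum>k<n. c k * g k) + F + 2 * (\<Sum>k<n. c k * p k * \<Delta> k)) / (2 * S n)"
        using Sn by (simp add: pos_le_divide_eq mult.commute)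
      also have "\<dots> = (V 0 + F) / (2 * S n) - (\<Sum>k<n. c k * g k) / S n + (\<Sum>k<n. c k * p k * \<Delta> k) / S n"
        by (simp add: add_divide_distrib diff_divide_distrib)
      finally show ?thesis .
    qed
    have k1: "(\<lambda>n. (\<Sum>k<n. c k * g k) / S n) \<longlonglongrightarrow> 0"
      unfolding S_def using elim(1) by (intro kronecker_lemma[OF c_pos c_sum]) (simp add: a_def S_def g_def)
    have k2: "(\<lambda>n. (\<Sum>k<n. c k * p k * \<Delta> k) / S n) \<longlonglongrightarrow> 0"
      unfolding S_def
    proof (rule kronecker_lemma[OF c_pos c_sum])
      \<comment> \<open>Both factors are square summable: the normalized selection by the truncation
        argument, the increments by assumption.\<close>
      have "summable (\<lambda>k. (a k * p k)\<^sup>2 + (\<Delta> k)\<^sup>2)" using elim(2,3) by (intro summable_add) (auto simp: p_def \<Delta>_def)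
      then have "summable (\<lambda>k. (a k * p k) * \<Delta> k)"
        by (rule summable_comparison_test') (use abs_mult_le_sum_squares in auto)
      then show "summable (\<lambda>k. c k * p k * \<Delta> k / (\<Sum>j<Suc k. c j))" by (simp add: a_def S_def)
    qed
    have k3: "(\<lambda>n. (V 0 + F) / (2 * S n)) \<longlonglongrightarrow> 0"
      using c_sum unfolding S_def
      by (intro tendsto_divide_0[OF tendsto_const] filterlim_at_top_imp_at_infinity filterlim_tendsto_pos_mult_at_top[OF tendsto_const]) auto
    have err: "(\<lambda>n. (V 0 + F) / (2 * S n) - (\<Sum>k<n. c k * g k) / S n + (\<Sum>k<n. c k * p k * \<Delta> k) / S n) \<longlonglongrightarrow> 0"
      using tendsto_add[OF tendsto_diff[OF k3 k1] k2] by simp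
    \<comment> \<open>The summed inequality concerns means of \<open>z k\<close>, the conclusion
      means of \<open>z (Suc k)\<close>; they differ by a weighted mean of increments, which
      vanishes.\<close>
    have "(\<lambda>k. (\<Delta> k)\<^sup>2) \<longlonglongrightarrow> 0" using summable_LIMSEQ_zero[OF elim(3)] by (simp add: \<Delta>_def)
    then have "(\<lambda>k. sqrt ((\<Delta> k)\<^sup>2)) \<longlonglongrightarrow> sqrt 0" by (rule tendsto_real_sqrt)
    then have "(\<lambda>k. norm (z (Suc k) \<omega> - z k \<omega>)) \<longlonglongrightarrow> 0" by (simp add: \<Delta>_def)
    then have "(\<lambda>k. z (Suc k) \<omega> - z k \<omega>) \<longlonglongrightarrow> 0" by (rule tendsto_norm_zero_cancel)
    then have dm: "(\<lambda>n. (\<Sum>k<n. c k *\<^sub>R (z (Suc k) \<omega> - z k \<omega>)) /\<^sub>R S n) \<longlonglongrightarrow> 0"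
      unfolding S_def using c_pos by (intro weighted_mean_tendsto[OF _ c_sum]) (auto intro: less_imp_le)
    show ?case
    proof (intro allI impI)
      fix q l assume q: "strict_mono (q :: nat \<Rightarrow> nat)" and l: "(\<lambda>n. (\<Sum>k<q n. c k *\<^sub>R z (Suc k) \<omega>) /\<^sub>R (\<Sum>k<q n. c k)) \<longlonglongrightarrow> l"
      have sub: "filterlim q sequentially sequentially" by (rule filterlim_subseq[OF q])
      have "(\<lambda>n. (\<Sum>k<q n. c k *\<^sub>R z (Suc k) \<omega>) /\<^sub>R S (q n) - (\<Sum>k<q n. c k *\<^sub>R (z (Suc k) \<omega> - z k \<omega>)) /\<^sub>R S (q n)) \<longlonglongrightarrow> l - 0"
        using l by (intro tendsto_diff filterlim_compose[OF dm sub]) (simp add: S_def)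
      then have "(\<lambda>n. m (q n)) \<longlonglongrightarrow> l" by (simp add: m_def scaleR_diff_right sum_subtractf)
      then have "(\<lambda>n. v \<bullet> (m (q n) - u)) \<longlonglongrightarrow> v \<bullet> (l - u)" by (intro tendsto_intros)
      moreover have "eventually (\<lambda>n. v \<bullet> (m (q n) - u) \<le> (V 0 + F) / (2 * S (q n)) - (\<Sum>k<q n. c k * g k) / S (q n) + (\<Sum>k<q n. c k * p k * \<Delta> k) / S (q n)) sequentially"
        using filterlim_compose[OF sub filterlim_ident] eventually_compose_filterlim[OF eventually_ge_at_top[of 1] sub]
        by (auto elim!: eventually_mono intro!: total)
      ultimately have "v \<bullet> (l - u) \<le> 0"
        using tendsto_le[OF sequentially_bot filterlim_compose[OF err sub]] by blast
      then show "0 \<le> (\<integral>s. \<eta> s \<partial>\<mu>) \<bullet> (u - l)" by (simp add: v_def inner_diff_right)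
    qed
  qed
qed

end

text \<open>Nearest points \<open>y k\<close> in the closure have their weighted means inside this
  closed convex set, and the means of \<open>x k - y k\<close> vanish.\<close>

lemma weighted_mean_cluster_in_closure:
  fixes x :: "nat \<Rightarrow> 'a::euclidean_space" and c :: "nat \<Rightarrow> real"
  assumes D: "convex D" "D \<noteq> {}" and x: "(\<lambda>k. infdist (x k) D) \<longlonglongrightarrow> 0"
    and c: "\<And>k. 0 < c k" "filterlim (\<lambda>n. \<Sum>k<n. c k) at_top sequentially"
    and q: "strict_mono (q :: nat \<Rightarrow> nat)" "(\<lambda>n. (\<Sum>k<q n. c k *\<^sub>R x k) /\<^sub>R (\<Sum>k<q n. c k)) \<longlonglongrightarrow> l"
  shows "l \<in> closure D"
proof -
  have "\<exists>y. y \<in> closure D \<and> infdist (x k) D = dist (x k) y" for k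
  proof -
    have "closure D \<noteq> {}" using D(2) by simp
    then obtain y where "y \<in> closure D" "infdist (x k) (closure D) = dist (x k) y"
      using infdist_attains_inf[OF closed_closure] by blast
    then show ?thesis by (auto simp: infdist_eq_setdist)
  qed
  then obtain y where y: "\<And>k. y k \<in> closure D" "\<And>k. infdist (x k) D = dist (x k) (y k)" by metis
  have "(\<lambda>k. x k - y k) \<longlonglongrightarrow> 0" using x unfolding y dist_norm by (rule tendsto_norm_zero_cancel)
  then have "(\<lambda>n. (\<Sum>k<n. c k *\<^sub>R (x k - y k)) /\<^sub>R (\<Sum>k<n. c k)) \<longlonglongrightarrow> 0"
    using c by (intro weighted_mean_tendsto) (auto intro: less_imp_le)
  then have "(\<lambda>n. (\<Sum>k<q n. c k *\<^sub>R x k) /\<^sub>R (\<Sum>k<q n. c k) - (\<Sum>k<q n. c k *\<^sub>R (x k - y k)) /\<^sub>R (\<Sum>k<q n. c k)) \<longlonglongrightarrow> l - 0"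
    by (intro tendsto_diff q filterlim_compose[OF _ filterlim_subseq[OF q(1)]])
  then have lim: "(\<lambda>n. (\<Sum>k<q n. c k *\<^sub>R y k) /\<^sub>R (\<Sum>k<q n. c k)) \<longlonglongrightarrow> l"
    by (simp add: scaleR_diff_right sum_subtractf)
  have "(\<Sum>k<n. c k *\<^sub>R y k) /\<^sub>R (\<Sum>k<n. c k) \<in> closure D" if "1 \<le> n" for n
  proof -
    have pos: "0 < (\<Sum>k<n. c k)" using c that by (intro sum_pos) (auto simp: lessThan_empty_iff)
    have "(\<Sum>k<n. (c k / (\<Sum>k<n. c k)) *\<^sub>R y k) \<in> closure D"
      using pos c y convex_closure[OF D(1)]
      by (intro convex_sum) (auto simp: less_imp_le sum_divide_distrib[symmetric])
    then show ?thesis by (simp add: scaleR_sum_right divide_inverse mult.commute)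
  qed
  moreover have "eventually (\<lambda>n. 1 \<le> q n) sequentially"
    using eventually_compose_filterlim[OF eventually_ge_at_top[of 1] filterlim_subseq[OF q(1)]] .
  ultimately have "eventually (\<lambda>n. (\<Sum>k<q n. c k *\<^sub>R y k) /\<^sub>R (\<Sum>k<q n. c k) \<in> closure D) sequentially"
    by (auto elim!: eventually_mono)
  then show ?thesis by (rule Lim_in_closed_set[OF closed_closure _ sequentially_bot lim])
qed

text \<open>Opial's argument for weighted means: the difference of two squared distances is affine in
  the iterate, so it has the same limit along the means, and two cluster points must coincide.\<close>

lemma weighted_mean_opial:
  fixes z :: "nat \<Rightarrow> 'a::euclidean_space" and c :: "nat \<Rightarrow> real"
  assumes S: "S0 \<subseteq> S" "S \<subseteq> closure S0" "S \<noteq> {}"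
    and dist: "\<And>u. u \<in> S0 \<Longrightarrow> convergent (\<lambda>n. norm (z n - u))"
    and c: "\<And>k. 0 < c k" "filterlim (\<lambda>n. \<Sum>k<n. c k) at_top sequentially"
    and cluster: "\<And>q l. strict_mono (q :: nat \<Rightarrow> nat) \<Longrightarrow>
      (\<lambda>n. (\<Sum>k<q n. c k *\<^sub>R z (Suc k)) /\<^sub>R (\<Sum>k<q n. c k)) \<longlonglongrightarrow> l \<Longrightarrow> l \<in> S"
  shows "\<exists>l\<in>S. (\<lambda>n. (\<Sum>k<n. c k *\<^sub>R z (Suc k)) /\<^sub>R (\<Sum>k<n. c k)) \<longlonglongrightarrow> l"
proof -
  \<comment> \<open>Distances to \<open>u\<close> and to a nearby \<open>u0\<close> differ by at
    most \<open>dist u0 u\<close>, uniformly in \<open>n\<close>; convergence thus passes from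
    \<open>S0\<close> to \<open>S\<close>.\<close>
  have distS: "convergent (\<lambda>n. norm (z n - u))" if u: "u \<in> S" for u
  proof (rule Cauchy_convergent, rule CauchyI)
    fix e :: real assume e: "0 < e"
    obtain u0 where u0: "u0 \<in> S0" "dist u0 u < e / 3" using S(2) u e by (meson closure_approachable divide_pos_pos subsetD zero_less_numeral)
    obtain N where N: "\<And>m n. m \<ge> N \<Longrightarrow> n \<ge> N \<Longrightarrow> norm (norm (z m - u0) - norm (z n - u0)) < e / 3"
      using CauchyD[OF convergent_Cauchy[OF dist[OF u0(1)]], of "e / 3"] e by auto
    have close: "\<bar>norm (z n - u) - norm (z n - u0)\<bar> < e / 3" for n
      using norm_triangle_ineq3[of "z n - u" "z n - u0"] u0(2) by (simp add: dist_norm norm_minus_commute)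
    have "norm (norm (z m - u) - norm (z n - u)) < e" if "m \<ge> N" "n \<ge> N" for m n
      using N[OF that] close[of m] close[of n] by (simp add: abs_if split: if_splits)
    then show "\<exists>N. \<forall>m\<ge>N. \<forall>n\<ge>N. norm (norm (z m - u) - norm (z n - u)) < e" by blast
  qed
  define a where "a n = (\<Sum>k<n. c k *\<^sub>R z (Suc k)) /\<^sub>R (\<Sum>k<n. c k)" for n
  obtain u where u: "u \<in> S" using S(3) by auto
  have "bounded (range (\<lambda>n. norm (z n - u)))" using distS[OF u] by (auto simp: convergent_def intro: convergent_imp_bounded)
  then obtain B where B: "\<And>n. norm (z n - u) \<le> B" unfolding bounded_iff by (metis abs_norm_cancel rangeI real_norm_def)
  have zB: "norm (z n) \<le> B + norm u" for n using B[of n] norm_triangle_sub[of "z n" u] by simp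
  have B0: "0 \<le> B + norm u" using zB[of 0] norm_ge_zero order_trans by blast
  have aB: "norm (a n) \<le> B + norm u" for n
  proof (cases "n = 0")
    case False
    have pos: "0 < (\<Sum>k<n. c k)" using c False by (intro sum_pos) (auto simp: lessThan_empty_iff)
    have "norm (\<Sum>k<n. c k *\<^sub>R z (Suc k)) \<le> (\<Sum>k<n. c k * (B + norm u))"
      using c(1) zB by (intro sum_norm_le) (auto intro!: mult_left_mono simp: less_imp_le abs_of_pos)
    also have "\<dots> = (\<Sum>k<n. c k) * (B + norm u)" by (rule sum_distrib_right[symmetric])
    finally have "norm (\<Sum>k<n. c k *\<^sub>R z (Suc k)) / (\<Sum>k<n. c k) \<le> B + norm u" using pos by (simp add: pos_divide_le_eq mult.commute)
    then show ?thesis using pos by (simp add: a_def divide_inverse mult.commute)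
  qed (use B0 in \<open>simp add: a_def\<close>)
  have unique: "p = q" if p: "strict_mono r" "(a \<circ> r) \<longlonglongrightarrow> p" and q: "strict_mono r'" "(a \<circ> r') \<longlonglongrightarrow> q" for p q r r'
  proof -
    have pS: "p \<in> S" "q \<in> S" using cluster[OF p(1), of p] cluster[OF q(1), of q] p(2) q(2) by (auto simp: a_def o_def)
    obtain P where P: "(\<lambda>n. norm (z n - p)) \<longlonglongrightarrow> P" using distS[OF pS(1)] by (auto simp: convergent_def)
    obtain Q where Q: "(\<lambda>n. norm (z n - q)) \<longlonglongrightarrow> Q" using distS[OF pS(2)] by (auto simp: convergent_def)
    have eq: "z n \<bullet> (p - q) = ((norm (z n - q))\<^sup>2 - (norm (z n - p))\<^sup>2 + (p \<bullet> p - q \<bullet> q)) / 2" for n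
      unfolding power2_norm_eq_inner by (simp add: inner_diff inner_commute)
    define k where "k = (Q\<^sup>2 - P\<^sup>2 + (p \<bullet> p - q \<bullet> q)) / 2"
    have "(\<lambda>n. z n \<bullet> (p - q)) \<longlonglongrightarrow> k" unfolding eq k_def by (intro tendsto_intros P Q) simp
    then have "(\<lambda>n. z (Suc n) \<bullet> (p - q)) \<longlonglongrightarrow> k" by (rule LIMSEQ_Suc)
    then have "(\<lambda>n. (\<Sum>k<n. c k *\<^sub>R (z (Suc k) \<bullet> (p - q))) /\<^sub>R (\<Sum>k<n. c k)) \<longlonglongrightarrow> k"
      using c by (intro weighted_mean_tendsto) (auto intro: less_imp_le)
    then have ak: "(\<lambda>n. a n \<bullet> (p - q)) \<longlonglongrightarrow> k" by (simp add: a_def inner_sum_left)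
    have "(\<lambda>n. a (r n) \<bullet> (p - q)) \<longlonglongrightarrow> k" "(\<lambda>n. a (r' n) \<bullet> (p - q)) \<longlonglongrightarrow> k"
      using LIMSEQ_subseq_LIMSEQ[OF ak p(1)] LIMSEQ_subseq_LIMSEQ[OF ak q(1)] by (auto simp: o_def)
    moreover have "(\<lambda>n. a (r n) \<bullet> (p - q)) \<longlonglongrightarrow> p \<bullet> (p - q)" "(\<lambda>n. a (r' n) \<bullet> (p - q)) \<longlonglongrightarrow> q \<bullet> (p - q)"
      using p(2) q(2) by (auto simp: o_def intro!: tendsto_intros)
    ultimately have "p \<bullet> (p - q) = q \<bullet> (p - q)" using LIMSEQ_unique by metis
    then have "(p - q) \<bullet> (p - q) = 0" by (simp add: inner_diff_left)
    then show ?thesis by simp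
  qed
  have bd: "bounded (range a)" using aB by (auto simp: bounded_iff)
  then obtain l r where r: "strict_mono (r :: nat \<Rightarrow> nat)" "(a \<circ> r) \<longlonglongrightarrow> l"
    using bounded_imp_convergent_subsequence by blast
  have "a \<longlonglongrightarrow> l" by (rule tendsto_unique_cluster_point[OF bd]) (rule unique[OF _ _ r])
  moreover have "l \<in> S" using cluster[OF r(1), of l] r(2) by (simp add: a_def o_def)
  ultimately show ?thesis unfolding a_def by blast
qed

section \<open>Spaces of random vectors\<close>

lemma Lr_nn_integral:
  "\<phi> \<in> Lr M r \<longleftrightarrow> \<phi> \<in> borel_measurable M \<and> (\<integral>\<^sup>+ s. ennreal (norm (\<phi> s) powr r) \<partial>M) < \<infinity>"
  by (auto simp: Lr_def integrable_iff_bounded)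

lemma Lr_power: "0 < k \<Longrightarrow> \<phi> \<in> Lr M (real k) \<longleftrightarrow> \<phi> \<in> borel_measurable M \<and> integrable M (\<lambda>s. norm (\<phi> s) ^ k)"
  by (simp add: Lr_def powr_realpow')

lemma Lr_dominated_sum:
  fixes \<phi> :: "'s \<Rightarrow> 'a::euclidean_space" and \<psi> :: "'s \<Rightarrow> 'b::euclidean_space" and h :: "'s \<Rightarrow> 'c::euclidean_space"
  assumes \<phi>: "\<phi> \<in> Lr M r" and \<psi>: "\<psi> \<in> Lr M r" and h: "h \<in> borel_measurable M"
    and r: "0 \<le> r" and le: "\<And>s. s \<in> space M \<Longrightarrow> norm (h s) \<le> norm (\<phi> s) + norm (\<psi> s)"
  shows "h \<in> Lr M r"
proof -
  have "norm (h s) powr r \<le> 2 powr r * (norm (\<phi> s) powr r + norm (\<psi> s) powr r)" if s: "s \<in> space M" for s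
  proof -
    define k where "k = max (norm (\<phi> s)) (norm (\<psi> s))"
    have "norm (h s) powr r \<le> (2 * k) powr r" using le[OF s] r by (intro powr_mono2) (auto simp: k_def)
    also have "\<dots> = 2 powr r * k powr r" by (simp add: powr_mult k_def)
    also have "\<dots> \<le> 2 powr r * (norm (\<phi> s) powr r + norm (\<psi> s) powr r)"
      unfolding k_def max_def by (intro mult_left_mono) auto
    finally show ?thesis .
  qed
  note bound = this
  have int: "integrable M (\<lambda>s. 2 powr r * (norm (\<phi> s) powr r + norm (\<psi> s) powr r))"
    using \<phi> \<psi> by (auto simp: Lr_def)
  have "integrable M (\<lambda>s. norm (h s) powr r)"
    by (rule Bochner_Integration.integrable_bound[OF int]) (use h bound in \<open>auto intro!: AE_I2\<close>)
  then show ?thesis using h by (simp add: Lr_def)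
qed

lemma Lr_add: "\<phi> \<in> Lr M r \<Longrightarrow> \<psi> \<in> Lr M r \<Longrightarrow> 0 \<le> r \<Longrightarrow> (\<lambda>s. \<phi> s + \<psi> s) \<in> Lr M r"
  by (rule Lr_dominated_sum[of \<phi> M r \<psi>]) (auto simp: Lr_def norm_triangle_ineq)

lemma Lr_Pair: "\<phi> \<in> Lr M r \<Longrightarrow> \<psi> \<in> Lr M r \<Longrightarrow> 0 \<le> r \<Longrightarrow> (\<lambda>s. (\<phi> s, \<psi> s)) \<in> Lr M r"
  by (rule Lr_dominated_sum[of \<phi> M r \<psi>]) (auto simp: Lr_def norm_Pair_le)

lemma (in prob_space) Lr_mono:
  assumes \<phi>: "\<phi> \<in> Lr M q" and r: "0 \<le> r" "r \<le> q"
  shows "\<phi> \<in> Lr M r"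
proof -
  have "norm (\<phi> s) powr r \<le> 1 + norm (\<phi> s) powr q" for s
  proof (cases "norm (\<phi> s) \<le> 1")
    case True
    then have "norm (\<phi> s) powr r \<le> 1" using r powr_le1 by auto
    then show ?thesis by (simp add: add_increasing2)
  next
    case False
    then have "norm (\<phi> s) powr r \<le> norm (\<phi> s) powr q" using r by (intro powr_mono) auto
    then show ?thesis by simp
  qed
  then have "integrable M (\<lambda>s. norm (\<phi> s) powr r)"
    using \<phi> by (intro Bochner_Integration.integrable_bound[of M "\<lambda>s. 1 + norm (\<phi> s) powr q" "\<lambda>s. norm (\<phi> s) powr r"])
      (auto simp: Lr_def abs_of_nonneg add_nonneg_nonneg)
  then show ?thesis using \<phi> by (simp add: Lr_def)
qed

lemma (in prob_space) Lr_integrable: "\<phi> \<in> Lr M r \<Longrightarrow> 1 \<le> r \<Longrightarrow> integrable M \<phi>"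
  using Lr_mono[of \<phi> r 1] integrable_norm_iff[of \<phi> M] by (simp add: Lr_def)

lemma integral_Pair:
  fixes \<phi> :: "'s \<Rightarrow> 'a::euclidean_space" and \<psi> :: "'s \<Rightarrow> 'b::euclidean_space"
  assumes "integrable M \<phi>" "integrable M \<psi>"
  shows "integrable M (\<lambda>s. (\<phi> s, \<psi> s))" "(\<integral>s. (\<phi> s, \<psi> s) \<partial>M) = (\<integral>s. \<phi> s \<partial>M, \<integral>s. \<psi> s \<partial>M)"
proof -
  have "integrable M (\<lambda>s. norm (\<phi> s) + norm (\<psi> s))" using assms by auto
  then show int: "integrable M (\<lambda>s. (\<phi> s, \<psi> s))"
    using assms by (elim Bochner_Integration.integrable_bound) (auto intro!: AE_I2 order_trans[OF norm_Pair_le])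
  show "(\<integral>s. (\<phi> s, \<psi> s) \<partial>M) = (\<integral>s. \<phi> s \<partial>M, \<integral>s. \<psi> s \<partial>M)"
    using integral_bounded_linear[OF bounded_linear_fst int] integral_bounded_linear[OF bounded_linear_snd int]
    by (simp add: prod_eq_iff)
qed

section \<open>Adjoints of random operators\<close>

lemma adjoint_blinfun:
  fixes L :: "'a::euclidean_space \<Rightarrow>\<^sub>L 'b::euclidean_space"
  shows "adjoint (blinfun_apply L) y \<bullet> x = y \<bullet> blinfun_apply L x"
  using adjoint_works[of "blinfun_apply L" x y] blinfun.bounded_linear_right[of L]
  by (simp add: bounded_linear.linear inner_commute)

text \<open>In coordinates only the images of the basis vectors occur, so measurability and
  integration of the random adjoint reduce to those of \<open>L\<close> at fixed vectors.\<close>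

lemma adjoint_blinfun_expand:
  fixes L :: "'a::euclidean_space \<Rightarrow>\<^sub>L 'b::euclidean_space"
  shows "adjoint (blinfun_apply L) y = (\<Sum>i\<in>Basis. (blinfun_apply L i \<bullet> y) *\<^sub>R i)"
  using euclidean_representation[of "adjoint (blinfun_apply L) y", unfolded adjoint_blinfun]
  by (simp add: inner_commute[of y])

lemma norm_adjoint_blinfun_le:
  fixes L :: "'a::euclidean_space \<Rightarrow>\<^sub>L 'b::euclidean_space"
  shows "norm (adjoint (blinfun_apply L) y) \<le> norm L * norm y"
proof -
  define v where "v = adjoint (blinfun_apply L) y"
  have "(norm v)\<^sup>2 = y \<bullet> blinfun_apply L v" by (simp add: v_def power2_norm_eq_inner adjoint_blinfun)
  also have "\<dots> \<le> norm y * (norm L * norm v)"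
    by (intro order_trans[OF norm_cauchy_schwarz] mult_left_mono norm_blinfun) auto
  finally have "norm v * norm v \<le> (norm L * norm y) * norm v" by (simp add: power2_eq_square mult_ac)
  then show ?thesis by (cases "norm v = 0") (auto simp: v_def)
qed

lemma blinfun_apply_measurable:
  fixes L :: "'s \<Rightarrow> 'a::euclidean_space \<Rightarrow>\<^sub>L 'b::euclidean_space"
  assumes "L \<in> borel_measurable M" "f \<in> borel_measurable M"
  shows "(\<lambda>s. blinfun_apply (L s) (f s)) \<in> borel_measurable M"
  using assms by (rule borel_measurable_continuous_Pair) (intro continuous_intros)

lemma adjoint_measurable:
  fixes L :: "'s \<Rightarrow> 'a::euclidean_space \<Rightarrow>\<^sub>L 'b::euclidean_space"
  assumes "L \<in> borel_measurable M" "f \<in> borel_measurable M"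
  shows "(\<lambda>s. adjoint (blinfun_apply (L s)) (f s)) \<in> borel_measurable M"
  unfolding adjoint_blinfun_expand
  using assms blinfun_apply_measurable[OF assms(1) borel_measurable_const]
  by (intro borel_measurable_sum borel_measurable_scaleR borel_measurable_inner) auto

lemma integral_blinfun_apply:
  fixes L :: "'s \<Rightarrow> 'a::euclidean_space \<Rightarrow>\<^sub>L 'b::euclidean_space"
  assumes L: "integrable M L"
  shows "integrable M (\<lambda>s. blinfun_apply (L s) x)" "(\<integral>s. blinfun_apply (L s) x \<partial>M) = blinfun_apply (\<integral>s. L s \<partial>M) x"
  using integrable_bounded_linear[OF blinfun.bounded_linear_left L] integral_bounded_linear[OF blinfun.bounded_linear_left L] by auto

lemma integral_adjoint:
  fixes L :: "'s \<Rightarrow> 'a::euclidean_space \<Rightarrow>\<^sub>L 'b::euclidean_space"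
  assumes L: "integrable M L"
  shows "integrable M (\<lambda>s. adjoint (blinfun_apply (L s)) y)"
    "(\<integral>s. adjoint (blinfun_apply (L s)) y \<partial>M) = adjoint (blinfun_apply (\<integral>s. L s \<partial>M)) y"
  unfolding adjoint_blinfun_expand
  using integral_blinfun_apply[OF L]
  by (auto simp: Bochner_Integration.integral_sum integral_scaleR_left integral_inner_left)

section \<open>The primal-dual iteration\<close>

text \<open>Polarization produces \<open>(t - y) . (t - u)\<close>. The backward part is compared at
  \<open>t\<close>, where its subgradient lives, the forward part at \<open>y\<close>; exchanging
  the base points costs the term \<open>(b + \<phi>) . (t - y)\<close>.\<close>

lemma forward_backward_inequality:
  fixes t y u a b \<phi> \<psi> :: "'e::euclidean_space"
  assumes step: "t - y = - k *\<^sub>R (b + a)" and k: "0 \<le> k"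
    and a: "0 \<le> (a - \<phi>) \<bullet> (t - u)" and b: "0 \<le> (b - \<psi>) \<bullet> (y - u)"
  shows "(norm (t - u))\<^sup>2 \<le> (norm (y - u))\<^sup>2 - 2 * k * ((\<phi> + \<psi>) \<bullet> (y - u)) - 2 * k * ((b + \<phi>) \<bullet> (t - y)) - (norm (t - y))\<^sup>2"
proof -
  have "(norm (t - u))\<^sup>2 = (norm (y - u))\<^sup>2 + 2 * ((t - y) \<bullet> (t - u)) - (norm (t - y))\<^sup>2"
    unfolding power2_norm_eq_inner by (simp add: inner_diff inner_commute)
  also have "(t - y) \<bullet> (t - u) = - k * ((b + a) \<bullet> (t - u))" unfolding step by simp
  also have "(b + a) \<bullet> (t - u) = (a - \<phi>) \<bullet> (t - u) + (b - \<psi>) \<bullet> (y - u) + (\<phi> + \<psi>) \<bullet> (y - u) + (b + \<phi>) \<bullet> (t - y)"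
    by (simp add: inner_diff inner_add)
  finally have "(norm (t - u))\<^sup>2 = (norm (y - u))\<^sup>2 - 2 * k * ((a - \<phi>) \<bullet> (t - u) + (b - \<psi>) \<bullet> (y - u))
      - 2 * k * ((\<phi> + \<psi>) \<bullet> (y - u)) - 2 * k * ((b + \<phi>) \<bullet> (t - y)) - (norm (t - y))\<^sup>2"
    by (simp add: algebra_simps)
  moreover have "0 \<le> 2 * k * ((a - \<phi>) \<bullet> (t - u) + (b - \<psi>) \<bullet> (y - u))" using k a b by simp
  ultimately show ?thesis by linarith
qed

text \<open>The data and assumptions that do not involve the random process, with \<open>g\<close>
  and \<open>p\<close> as two instances of the same locale; the filtration and the draws are added
  later.\<close>

locale primal_dual = g: mean_integrand \<mu> g G + p: mean_integrand \<mu> p P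
  for \<mu> :: "'s measure" and g :: "'s \<Rightarrow> 'a::euclidean_space \<Rightarrow> ereal" and G
    and p :: "'s \<Rightarrow> 'b::euclidean_space \<Rightarrow> ereal" and P +
  fixes f :: "'s \<Rightarrow> 'a \<Rightarrow> ereal" and F :: "'a \<Rightarrow> ereal" and L :: "'s \<Rightarrow> 'a \<Rightarrow>\<^sub>L 'b" and A :: "'a \<Rightarrow>\<^sub>L 'b"
    and gradf :: "'s \<Rightarrow> 'a \<Rightarrow> 'a" and m :: nat and \<beta> :: "'s \<Rightarrow> real"
  assumes f_normal: "convex_normal_integrand \<mu> f" and f_Gamma0: "AE s in \<mu>. f s \<in> Gamma0"
    and f_finite: "\<And>y. (\<integral>\<^sup>+ s. e2ennreal \<bar>f s y\<bar> \<partial>\<mu>) < \<infinity>"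
    and F_mean: "F = (\<lambda>y. extended_expectation \<mu> (\<lambda>s. f s y))"
    and L_measurable: "L \<in> borel_measurable \<mu>" and A_mean: "A = (\<integral>s. L s \<partial>\<mu>)"
    and gradf_measurable: "(\<lambda>(s, y). gradf s y) \<in> borel_measurable (\<mu> \<Otimes>\<^sub>M borel)"
    and gradf_selection: "\<And>y. (\<lambda>s. gradf s y) \<in> selections \<mu> 1 f y"
    and m: "2 \<le> m" and L_moment: "integrable \<mu> (\<lambda>s. norm (L s) ^ (2 * m))"
    and \<beta>_measurable: "\<beta> \<in> borel_measurable \<mu>" and \<beta>_nonneg: "\<And>s. s \<in> space \<mu> \<Longrightarrow> 0 \<le> \<beta> s"
    and \<beta>_moment: "integrable \<mu> (\<lambda>s. \<beta> s ^ (2 * m))"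
    and gradf_growth: "\<And>s y. s \<in> space \<mu> \<Longrightarrow> norm (gradf s y) \<le> \<beta> s * (1 + norm y)"
    and g_interchange: "subdifferential_interchange \<mu> g G" and p_interchange: "subdifferential_interchange \<mu> p P"
    and g_moment: "compact_moment_condition \<mu> g G" and p_moment: "compact_moment_condition \<mu> p P"
    and g_domain: "domain_regularity \<mu> g G" and p_domain: "domain_regularity \<mu> p P"
    and representation: "\<exists>(xs, ls)\<in>saddle_points F G (fenchel_conjugate P) A. integrable_representation \<mu> (real (2 * m)) f g p A xs ls"
    and representation_square: "\<forall>(xs, ls)\<in>saddle_points F G (fenchel_conjugate P) A. integrable_representation \<mu> 2 f g p A xs ls"
begin

lemma m_pos: "0 < 2 * m" using m by simp

lemma L_Lr: "(\<lambda>s. norm (L s)) \<in> Lr \<mu> (real (2 * m))"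
  using L_moment L_measurable m_pos by (subst Lr_power) auto

lemma L_integrable: "integrable \<mu> L"
  using g.Lr_integrable[OF L_Lr] m L_measurable by (simp add: integrable_norm_iff)

lemma \<beta>_Lr: "\<beta> \<in> Lr \<mu> (real (2 * m))"
  using \<beta>_moment \<beta>_measurable m_pos by (subst Lr_power) (auto simp: power_mult)

lemma gradf_section: "(\<lambda>s. gradf s y) \<in> borel_measurable \<mu>"
  using measurable_compose[OF measurable_Pair2' gradf_measurable, of y] by simp

lemma gradf_Lr: "(\<lambda>s. gradf s y) \<in> Lr \<mu> (real (2 * m))"
proof (rule Lr_dominated_sum[OF \<beta>_Lr])
  show "(\<lambda>s. \<beta> s *\<^sub>R y) \<in> Lr \<mu> (real (2 * m))"
    using \<beta>_moment \<beta>_measurable m_pos by (subst Lr_power) (auto simp: power_mult_distrib power_mult)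
  show "norm (gradf s y) \<le> norm (\<beta> s) + norm (\<beta> s *\<^sub>R y)" if "s \<in> space \<mu>" for s
    using gradf_growth[OF that, of y] \<beta>_nonneg[OF that] by (simp add: algebra_simps)
qed (use gradf_section in auto)

lemma adjoint_Lr: "(\<lambda>s. adjoint (blinfun_apply (L s)) y) \<in> Lr \<mu> (real (2 * m))"
proof (rule Lr_dominated_sum)
  show "(\<lambda>s. norm (L s) *\<^sub>R y) \<in> Lr \<mu> (real (2 * m))" "(\<lambda>s. 0 :: real) \<in> Lr \<mu> (real (2 * m))"
    using L_moment L_measurable m_pos by (subst Lr_power; auto simp: power_mult_distrib)+
qed (use norm_adjoint_blinfun_le adjoint_measurable[OF L_measurable] in auto)

lemma apply_Lr: "(\<lambda>s. - blinfun_apply (L s) x) \<in> Lr \<mu> (real (2 * m))"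
proof (rule Lr_dominated_sum)
  show "(\<lambda>s. norm (L s) *\<^sub>R x) \<in> Lr \<mu> (real (2 * m))" "(\<lambda>s. 0 :: real) \<in> Lr \<mu> (real (2 * m))"
    using L_moment L_measurable m_pos by (subst Lr_power; auto simp: power_mult_distrib)+
qed (use norm_blinfun blinfun_apply_measurable[OF L_measurable] in auto)

lemma gradf_subgradient: "AE s in \<mu>. gradf s y \<in> subdifferential (f s) y"
  using gradf_selection[of y] by (auto simp: selections_def split: if_splits)

section \<open>The mean of \<open>f\<close> as a real convex function\<close>

definition mean_f :: "'a \<Rightarrow> real" where "mean_f y = (\<integral>s. real_of_ereal (f s y) \<partial>\<mu>)"

lemma f_real: "AE s in \<mu>. f s y = ereal (real_of_ereal (f s y))" "integrable \<mu> (\<lambda>s. real_of_ereal (f s y))"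
proof -
  note [measurable] = normal_integrand_measurable[OF f_normal]
  have "AE s in \<mu>. e2ennreal \<bar>f s y\<bar> \<noteq> \<infinity>" using f_finite[of y] by (intro nn_integral_PInf_AE) auto
  then show 1: "AE s in \<mu>. f s y = ereal (real_of_ereal (f s y))"
  proof eventually_elim
    case (elim s)
    then show ?case by (cases "f s y") auto
  qed
  have "(\<integral>\<^sup>+ s. ennreal (norm (real_of_ereal (f s y))) \<partial>\<mu>) = (\<integral>\<^sup>+ s. e2ennreal \<bar>f s y\<bar> \<partial>\<mu>)"
    by (rule nn_integral_cong_AE, use 1 in eventually_elim) (metis abs_ereal.simps(1) e2ennreal_ereal real_norm_def)
  then show "integrable \<mu> (\<lambda>s. real_of_ereal (f s y))" using f_finite[of y] by (intro integrableI_bounded) auto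
qed

lemma F_eq: "F = (\<lambda>y. ereal (mean_f y))"
  unfolding F_mean mean_f_def
  by (intro ext extended_expectation_integrable[OF normal_integrand_measurable[OF f_normal] f_real(2,1)])

lemma F_subgradient:
  assumes \<phi>: "integrable \<mu> \<phi>" "AE s in \<mu>. \<phi> s \<in> subdifferential (f s) x"
  shows "(\<integral>s. \<phi> s \<partial>\<mu>) \<in> subdifferential (\<lambda>y. ereal (mean_f y)) x"
proof -
  have "mean_f x + (\<integral>s. \<phi> s \<partial>\<mu>) \<bullet> (y - x) \<le> mean_f y" for y
  proof -
    have "mean_f x + (\<integral>s. \<phi> s \<partial>\<mu>) \<bullet> (y - x) = (\<integral>s. real_of_ereal (f s x) + \<phi> s \<bullet> (y - x) \<partial>\<mu>)"
      unfolding mean_f_def using f_real(2)[of x] \<phi>(1) by (simp add: integral_inner_left)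
    also have "\<dots> \<le> mean_f y"
      unfolding mean_f_def
    proof (rule integral_mono_AE)
      show "AE s in \<mu>. real_of_ereal (f s x) + \<phi> s \<bullet> (y - x) \<le> real_of_ereal (f s y)"
        using f_real(1)[of x] f_real(1)[of y] \<phi>(2)
      proof eventually_elim
        case (elim s)
        show ?case using subdifferentialD[OF elim(3), of y] elim(1,2) by (metis ereal_less_eq(3) plus_ereal.simps(1))
      qed
    qed (use f_real(2) \<phi>(1) in auto)
    finally show ?thesis .
  qed
  then show ?thesis by (simp add: subdifferential_def)
qed

lemma mean_f_convex: "convex_on UNIV mean_f"
proof (rule convex_onI)
  fix t :: real and x y :: 'a assume t: "0 < t" "t < 1"
  have "mean_f ((1 - t) *\<^sub>R x + t *\<^sub>R y) \<le> (\<integral>s. (1 - t) * real_of_ereal (f s x) + t * real_of_ereal (f s y) \<partial>\<mu>)"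
    unfolding mean_f_def
  proof (rule integral_mono_AE)
    show "AE s in \<mu>. real_of_ereal (f s ((1 - t) *\<^sub>R x + t *\<^sub>R y)) \<le> (1 - t) * real_of_ereal (f s x) + t * real_of_ereal (f s y)"
      using f_real(1)[of x] f_real(1)[of y] f_real(1)[of "(1 - t) *\<^sub>R x + t *\<^sub>R y"] f_Gamma0
    proof eventually_elim
      case (elim s)
      have "f s ((1 - t) *\<^sub>R x + t *\<^sub>R y) \<le> ereal (1 - t) * f s x + ereal t * f s y"
        using elim(4) t by (auto simp: Gamma0_def convex_fun_def)
      then show ?case using elim(1-3) by (metis ereal_less_eq(3) plus_ereal.simps(1) times_ereal.simps(1))
    qed
  qed (use f_real(2) in auto)
  also have "\<dots> = (1 - t) * mean_f x + t * mean_f y" unfolding mean_f_def using f_real(2) by simp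
  finally show "mean_f ((1 - t) *\<^sub>R x + t *\<^sub>R y) \<le> (1 - t) * mean_f x + t * mean_f y" .
qed simp

text \<open>On the product space the coupling is the skew operator with components
  \<open>L^T l\<close> and \<open>- L x\<close>, which turns the saddle point conditions into one
  monotone inclusion.\<close>

definition forward :: "'s \<Rightarrow> 'a \<times> 'b \<Rightarrow> 'a \<times> 'b" where
  "forward s = (\<lambda>(x, l). (gradf s x + adjoint (blinfun_apply (L s)) l, - blinfun_apply (L s) x))"

definition growth :: "'s \<Rightarrow> real" where "growth s = \<beta> s + 2 * norm (L s)"

text \<open>A null set fixed once and for all, so that \<open>step\<close> can refer to it.\<close>

definition Ng where "Ng = (SOME N. N \<in> null_sets \<mu> \<and> (\<forall>s\<in>space \<mu> - N. g s \<in> Gamma0))"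

definition Np where "Np = (SOME N. N \<in> null_sets \<mu> \<and> (\<forall>s\<in>space \<mu> - N. p s \<in> Gamma0))"

lemma Ng: "Ng \<in> null_sets \<mu>" "\<And>s. s \<in> space \<mu> - Ng \<Longrightarrow> g s \<in> Gamma0"
proof -
  obtain N where "N \<in> null_sets \<mu> \<and> (\<forall>s\<in>space \<mu> - N. g s \<in> Gamma0)"
    using AE_Gamma0_null_set[OF g.Gamma0] by metis
  then have "Ng \<in> null_sets \<mu> \<and> (\<forall>s\<in>space \<mu> - Ng. g s \<in> Gamma0)" unfolding Ng_def by (rule someI)
  then show "Ng \<in> null_sets \<mu>" "\<And>s. s \<in> space \<mu> - Ng \<Longrightarrow> g s \<in> Gamma0" by auto
qed

lemma Np: "Np \<in> null_sets \<mu>" "\<And>s. s \<in> space \<mu> - Np \<Longrightarrow> p s \<in> Gamma0"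
proof -
  obtain N where "N \<in> null_sets \<mu> \<and> (\<forall>s\<in>space \<mu> - N. p s \<in> Gamma0)"
    using AE_Gamma0_null_set[OF p.Gamma0] by metis
  then have "Np \<in> null_sets \<mu> \<and> (\<forall>s\<in>space \<mu> - Np. p s \<in> Gamma0)" unfolding Np_def by (rule someI)
  then show "Np \<in> null_sets \<mu>" "\<And>s. s \<in> space \<mu> - Np \<Longrightarrow> p s \<in> Gamma0" by auto
qed

text \<open>Both components start from the old pair. On the exceptional null sets the proximal map
  is replaced by \<open>0\<close>, which makes the step jointly measurable.\<close>

definition step :: "real \<Rightarrow> 's \<Rightarrow> 'a \<times> 'b \<Rightarrow> 'a \<times> 'b" where
  "step k s y = (if s \<in> Ng then 0 else prox (\<lambda>v. ereal k * g s v) (fst (y - k *\<^sub>R forward s y)),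
    if s \<in> Np then 0 else prox (\<lambda>v. ereal k * p s v) (snd (y - k *\<^sub>R forward s y)))"

lemma AE_regular: "AE s in \<mu>. s \<notin> Ng \<and> s \<notin> Np \<and> g s \<in> Gamma0 \<and> p s \<in> Gamma0"
  using AE_not_in[OF Ng(1)] AE_not_in[OF Np(1)] g.Gamma0 p.Gamma0 by eventually_elim auto

lemma forward_measurable: "(\<lambda>(s, y). forward s y) \<in> borel_measurable (\<mu> \<Otimes>\<^sub>M borel)"
proof -
  have Lm: "(\<lambda>w. L (fst w)) \<in> borel_measurable (\<mu> \<Otimes>\<^sub>M borel)" by (rule measurable_compose[OF measurable_fst L_measurable])
  have x: "(\<lambda>w. fst (snd w)) \<in> borel_measurable (\<mu> \<Otimes>\<^sub>M (borel :: ('a \<times> 'b) measure))"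
    and l: "(\<lambda>w. snd (snd w)) \<in> borel_measurable (\<mu> \<Otimes>\<^sub>M (borel :: ('a \<times> 'b) measure))"
    by (auto intro!: measurable_compose[OF measurable_snd] borel_measurable_continuous_onI continuous_intros)
  have gm: "(\<lambda>w. gradf (fst w) (fst (snd w))) \<in> borel_measurable (\<mu> \<Otimes>\<^sub>M (borel :: ('a \<times> 'b) measure))"
    using measurable_compose[OF measurable_Pair[OF measurable_fst x] gradf_measurable] by simp
  have "(\<lambda>w. (gradf (fst w) (fst (snd w)) + adjoint (blinfun_apply (L (fst w))) (snd (snd w)), - blinfun_apply (L (fst w)) (fst (snd w))))
      \<in> borel_measurable (\<mu> \<Otimes>\<^sub>M (borel :: ('a \<times> 'b) measure))"
    by (intro borel_measurable_Pair borel_measurable_add borel_measurable_uminus gm adjoint_measurable[OF Lm l] blinfun_apply_measurable[OF Lm x])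
  then show ?thesis by (simp add: forward_def case_prod_beta)
qed

lemma step_measurable:
  assumes k: "0 < k"
  shows "(\<lambda>(s, y). step k s y) \<in> borel_measurable (\<mu> \<Otimes>\<^sub>M borel)"
proof -
  have y: "(\<lambda>w. snd w - k *\<^sub>R forward (fst w) (snd w)) \<in> borel_measurable (\<mu> \<Otimes>\<^sub>M borel)"
    using forward_measurable by (intro borel_measurable_diff borel_measurable_scaleR) (auto simp: case_prod_beta)
  have y1: "(\<lambda>w. fst (snd w - k *\<^sub>R forward (fst w) (snd w))) \<in> borel_measurable (\<mu> \<Otimes>\<^sub>M borel)"
    by (rule measurable_compose[OF y]) (intro borel_measurable_continuous_onI continuous_intros)
  have y2: "(\<lambda>w. snd (snd w - k *\<^sub>R forward (fst w) (snd w))) \<in> borel_measurable (\<mu> \<Otimes>\<^sub>M borel)"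
    by (rule measurable_compose[OF y]) (intro borel_measurable_continuous_onI continuous_intros)
  show ?thesis
    using measurable_compose[OF measurable_Pair[OF measurable_fst y1] prox_measurable_version[OF g.normal Ng k]]
      measurable_compose[OF measurable_Pair[OF measurable_fst y2] prox_measurable_version[OF p.normal Np k]]
    unfolding step_def case_prod_beta fst_conv snd_conv by (intro borel_measurable_Pair)
qed

lemma forward_growth:
  assumes s: "s \<in> space \<mu>"
  shows "norm (forward s y) \<le> growth s * (1 + norm y)"
proof -
  obtain x l where y: "y = (x, l)" by (cases y)
  have xl: "norm x \<le> norm y" "norm l \<le> norm y" using norm_fst_le[of x l] norm_snd_le[of l x] by (auto simp: y)
  have "norm (forward s y) \<le> norm (gradf s x) + norm (adjoint (blinfun_apply (L s)) l) + norm (blinfun_apply (L s) x)"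
    unfolding y forward_def using norm_Pair_le[of "gradf s x + adjoint (blinfun_apply (L s)) l" "- blinfun_apply (L s) x"]
      norm_triangle_ineq[of "gradf s x" "adjoint (blinfun_apply (L s)) l"] by simp
  also have "\<dots> \<le> \<beta> s * (1 + norm y) + norm (L s) * (1 + norm y) + norm (L s) * (1 + norm y)"
  proof (intro add_mono)
    show "norm (gradf s x) \<le> \<beta> s * (1 + norm y)"
      using gradf_growth[OF s, of x] mult_left_mono[of "1 + norm x" "1 + norm y" "\<beta> s"] \<beta>_nonneg[OF s] xl by simp
    show "norm (adjoint (blinfun_apply (L s)) l) \<le> norm (L s) * (1 + norm y)"
      using norm_adjoint_blinfun_le[of "L s" l] mult_left_mono[of "norm l" "1 + norm y" "norm (L s)"] xl by simp
    show "norm (blinfun_apply (L s) x) \<le> norm (L s) * (1 + norm y)"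
      using norm_blinfun[of "L s" x] mult_left_mono[of "norm x" "1 + norm y" "norm (L s)"] xl by simp
  qed
  also have "\<dots> = growth s * (1 + norm y)" by (simp add: growth_def algebra_simps)
  finally show ?thesis .
qed

lemma growth_Lr: "growth \<in> Lr \<mu> (real (2 * m))"
proof -
  have "(\<lambda>s. \<beta> s + (norm (L s) + norm (L s))) \<in> Lr \<mu> (real (2 * m))"
    by (intro Lr_add \<beta>_Lr L_Lr) auto
  then show ?thesis by (simp add: growth_def[abs_def])
qed

lemma Lr_square: "\<phi> \<in> Lr \<mu> 2 \<longleftrightarrow> \<phi> \<in> borel_measurable \<mu> \<and> integrable \<mu> (\<lambda>s. (norm (\<phi> s))\<^sup>2)"
  using Lr_power[of 2 \<phi> \<mu>] by simp

lemma growth_moments: "integrable \<mu> (\<lambda>s. growth s ^ (2 * m))" "integrable \<mu> (\<lambda>s. (growth s)\<^sup>2)" "growth \<in> borel_measurable \<mu>"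
proof -
  have "integrable \<mu> (\<lambda>s. norm (growth s) ^ (2 * m))" using growth_Lr Lr_power[OF m_pos, of growth \<mu>] by blast
  then show "integrable \<mu> (\<lambda>s. growth s ^ (2 * m))" by (simp add: power_mult)
  have "growth \<in> Lr \<mu> 2" using m by (intro g.Lr_mono[OF growth_Lr]) auto
  then show "integrable \<mu> (\<lambda>s. (growth s)\<^sup>2)" "growth \<in> borel_measurable \<mu>" by (auto simp: Lr_square)
qed


text \<open>The residuals of the two proximal maps, divided by \<open>k\<close>, are subgradients at
  the new point. In the pairing of the forward fields the coupling cancels by skewness, and only the
  monotone part from \<open>f\<close> remains.\<close>

lemma step_inequality:
  assumes k: "0 < k" and \<phi>f: "AE s in \<mu>. \<phi>f s \<in> subdifferential (f s) (fst u)"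
    and \<phi>g: "AE s in \<mu>. \<phi>g s \<in> subdifferential (g s) (fst u)"
    and \<phi>p: "AE s in \<mu>. \<phi>p s \<in> subdifferential (p s) (snd u)"
  shows "AE s in \<mu>. (norm (step k s y - u))\<^sup>2 \<le> (norm (y - u))\<^sup>2
      - 2 * k * (((\<phi>g s, \<phi>p s) + (\<phi>f s + adjoint (blinfun_apply (L s)) (snd u), - blinfun_apply (L s) (fst u))) \<bullet> (y - u))
      - 2 * k * ((forward s y + (\<phi>g s, \<phi>p s)) \<bullet> (step k s y - y)) - (norm (step k s y - y))\<^sup>2"
  using AE_regular \<phi>f \<phi>g \<phi>p gradf_subgradient[of "fst y"] f_Gamma0
proof eventually_elim
  case (elim s)
  obtain x l where y: "y = (x, l)" by (cases y)
  obtain xu lu where u: "u = (xu, lu)" by (cases u)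
  define v where "v = y - k *\<^sub>R forward s y"
  define p1 where "p1 = prox (\<lambda>v. ereal k * g s v) (fst v)"
  define p2 where "p2 = prox (\<lambda>v. ereal k * p s v) (snd v)"
  have t: "step k s y = (p1, p2)" using elim(1) by (simp add: step_def p1_def p2_def v_def)
  define a where "a = ((1 / k) *\<^sub>R (fst v - p1), (1 / k) *\<^sub>R (snd v - p2))"
  have a1: "fst a \<in> subdifferential (g s) p1" and a2: "snd a \<in> subdifferential (p s) p2"
    using prox_scale_subgradient[OF _ k] elim(1) by (auto simp: a_def p1_def p2_def)
  have ka: "k *\<^sub>R a = v - (p1, p2)" using k by (simp add: a_def prod_eq_iff)
  show ?case
  proof (rule forward_backward_inequality[where a=a])
    show "step k s y - y = - k *\<^sub>R (forward s y + a)" unfolding t scaleR_add_right scaleR_minus_left ka by (simp add: v_def)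
    have pg: "proper_fun (g s)" "proper_fun (p s)" "proper_fun (f s)" using elim(1,6) by (auto simp: Gamma0_def)
    have "0 \<le> (fst a - \<phi>g s) \<bullet> (p1 - xu)" "0 \<le> (snd a - \<phi>p s) \<bullet> (p2 - lu)"
      using subdifferential_monotone[OF pg(1) a1, of "\<phi>g s" xu] subdifferential_monotone[OF pg(2) a2, of "\<phi>p s" lu] elim(3,4) by (auto simp: u)
    then show "0 \<le> (a - (\<phi>g s, \<phi>p s)) \<bullet> (step k s y - u)" by (simp add: t u inner_prod_def)
    have "0 \<le> (gradf s x - \<phi>f s) \<bullet> (x - xu)"
      using subdifferential_monotone[OF pg(3), of "gradf s x" x "\<phi>f s" xu] elim(2,5) by (simp add: y u)
    moreover have "(adjoint (blinfun_apply (L s)) l - adjoint (blinfun_apply (L s)) lu) \<bullet> (x - xu)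
        + (- blinfun_apply (L s) x + blinfun_apply (L s) xu) \<bullet> (l - lu) = 0"
      by (simp add: inner_diff_left inner_add_left adjoint_blinfun blinfun.bilinear_simps inner_diff_right) (simp add: inner_commute)
    ultimately show "0 \<le> (forward s y - (\<phi>f s + adjoint (blinfun_apply (L s)) (snd u), - blinfun_apply (L s) (fst u))) \<bullet> (y - u)"
      by (simp add: forward_def y u inner_prod_def inner_diff_left inner_add_left)
  qed (use k in simp)
qed

text \<open>A proximal step of any size lands in the domain of the random subdifferential, so the
  distance to that domain is at most the length of the step. Domain regularity can thereby be
  combined with the summability of the squared increments.\<close>

lemma domain_distance:
  assumes k: "0 < k"
  shows "(\<integral>\<^sup>+ s. ennreal ((infdist (fst y) (dom_subdifferential (g s)))\<^sup>2) \<partial>\<mu>) \<le> (\<integral>\<^sup>+ s. ennreal ((norm (step k s y - y))\<^sup>2) \<partial>\<mu>)"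
    "(\<integral>\<^sup>+ s. ennreal ((infdist (snd y) (dom_subdifferential (p s)))\<^sup>2) \<partial>\<mu>) \<le> (\<integral>\<^sup>+ s. ennreal ((norm (step k s y - y))\<^sup>2) \<partial>\<mu>)"
proof -
  show "(\<integral>\<^sup>+ s. ennreal ((infdist (fst y) (dom_subdifferential (g s)))\<^sup>2) \<partial>\<mu>) \<le> (\<integral>\<^sup>+ s. ennreal ((norm (step k s y - y))\<^sup>2) \<partial>\<mu>)"
  proof (rule nn_integral_mono_AE, use AE_regular in eventually_elim)
    case (elim s)
    then have "fst (step k s y) \<in> dom_subdifferential (g s)"
      using prox_in_dom_subdifferential[of "g s", OF _ k] unfolding step_def by simp
    then have "infdist (fst y) (dom_subdifferential (g s)) \<le> dist (fst y) (fst (step k s y))" by (rule infdist_le)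
    also have "\<dots> \<le> norm (step k s y - y)" using dist_fst_le[of "step k s y" y] by (simp add: dist_norm dist_commute norm_minus_commute)
    finally show ?case by (intro ennreal_leI power_mono infdist_nonneg)
  qed
  show "(\<integral>\<^sup>+ s. ennreal ((infdist (snd y) (dom_subdifferential (p s)))\<^sup>2) \<partial>\<mu>) \<le> (\<integral>\<^sup>+ s. ennreal ((norm (step k s y - y))\<^sup>2) \<partial>\<mu>)"
  proof (rule nn_integral_mono_AE, use AE_regular in eventually_elim)
    case (elim s)
    then have "snd (step k s y) \<in> dom_subdifferential (p s)"
      using prox_in_dom_subdifferential[of "p s", OF _ k] unfolding step_def by simp
    then have "infdist (snd y) (dom_subdifferential (p s)) \<le> dist (snd y) (snd (step k s y))" by (rule infdist_le)
    also have "\<dots> \<le> norm (step k s y - y)" using dist_snd_le[of "step k s y" y] by (simp add: dist_norm dist_commute norm_minus_commute)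
    finally show ?case by (intro ennreal_leI power_mono infdist_nonneg)
  qed
qed

text \<open>The mean of \<open>\<eta>\<close> is the residual of the two optimality conditions at
  \<open>(xu, lu)\<close>, hence zero at a saddle point represented by these selections.\<close>

lemma assemble_selections:
  fixes xu :: 'a and lu :: 'b
  assumes r: "1 \<le> r" "r \<le> real (2 * m)" and \<phi>f: "\<phi>f \<in> Lr \<mu> r" and \<phi>g: "\<phi>g \<in> Lr \<mu> r" and \<phi>p: "\<phi>p \<in> Lr \<mu> r"
  defines "\<phi> \<equiv> \<lambda>s. (\<phi>g s, \<phi>p s)"
    and "\<eta> \<equiv> \<lambda>s. (\<phi>g s, \<phi>p s) + (\<phi>f s + adjoint (blinfun_apply (L s)) lu, - blinfun_apply (L s) xu)"
  shows "\<phi> \<in> Lr \<mu> r" "\<eta> \<in> Lr \<mu> r" "integrable \<mu> \<eta>"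
    "(\<integral>s. \<eta> s \<partial>\<mu>) = ((\<integral>s. \<phi>f s \<partial>\<mu>) + (\<integral>s. \<phi>g s \<partial>\<mu>) + adjoint (blinfun_apply A) lu, - blinfun_apply A xu + (\<integral>s. \<phi>p s \<partial>\<mu>))"
proof -
  have aux: "(\<lambda>s. adjoint (blinfun_apply (L s)) lu) \<in> Lr \<mu> r" "(\<lambda>s. - blinfun_apply (L s) xu) \<in> Lr \<mu> r"
    using g.Lr_mono[OF adjoint_Lr _ r(2)] g.Lr_mono[OF apply_Lr _ r(2)] r by auto
  show "\<phi> \<in> Lr \<mu> r" unfolding \<phi>_def using r by (intro Lr_Pair \<phi>g \<phi>p) auto
  show \<eta>: "\<eta> \<in> Lr \<mu> r" unfolding \<eta>_def using r by (intro Lr_add Lr_Pair \<phi>f \<phi>g \<phi>p aux) auto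
  show "integrable \<mu> \<eta>" by (rule g.Lr_integrable[OF \<eta> r(1)])
  have i: "integrable \<mu> \<phi>f" "integrable \<mu> \<phi>g" "integrable \<mu> \<phi>p"
    "integrable \<mu> (\<lambda>s. adjoint (blinfun_apply (L s)) lu)" "integrable \<mu> (\<lambda>s. - blinfun_apply (L s) xu)"
    by (rule g.Lr_integrable[OF _ r(1)], fact)+
  have "\<eta> = (\<lambda>s. (\<phi>g s + (\<phi>f s + adjoint (blinfun_apply (L s)) lu), \<phi>p s + - blinfun_apply (L s) xu))" by (simp add: \<eta>_def)
  then have "(\<integral>s. \<eta> s \<partial>\<mu>) = (\<integral>s. \<phi>g s + (\<phi>f s + adjoint (blinfun_apply (L s)) lu) \<partial>\<mu>, \<integral>s. \<phi>p s + - blinfun_apply (L s) xu \<partial>\<mu>)"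
    using integral_Pair(2)[of \<mu> "\<lambda>s. \<phi>g s + (\<phi>f s + adjoint (blinfun_apply (L s)) lu)" "\<lambda>s. \<phi>p s + - blinfun_apply (L s) xu"] i by simp
  also have "(\<integral>s. \<phi>g s + (\<phi>f s + adjoint (blinfun_apply (L s)) lu) \<partial>\<mu>) = (\<integral>s. \<phi>g s \<partial>\<mu>) + ((\<integral>s. \<phi>f s \<partial>\<mu>) + adjoint (blinfun_apply A) lu)"
    using i integral_adjoint[OF L_integrable, of lu] by (simp add: A_mean)
  also have "(\<integral>s. \<phi>p s + - blinfun_apply (L s) xu \<partial>\<mu>) = (\<integral>s. \<phi>p s \<partial>\<mu>) + - blinfun_apply A xu"
    using i integral_blinfun_apply[OF L_integrable, of xu] by (simp add: A_mean)
  finally show "(\<integral>s. \<eta> s \<partial>\<mu>) = ((\<integral>s. \<phi>f s \<partial>\<mu>) + (\<integral>s. \<phi>g s \<partial>\<mu>) + adjoint (blinfun_apply A) lu, - blinfun_apply A xu + (\<integral>s. \<phi>p s \<partial>\<mu>))"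
    by (simp add: add.commute add.left_commute)
qed

end

section \<open>The iterates and their limit\<close>

context primal_dual
begin

text \<open>Built from \<open>step\<close>, so that it is adapted to the filtration; a process
  satisfying the original recursion is identified with it almost surely.\<close>

primrec iterate :: "(nat \<Rightarrow> real) \<Rightarrow> (nat \<Rightarrow> 'w \<Rightarrow> 's) \<Rightarrow> ('w \<Rightarrow> 'a \<times> 'b) \<Rightarrow> nat \<Rightarrow> 'w \<Rightarrow> 'a \<times> 'b" where
  "iterate c \<xi> z0 0 = z0"
| "iterate c \<xi> z0 (Suc n) = (\<lambda>\<omega>. step (c n) (\<xi> (Suc n) \<omega>) (iterate c \<xi> z0 n \<omega>))"

lemma iterate_convergence:
  fixes \<P> :: "'w measure" and \<xi> :: "nat \<Rightarrow> 'w \<Rightarrow> 's" and c :: "nat \<Rightarrow> real"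
  assumes inn: "innovations \<P> \<F> \<mu> \<xi>" and z0: "z0 \<in> borel_measurable (\<F> 0)"
    and z0_moment: "integrable \<P> (\<lambda>\<omega>. norm (z0 \<omega>) ^ (2 * m))"
    and c: "\<And>n. 0 < c n" "summable (\<lambda>n. (c n)\<^sup>2)" "filterlim (\<lambda>n. \<Sum>k<n. c k) at_top sequentially"
  obtains C Z where "0 \<le> C" "\<And>n. (\<integral>\<^sup>+ \<omega>. ennreal (norm (iterate c \<xi> z0 n \<omega>) ^ (2 * m)) \<partial>\<P>) \<le> ennreal C"
    "Z \<in> borel_measurable \<P>"
    "AE \<omega> in \<P>. Z \<omega> \<in> saddle_points F G (fenchel_conjugate P) A \<and>
      (\<lambda>n. (\<Sum>k<n. c k *\<^sub>R iterate c \<xi> z0 (Suc k) \<omega>) /\<^sub>R (\<Sum>k<n. c k)) \<longlonglongrightarrow> Z \<omega>"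
proof -
  define z where "z = iterate c \<xi> z0"
  define S where "S = saddle_points F G (fenchel_conjugate P) A"
  interpret innovations \<P> \<F> \<mu> \<xi> by (rule inn)
  interpret fb: forward_backward \<P> \<F> \<mu> \<xi> c forward "\<lambda>n. step (c n)" z growth
  proof unfold_locales
    show "z 0 \<in> borel_measurable (\<F> 0)" using z0 by (simp add: z_def)
    show "z (Suc n) \<omega> = step (c n) (\<xi> (Suc n) \<omega>) (z n \<omega>)" for n \<omega> by (simp add: z_def)
    show "0 \<le> growth s" if "s \<in> space \<mu>" for s using \<beta>_nonneg[OF that] by (simp add: growth_def)
  qed (use c forward_measurable step_measurable growth_moments forward_growth in auto)
  \<comment> \<open>Saddle points and arbitrary points of the domain are treated alike here; they
    differ only in the exponent \<open>r\<close> and in the mean of \<open>\<eta>\<close>.\<close>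
  have comparison: "\<exists>\<phi> \<eta>. fb.comparison u \<phi> \<eta> \<and> \<phi> \<in> Lr \<mu> r \<and> \<eta> \<in> Lr \<mu> r \<and> integrable \<mu> \<eta> \<and>
      (\<integral>s. \<eta> s \<partial>\<mu>) = ((\<integral>s. \<phi>f s \<partial>\<mu>) + (\<integral>s. \<phi>g s \<partial>\<mu>) + adjoint (blinfun_apply A) (snd u), - blinfun_apply A (fst u) + (\<integral>s. \<phi>p s \<partial>\<mu>))"
    if r: "1 \<le> r" "r \<le> real (2 * m)" and \<phi>: "\<phi>f \<in> Lr \<mu> r" "\<phi>g \<in> Lr \<mu> r" "\<phi>p \<in> Lr \<mu> r"
      and sel: "AE s in \<mu>. \<phi>f s \<in> subdifferential (f s) (fst u)" "AE s in \<mu>. \<phi>g s \<in> subdifferential (g s) (fst u)"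
        "AE s in \<mu>. \<phi>p s \<in> subdifferential (p s) (snd u)"
    for r u \<phi>f \<phi>g \<phi>p
  proof -
    note asm = assemble_selections(1)[OF r \<phi>] assemble_selections(2-4)[OF r \<phi>, where xu="fst u" and lu="snd u"]
    show ?thesis
    proof (intro exI conjI)
      show "fb.comparison u (\<lambda>s. (\<phi>g s, \<phi>p s)) (\<lambda>s. (\<phi>g s, \<phi>p s) + (\<phi>f s + adjoint (blinfun_apply (L s)) (snd u), - blinfun_apply (L s) (fst u)))"
        unfolding fb.comparison_def using asm(1,2) step_inequality[OF c(1) sel] by (auto simp: Lr_def)
    qed (rule asm)+
  qed
  have rep: "\<exists>\<phi> \<eta>. fb.comparison u \<phi> \<eta> \<and> \<phi> \<in> Lr \<mu> r \<and> \<eta> \<in> Lr \<mu> r \<and> (\<integral>s. \<eta> s \<partial>\<mu>) = 0"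
    if r: "1 \<le> r" "r \<le> real (2 * m)" and u: "integrable_representation \<mu> r f g p A (fst u) (snd u)" for r u
  proof -
    obtain \<phi>f \<phi>g \<phi>p where \<phi>: "\<phi>f \<in> selections \<mu> r f (fst u)" "\<phi>g \<in> selections \<mu> r g (fst u)" "\<phi>p \<in> selections \<mu> r p (snd u)"
      and zero: "(\<integral>s. \<phi>f s \<partial>\<mu>) + (\<integral>s. \<phi>g s \<partial>\<mu>) + adjoint (blinfun_apply A) (snd u) = 0" "- blinfun_apply A (fst u) + (\<integral>s. \<phi>p s \<partial>\<mu>) = 0"
      using u by (auto simp: integrable_representation_def)
    have Lr: "\<phi>f \<in> Lr \<mu> r" "\<phi>g \<in> Lr \<mu> r" "\<phi>p \<in> Lr \<mu> r"
      and sel: "AE s in \<mu>. \<phi>f s \<in> subdifferential (f s) (fst u)" "AE s in \<mu>. \<phi>g s \<in> subdifferential (g s) (fst u)"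
        "AE s in \<mu>. \<phi>p s \<in> subdifferential (p s) (snd u)"
      using \<phi> by (auto simp: selections_def split: if_splits)
    show ?thesis using comparison[OF r Lr sel] unfolding zero zero_prod_def[symmetric] by blast
  qed
  obtain us where us: "us \<in> S" "integrable_representation \<mu> (real (2 * m)) f g p A (fst us) (snd us)"
    using representation by (auto simp: S_def)
  have m2: "1 \<le> real (2 * m)" "2 \<le> real (2 * m)" using m by auto
  obtain C where C: "0 \<le> C" "\<And>n. (\<integral>\<^sup>+ \<omega>. ennreal (norm (z n \<omega>) ^ (2 * m)) \<partial>\<P>) \<le> ennreal C"
  proof -
    obtain \<phi> \<eta> where \<phi>: "fb.comparison us \<phi> \<eta>" "\<phi> \<in> Lr \<mu> (real (2 * m))" "\<eta> \<in> Lr \<mu> (real (2 * m))" "(\<integral>s. \<eta> s \<partial>\<mu>) = 0"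
      using rep[OF m2(1) order_refl us(2)] by blast
    have "integrable \<mu> (\<lambda>s. norm (\<phi> s) ^ (2 * m))" "integrable \<mu> (\<lambda>s. norm (\<eta> s) ^ (2 * m))"
      using \<phi>(2,3) Lr_power[OF m_pos] by blast+
    from fb.comparison_moments[OF \<phi>(1) m growth_moments(1) this \<phi>(4)] z0_moment that show ?thesis
      by (auto simp: z_def)
  qed
  have C2: "(\<integral>\<^sup>+ \<omega>. ennreal ((norm (z n \<omega>))\<^sup>2) \<partial>\<P>) \<le> ennreal (1 + C)" for n
  proof -
    have "(\<integral>\<^sup>+ \<omega>. ennreal ((norm (z n \<omega>))\<^sup>2) \<partial>\<P>) \<le> (\<integral>\<^sup>+ \<omega>. 1 + ennreal (norm (z n \<omega>) ^ (2 * m)) \<partial>\<P>)"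
    proof (rule nn_integral_mono)
      fix \<omega>
      have "(norm (z n \<omega>))\<^sup>2 \<le> 1 + norm (z n \<omega>) ^ (2 * m)"
        using power_le_sum_of_extremes[of "norm (z n \<omega>)" 0 2 "2 * m"] m by simp
      then have "ennreal ((norm (z n \<omega>))\<^sup>2) \<le> ennreal (1 + norm (z n \<omega>) ^ (2 * m))" by (rule ennreal_leI)
      then show "ennreal ((norm (z n \<omega>))\<^sup>2) \<le> 1 + ennreal (norm (z n \<omega>) ^ (2 * m))" by simp
    qed
    also have "\<dots> \<le> 1 + ennreal C" using C(2)[of n] by (simp add: nn_integral_add emeasure_space_1)
    finally show ?thesis using C(1) by simp
  qed
  have C0: "0 \<le> 1 + C" using C by simp
  \<comment> \<open>The square integrable representation exists at every saddle point, so distances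
    converge to each of them, off a null set depending on \<open>u\<close>; for the increments the
    single point \<open>us\<close> is enough.\<close>
  have square: "\<exists>d. (\<forall>n. 0 \<le> d n) \<and> summable d \<and> (\<forall>n. (\<integral>\<^sup>+ \<omega>. ennreal ((norm (z (Suc n) \<omega> - z n \<omega>))\<^sup>2) \<partial>\<P>) \<le> ennreal (d n)) \<and>
      (AE \<omega> in \<P>. convergent (\<lambda>n. norm (z n \<omega> - u)))" if u: "u \<in> S" for u
  proof -
    have "integrable_representation \<mu> 2 f g p A (fst u) (snd u)" using representation_square u by (auto simp: S_def)
    then obtain \<phi> \<eta> where \<phi>: "fb.comparison u \<phi> \<eta>" "\<phi> \<in> Lr \<mu> 2" "\<eta> \<in> Lr \<mu> 2" "(\<integral>s. \<eta> s \<partial>\<mu>) = 0"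
      using rep[of 2 u] m2 by auto
    have "integrable \<mu> (\<lambda>s. (norm (\<phi> s))\<^sup>2)" "integrable \<mu> (\<lambda>s. (norm (\<eta> s))\<^sup>2)"
      using \<phi>(2,3) by (auto simp: Lr_square)
    then show ?thesis by (rule fb.comparison_square[OF \<phi>(1) _ _ \<phi>(4) C0 C2]) blast
  qed
  obtain d where d: "\<And>n. 0 \<le> d n" "summable d" "\<And>n. (\<integral>\<^sup>+ \<omega>. ennreal ((norm (z (Suc n) \<omega> - z n \<omega>))\<^sup>2) \<partial>\<P>) \<le> ennreal (d n)"
    using square[OF us(1)] by blast
  have incr: "AE \<omega> in \<P>. summable (\<lambda>n. (norm (z (Suc n) \<omega> - z n \<omega>))\<^sup>2)"
  proof (rule AE_summable[OF _ _ d(3,2,1)])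
    show "(\<lambda>\<omega>. (norm (z (Suc n) \<omega> - z n \<omega>))\<^sup>2) \<in> borel_measurable \<P>" for n
      by measurable
  qed simp
  \<comment> \<open>Stated for a continuous \<open>\<pi>\<close> so that it serves both projections.
    Its premise \<open>le\<close> is the comparison of the distance to the random domain with the
    step length.\<close>
  have domain: "AE \<omega> in \<P>. (\<lambda>n. infdist (\<pi> (z n \<omega>)) D) \<longlonglongrightarrow> 0"
    if \<pi>: "continuous_on UNIV \<pi>" and K: "0 < K" "\<And>y. ennreal (K * (infdist (\<pi> y) D)\<^sup>2) \<le> (\<integral>\<^sup>+ s. ennreal ((infdist (\<pi> y) (Ds s))\<^sup>2) \<partial>\<mu>)"
      and le: "\<And>k y. 0 < k \<Longrightarrow> (\<integral>\<^sup>+ s. ennreal ((infdist (\<pi> y) (Ds s))\<^sup>2) \<partial>\<mu>) \<le> (\<integral>\<^sup>+ s. ennreal ((norm (step k s y - y))\<^sup>2) \<partial>\<mu>)"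
    for \<pi> :: "'a \<times> 'b \<Rightarrow> 'e::euclidean_space" and D Ds K
  proof -
    have [measurable]: "(\<lambda>\<omega>. infdist (\<pi> (z n \<omega>)) D) \<in> borel_measurable \<P>" for n
      by (rule measurable_compose[OF fb.z_measurable]) (intro borel_measurable_continuous_onI continuous_on_infdist \<pi>)
    have "AE \<omega> in \<P>. summable (\<lambda>n. K * (infdist (\<pi> (z n \<omega>)) D)\<^sup>2)"
    proof (rule AE_summable[where b=d])
      fix n
      have hm: "(\<lambda>v. ennreal ((norm (step (c n) (snd v) (z n (fst v)) - z n (fst v)))\<^sup>2)) \<in> borel_measurable (\<F> n \<Otimes>\<^sub>M \<mu>)"
        using fb.step_measurable[of n] by measurable
      have "(\<integral>\<^sup>+ \<omega>. ennreal (K * (infdist (\<pi> (z n \<omega>)) D)\<^sup>2) \<partial>\<P>) \<le> (\<integral>\<^sup>+ \<omega>. (\<integral>\<^sup>+ s. ennreal ((norm (step (c n) s (z n \<omega>) - z n \<omega>))\<^sup>2) \<partial>\<mu>) \<partial>\<P>)"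
        by (intro nn_integral_mono order_trans[OF K(2) le] c)
      also have "\<dots> = (\<integral>\<^sup>+ \<omega>. ennreal ((norm (z (Suc n) \<omega> - z n \<omega>))\<^sup>2) \<partial>\<P>)"
        using nn_integral_innovation[OF hm] by (simp add: z_def)
      also have "\<dots> \<le> ennreal (d n)" by (rule d)
      finally show "(\<integral>\<^sup>+ \<omega>. ennreal (K * (infdist (\<pi> (z n \<omega>)) D)\<^sup>2) \<partial>\<P>) \<le> ennreal (d n)" .
    qed (use K d in auto)
    then show ?thesis
    proof eventually_elim
      case (elim \<omega>)
      have "(\<lambda>n. (infdist (\<pi> (z n \<omega>)) D)\<^sup>2) \<longlonglongrightarrow> 0" using summable_LIMSEQ_zero[OF elim] K(1) by simp
      then show ?case by simp
    qed
  qed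
  obtain Kg where Kg: "0 < Kg" "\<And>x. ennreal (Kg * (infdist x (dom_subdifferential G))\<^sup>2) \<le> (\<integral>\<^sup>+ s. ennreal ((infdist x (dom_subdifferential (g s)))\<^sup>2) \<partial>\<mu>)"
    using g_domain by (auto simp: domain_regularity_def)
  obtain Kp where Kp: "0 < Kp" "\<And>x. ennreal (Kp * (infdist x (dom_subdifferential P))\<^sup>2) \<le> (\<integral>\<^sup>+ s. ennreal ((infdist x (dom_subdifferential (p s)))\<^sup>2) \<partial>\<mu>)"
    using p_domain by (auto simp: domain_regularity_def)
  have dist_g: "AE \<omega> in \<P>. (\<lambda>n. infdist (fst (z n \<omega>)) (dom_subdifferential G)) \<longlonglongrightarrow> 0"
    by (rule domain[OF _ Kg domain_distance(1)]) (auto intro!: continuous_intros)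
  have dist_p: "AE \<omega> in \<P>. (\<lambda>n. infdist (snd (z n \<omega>)) (dom_subdifferential P)) \<longlonglongrightarrow> 0"
    by (rule domain[OF _ Kp domain_distance(2)]) (auto intro!: continuous_intros)
  define mean where "mean n \<omega> = (\<Sum>k<n. c k *\<^sub>R z (Suc k) \<omega>) /\<^sub>R (\<Sum>k<n. c k)" for n \<omega>
  define Dom where "Dom = dom_subdifferential G \<times> dom_subdifferential P"
  \<comment> \<open>\<open>v\<close> is an element of the saddle operator at \<open>u\<close>,
    decomposed as the variational lemma requires, which satisfies the inequality at all cluster
    points of the means off a null set depending on \<open>u\<close>.\<close>
  define good where "good u v \<longleftrightarrow> (\<exists>a\<in>subdifferential (\<lambda>y. ereal (mean_f y)) (fst u). \<exists>b\<in>subdifferential G (fst u). \<exists>w\<in>subdifferential P (snd u).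
      v = (a + b + adjoint (blinfun_apply A) (snd u), w - blinfun_apply A (fst u))) \<and>
      (AE \<omega> in \<P>. \<forall>q l. strict_mono q \<longrightarrow> (\<lambda>n. mean (q n) \<omega>) \<longlonglongrightarrow> l \<longrightarrow> 0 \<le> v \<bullet> (u - l))" for u v
  have "\<exists>v. good u v" if u: "u \<in> Dom" for u
  proof -
    obtain eg \<phi>g where g': "0 < eg" "eg \<le> 1" "\<phi>g \<in> borel_measurable \<mu>" "AE s in \<mu>. \<phi>g s \<in> subdifferential (g s) (fst u)"
      "(\<integral>\<^sup>+ s. ennreal (norm (\<phi>g s) powr (1 + eg)) \<partial>\<mu>) < \<infinity>" "integrable \<mu> \<phi>g" "(\<integral>s. \<phi>g s \<partial>\<mu>) \<in> subdifferential G (fst u)"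
      by (rule g.minimal_selection[OF g_interchange g_moment, of "fst u"]) (use u in \<open>auto simp: Dom_def\<close>)
    obtain ep \<phi>p where p': "0 < ep" "ep \<le> 1" "\<phi>p \<in> borel_measurable \<mu>" "AE s in \<mu>. \<phi>p s \<in> subdifferential (p s) (snd u)"
      "(\<integral>\<^sup>+ s. ennreal (norm (\<phi>p s) powr (1 + ep)) \<partial>\<mu>) < \<infinity>" "integrable \<mu> \<phi>p" "(\<integral>s. \<phi>p s \<partial>\<mu>) \<in> subdifferential P (snd u)"
      by (rule p.minimal_selection[OF p_interchange p_moment, of "snd u"]) (use u in \<open>auto simp: Dom_def\<close>)
    \<comment> \<open>\<open>g\<close> and \<open>p\<close> provide different exponents; the smaller
      one serves the pair.\<close>
    define r where "r = 1 + min eg ep"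
    have r: "1 < r" "r \<le> 2" "r \<le> 1 + eg" "r \<le> 1 + ep" "r \<le> real (2 * m)" using g'(1,2) p'(1,2) m2 by (auto simp: r_def)
    have Lg: "\<phi>g \<in> Lr \<mu> r" using g.Lr_mono[of \<phi>g "1 + eg" r] g'(3,5) r by (auto simp: Lr_nn_integral)
    have Lp: "\<phi>p \<in> Lr \<mu> r" using g.Lr_mono[of \<phi>p "1 + ep" r] p'(3,5) r by (auto simp: Lr_nn_integral)
    define \<phi>f where "\<phi>f s = gradf s (fst u)" for s
    have Lf: "\<phi>f \<in> Lr \<mu> r" unfolding \<phi>f_def using g.Lr_mono[OF gradf_Lr] r by auto
    have sf: "AE s in \<mu>. \<phi>f s \<in> subdifferential (f s) (fst u)" unfolding \<phi>f_def by (rule gradf_subgradient)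
    obtain \<phi> \<eta> where \<eta>: "fb.comparison u \<phi> \<eta>" "\<phi> \<in> Lr \<mu> r" "\<eta> \<in> Lr \<mu> r" "integrable \<mu> \<eta>"
      "(\<integral>s. \<eta> s \<partial>\<mu>) = ((\<integral>s. \<phi>f s \<partial>\<mu>) + (\<integral>s. \<phi>g s \<partial>\<mu>) + adjoint (blinfun_apply A) (snd u), - blinfun_apply A (fst u) + (\<integral>s. \<phi>p s \<partial>\<mu>))"
      using comparison[OF _ r(5) Lf Lg Lp sf g'(4) p'(4)] r(1) by auto
    have "AE \<omega> in \<P>. \<forall>q l. strict_mono q \<longrightarrow> (\<lambda>n. mean (q n) \<omega>) \<longlonglongrightarrow> l \<longrightarrow> 0 \<le> (\<integral>s. \<eta> s \<partial>\<mu>) \<bullet> (u - l)"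
      unfolding mean_def using \<eta>(2,3) by (intro fb.comparison_weighted_mean[OF \<eta>(1) r(1,2) _ _ \<eta>(4) C0 C2 incr]) (auto simp: Lr_nn_integral)
    moreover have "(\<integral>s. \<phi>f s \<partial>\<mu>) \<in> subdifferential (\<lambda>y. ereal (mean_f y)) (fst u)"
      by (rule F_subgradient[OF g.Lr_integrable[OF Lf] sf]) (use r in simp)
    ultimately have "good u (\<integral>s. \<eta> s \<partial>\<mu>)" unfolding good_def using g'(7) p'(7) \<eta>(5) by auto
    then show ?thesis by blast
  qed
  then obtain V where V: "\<And>u. u \<in> Dom \<Longrightarrow> good u (V u)" by metis
  define \<Gamma> where "\<Gamma> = (\<lambda>u. (u, V u)) ` Dom"
  \<comment> \<open>Density is in the graph of \<open>V\<close>: the inequality is closed in the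
    pair \<open>(u, V u)\<close>, so countably many null sets are enough for all of
    \<open>Dom\<close>.\<close>
  obtain \<Gamma>0 where \<Gamma>0: "countable \<Gamma>0" "\<Gamma>0 \<subseteq> \<Gamma>" "\<Gamma> \<subseteq> closure \<Gamma>0" using separable[of \<Gamma>] by blast
  have minty0: "AE \<omega> in \<P>. \<forall>w\<in>\<Gamma>0. \<forall>q l. strict_mono q \<longrightarrow> (\<lambda>n. mean (q n) \<omega>) \<longlonglongrightarrow> l \<longrightarrow> 0 \<le> snd w \<bullet> (fst w - l)"
    using \<Gamma>0(1,2) V by (subst AE_ball_countable) (auto simp: \<Gamma>_def good_def)
  obtain S0 where S0: "countable S0" "S0 \<subseteq> S" "S \<subseteq> closure S0" using separable[of S] by blast
  have opial0: "AE \<omega> in \<P>. \<forall>u\<in>S0. convergent (\<lambda>n. norm (z n \<omega> - u))"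
    using S0(1,2) square by (subst AE_ball_countable) auto
  have GP: "G \<in> Gamma0" "P \<in> Gamma0"
  proof -
    obtain \<phi>g \<phi>p where "\<phi>g \<in> selections \<mu> (real (2 * m)) g (fst us)" "\<phi>p \<in> selections \<mu> (real (2 * m)) p (snd us)"
      using us(2) by (auto simp: integrable_representation_def)
    then show "G \<in> Gamma0" "P \<in> Gamma0"
      using g.mean_Gamma0[of \<phi>g "fst us"] p.mean_Gamma0[of \<phi>p "snd us"] g.Lr_integrable[OF _ m2(1)]
      by (auto simp: selections_def split: if_splits)
  qed
  have dom_ne: "dom_subdifferential G \<noteq> {}" "dom_subdifferential P \<noteq> {}"
  proof -
    obtain x l where "us = (x, l)" by (cases us)
    then have "\<exists>v. v \<in> subdifferential G x" using us(1) by (auto simp: S_def saddle_points_def)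
    then show "dom_subdifferential G \<noteq> {}" by (auto simp: dom_subdifferential_def)
    \<comment> \<open>A saddle point only provides a subgradient of the biconjugate of
      \<open>P\<close>; a proximal point provides one of \<open>P\<close> itself.\<close>
    have "P' \<in> Gamma0 \<Longrightarrow> dom_subdifferential P' \<noteq> {}" for P' :: "'b \<Rightarrow> ereal"
      using prox_in_dom_subdifferential[of P' 1] by auto
    then show "dom_subdifferential P \<noteq> {}" using GP(2) .
  qed
  have conv: "AE \<omega> in \<P>. \<exists>l\<in>S. (\<lambda>n. mean n \<omega>) \<longlonglongrightarrow> l"
    using minty0 opial0 dist_g dist_p
  proof eventually_elim
    case (elim \<omega>)
    have cluster: "l \<in> S" if q: "strict_mono (q :: nat \<Rightarrow> nat)" and l: "(\<lambda>n. mean (q n) \<omega>) \<longlonglongrightarrow> l" for q l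
    proof -
      have prG: "convex (effective_domain G)" "dom_subdifferential G \<subseteq> effective_domain G"
        using GP convex_effective_domain dom_subdifferential_subset by (auto simp: Gamma0_def)
      have prP: "convex (effective_domain P)" "dom_subdifferential P \<subseteq> effective_domain P"
        using GP convex_effective_domain dom_subdifferential_subset by (auto simp: Gamma0_def)
      \<comment> \<open>Shifts the index to \<open>Suc k\<close>, as in the means, and enlarges the
        domain of the subdifferential to the effective domain, which is convex.\<close>
      have to0: "(\<lambda>k. infdist (x (Suc k)) E) \<longlonglongrightarrow> 0" if "(\<lambda>n. infdist (x n) D) \<longlonglongrightarrow> 0" "D \<subseteq> E" "D \<noteq> {}" for x :: "nat \<Rightarrow> 'e::euclidean_space" and D E
        by (rule tendsto_sandwich[OF _ _ tendsto_const LIMSEQ_Suc[OF that(1)]]; rule always_eventually)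
          (simp_all add: infdist_nonneg infdist_mono[OF that(2,3)])
      have "fst l \<in> closure (effective_domain G)"
      proof (rule weighted_mean_cluster_in_closure[OF prG(1) _ to0[OF elim(3) prG(2) dom_ne(1)] c(1,3) q])
        show "(\<lambda>n. (\<Sum>k<q n. c k *\<^sub>R fst (z (Suc k) \<omega>)) /\<^sub>R (\<Sum>k<q n. c k)) \<longlonglongrightarrow> fst l"
          using tendsto_fst[OF l] by (simp add: mean_def fst_sum)
      qed (use prG dom_ne in auto)
      moreover have "snd l \<in> closure (effective_domain P)"
      proof (rule weighted_mean_cluster_in_closure[OF prP(1) _ to0[OF elim(4) prP(2) dom_ne(2)] c(1,3) q])
        show "(\<lambda>n. (\<Sum>k<q n. c k *\<^sub>R snd (z (Suc k) \<omega>)) /\<^sub>R (\<Sum>k<q n. c k)) \<longlonglongrightarrow> snd l"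
          using tendsto_snd[OF l] by (simp add: mean_def snd_sum)
      qed (use prP dom_ne in auto)
      moreover have "\<exists>a\<in>subdifferential (\<lambda>y. ereal (mean_f y)) x. \<exists>b\<in>subdifferential G x. \<exists>w\<in>subdifferential P v.
          0 \<le> (a + b + adjoint (blinfun_apply A) v) \<bullet> (x - fst l) + (w - blinfun_apply A x) \<bullet> (v - snd l)"
        if xv: "x \<in> dom_subdifferential G" "v \<in> dom_subdifferential P" for x v
      proof -
        have D: "(x, v) \<in> Dom" using xv by (simp add: Dom_def)
        have "closed {w :: ('a \<times> 'b) \<times> ('a \<times> 'b). 0 \<le> snd w \<bullet> (fst w - l)}" by (intro closed_Collect_le continuous_intros)
        moreover have "\<Gamma>0 \<subseteq> {w. 0 \<le> snd w \<bullet> (fst w - l)}" using elim(1) q l by blast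
        ultimately have "closure \<Gamma>0 \<subseteq> {w. 0 \<le> snd w \<bullet> (fst w - l)}" by (rule closure_minimal[rotated])
        then have "0 \<le> V (x, v) \<bullet> ((x, v) - l)" using \<Gamma>0(3) D by (force simp: \<Gamma>_def)
        moreover have "good (x, v) (V (x, v))" by (rule V[OF D])
        ultimately show ?thesis unfolding good_def by (force simp: inner_prod_def)
      qed
      ultimately have "(fst l, snd l) \<in> saddle_points (\<lambda>y. ereal (mean_f y)) G (fenchel_conjugate P) A"
        by (intro saddle_point_of_monotone_inequalities[OF mean_f_convex GP]) auto
      then show "l \<in> S" by (simp add: S_def F_eq)
    qed
    show ?case
      unfolding mean_def
    proof (rule weighted_mean_opial[OF S0(2,3) _ _ c(1,3)])
      show "S \<noteq> {}" using us(1) by auto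
      show "convergent (\<lambda>n. norm (z n \<omega> - u))" if "u \<in> S0" for u using elim(2) that by blast
    qed (use cluster in \<open>auto simp: mean_def\<close>)
  qed
  define Z where "Z \<omega> = lim (\<lambda>n. mean n \<omega>)" for \<omega>
  have [measurable]: "mean n \<in> borel_measurable \<P>" for n
    unfolding mean_def by (intro borel_measurable_scaleR borel_measurable_sum borel_measurable_const fb.z_measurable)
  have Zm: "Z \<in> borel_measurable \<P>" unfolding Z_def by (rule borel_measurable_lim_metric) measurable
  have "AE \<omega> in \<P>. Z \<omega> \<in> S \<and> (\<lambda>n. mean n \<omega>) \<longlonglongrightarrow> Z \<omega>"
    using conv by eventually_elim (auto simp: Z_def limI)
  then show thesis
    by (intro that[OF C(1) C(2)[unfolded z_def] Zm]) (simp only: S_def mean_def z_def)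
qed

end

section \<open>Reduction of the given process to the adapted iteration\<close>

theorem theorem2p1:
  fixes \<mu> :: "'s measure"
    and \<P> :: "'w measure"
    and f g :: "'s \<Rightarrow> 'a::euclidean_space \<Rightarrow> ereal"
    and p :: "'s \<Rightarrow> 'b::euclidean_space \<Rightarrow> ereal"
    and L :: "'s \<Rightarrow> 'a \<Rightarrow>\<^sub>L 'b"
    and F G :: "'a \<Rightarrow> ereal"
    and P H :: "'b \<Rightarrow> ereal"
    and A :: "'a \<Rightarrow>\<^sub>L 'b"
    and gradf :: "'s \<Rightarrow> 'a \<Rightarrow> 'a"
    and \<xi> :: "nat \<Rightarrow> 'w \<Rightarrow> 's"
    and \<gamma> :: "nat \<Rightarrow> real"
    and x :: "nat \<Rightarrow> 'w \<Rightarrow> 'a"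
    and l :: "nat \<Rightarrow> 'w \<Rightarrow> 'b"
    and m :: nat
    and \<beta> :: "'s \<Rightarrow> real"
  \<comment> \<open>the data\<close>
  assumes mu: "prob_space \<mu>" "complete_measure \<mu>"
    and f: "convex_normal_integrand \<mu> f" "AE s in \<mu>. f s \<in> Gamma0"
      "\<And>y. (\<integral>\<^sup>+ s. e2ennreal \<bar>f s y\<bar> \<partial>\<mu>) < \<infinity>"
    and F: "F = (\<lambda>y. extended_expectation \<mu> (\<lambda>s. f s y))"
    and g: "convex_normal_integrand \<mu> g" "AE s in \<mu>. g s \<in> Gamma0"
    and G: "G = (\<lambda>y. extended_expectation \<mu> (\<lambda>s. g s y))" "proper_fun G"
    and p: "convex_normal_integrand \<mu> p" "AE s in \<mu>. p s \<in> Gamma0"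
    and P: "P = (\<lambda>y. extended_expectation \<mu> (\<lambda>s. p s y))" "P \<in> Gamma0"
    and H: "H = fenchel_conjugate P"
    and L: "L \<in> borel_measurable \<mu>" "integrable \<mu> (\<lambda>s. norm (L s))"
    and A: "A = (\<integral>s. L s \<partial>\<mu>)"
    and gradf: "(\<lambda>(s, y). gradf s y) \<in> borel_measurable (\<mu> \<Otimes>\<^sub>M borel)"
      "\<And>y. (\<lambda>s. gradf s y) \<in> selections \<mu> 1 f y"
    and Pr: "prob_space \<P>"
    and xi: "prob_space.indep_vars \<P> (\<lambda>_. \<mu>) \<xi> {1..}"
      "\<And>n. 1 \<le> n \<Longrightarrow> distr \<P> \<mu> (\<xi> n) = \<mu>"
    and solutions: "\<exists>y. is_arg_min (\<lambda>y. F y + G y + H (blinfun_apply A y)) (\<lambda>_. True) y"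
  \<comment> \<open>the algorithm\<close>
    and gamma_pos: "\<And>n. 1 \<le> n \<Longrightarrow> 0 < \<gamma> n"
    and x_rv: "\<And>n. x n \<in> borel_measurable \<P>"
    and l_rv: "\<And>n. l n \<in> borel_measurable \<P>"
    and init_moment: "integrable \<P> (\<lambda>\<omega>. norm (x 0 \<omega>, l 0 \<omega>) ^ (2 * m))"
    and init_indep: "prob_space.indep_set \<P>
      (sets (vimage_algebra (space \<P>) (\<lambda>\<omega>. (x 0 \<omega>, l 0 \<omega>)) borel))
      (sets (vimage_algebra (space \<P>) (\<lambda>\<omega>. \<lambda>n\<in>{1..}. \<xi> n \<omega>) (PiM {1..} (\<lambda>_. \<mu>))))"
    and x_step: "\<And>n. AE \<omega> in \<P>. x (Suc n) \<omega> =
      prox (\<lambda>y. ereal (\<gamma> (Suc n)) * g (\<xi> (Suc n) \<omega>) y)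
        (x n \<omega> - \<gamma> (Suc n) *\<^sub>R (gradf (\<xi> (Suc n) \<omega>) (x n \<omega>)
                     + adjoint (blinfun_apply (L (\<xi> (Suc n) \<omega>))) (l n \<omega>)))"
    and l_step: "\<And>n. AE \<omega> in \<P>. l (Suc n) \<omega> =
      prox (\<lambda>y. ereal (\<gamma> (Suc n)) * p (\<xi> (Suc n) \<omega>) y)
        (l n \<omega> + \<gamma> (Suc n) *\<^sub>R blinfun_apply (L (\<xi> (Suc n) \<omega>)) (x n \<omega>))"
  \<comment> \<open>assumption (1)\<close>
    and a1: "summable (\<lambda>n. \<bar>\<gamma> n\<bar> ^ 2)" "\<not> summable (\<lambda>n. \<bar>\<gamma> n\<bar>)"
      "(\<lambda>n. \<gamma> (Suc n) / \<gamma> n) \<longlonglongrightarrow> 1"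
  \<comment> \<open>assumption (2)\<close>
    and a2: "subdifferential_interchange \<mu> g G"
  \<comment> \<open>assumption (3)\<close>
    and a3: "2 \<le> m" "integrable \<mu> (\<lambda>s. norm (L s) ^ (2 * m))"
      "\<exists>(xs, ls)\<in>saddle_points F G H A. integrable_representation \<mu> (real (2 * m)) f g p A xs ls"
      "\<forall>(xs, ls)\<in>saddle_points F G H A. integrable_representation \<mu> 2 f g p A xs ls"
  \<comment> \<open>assumption (4)\<close>
    and a4: "compact_moment_condition \<mu> g G"
  \<comment> \<open>assumption (5)\<close>
    and a5: "\<beta> \<in> borel_measurable \<mu>" "\<And>s. s \<in> space \<mu> \<Longrightarrow> 0 \<le> \<beta> s"
      "integrable \<mu> (\<lambda>s. \<beta> s ^ (2 * m))"
      "\<And>s y. s \<in> space \<mu> \<Longrightarrow> norm (gradf s y) \<le> \<beta> s * (1 + norm y)"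
      "\<exists>C>0. \<forall>y. (\<integral>\<^sup>+ s. ennreal (norm (gradf s y) ^ 4) \<partial>\<mu>) \<le> ennreal (C * (1 + norm y ^ (2 * m)))"
  \<comment> \<open>assumption (6)\<close>
    and a6: "domain_regularity \<mu> g G"
  \<comment> \<open>assumption (7)\<close>
    and a7: "prox_projection_bound \<mu> m g"
  \<comment> \<open>assumption (8)\<close>
    and a8: "subdifferential_interchange \<mu> p P" "compact_moment_condition \<mu> p P"
      "domain_regularity \<mu> p P" "prox_projection_bound \<mu> m p"
  shows "(SUP n. \<integral>\<^sup>+ \<omega>. ennreal (norm (x n \<omega>, l n \<omega>) ^ (2 * m)) \<partial>\<P>) < \<infinity>
    \<and> (\<exists>X \<Lambda>. X \<in> borel_measurable \<P> \<and> \<Lambda> \<in> borel_measurable \<P>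
        \<and> (AE \<omega> in \<P>. (X \<omega>, \<Lambda> \<omega>) \<in> saddle_points F G H A)
        \<and> (AE \<omega> in \<P>. (\<lambda>n. (weighted_average \<gamma> (\<lambda>k. x k \<omega>) n, weighted_average \<gamma> (\<lambda>k. l k \<omega>) n))
              \<longlonglongrightarrow> (X \<omega>, \<Lambda> \<omega>)))"
proof -
  interpret primal_dual \<mu> g G p P f F L A gradf m \<beta>
  proof -
    have pp: "proper_fun P" using P(2) by (simp add: Gamma0_def)
    interpret prob_space \<mu> by (rule mu)
    show "primal_dual \<mu> g G p P f F L A gradf m \<beta>"
      using f F g G p pp P(1) L(1) A gradf a2 a3 a4 a5(1-4) a6 a8(1-3)
      unfolding H[symmetric] by unfold_locales (simp_all add: H)
  qed
  \<comment> \<open>The step leaving time \<open>n\<close> uses \<open>\<gamma> (Suc n)\<close>,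
    hence the shift of the weights by one.\<close>
  define c where "c n = \<gamma> (Suc n)" for n
  have c: "\<And>n. 0 < c n" using gamma_pos by (simp add: c_def)
  have c2: "summable (\<lambda>n. (c n)\<^sup>2)" using a1(1) unfolding c_def by (subst (asm) summable_Suc_iff[symmetric]) simp
  have cS: "filterlim (\<lambda>n. \<Sum>k<n. c k) at_top sequentially"
  proof -
    have "\<not> summable c"
    proof
      assume "summable c"
      then have "summable (\<lambda>n. \<bar>\<gamma> (Suc n)\<bar>)" using gamma_pos by (simp add: c_def[abs_def] abs_of_pos)
      then show False using a1(2) summable_Suc_iff[of "\<lambda>n. \<bar>\<gamma> n\<bar>"] by simp
    qed
    then have unb: "\<exists>n. B < (\<Sum>k<n. c k)" for B
      using summableI_nonneg_bounded[of c B] c by (meson less_imp_le not_le)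
    show ?thesis
      unfolding filterlim_at_top eventually_sequentially
    proof
      fix B
      obtain n0 where "B < (\<Sum>k<n0. c k)" using unb by blast
      moreover have "(\<Sum>k<n0. c k) \<le> (\<Sum>k<n. c k)" if "n0 \<le> n" for n
        using that c by (intro sum_mono2) (auto intro: less_imp_le)
      ultimately show "\<exists>N. \<forall>n\<ge>N. B \<le> (\<Sum>k<n. c k)" by (intro exI[of _ n0]) (auto intro: order_trans less_imp_le)
    qed
  qed
  interpret Pr: prob_space \<P> by (rule Pr)
  define z0 where "z0 \<omega> = (x 0 \<omega>, l 0 \<omega>)" for \<omega>
  have z0m: "z0 \<in> borel_measurable \<P>" unfolding z0_def using x_rv l_rv by (intro borel_measurable_Pair) auto
  obtain \<F> where \<F>: "innovations \<P> \<F> \<mu> \<xi>" "z0 \<in> borel_measurable (\<F> 0)"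
    using Pr.innovations_of_iid[OF mu(1) xi z0m] init_indep unfolding z0_def by blast
  have z0i: "integrable \<P> (\<lambda>\<omega>. norm (z0 \<omega>) ^ (2 * m))" using init_moment by (simp add: z0_def)
  define z where "z = iterate c \<xi> z0"
  obtain C Z where C: "0 \<le> C" "\<And>n. (\<integral>\<^sup>+ \<omega>. ennreal (norm (z n \<omega>) ^ (2 * m)) \<partial>\<P>) \<le> ennreal C"
    and Z: "Z \<in> borel_measurable \<P>" "AE \<omega> in \<P>. Z \<omega> \<in> saddle_points F G H A \<and>
      (\<lambda>n. (\<Sum>k<n. c k *\<^sub>R z (Suc k) \<omega>) /\<^sub>R (\<Sum>k<n. c k)) \<longlonglongrightarrow> Z \<omega>"
    using iterate_convergence[OF \<F> z0i c c2 cS] unfolding H z_def by blast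
  interpret innovations \<P> \<F> \<mu> \<xi> by (rule \<F>)
  have AEx: "AE \<omega> in \<P>. \<forall>n. x (Suc n) \<omega> =
      prox (\<lambda>y. ereal (\<gamma> (Suc n)) * g (\<xi> (Suc n) \<omega>) y)
        (x n \<omega> - \<gamma> (Suc n) *\<^sub>R (gradf (\<xi> (Suc n) \<omega>) (x n \<omega>)
                     + adjoint (blinfun_apply (L (\<xi> (Suc n) \<omega>))) (l n \<omega>)))"
    using x_step unfolding AE_all_countable by blast
  have AEl: "AE \<omega> in \<P>. \<forall>n. l (Suc n) \<omega> =
      prox (\<lambda>y. ereal (\<gamma> (Suc n)) * p (\<xi> (Suc n) \<omega>) y)
        (l n \<omega> + \<gamma> (Suc n) *\<^sub>R blinfun_apply (L (\<xi> (Suc n) \<omega>)) (x n \<omega>))"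
    using l_step unfolding AE_all_countable by blast
  have AEr: "AE \<omega> in \<P>. \<forall>n. \<xi> (Suc n) \<omega> \<notin> Ng \<and> \<xi> (Suc n) \<omega> \<notin> Np"
    unfolding AE_all_countable using AE_regular by (intro allI AE_xi) auto
  \<comment> \<open>The recursion holds almost surely at each time, and the draws almost surely
    avoid \<open>Ng\<close> and \<open>Np\<close>. On the intersection of these countably many
    events, induction identifies the two processes for all times at once.\<close>
  have eq: "AE \<omega> in \<P>. \<forall>n. z n \<omega> = (x n \<omega>, l n \<omega>)"
    using AEx AEl AEr
  proof eventually_elim
    case (elim \<omega>)
    show ?case
    proof
      fix n show "z n \<omega> = (x n \<omega>, l n \<omega>)"
      proof (induction n)
        case (Suc n)
        have "z (Suc n) \<omega> = step (c n) (\<xi> (Suc n) \<omega>) (x n \<omega>, l n \<omega>)" using Suc by (simp add: z_def)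
        also have "\<dots> = (x (Suc n) \<omega>, l (Suc n) \<omega>)"
          using elim(3)[rule_format, of n] elim(1,2)[rule_format, of n] by (simp add: step_def forward_def c_def)
        finally show ?case .
      qed (simp add: z_def z0_def)
    qed
  qed
  have "(\<integral>\<^sup>+ \<omega>. ennreal (norm (x n \<omega>, l n \<omega>) ^ (2 * m)) \<partial>\<P>) \<le> ennreal C" for n
  proof -
    have "(\<integral>\<^sup>+ \<omega>. ennreal (norm (x n \<omega>, l n \<omega>) ^ (2 * m)) \<partial>\<P>) = (\<integral>\<^sup>+ \<omega>. ennreal (norm (z n \<omega>) ^ (2 * m)) \<partial>\<P>)"
      by (rule nn_integral_cong_AE, use eq in eventually_elim) simp
    then show ?thesis using C(2) by simp
  qed
  then have 1: "(SUP n. \<integral>\<^sup>+ \<omega>. ennreal (norm (x n \<omega>, l n \<omega>) ^ (2 * m)) \<partial>\<P>) < \<infinity>"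
    by (intro le_less_trans[OF SUP_least[of UNIV _ "ennreal C"]]) auto
  have avg: "weighted_average \<gamma> v n = (\<Sum>k<n. c k *\<^sub>R v (Suc k)) /\<^sub>R (\<Sum>k<n. c k)" for v :: "nat \<Rightarrow> 'e::euclidean_space" and n
    by (simp add: weighted_average_def c_def sum.atLeast1_atMost_eq)
  have 2: "AE \<omega> in \<P>. (\<lambda>n. (weighted_average \<gamma> (\<lambda>k. x k \<omega>) n, weighted_average \<gamma> (\<lambda>k. l k \<omega>) n))
      \<longlonglongrightarrow> (fst (Z \<omega>), snd (Z \<omega>))"
    using Z(2) eq
  proof eventually_elim
    case (elim \<omega>)
    have "(weighted_average \<gamma> (\<lambda>k. x k \<omega>) n, weighted_average \<gamma> (\<lambda>k. l k \<omega>) n) = (\<Sum>k<n. c k *\<^sub>R z (Suc k) \<omega>) /\<^sub>R (\<Sum>k<n. c k)" for n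
      using elim(2) by (simp add: avg prod_eq_iff fst_sum snd_sum)
    then show ?case using elim(1) by simp
  qed
  have meas: "(\<lambda>\<omega>. fst (Z \<omega>)) \<in> borel_measurable \<P>" "(\<lambda>\<omega>. snd (Z \<omega>)) \<in> borel_measurable \<P>"
    by (auto intro!: measurable_compose[OF Z(1)] borel_measurable_continuous_onI continuous_intros)
  have "AE \<omega> in \<P>. (fst (Z \<omega>), snd (Z \<omega>)) \<in> saddle_points F G H A" using Z(2) by eventually_elim simp
  with 1 2 meas show ?thesis by blast
qed

end
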